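(* Let $\Omega = B_1(0)\subset\mathbb{R}^2$ be the open unit disk, let $K>1$, $k=\frac{K-1}{K+1}$, and let $0<\varepsilon_0<\frac{4k}{1-k^2}$. Set \[ \ell_0 = \sqrt{\frac{\sqrt{4+\varepsilon_0^2}-2}{\varepsilon_0\, k}} . \] Then for every $q\in B_1(0)$ the resolution limit at level $\varepsilon_0$ relative to the center $q$ is \[ \ell_q = \frac{1+\ell_0^2-\sqrt{1+(4|q|^2-2)\ell_0^2+\ell_0^4}}{2\ell_0}. \]
   Context: $\mathbb{R}^2$ is identified with $\mathbb{C}$; $B_\rho(q)$ is the open disk of radius $\rho$ centered at $q$. Let $\Omega\subset\mathbb{R}^2$ be a simply connected domain with $C^{1,\alpha}$ boundary, $0<\alpha<1$ (here $\Omega=B_1(0)$). Function spaces. $H^1_\Diamond(\Omega)$ is the space of equivalence classes modulo additive constants of real functions $u\in H^1_{\mathrm{loc}}(\Omega)$ with $\int_\Omega|\nabla u|^2<\infty$, with norm $\|u\|=(\int_\Omega|\nabla u|^2)^{1/2}$. The trace space is $H^{1/2}_\Diamond(\partial\Omega)=H^1_\Diamond(\Omega)/H^1_0(\Omega)$, where $H^1_0(\Omega)$ is identified with the closure of (the classes of) $C_c^\infty(\Omega)$ in $H^1_\Diamond(\Omega)$; "$u|_{\partial\Omega}=\varphi$" means that $u$ belongs to the coset $\varphi$. The norm is $\|\varphi\|_{1/2}=\inf\{\|\nabla u\|_{L^2(\Omega)}: u\in H^1_\Diamond(\Omega),\ u|_{\partial\Omega}=\varphi\}$. $H^{-1/2}(\partial\Omega)$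 is the dual of $H^{1/2}_\Diamond(\partial\Omega)$, with dual norm $\|\cdot\|_{-1/2}$ and duality pairing $\langle\cdot,\cdot\rangle$. Dirichlet-to-Neumann map. For a conductivity $\gamma\in L^\infty(\Omega)$ with $K^{-1}\le\gamma\le K$, $\Lambda_\gamma:H^{1/2}_\Diamond(\partial\Omega)\to H^{-1/2}(\partial\Omega)$ is defined by $\langle\Lambda_\gamma\varphi_1,\varphi_2\rangle=\int_\Omega\gamma\nabla u_1\cdot\nabla v_2$, where $u_1\in H^1_\Diamond(\Omega)$ is the unique weak solution of $\mathrm{div}(\gamma\nabla u_1)=0$ in $\Omega$, $u_1|_{\partial\Omega}=\varphi_1$, and $v_2\in H^1_\Diamond(\Omega)$ is any function with $v_2|_{\partial\Omega}=\varphi_2$. For bounded linear $L:H^{1/2}_\Diamond(\partial\Omega)\to H^{-1/2}(\partial\Omega)$, $\|L\|_*=\sup_{\|\varphi\|_{1/2}=1}\|L\varphi\|_{-1/2}$. Resolution limit. For $q\in\Omega$ and $\rho>0$ with $B_\rho(q)\subset\Omega$, $\Gamma_\Omega(\rho,q)=\{\gamma\in L^\infty(\Omega): K^{-1}\le\gamma\le K,\ \gamma=1+\chi_{B_\rho(q)}(\gamma-1)\}$. Two conductivities $\gamma_1,\gamma_2$ are ($\varepsilon_0$-)indistinguishable if $\|\Lambda_{\gamma_1}-\Lambda_{\gamma_2}\|_*\le\varepsilon_0$. The resolution limit at level $\varepsilon_0$ relative to the center $q\in\Omega$ is $\ell_q=\sup\{\rho>0: B_\rho(q)\subset\Omega \text{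 and all } \gamma_1,\gamma_2\in\Gamma_\Omega(\rho,q) \text{ are } \varepsilon_0\text{-indistinguishable}\}$. *)

theory Defs
  imports "HOL-Analysis.Analysis"
begin

text \<open>
  The plane is the type \<^typ>\<open>complex\<close>; its real inner product is \<open>\<bullet>\<close> and \<^term>\<open>Basis :: complex set\<close>
  consists of the two coordinate directions \<open>1\<close> and \<open>\<i>\<close>.  Gradients are complex-valued.
  Integration over \<open>\<Omega>\<close> is with respect to \<^term>\<open>lebesgue_on \<Omega>\<close>.
\<close>

section \<open>Test functions and weak gradients\<close>

primrec Ck :: "nat \<Rightarrow> (complex \<Rightarrow> real) \<Rightarrow> bool" where
  "Ck 0 f \<longleftrightarrow> continuous_on UNIV f"
| "Ck (Suc n) f \<longleftrightarrow> f differentiable_on UNIV \<and>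
     (\<forall>h\<in>Basis. Ck n (\<lambda>z. frechet_derivative f (at z) h))"

text \<open>Elements of \<open>C\<^sub>c\<^sup>\<infinity>(\<Omega>)\<close>, extended by zero to the whole plane.\<close>

definition test_functions :: "complex set \<Rightarrow> (complex \<Rightarrow> real) set" where
  "test_functions \<Omega> = {\<phi>. (\<forall>n. Ck n \<phi>) \<and>
     compact (closure {z. \<phi> z \<noteq> 0}) \<and> closure {z. \<phi> z \<noteq> 0} \<subseteq> \<Omega>}"

definition L2_loc :: "complex set \<Rightarrow> (complex \<Rightarrow> 'b::euclidean_space) set" where
  "L2_loc \<Omega> = {f \<in> borel_measurable (lebesgue_on \<Omega>).
     \<forall>C. compact C \<and> C \<subseteq> \<Omega> \<longrightarrow> integrable (lebesgue_on C) (\<lambda>z. (norm (f z))\<^sup>2)}"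

text \<open>
  Since both functions are required to be locally square integrable, \<open>\<exists>g. has_weak_gradient \<Omega> u g\<close>
  says exactly that \<open>u\<close> belongs to \<open>H\<^sup>1\<^sub>l\<^sub>o\<^sub>c(\<Omega>)\<close>.
\<close>

definition has_weak_gradient ::
  "complex set \<Rightarrow> (complex \<Rightarrow> real) \<Rightarrow> (complex \<Rightarrow> complex) \<Rightarrow> bool" where
  "has_weak_gradient \<Omega> u g \<longleftrightarrow> u \<in> L2_loc \<Omega> \<and> g \<in> L2_loc \<Omega> \<and>
     (\<forall>\<phi>\<in>test_functions \<Omega>. \<forall>h\<in>Basis.
        (LINT z|lebesgue_on \<Omega>. u z * frechet_derivative \<phi> (at z) h)
          = - (LINT z|lebesgue_on \<Omega>. (g z \<bullet> h) * \<phi> z))"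

section \<open>The space \<open>H\<^sup>1\<close> modulo constants\<close>

definition finite_energy :: "complex set \<Rightarrow> (complex \<Rightarrow> real) set" where
  "finite_energy \<Omega> = {u. \<exists>g. has_weak_gradient \<Omega> u g \<and>
     integrable (lebesgue_on \<Omega>) (\<lambda>z. (norm (g z))\<^sup>2)}"

definition const_rel :: "complex set \<Rightarrow> ((complex \<Rightarrow> real) \<times> (complex \<Rightarrow> real)) set" where
  "const_rel \<Omega> = {(u, v). u \<in> finite_energy \<Omega> \<and> v \<in> finite_energy \<Omega> \<and>
     (\<exists>c. AE z in lebesgue_on \<Omega>. u z = v z + c)}"

definition H1_Diamond :: "complex set \<Rightarrow> (complex \<Rightarrow> real) set set" where
  "H1_Diamond \<Omega> = finite_energy \<Omega> // const_rel \<Omega>"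

definition H1_class :: "complex set \<Rightarrow> (complex \<Rightarrow> real) \<Rightarrow> (complex \<Rightarrow> real) set" where
  "H1_class \<Omega> u = const_rel \<Omega> `` {u}"

definition H1_diff ::
  "complex set \<Rightarrow> (complex \<Rightarrow> real) set \<Rightarrow> (complex \<Rightarrow> real) set \<Rightarrow> (complex \<Rightarrow> real) set" where
  "H1_diff \<Omega> U V = (\<Union>u\<in>U. \<Union>v\<in>V. H1_class \<Omega> (\<lambda>z. u z - v z))"

text \<open>
  The weak gradient of a class is determined almost everywhere on \<open>\<Omega>\<close>, and below it occurs only
  under integrals over \<open>\<Omega>\<close>.
\<close>

definition H1_grad :: "complex set \<Rightarrow> (complex \<Rightarrow> real) set \<Rightarrow> complex \<Rightarrow> complex" where
  "H1_grad \<Omega> U = (SOME g. \<exists>u\<in>U. has_weak_gradient \<Omega> u g)"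

definition H1_norm :: "complex set \<Rightarrow> (complex \<Rightarrow> real) set \<Rightarrow> real" where
  "H1_norm \<Omega> U = sqrt (LINT z|lebesgue_on \<Omega>. (norm (H1_grad \<Omega> U z))\<^sup>2)"

definition H10 :: "complex set \<Rightarrow> (complex \<Rightarrow> real) set set" where
  "H10 \<Omega> = {U \<in> H1_Diamond \<Omega>. \<forall>e>0. \<exists>\<phi>\<in>test_functions \<Omega>.
     H1_norm \<Omega> (H1_diff \<Omega> U (H1_class \<Omega> \<phi>)) < e}"

section \<open>The trace space and its dual norm\<close>

text \<open>
  An element \<open>\<phi>\<close> of the trace space is a coset of \<^const>\<open>H10\<close>, i.e. a set of elements of
  \<^const>\<open>H1_Diamond\<close>; having trace \<open>\<phi>\<close> means being a member of \<open>\<phi>\<close>.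
\<close>

definition trace_rel :: "complex set \<Rightarrow> ((complex \<Rightarrow> real) set \<times> (complex \<Rightarrow> real) set) set" where
  "trace_rel \<Omega> = {(U, V). U \<in> H1_Diamond \<Omega> \<and> V \<in> H1_Diamond \<Omega> \<and> H1_diff \<Omega> U V \<in> H10 \<Omega>}"

definition H_half :: "complex set \<Rightarrow> (complex \<Rightarrow> real) set set set" where
  "H_half \<Omega> = H1_Diamond \<Omega> // trace_rel \<Omega>"

definition norm_half :: "complex set \<Rightarrow> (complex \<Rightarrow> real) set set \<Rightarrow> real" where
  "norm_half \<Omega> \<phi> = Inf (H1_norm \<Omega> ` \<phi>)"

text \<open>
  Functionals on the trace space are functions on cosets, of which only the values on
  \<^term>\<open>H_half \<Omega>\<close> matter; the duality pairing is application.  The suprema below are real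
  suprema, hence meaningful for bounded functionals and operators.
\<close>

definition norm_minus_half ::
  "complex set \<Rightarrow> ((complex \<Rightarrow> real) set set \<Rightarrow> real) \<Rightarrow> real" where
  "norm_minus_half \<Omega> F = Sup {\<bar>F \<phi>\<bar> |\<phi>. \<phi> \<in> H_half \<Omega> \<and> norm_half \<Omega> \<phi> \<le> 1}"

definition norm_star ::
  "complex set \<Rightarrow> ((complex \<Rightarrow> real) set set \<Rightarrow> (complex \<Rightarrow> real) set set \<Rightarrow> real) \<Rightarrow> real" where
  "norm_star \<Omega> L = Sup {norm_minus_half \<Omega> (L \<phi>) |\<phi>. \<phi> \<in> H_half \<Omega> \<and> norm_half \<Omega> \<phi> = 1}"

section \<open>The Dirichlet-to-Neumann map\<close>

definition energy_form ::
  "complex set \<Rightarrow> (complex \<Rightarrow> real) \<Rightarrow> (complex \<Rightarrow> real) set \<Rightarrow> (complex \<Rightarrow> real) set \<Rightarrow> real" where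
  "energy_form \<Omega> \<gamma> U V =
     (LINT z|lebesgue_on \<Omega>. \<gamma> z * (H1_grad \<Omega> U z \<bullet> H1_grad \<Omega> V z))"

definition weak_solution ::
  "complex set \<Rightarrow> (complex \<Rightarrow> real) \<Rightarrow> (complex \<Rightarrow> real) set \<Rightarrow> bool" where
  "weak_solution \<Omega> \<gamma> U \<longleftrightarrow> U \<in> H1_Diamond \<Omega> \<and>
     (\<forall>\<phi>\<in>test_functions \<Omega>. energy_form \<Omega> \<gamma> U (H1_class \<Omega> \<phi>) = 0)"

definition dirichlet_solution ::
  "complex set \<Rightarrow> (complex \<Rightarrow> real) \<Rightarrow> (complex \<Rightarrow> real) set set \<Rightarrow> (complex \<Rightarrow> real) set" where
  "dirichlet_solution \<Omega> \<gamma> \<phi> = (THE U. U \<in> \<phi> \<and> weak_solution \<Omega> \<gamma> U)"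

text \<open>The value does not depend on the chosen extension \<open>V\<close> of the second argument.\<close>

definition DN_map :: "complex set \<Rightarrow> (complex \<Rightarrow> real) \<Rightarrow>
    (complex \<Rightarrow> real) set set \<Rightarrow> (complex \<Rightarrow> real) set set \<Rightarrow> real" where
  "DN_map \<Omega> \<gamma> \<phi>\<^sub>1 \<phi>\<^sub>2 = energy_form \<Omega> \<gamma> (dirichlet_solution \<Omega> \<gamma> \<phi>\<^sub>1) (SOME V. V \<in> \<phi>\<^sub>2)"

section \<open>The resolution limit\<close>

text \<open>Conductivities are elements of \<open>L\<^sup>\<infinity>(\<Omega>)\<close>, so all pointwise conditions hold almost everywhere.\<close>

definition Gamma_cond :: "complex set \<Rightarrow> real \<Rightarrow> real \<Rightarrow> complex \<Rightarrow> (complex \<Rightarrow> real) set" where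
  "Gamma_cond \<Omega> K \<rho> q = {\<gamma> \<in> borel_measurable (lebesgue_on \<Omega>).
     (AE z in lebesgue_on \<Omega>. inverse K \<le> \<gamma> z \<and> \<gamma> z \<le> K) \<and>
     (AE z in lebesgue_on \<Omega>. \<gamma> z = 1 + indicator (ball q \<rho>) z * (\<gamma> z - 1))}"

definition indistinguishable ::
  "complex set \<Rightarrow> real \<Rightarrow> (complex \<Rightarrow> real) \<Rightarrow> (complex \<Rightarrow> real) \<Rightarrow> bool" where
  "indistinguishable \<Omega> \<epsilon>\<^sub>0 \<gamma>\<^sub>1 \<gamma>\<^sub>2 \<longleftrightarrow>
     norm_star \<Omega> (\<lambda>\<phi> \<psi>. DN_map \<Omega> \<gamma>\<^sub>1 \<phi> \<psi> - DN_map \<Omega> \<gamma>\<^sub>2 \<phi> \<psi>) \<le> \<epsilon>\<^sub>0"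

definition resolution_limit :: "complex set \<Rightarrow> real \<Rightarrow> real \<Rightarrow> complex \<Rightarrow> real" where
  "resolution_limit \<Omega> K \<epsilon>\<^sub>0 q = Sup {\<rho>. \<rho> > 0 \<and> ball q \<rho> \<subseteq> \<Omega> \<and>
     (\<forall>\<gamma>\<^sub>1\<in>Gamma_cond \<Omega> K \<rho> q. \<forall>\<gamma>\<^sub>2\<in>Gamma_cond \<Omega> K \<rho> q. indistinguishable \<Omega> \<epsilon>\<^sub>0 \<gamma>\<^sub>1 \<gamma>\<^sub>2)}"

end

theory Submission
  imports Defs "HOL-Complex_Analysis.Complex_Analysis" "HOL-Real_Asymp.Real_Asymp"
begin

text \<open>
  In the coordinate \<open>T z = (z - a) / (1 - cnj a * z)\<close>, for suitable \<open>a\<close> and \<open>r\<close>, the inclusion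
  \<open>B\<close> becomes \<open>|T| < r\<close>. Let \<open>S\<close> be composition with the dilation \<open>T \<mapsto> r\<^sup>2 T\<close>; it is self-adjoint
  for the Dirichlet form on harmonic functions. For harmonic \<open>v\<close> with moments
  \<open>s\<^sub>j = \<langle>S\<^sup>j v, v\<rangle>\<close>, the method of images shows that with conductivity \<open>(1 + k) / (1 - k)\<close> in \<open>B\<close>
  and \<open>1\<close> outside, the boundary values of \<open>v\<close> have energy
  \<open>s\<^sub>0 + 2 k (s\<^sub>1 + k s\<^sub>2 + k\<^sup>2 s\<^sub>3 + \<dots>)\<close>.
  Log-convexity gives \<open>s\<^sub>j \<le> r\<^bsup>2j\<^esup> s\<^sub>0\<close>, with equality for \<open>v = Re T\<close>. Changing \<open>k\<close> to \<open>- k\<close> replaces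
  \<open>K\<close> by \<open>1 / K\<close>, so the two Dirichlet-to-Neumann maps differ by \<open>4 k r\<^sup>2 / (1 - k\<^sup>2 r\<^sup>4)\<close> in norm, and by
  monotonicity of the energy this is the extreme case. This equals \<open>\<epsilon>\<^sub>0\<close> for \<open>r = l\<^sub>0\<close>; the radius
  of \<open>B\<close> as a function of \<open>r\<close> and the centre is the asserted formula.

  The statement concerns weak solutions, so all of this is carried out for square integrable
  fields modulo the closure of the gradients of test functions; Weyl's lemma identifies the
  orthogonal complement with the gradients of real parts of holomorphic functions.
\<close>

section \<open>Smooth functions\<close>

text \<open>Self-adjointness and positivity of \<open>S\<close> come from a Helmholtz decomposition.
  Reflection in the two circles splits explicitly the field that is grad Re f in \<open>B\<close>
  and 0 outside: a limit of gradients of test functions, plus the harmonic field grad Re (S f), plus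
  a limit of such gradients turned by a right angle. The last part is orthogonal to every gradient,
  the first to every harmonic one; so <S f, h> is the Dirichlet integral of f and h over
  \<open>B\<close>. Pairing the same splitting with the solution of the two-phase problem gives the
  recursion whose iteration is the series of moments. Boundary values thus enter only as cosets, and
  a vanishing normal component only as a rotated limit of gradients. The regularity at the boundary
  comes down to one fact: a Lipschitz function, C^1 off two circles and zero outside the disk, has
  its gradient in the closure. The shape of \<open>l\<^sub>0\<close> arises because the equation for
  r is quadratic in x = k r^2, namely 4 x / (1 - x^2) = \<open>\<epsilon>\<^sub>0\<close>; the
  hypothesis on \<open>\<epsilon>\<^sub>0\<close> says x < k, i.e. r < 1.\<close>

lemma Ck_SucI:
  assumes "\<And>z. (f has_derivative f' z) (at z)" "\<And>h. h \<in> Basis \<Longrightarrow> Ck n (\<lambda>z. f' z h)"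
  shows "Ck (Suc n) f"
proof -
  have "frechet_derivative f (at z) = f' z" for z
    using assms(1) frechet_derivative_at by metis
  then show ?thesis
    using assms by (auto simp: differentiable_on_def differentiable_def intro: has_derivative_at_withinI)
qed

lemma Ck_SucD:
  assumes "Ck (Suc n) f"
  shows "(f has_derivative frechet_derivative f (at z)) (at z)"
    and "h \<in> Basis \<Longrightarrow> Ck n (\<lambda>z. frechet_derivative f (at z) h)"
  using assms by (auto simp: differentiable_on_def frechet_derivative_works)

lemma Ck_Suc_imp: "Ck (Suc n) f \<Longrightarrow> Ck n f"
proof (induction n arbitrary: f)
  case 0
  then show ?case by (auto intro: differentiable_imp_continuous_on)
next
  case (Suc n)
  then show ?case by (metis Ck.simps(2))
qed

lemma Ck_continuous: "Ck n f \<Longrightarrow> continuous_on UNIV f"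
  by (cases n) (auto intro: differentiable_imp_continuous_on)

lemma Ck_const: "Ck n (\<lambda>z. c)"
  by (induction n arbitrary: c) (auto intro!: Ck_SucI[where f'="\<lambda>_ _. 0"] derivative_eq_intros simp del: Ck.simps(2))

lemma Ck_add: "Ck n f \<Longrightarrow> Ck n g \<Longrightarrow> Ck n (\<lambda>z. f z + g z)"
proof (induction n arbitrary: f g)
  case 0
  then show ?case by (auto intro: continuous_intros)
next
  case (Suc n)
  show ?case
    by (rule Ck_SucI[where f'="\<lambda>z h. frechet_derivative f (at z) h + frechet_derivative g (at z) h"])
      (use Suc.IH Ck_SucD[OF Suc.prems(1)] Ck_SucD[OF Suc.prems(2)] in \<open>auto intro!: has_derivative_add\<close>)
qed

lemma Ck_mult: "Ck n f \<Longrightarrow> Ck n g \<Longrightarrow> Ck n (\<lambda>z. f z * g z)"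
proof (induction n arbitrary: f g)
  case 0
  then show ?case by (auto intro: continuous_intros)
next
  case (Suc n)
  show ?case
    by (rule Ck_SucI[where f'="\<lambda>z h. f z * frechet_derivative g (at z) h + frechet_derivative f (at z) h * g z"])
      (use Suc.IH Ck_SucD[OF Suc.prems(1)] Ck_SucD[OF Suc.prems(2)] Ck_Suc_imp[OF Suc.prems(1)] Ck_Suc_imp[OF Suc.prems(2)]
        in \<open>auto intro!: has_derivative_mult Ck_add\<close>)
qed

lemma Ck_bounded_linear: "bounded_linear f \<Longrightarrow> Ck n f"
proof (cases n)
  case 0
  then show "bounded_linear f \<Longrightarrow> Ck n f" by (simp add: linear_continuous_on)
next
  case (Suc m)
  then show "bounded_linear f \<Longrightarrow> Ck n f"
    by (auto simp del: Ck.simps intro!: Ck_SucI[where f'="\<lambda>_. f"] Ck_const bounded_linear_imp_has_derivative)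
qed

lemma Ck_affine_compose:
  fixes c :: real
  shows "Ck n f \<Longrightarrow> Ck n (\<lambda>z. f (c *\<^sub>R z + a))"
proof (induction n arbitrary: f)
  case 0
  then show ?case by (auto intro!: continuous_intros continuous_on_compose2[of UNIV f])
next
  case (Suc n)
  show ?case
  proof (rule Ck_SucI[where f'="\<lambda>z h. c * frechet_derivative f (at (c *\<^sub>R z + a)) h"])
    fix z
    have "((\<lambda>z. f (c *\<^sub>R z + a)) has_derivative (\<lambda>h. frechet_derivative f (at (c *\<^sub>R z + a)) (c *\<^sub>R h))) (at z)"
      by (rule has_derivative_compose[of "\<lambda>z. c *\<^sub>R z + a" "\<lambda>h. c *\<^sub>R h", OF _ Ck_SucD(1)[OF Suc.prems]])
        (auto intro!: derivative_eq_intros)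
    moreover have "linear (frechet_derivative f (at (c *\<^sub>R z + a)))"
      using Ck_SucD(1)[OF Suc.prems] has_derivative_linear by blast
    ultimately show "((\<lambda>z. f (c *\<^sub>R z + a)) has_derivative (\<lambda>h. c * frechet_derivative f (at (c *\<^sub>R z + a)) h)) (at z)"
      by (simp add: linear_cmul)
  next
    fix h :: complex assume "h \<in> Basis"
    then show "Ck n (\<lambda>z. c * frechet_derivative f (at (c *\<^sub>R z + a)) h)"
      using Suc.IH[OF Ck_SucD(2)[OF Suc.prems]] by (intro Ck_mult Ck_const) auto
  qed
qed

text \<open>For \<open>m = 0\<close> this is the classical flat function. The powers of
  \<open>1 / x\<close> close the family under differentiation, up to linear combinations, so
  smoothness of every member follows by a single induction on the order.\<close>

definition flat_exp :: "nat \<Rightarrow> real \<Rightarrow> real" where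
  "flat_exp m x = (if x \<le> 0 then 0 else exp (- (1 / x)) / x ^ m)"

lemma flat_exp_tendsto_0: "(flat_exp m \<longlongrightarrow> 0) (at 0)"
proof -
  have "((\<lambda>x::real. x ^ m / exp x) \<longlongrightarrow> 0) at_top"
    by (rule tendsto_power_div_exp_0)
  then have "((\<lambda>x::real. inverse x ^ m / exp (inverse x)) \<longlongrightarrow> 0) (at_right 0)"
    using filterlim_compose filterlim_inverse_at_top_right by blast
  then have "(flat_exp m \<longlongrightarrow> 0) (at_right 0)"
  proof (rule Lim_transform_eventually)
    show "\<forall>\<^sub>F x in at_right 0. inverse x ^ m / exp (inverse x) = flat_exp m x"
      by (auto simp: eventually_at_right_field flat_exp_def exp_minus divide_simps power_inverse intro!: exI[of _ 1])
  qed
  moreover have "(flat_exp m \<longlongrightarrow> 0) (at_left 0)"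
    by (rule Lim_transform_eventually[OF tendsto_const])
      (auto simp: eventually_at_left_field flat_exp_def intro!: exI[of _ "-1"])
  ultimately show ?thesis by (simp add: filterlim_split_at)
qed

lemma flat_exp_has_derivative:
  "(flat_exp m has_real_derivative (flat_exp (m + 2) x - m * flat_exp (Suc m) x)) (at x)"
proof (cases x "0 :: real" rule: linorder_cases)
  case less
  have "((\<lambda>_. 0) has_real_derivative 0) (at x)" by simp
  then have "(flat_exp m has_real_derivative 0) (at x)"
    by (rule DERIV_cong_ev[THEN iffD1, rotated -1])
       (use less in \<open>auto simp: flat_exp_def intro!: eventually_nhds_in_open[of "{..<0}", THEN eventually_mono]\<close>)
  with less show ?thesis by (simp add: flat_exp_def)
next
  case greater
  have "((\<lambda>x. exp (- (1 / x)) / x ^ m) has_real_derivative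
      (exp (- (1 / x)) * (1 / x^2) * x ^ m - exp (- (1 / x)) * (m * x ^ (m - 1))) / (x ^ m * x ^ m)) (at x)"
    using greater by (auto intro!: derivative_eq_intros simp: power2_eq_square)
  also have "(exp (- (1 / x)) * (1 / x^2) * x ^ m - exp (- (1 / x)) * (m * x ^ (m - 1))) / (x ^ m * x ^ m)
     = flat_exp (m + 2) x - m * flat_exp (Suc m) x"
    using greater by (cases m) (auto simp: flat_exp_def field_simps power2_eq_square)
  finally show ?thesis
    by (rule DERIV_cong_ev[THEN iffD1, rotated -1])
       (use greater in \<open>auto simp: flat_exp_def intro!: eventually_nhds_in_open[of "{0<..}", THEN eventually_mono]\<close>)
next
  case equal
  \<comment> \<open>Dividing by \<open>h\<close> raises the exponent: the difference quotient at 0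
    is again a member of the family, and tends to 0 as all members do.\<close>
  have "((\<lambda>h. (flat_exp m (0 + h) - flat_exp m 0) / h) \<longlongrightarrow> 0) (at 0)"
  proof (rule Lim_transform_eventually[OF flat_exp_tendsto_0[of "Suc m"]])
    show "\<forall>\<^sub>F h in at 0. flat_exp (Suc m) h = (flat_exp m (0 + h) - flat_exp m 0) / h"
      by (auto simp: eventually_at_filter flat_exp_def)
  qed
  then show ?thesis unfolding DERIV_def using equal by (simp add: flat_exp_def)
qed

lemma Ck_flat_exp: "Ck n u \<Longrightarrow> Ck n (\<lambda>z. flat_exp m (u z))"
proof (induction n arbitrary: m u)
  case 0
  have "continuous_on UNIV (flat_exp m)"
    using flat_exp_has_derivative[of m] by (meson DERIV_isCont continuous_at_imp_continuous_on)
  with 0 show ?case by (auto intro: continuous_on_compose2)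
next
  case (Suc n)
  show ?case
  proof (rule Ck_SucI)
    show "((\<lambda>z. flat_exp m (u z)) has_derivative (\<lambda>h. (flat_exp (m + 2) (u z) + (- m) * flat_exp (Suc m) (u z)) *
        frechet_derivative u (at z) h)) (at z)" for z
      using has_derivative_compose[OF Ck_SucD(1)[OF Suc.prems] flat_exp_has_derivative[of m "u z", unfolded has_field_derivative_def]]
      by simp
    show "Ck n (\<lambda>z. (flat_exp (m + 2) (u z) + (- m) * flat_exp (Suc m) (u z)) * frechet_derivative u (at z) h)"
      if "h \<in> Basis" for h
      using Suc.IH[OF Ck_Suc_imp[OF Suc.prems]] Ck_SucD(2)[OF Suc.prems that]
      by (intro Ck_mult Ck_add Ck_const) auto
  qed
qed

lemma Ck_norm_sq: "Ck n (\<lambda>z. (norm z)\<^sup>2)"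
proof -
  have "(\<lambda>z. (cmod z)\<^sup>2) = (\<lambda>z. Re z * Re z + Im z * Im z)"
    by (rule ext) (metis cmod_power2 power2_eq_square)
  then show ?thesis
    by (simp only:) (intro Ck_add Ck_mult Ck_bounded_linear bounded_linear_Re bounded_linear_Im)
qed

lemma flat_exp_nonneg: "0 \<le> flat_exp m x"
  by (auto simp: flat_exp_def)

section \<open>Test functions\<close>

definition grad :: "(complex \<Rightarrow> real) \<Rightarrow> complex \<Rightarrow> complex" where
  "grad \<phi> z = Complex (frechet_derivative \<phi> (at z) 1) (frechet_derivative \<phi> (at z) \<i>)"

lemma grad_eqI:
  assumes "(\<phi> has_derivative (\<lambda>h. g \<bullet> h)) (at z)" shows "grad \<phi> z = g"
proof -
  have "frechet_derivative \<phi> (at z) = (\<lambda>h. g \<bullet> h)"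
    using assms frechet_derivative_at by metis
  then show ?thesis by (auto simp: grad_def complex_eq_iff inner_complex_def)
qed

lemma has_derivative_grad:
  assumes "\<phi> differentiable (at z)" shows "(\<phi> has_derivative (\<lambda>h. grad \<phi> z \<bullet> h)) (at z)"
proof -
  let ?D = "frechet_derivative \<phi> (at z)"
  have D: "(\<phi> has_derivative ?D) (at z)" using assms frechet_derivative_works by blast
  then interpret linear ?D by (rule has_derivative_linear)
  have "?D h = grad \<phi> z \<bullet> h" for h
  proof -
    have "h = Re h *\<^sub>R 1 + Im h *\<^sub>R \<i>" by (simp add: complex_eq_iff)
    then have "?D h = ?D (Re h *\<^sub>R 1 + Im h *\<^sub>R \<i>)" by (rule arg_cong)
    also have "\<dots> = Re h * ?D 1 + Im h * ?D \<i>" by (metis add scaleR real_scaleR_def)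
    finally show ?thesis by (simp add: grad_def inner_complex_def)
  qed
  then have "?D = (\<lambda>h. grad \<phi> z \<bullet> h)" by (rule ext)
  with D show ?thesis by simp
qed

lemma test_functions_mono: "S \<subseteq> T \<Longrightarrow> \<phi> \<in> test_functions S \<Longrightarrow> \<phi> \<in> test_functions T"
  by (auto simp: test_functions_def)

lemma test_functionsI:
  assumes "\<And>n. Ck n \<phi>" "compact C" "C \<subseteq> \<Omega>" "\<And>z. z \<notin> C \<Longrightarrow> \<phi> z = 0"
  shows "\<phi> \<in> test_functions \<Omega>"
proof -
  have "closure {z. \<phi> z \<noteq> 0} \<subseteq> C"
    using assms by (intro closure_minimal compact_imp_closed) auto
  then show ?thesis
    using assms unfolding test_functions_def by (auto intro: compact_closure[THEN iffD2] bounded_subset[OF compact_imp_bounded])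
qed

lemma test_functionsD:
  assumes "\<phi> \<in> test_functions \<Omega>"
  shows "Ck n \<phi>" "\<phi> differentiable (at z)" "continuous_on S \<phi>"
    "(\<phi> has_derivative (\<lambda>h. grad \<phi> z \<bullet> h)) (at z)"
proof -
  show *: "Ck n \<phi>" for n using assms by (auto simp: test_functions_def)
  show "\<phi> differentiable (at z)" using *[of 1] by (auto simp: differentiable_on_def)
  then show "(\<phi> has_derivative (\<lambda>h. grad \<phi> z \<bullet> h)) (at z)" by (rule has_derivative_grad)
  show "continuous_on S \<phi>" using Ck_continuous[OF *[of 0]] continuous_on_subset by blast
qed

lemma test_functions_support:
  assumes "\<phi> \<in> test_functions \<Omega>"
  obtains C where "compact C" "C \<subseteq> \<Omega>" "\<And>z. z \<notin> C \<Longrightarrow> \<phi> z = 0"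
    "\<And>z. z \<notin> C \<Longrightarrow> grad \<phi> z = 0"
proof
  let ?C = "closure {z. \<phi> z \<noteq> 0}"
  show "compact ?C" "?C \<subseteq> \<Omega>" using assms by (auto simp: test_functions_def)
  show z: "\<phi> z = 0" if "z \<notin> ?C" for z using that closure_subset[of "{z. \<phi> z \<noteq> 0}"] by blast
  show "grad \<phi> z = 0" if "z \<notin> ?C" for z
  proof (rule grad_eqI)
    have "((\<lambda>_. 0) has_derivative (\<lambda>h. 0 \<bullet> h)) (at z)" by simp
    then show "(\<phi> has_derivative (\<lambda>h. 0 \<bullet> h)) (at z)"
    proof (rule has_derivative_transform_within_open)
      show "open (- ?C)" "z \<in> - ?C" using that by auto
      show "0 = \<phi> x" if "x \<in> - ?C" for x using z[of x] that by auto
    qed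
  qed
qed

lemma Ck_frechet:
  assumes "\<And>n. Ck n \<phi>" "h \<in> Basis" shows "Ck n (\<lambda>z. frechet_derivative \<phi> (at z) h)"
  using assms Ck_SucD(2) by blast

lemma frechet_grad:
  "(\<phi> differentiable (at z)) \<Longrightarrow> frechet_derivative \<phi> (at z) h = grad \<phi> z \<bullet> h"
  using has_derivative_grad frechet_derivative_at by metis

lemma test_functions_grad:
  assumes "\<phi> \<in> test_functions \<Omega>"
  shows "(\<lambda>z. grad \<phi> z \<bullet> h) \<in> test_functions \<Omega>"
proof -
  obtain C where C: "compact C" "C \<subseteq> \<Omega>" "\<And>z. z \<notin> C \<Longrightarrow> grad \<phi> z = 0"
    using test_functions_support[OF assms] by metis
  have "grad \<phi> z \<bullet> h = Re h * frechet_derivative \<phi> (at z) 1 + Im h * frechet_derivative \<phi> (at z) \<i>" for z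
    by (simp add: grad_def inner_complex_def)
  then have "Ck n (\<lambda>z. grad \<phi> z \<bullet> h)" for n
    using test_functionsD(1)[OF assms]
    by (simp only:) (intro Ck_add Ck_mult Ck_const Ck_frechet; simp add: Basis_complex_def)
  with C show ?thesis by (intro test_functionsI[of _ C]) auto
qed

lemma test_functions_mult:
  assumes "\<phi> \<in> test_functions \<Omega>" "\<And>n. Ck n f"
  shows "(\<lambda>z. f z * \<phi> z) \<in> test_functions \<Omega>"
proof -
  obtain C where C: "compact C" "C \<subseteq> \<Omega>" "\<And>z. z \<notin> C \<Longrightarrow> \<phi> z = 0"
    using test_functions_support[OF assms(1)] by metis
  with assms test_functionsD(1)[OF assms(1)] show ?thesis
    by (intro test_functionsI[of _ C] Ck_mult) auto
qed

lemma test_functions_add: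
  assumes "\<phi> \<in> test_functions \<Omega>" "\<psi> \<in> test_functions \<Omega>"
  shows "(\<lambda>z. \<phi> z + \<psi> z) \<in> test_functions \<Omega>"
proof -
  obtain C where C: "compact C" "C \<subseteq> \<Omega>" "\<And>z. z \<notin> C \<Longrightarrow> \<phi> z = 0"
    using test_functions_support[OF assms(1)] by metis
  obtain D where D: "compact D" "D \<subseteq> \<Omega>" "\<And>z. z \<notin> D \<Longrightarrow> \<psi> z = 0"
    using test_functions_support[OF assms(2)] by metis
  show ?thesis
    using test_functionsD(1)[OF assms(1)] test_functionsD(1)[OF assms(2)] C D
    by (intro test_functionsI[of _ "C \<union> D"] Ck_add) auto
qed

lemma test_functions_cmult:
  "\<phi> \<in> test_functions \<Omega> \<Longrightarrow> (\<lambda>z. c * \<phi> z) \<in> test_functions \<Omega>"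
  by (rule test_functions_mult[OF _ Ck_const])

lemma test_functions_zero: "(\<lambda>z. 0) \<in> test_functions \<Omega>"
  by (rule test_functionsI[of _ "{}"]) (auto intro: Ck_const)

lemma grad_add:
  assumes "\<phi> \<in> test_functions \<Omega>" "\<psi> \<in> test_functions \<Omega>"
  shows "grad (\<lambda>z. \<phi> z + \<psi> z) z = grad \<phi> z + grad \<psi> z"
  using has_derivative_add[OF test_functionsD(4)[OF assms(1)] test_functionsD(4)[OF assms(2)]]
  by (intro grad_eqI) (simp add: inner_add_left)

lemma grad_cmult:
  assumes "\<phi> \<in> test_functions \<Omega>"
  shows "grad (\<lambda>z. c * \<phi> z) z = c *\<^sub>R grad \<phi> z"
  using has_derivative_mult_right[OF test_functionsD(4)[OF assms(1)], of c]
  by (intro grad_eqI) (simp)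

lemma continuous_grad:
  assumes "\<phi> \<in> test_functions \<Omega>" shows "continuous_on S (grad \<phi>)"
proof -
  have "continuous_on S (\<lambda>z. Complex (grad \<phi> z \<bullet> 1) (grad \<phi> z \<bullet> \<i>))"
    by (intro continuous_on_Complex test_functionsD(3)[OF test_functions_grad[OF assms]])
  then show ?thesis by (simp add: inner_complex_def)
qed

text \<open>One constant for value, gradient and Lipschitz bound, because the domination arguments
  below use them together.\<close>

lemma test_functions_bounded:
  assumes "\<phi> \<in> test_functions \<Omega>"
  obtains M where "M \<ge> 0" "\<And>z. \<bar>\<phi> z\<bar> \<le> M" "\<And>z. norm (grad \<phi> z) \<le> M" "\<And>x y. \<bar>\<phi> x - \<phi> y\<bar> \<le> M * norm (x - y)"
proof -
  obtain C where C: "compact C" "\<And>z. z \<notin> C \<Longrightarrow> \<phi> z = 0" "\<And>z. z \<notin> C \<Longrightarrow> grad \<phi> z = 0"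
    using test_functions_support[OF assms(1)] by metis
  have "bounded (\<phi> ` C)" "bounded (grad \<phi> ` C)"
    by (intro compact_imp_bounded compact_continuous_image C test_functionsD(3)[OF assms] continuous_grad[OF assms])+
  then obtain a b where ab: "\<And>z. z \<in> C \<Longrightarrow> norm (\<phi> z) \<le> a" "\<And>z. z \<in> C \<Longrightarrow> norm (grad \<phi> z) \<le> b"
    by (auto simp: bounded_iff)
  define M where "M = max (max a b) 0"
  have M: "M \<ge> 0" "\<bar>\<phi> z\<bar> \<le> M" "norm (grad \<phi> z) \<le> M" for z
    using ab[of z] C(2,3)[of z] by (cases "z \<in> C"; force simp: M_def)+
  moreover have "\<bar>\<phi> x - \<phi> y\<bar> \<le> M * norm (x - y)" for x y
  proof -
    have "onorm (\<lambda>h. grad \<phi> z \<bullet> h) \<le> M" for z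
      by (rule onorm_bound[OF M(1)]) (metis M(3) Cauchy_Schwarz_ineq2 mult_right_mono norm_ge_zero order_trans real_norm_def)
    then show ?thesis
      using differentiable_bound[of UNIV \<phi> "\<lambda>z h. grad \<phi> z \<bullet> h" M x y] test_functionsD(4)[OF assms] by simp
  qed
  ultimately show ?thesis using that by blast
qed

section \<open>Differentiation under the integral sign and integration by parts\<close>

lemma continuous_borel_measurable_lebesgue_on:
  fixes f :: "complex \<Rightarrow> 'b::euclidean_space"
  assumes "continuous_on UNIV f" shows "f \<in> borel_measurable (lebesgue_on S)"
  using assms by (intro measurable_restrict_space1 measurable_completion) (simp add: borel_measurable_continuous_onI)

lemma continuous_borel_measurable_lebesgue:
  fixes f :: "complex \<Rightarrow> 'b::euclidean_space"
  assumes "continuous_on UNIV f" shows "f \<in> borel_measurable lebesgue"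
  using continuous_borel_measurable_lebesgue_on[OF assms, of UNIV] by (simp add: lebesgue_on_UNIV_eq)

lemma integral_translate:
  fixes p :: "complex \<Rightarrow> real"
  assumes "continuous_on UNIV p"
  shows "integral\<^sup>L lebesgue (\<lambda>z. p (z + c)) = integral\<^sup>L lebesgue p"
proof -
  have m: "p \<in> borel_measurable borel" "(\<lambda>z. p (z + c)) \<in> borel_measurable borel"
    using assms by (auto intro!: borel_measurable_continuous_onI continuous_on_compose2[OF assms] continuous_intros)
  have "integral\<^sup>L lborel p = integral\<^sup>L (distr lborel borel ((+) c)) p"
    by (simp add: lborel_distr_plus)
  also have "\<dots> = integral\<^sup>L lborel (\<lambda>z. p (z + c))"
    by (subst integral_distr) (use m in \<open>auto simp: add.commute\<close>)
  finally show ?thesis using m by (simp add: integral_completion)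
qed

lemma integrable_indicator_bounded_lebesgue:
  "bounded S \<Longrightarrow> S \<in> sets lebesgue \<Longrightarrow> integrable lebesgue (\<lambda>z. c * indicator S z :: real)"
  by (intro integrable_mult_right integrable_real_indicator)
     (auto intro: bounded_set_imp_lmeasurable dest: fmeasurableD2 simp: fmeasurable_def top.not_eq_extremum
       dest!: bounded_set_imp_lmeasurable)

text \<open>The integral of a difference quotient vanishes by translation invariance.\<close>

lemma integral_derivative_eq_0:
  fixes p :: "complex \<Rightarrow> real"
  assumes lip: "\<And>x y. \<bar>p x - p y\<bar> \<le> C * norm (x - y)"
    and supp: "\<And>z. norm z \<ge> R \<Longrightarrow> p z = 0"
    and der: "AE z in lebesgue. (p has_derivative p' z) (at z)"
    and meas: "(\<lambda>z. p' z h) \<in> borel_measurable lebesgue"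
  shows "integral\<^sup>L lebesgue (\<lambda>z. p' z h) = 0"
proof -
  have C: "C \<ge> 0" using lip[of 0 1] by (simp add: order_trans[OF abs_ge_zero])
  have cont: "continuous_on UNIV p"
    by (rule lipschitz_on_continuous_on[of C]) (auto simp: lipschitz_on_def dist_norm lip C)
  have contc: "continuous_on UNIV (\<lambda>z. p (z + c))" for c
    by (auto intro!: continuous_intros continuous_on_compose2[OF cont])
  define e where "e n = inverse (real (Suc n))" for n
  have e: "e n > 0" "e n \<le> 1" for n by (auto simp: e_def field_simps)
  define s where "s n z = (p (z + e n *\<^sub>R h) - p z) / e n" for n z
  \<comment> \<open>Inside the disk of radius \<open>R\<close> the value is compared with that at
    \<open>of_real R\<close>, where \<open>p\<close> vanishes and which is at distance at most
    \<open>2 * R\<close>.\<close>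
  have bnd: "\<bar>p z\<bar> \<le> C * (2 * \<bar>R\<bar>) * indicator (ball 0 (\<bar>R\<bar> + 1)) z" for z
  proof (cases "norm z \<ge> R")
    case True then show ?thesis using supp C by auto
  next
    case False
    then have R: "R > 0" by (meson norm_ge_zero not_less order_trans le_less_linear)
    have "\<bar>p z - p (of_real R)\<bar> \<le> C * norm (z - of_real R)" by (rule lip)
    moreover have "norm (z - of_real R) \<le> 2 * R"
      using norm_triangle_ineq4[of z "of_real R"] False R by auto
    ultimately have "\<bar>p z\<bar> \<le> C * (2 * R)"
      using supp[of "of_real R"] R C by (smt (verit) mult_left_mono norm_of_real)
    then show ?thesis using False R by (simp add: indicator_def)
  qed
  have int_p: "integrable lebesgue p"
  proof (rule Bochner_Integration.integrable_bound)
    show "integrable lebesgue (\<lambda>z::complex. C * (2 * \<bar>R\<bar>) * indicator (ball 0 (\<bar>R\<bar> + 1)) z)"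
      by (rule integrable_indicator_bounded_lebesgue) auto
    show "AE x in lebesgue. norm (p x) \<le> norm (C * (2 * \<bar>R\<bar>) * indicator (ball 0 (\<bar>R\<bar> + 1)) x)"
      using bnd by (intro always_eventually allI) (metis abs_ge_self order_trans real_norm_def)
  qed (rule continuous_borel_measurable_lebesgue[OF cont])
  have sup0: "integrable lebesgue (\<lambda>z. p (z + c))" for c
  proof -
    have m: "p \<in> borel_measurable borel" using cont by (rule borel_measurable_continuous_onI)
    have "integrable lborel p" using int_p m by (simp add: integrable_completion)
    then have "integrable (distr lborel borel ((+) c)) p" by (simp add: lborel_distr_plus)
    then have "integrable lborel (\<lambda>z. p (c + z))" using m by (subst (asm) integrable_distr_eq) auto
    then show ?thesis
      using borel_measurable_continuous_onI[OF contc[of c]] by (simp add: integrable_completion add.commute)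
  qed
  have int_s: "integral\<^sup>L lebesgue (s n) = 0" for n
    unfolding s_def using sup0[of "e n *\<^sub>R h"] int_p integral_translate[OF cont] by simp
  have "(\<lambda>n. integral\<^sup>L lebesgue (s n)) \<longlonglongrightarrow> integral\<^sup>L lebesgue (\<lambda>z. p' z h)"
  \<comment> \<open>The shifts have length at most \<open>norm h\<close>, so the difference
    quotients vanish outside the ball enlarged by that much; inside, the Lipschitz bound dominates
    them.\<close>
  proof (rule integral_dominated_convergence[where w="\<lambda>z. (C * norm h) * indicator (ball 0 (\<bar>R\<bar> + 1 + norm h)) z"])
    show "integrable lebesgue (\<lambda>z::complex. (C * norm h) * indicator (ball 0 (\<bar>R\<bar> + 1 + norm h)) z)"
      by (rule integrable_indicator_bounded_lebesgue) auto
    show "s n \<in> borel_measurable lebesgue" for n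
      unfolding s_def using e[of n]
      by (intro continuous_borel_measurable_lebesgue continuous_intros cont contc) auto
    show "AE x in lebesgue. norm (s n x) \<le> (C * norm h) * indicator (ball 0 (\<bar>R\<bar> + 1 + norm h)) x" for n
    proof (intro always_eventually allI)
      fix x
      show "norm (s n x) \<le> (C * norm h) * indicator (ball 0 (\<bar>R\<bar> + 1 + norm h)) x"
      proof (cases "x \<in> ball 0 (\<bar>R\<bar> + 1 + norm h)")
        case True
        have "\<bar>p (x + e n *\<^sub>R h) - p x\<bar> \<le> C * (e n * norm h)"
          using lip[of "x + e n *\<^sub>R h" x] e[of n] by simp
        then show ?thesis using True e[of n] by (simp add: s_def divide_simps mult_ac)
      next
        case False
        have "norm (e n *\<^sub>R h) \<le> norm h" using e[of n] by (simp add: mult_left_le_one_le)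
        then have "R \<le> norm x" "R \<le> norm (x + e n *\<^sub>R h)"
          using False norm_diff_ineq[of x "e n *\<^sub>R h"] norm_ge_zero[of h] by (simp_all del: norm_ge_zero)
        then show ?thesis using supp False by (simp add: s_def)
      qed
    qed
    show "AE x in lebesgue. (\<lambda>n. s n x) \<longlonglongrightarrow> p' x h"
      using der
    proof (rule eventually_mono)
      fix x assume D: "(p has_derivative p' x) (at x)"
      have "((\<lambda>t. (p (x + t *\<^sub>R h) - p x) /\<^sub>R t) \<longlongrightarrow> p' x h) (at_right 0)"
      proof -
        have "((\<lambda>t. p (x + t *\<^sub>R h)) has_derivative (\<lambda>t. p' x (t *\<^sub>R h))) (at 0)"
          by (rule has_derivative_compose[of "\<lambda>t. x + t *\<^sub>R h" "\<lambda>t. t *\<^sub>R h"])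
             (use D in \<open>auto intro!: derivative_eq_intros\<close>)
        moreover have "p' x (t *\<^sub>R h) = t * p' x h" for t
          using has_derivative_linear[OF D] by (simp add: linear_cmul)
        moreover have "(\<lambda>t. t * p' x h) = (*) (p' x h)" by (rule ext) (rule mult.commute)
        ultimately have "((\<lambda>t. p (x + t *\<^sub>R h)) has_real_derivative p' x h) (at 0)"
          by (simp add: has_field_derivative_def)
        then have "((\<lambda>t. (p (x + t *\<^sub>R h) - p x) / t) \<longlongrightarrow> p' x h) (at 0)"
          by (simp add: DERIV_def)
        then show ?thesis by (auto simp: divide_inverse mult.commute intro: tendsto_within_subset)
      qed
      moreover have "filterlim e (at_right 0) sequentially"
        unfolding e_def using LIMSEQ_inverse_real_of_nat
        by (auto simp: filterlim_at intro!: always_eventually)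
      ultimately have "(\<lambda>n. (p (x + e n *\<^sub>R h) - p x) /\<^sub>R e n) \<longlonglongrightarrow> p' x h"
        by (rule filterlim_compose)
      then show "(\<lambda>n. s n x) \<longlonglongrightarrow> p' x h"
        by (simp add: s_def divide_inverse mult.commute)
    qed
  qed (use meas in auto)
  then have "(\<lambda>n::nat. 0) \<longlonglongrightarrow> integral\<^sup>L lebesgue (\<lambda>z. p' z h)" by (simp only: int_s)
  then show ?thesis by (simp only: LIMSEQ_const_iff)
qed

text \<open>The bounds uniform in \<open>w\<close> dominate the remainder of the linearisation,
  divided by \<open>norm (p - p0)\<close>, by \<open>2 * C\<close> times the absolute value of
  \<open>f\<close>; hence only integrability of \<open>f\<close> is asked. The parameter type is
  general because it is the base point of a mollification in one use and the mollification radius in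
  another.\<close>

lemma has_derivative_integral_kernel:
  fixes k :: "'p::euclidean_space \<Rightarrow> 'w \<Rightarrow> real" and f :: "'w \<Rightarrow> real"
  assumes f: "integrable M f" and "\<delta> > 0"
    and meas: "\<And>p. p \<in> ball p0 \<delta> \<Longrightarrow> k p \<in> borel_measurable M"
    and meas': "\<And>h. (\<lambda>w. k' w h) \<in> borel_measurable M"
    and bnd: "\<And>w. \<bar>k p0 w\<bar> \<le> C"
    and lip: "\<And>w p. p \<in> ball p0 \<delta> \<Longrightarrow> \<bar>k p w - k p0 w\<bar> \<le> C * norm (p - p0)"
    and der: "\<And>w. w \<in> space M \<Longrightarrow> ((\<lambda>p. k p w) has_derivative k' w) (at p0)"
    and bnd': "\<And>w h. \<bar>k' w h\<bar> \<le> C * norm h"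
  shows "((\<lambda>p. \<integral>w. f w * k p w \<partial>M) has_derivative (\<lambda>h. \<integral>w. f w * k' w h \<partial>M)) (at p0)"
proof -
  have C: "C \<ge> 0" using bnd[of undefined] by linarith
  have int_k: "integrable M (\<lambda>w. f w * k p w)" if p: "p \<in> ball p0 \<delta>" for p
  proof (rule Bochner_Integration.integrable_bound)
    show "integrable M (\<lambda>w. (C + C * norm (p - p0)) * f w)" using f by simp
    show "AE w in M. norm (f w * k p w) \<le> norm ((C + C * norm (p - p0)) * f w)"
    proof (intro always_eventually allI)
      fix w
      have "\<bar>k p w\<bar> \<le> C + C * norm (p - p0)" using bnd[of w] lip[OF p, of w] by linarith
      then show "norm (f w * k p w) \<le> norm ((C + C * norm (p - p0)) * f w)"
        using C by (simp add: abs_mult mult.commute[of "\<bar>f w\<bar>"] mult_right_mono)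
    qed
  qed (use f meas[OF p] in auto)
  have int_k': "integrable M (\<lambda>w. f w * k' w h)" for h
  proof (rule Bochner_Integration.integrable_bound)
    show "integrable M (\<lambda>w. (C * norm h) * f w)" using f by simp
    show "AE w in M. norm (f w * k' w h) \<le> norm ((C * norm h) * f w)"
      using bnd' C by (intro always_eventually allI) (simp add: abs_mult mult.commute[of "\<bar>f _\<bar>"] mult_right_mono)
  qed (use f meas' in auto)
  have lin: "w \<in> space M \<Longrightarrow> bounded_linear (k' w)" for w using der has_derivative_bounded_linear by blast
  have bl: "bounded_linear (\<lambda>h. \<integral>w. f w * k' w h \<partial>M)"
  proof (rule bounded_linear_intro)
    show "(\<integral>w. f w * k' w (x + y) \<partial>M) = (\<integral>w. f w * k' w x \<partial>M) + (\<integral>w. f w * k' w y \<partial>M)" for x y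
    proof -
      have "(\<integral>w. f w * k' w (x + y) \<partial>M) = (\<integral>w. f w * k' w x + f w * k' w y \<partial>M)"
        by (rule Bochner_Integration.integral_cong) (use lin in \<open>auto simp: linear_add bounded_linear.linear distrib_left\<close>)
      then show ?thesis using int_k' by simp
    qed
    show "(\<integral>w. f w * k' w (r *\<^sub>R x) \<partial>M) = r *\<^sub>R (\<integral>w. f w * k' w x \<partial>M)" for r x
    proof -
      have "(\<integral>w. f w * k' w (r *\<^sub>R x) \<partial>M) = (\<integral>w. r * (f w * k' w x) \<partial>M)"
        by (rule Bochner_Integration.integral_cong) (use lin in \<open>auto simp: linear_cmul bounded_linear.linear\<close>)
      then show ?thesis using int_k' by simp
    qed
    show "norm (\<integral>w. f w * k' w x \<partial>M) \<le> norm x * (C * (\<integral>w. \<bar>f w\<bar> \<partial>M))" for x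
    proof -
      have "norm (\<integral>w. f w * k' w x \<partial>M) \<le> (\<integral>w. norm (f w * k' w x) \<partial>M)" by (rule integral_norm_bound)
      also have "\<dots> \<le> (\<integral>w. norm x * C * \<bar>f w\<bar> \<partial>M)"
        using f int_k'[of x] bnd'[of _ x]
        by (intro integral_mono integrable_norm)
           (auto simp: abs_mult mult.commute[of "\<bar>f _\<bar>"] mult.commute[of "norm x"] intro!: mult_right_mono)
      finally show ?thesis by (simp add: mult_ac)
    qed
  qed
  show ?thesis
    unfolding has_derivative_iff_norm
  proof (intro conjI bl)
    let ?q = "\<lambda>p. norm ((\<integral>w. f w * k p w \<partial>M) - (\<integral>w. f w * k p0 w \<partial>M) - (\<integral>w. f w * k' w (p - p0) \<partial>M)) / norm (p - p0)"
    let ?r = "\<lambda>p w. f w * ((k p w - k p0 w - k' w (p - p0)) / norm (p - p0))"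
    show "(?q \<longlongrightarrow> 0) (at p0)"
      unfolding tendsto_at_iff_sequentially comp_def
    proof (intro allI impI)
      fix X :: "nat \<Rightarrow> 'p" assume X: "\<forall>i. X i \<in> UNIV - {p0}" "X \<longlonglongrightarrow> p0"
      obtain N where N: "\<And>n. n \<ge> N \<Longrightarrow> X n \<in> ball p0 \<delta>"
        using X(2) \<open>\<delta> > 0\<close> unfolding lim_sequentially by (metis dist_commute mem_ball)
      define Y where "Y n = X (n + N)" for n
      have Y: "Y n \<in> ball p0 \<delta>" "Y n \<noteq> p0" for n using X(1) N by (auto simp: Y_def)
      have Yl: "Y \<longlonglongrightarrow> p0" unfolding Y_def using X(2) by (rule LIMSEQ_ignore_initial_segment)
      have "(\<lambda>n. \<integral>w. ?r (Y n) w \<partial>M) \<longlonglongrightarrow> (\<integral>w. 0 \<partial>M)"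
      proof (rule integral_dominated_convergence[where w="\<lambda>w. (2 * C) * \<bar>f w\<bar>"])
        show "(\<lambda>w. ?r (Y n) w) \<in> borel_measurable M" for n
          using f meas[OF Y(1)[of n]] meas[of p0] meas' \<open>\<delta> > 0\<close> by simp
        show "AE w in M. norm (?r (Y n) w) \<le> (2 * C) * \<bar>f w\<bar>" for n
        proof (intro always_eventually allI)
          fix w
          have "\<bar>k (Y n) w - k p0 w - k' w (Y n - p0)\<bar> \<le> 2 * C * norm (Y n - p0)"
            using lip[OF Y(1)[of n], of w] bnd'[of w "Y n - p0"] by linarith
          then have "\<bar>(k (Y n) w - k p0 w - k' w (Y n - p0)) / norm (Y n - p0)\<bar> \<le> 2 * C"
            using Y(2)[of n] by (simp add: divide_simps)
          then show "norm (?r (Y n) w) \<le> (2 * C) * \<bar>f w\<bar>"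
            by (simp only: real_norm_def abs_mult) (metis abs_ge_zero mult.commute mult_right_mono)
        qed
        show "AE w in M. (\<lambda>n. ?r (Y n) w) \<longlonglongrightarrow> 0"
        proof (rule AE_I2)
          fix w assume "w \<in> space M"
          from der[OF this] have "((\<lambda>y. norm (k y w - k p0 w - k' w (y - p0)) / norm (y - p0)) \<longlongrightarrow> 0) (at p0)"
            by (simp add: has_derivative_iff_norm)
          then have "(\<lambda>n. norm (k (Y n) w - k p0 w - k' w (Y n - p0)) / norm (Y n - p0)) \<longlonglongrightarrow> 0"
            using Yl Y(2) by (auto simp: tendsto_at_iff_sequentially comp_def)
          then have "(\<lambda>n. norm ((k (Y n) w - k p0 w - k' w (Y n - p0)) / norm (Y n - p0))) \<longlonglongrightarrow> 0"
            by (simp add: norm_divide)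
          then have "(\<lambda>n. (k (Y n) w - k p0 w - k' w (Y n - p0)) / norm (Y n - p0)) \<longlonglongrightarrow> 0"
            by (rule tendsto_norm_zero_cancel)
          then show "(\<lambda>n. ?r (Y n) w) \<longlonglongrightarrow> 0"
            using tendsto_mult_right_zero by blast
        qed
      qed (use f in auto)
      then have "(\<lambda>n. \<integral>w. ?r (Y n) w \<partial>M) \<longlonglongrightarrow> 0" by (simp only: Bochner_Integration.integral_zero)
      then have "(\<lambda>n. norm (\<integral>w. ?r (Y n) w \<partial>M)) \<longlonglongrightarrow> 0" by (rule tendsto_norm_zero)
      moreover have "norm (\<integral>w. ?r (Y n) w \<partial>M) = ?q (Y n)" for n
      proof -
        have "(\<integral>w. ?r (Y n) w \<partial>M) = (\<integral>w. (f w * k (Y n) w - f w * k p0 w - f w * k' w (Y n - p0)) / norm (Y n - p0) \<partial>M)"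
          by (simp add: algebra_simps diff_divide_distrib)
        also have "\<dots> = ((\<integral>w. f w * k (Y n) w \<partial>M) - (\<integral>w. f w * k p0 w \<partial>M) - (\<integral>w. f w * k' w (Y n - p0) \<partial>M)) / norm (Y n - p0)"
          using int_k[OF Y(1)[of n]] int_k[of p0] int_k' \<open>\<delta> > 0\<close> by simp
        finally show ?thesis by (simp only: abs_divide real_norm_def abs_norm_cancel)
      qed
      ultimately have "(\<lambda>n. ?q (Y n)) \<longlonglongrightarrow> 0" by (simp only:)
      then show "(\<lambda>n. ?q (X n)) \<longlonglongrightarrow> 0"
        unfolding Y_def by (rule LIMSEQ_offset)
    qed
  qed
qed

lemma mollify_has_derivative:
  assumes f: "integrable (lebesgue_on S) f" and \<eta>: "\<eta> \<in> test_functions UNIV"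
  shows "((\<lambda>z. \<integral>w. f w * \<eta> (z - w) \<partial>lebesgue_on S) has_derivative
    (\<lambda>h. \<integral>w. f w * (grad \<eta> (z - w) \<bullet> h) \<partial>lebesgue_on S)) (at z)"
proof -
  obtain C where C: "C \<ge> 0" "\<And>z. \<bar>\<eta> z\<bar> \<le> C" "\<And>z. norm (grad \<eta> z) \<le> C" "\<And>x y. \<bar>\<eta> x - \<eta> y\<bar> \<le> C * norm (x - y)"
    using test_functions_bounded[OF \<eta>] by metis
  show ?thesis
  proof (rule has_derivative_integral_kernel[where \<delta>=1 and C=C])
    show "(\<lambda>w. \<eta> (p - w)) \<in> borel_measurable (lebesgue_on S)" for p
      by (intro continuous_borel_measurable_lebesgue_on continuous_on_compose2[OF test_functionsD(3)[OF \<eta>, of UNIV]] continuous_intros) auto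
    show "(\<lambda>w. grad \<eta> (z - w) \<bullet> h) \<in> borel_measurable (lebesgue_on S)" for h
      by (intro continuous_borel_measurable_lebesgue_on continuous_intros continuous_on_compose2[OF continuous_grad[OF \<eta>, of UNIV]]) auto
    show "\<bar>\<eta> (p - w) - \<eta> (z - w)\<bar> \<le> C * norm (p - z)" for p w using C(4)[of "p - w" "z - w"] by simp
    show "\<bar>grad \<eta> (z - w) \<bullet> h\<bar> \<le> C * norm h" for w h
      using Cauchy_Schwarz_ineq2[of "grad \<eta> (z - w)" h] C(3)[of "z - w"] by (meson mult_right_mono norm_ge_zero order_trans)
    show "((\<lambda>p. \<eta> (p - w)) has_derivative (\<lambda>h. grad \<eta> (z - w) \<bullet> h)) (at z)" for w
      by (rule has_derivative_compose[of "\<lambda>p. p - w" "\<lambda>h. h", OF _ test_functionsD(4)[OF \<eta>]]) (auto intro!: derivative_eq_intros)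
  qed (use f C in auto)
qed

text \<open>Derivatives fall on the kernel and leave another mollification of the same
  \<open>f\<close>, with a directional derivative of \<open>\<eta>\<close> as kernel; hence the
  induction over all test functions \<open>\<eta>\<close>.\<close>

lemma Ck_mollify:
  assumes f: "integrable (lebesgue_on S) f"
  shows "\<eta> \<in> test_functions UNIV \<Longrightarrow> Ck n (\<lambda>z. \<integral>w. f w * \<eta> (z - w) \<partial>lebesgue_on S)"
proof (induction n arbitrary: \<eta>)
  case 0
  show ?case unfolding Ck.simps
    by (rule continuous_at_imp_continuous_on) (use has_derivative_continuous[OF mollify_has_derivative[OF f 0]] in blast)
next
  case (Suc n)
  show ?case
    by (rule Ck_SucI[OF mollify_has_derivative[OF f Suc.prems]]) (rule Suc.IH[OF test_functions_grad[OF Suc.prems]])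
qed

text \<open>The mean value theorem along \<open>h\<close>, for the difference of
  \<open>\<phi>\<close> at points a step \<open>t *\<^sub>R k\<close> apart, and then along
  \<open>k\<close>. The second difference is visibly symmetric in \<open>h\<close> and
  \<open>k\<close>, the derivative on the right is not: this is the source of
  \<open>mixed_partials\<close>.\<close>

lemma second_difference_mvt:
  assumes \<phi>: "\<phi> \<in> test_functions UNIV" and t: "t > 0"
  shows "\<exists>\<xi>. norm (\<xi> - z) \<le> t * (norm h + norm k) \<and>
    \<phi> (z + t *\<^sub>R h + t *\<^sub>R k) - \<phi> (z + t *\<^sub>R h) - \<phi> (z + t *\<^sub>R k) + \<phi> z = t * t * (grad (\<lambda>z. grad \<phi> z \<bullet> h) \<xi> \<bullet> k)"
proof -
  have line: "((\<lambda>x. \<psi> (a + x *\<^sub>R b)) has_real_derivative grad \<psi> (a + x *\<^sub>R b) \<bullet> b) (at x)"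
    if "\<psi> \<in> test_functions UNIV" for \<psi> a b x
    unfolding has_field_derivative_def
    by (rule has_derivative_eq_rhs, rule has_derivative_compose[of "\<lambda>x. a + x *\<^sub>R b" "\<lambda>x. x *\<^sub>R b", OF _ test_functionsD(4)[OF that]])
       (auto intro!: derivative_eq_intros)
  have "((\<lambda>x. \<phi> ((z + t *\<^sub>R k) + x *\<^sub>R h) - \<phi> (z + x *\<^sub>R h)) has_real_derivative
      grad \<phi> ((z + t *\<^sub>R k) + x *\<^sub>R h) \<bullet> h - grad \<phi> (z + x *\<^sub>R h) \<bullet> h) (at x)" for x
    by (intro DERIV_diff line \<phi>)
  from MVT2[OF t this]
  obtain x where x: "0 < x" "x < t" and
    1: "\<phi> ((z + t *\<^sub>R k) + t *\<^sub>R h) - \<phi> (z + t *\<^sub>R h) - (\<phi> (z + t *\<^sub>R k) - \<phi> z)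
        = t * (grad \<phi> ((z + t *\<^sub>R k) + x *\<^sub>R h) \<bullet> h - grad \<phi> (z + x *\<^sub>R h) \<bullet> h)"
    by auto
  let ?g = "\<lambda>z. grad \<phi> z \<bullet> h"
  from MVT2[OF t line[OF test_functions_grad[OF \<phi>]], of "z + x *\<^sub>R h" k h]
  obtain y where y: "0 < y" "y < t" and
    2: "?g (z + x *\<^sub>R h + t *\<^sub>R k) - ?g (z + x *\<^sub>R h) = t * (grad ?g (z + x *\<^sub>R h + y *\<^sub>R k) \<bullet> k)"
    by auto
  show ?thesis
  proof (intro exI[of _ "z + x *\<^sub>R h + y *\<^sub>R k"] conjI)
    have "norm (x *\<^sub>R h + y *\<^sub>R k) \<le> x * norm h + y * norm k"
      using norm_triangle_ineq[of "x *\<^sub>R h" "y *\<^sub>R k"] x y by simp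
    also have "\<dots> \<le> t * norm h + t * norm k" using x y by (intro add_mono mult_right_mono) auto
    finally show "norm (z + x *\<^sub>R h + y *\<^sub>R k - z) \<le> t * (norm h + norm k)" by (simp add: algebra_simps)
    have e: "(z + t *\<^sub>R k) + x *\<^sub>R h = z + x *\<^sub>R h + t *\<^sub>R k" by simp
    show "\<phi> (z + t *\<^sub>R h + t *\<^sub>R k) - \<phi> (z + t *\<^sub>R h) - \<phi> (z + t *\<^sub>R k) + \<phi> z = t * t * (grad ?g (z + x *\<^sub>R h + y *\<^sub>R k) \<bullet> k)"
      using 1[unfolded e 2] by (simp add: algebra_simps)
  qed
qed

lemma mixed_partials:
  assumes \<phi>: "\<phi> \<in> test_functions \<Omega>"
  shows "grad (\<lambda>z. grad \<phi> z \<bullet> h) z \<bullet> k = grad (\<lambda>z. grad \<phi> z \<bullet> k) z \<bullet> h"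
proof -
  have \<phi>: "\<phi> \<in> test_functions UNIV" using \<phi> test_functions_mono by blast
  define e where "e n = inverse (real (Suc n))" for n
  have e: "e n > 0" "e \<longlonglongrightarrow> 0" for n using LIMSEQ_inverse_real_of_nat by (auto simp: e_def[abs_def])
  let ?L = "\<lambda>h k \<xi>. grad (\<lambda>z. grad \<phi> z \<bullet> h) \<xi> \<bullet> k"
  have "\<forall>n. \<exists>\<xi>. norm (\<xi> - z) \<le> e n * (norm h + norm k) \<and> ?L h k \<xi> =
      (\<phi> (z + e n *\<^sub>R h + e n *\<^sub>R k) - \<phi> (z + e n *\<^sub>R h) - \<phi> (z + e n *\<^sub>R k) + \<phi> z) / (e n * e n)" for h k
    using second_difference_mvt[OF \<phi> e(1)] e(1) by (metis less_irrefl mult_eq_0_iff nonzero_mult_div_cancel_left)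
  then obtain \<xi> where \<xi>: "\<And>h k n. norm (\<xi> h k n - z) \<le> e n * (norm h + norm k)"
    "\<And>h k n. ?L h k (\<xi> h k n) = (\<phi> (z + e n *\<^sub>R h + e n *\<^sub>R k) - \<phi> (z + e n *\<^sub>R h) - \<phi> (z + e n *\<^sub>R k) + \<phi> z) / (e n * e n)"
    by metis
  have "(\<lambda>n. \<xi> h k n - z) \<longlonglongrightarrow> 0" for h k
    by (rule Lim_null_comparison[where g="\<lambda>n. e n * (norm h + norm k)"]) (use \<xi>(1) e(2) in \<open>auto intro!: tendsto_eq_intros\<close>)
  then have lim: "\<xi> h k \<longlonglongrightarrow> z" for h k using LIM_zero_cancel by blast
  have "isCont (?L h k) z" for h k
    using continuous_grad[OF test_functions_grad[OF \<phi>], of UNIV] by (intro continuous_intros) (auto simp: continuous_on_eq_continuous_at)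
  then have "(\<lambda>n. ?L h k (\<xi> h k n)) \<longlonglongrightarrow> ?L h k z" for h k using lim isCont_tendsto_compose by blast
  \<comment> \<open>The symmetry of the second difference exchanges the two directions before the
    limit is taken.\<close>
  moreover have "?L h k (\<xi> h k n) = ?L k h (\<xi> k h n)" for n by (simp add: \<xi>(2) algebra_simps)
  ultimately show ?thesis using LIMSEQ_unique by (metis (no_types, lifting) ext)
qed

section \<open>Weyl's lemma\<close>

text \<open>Open boxes are an intersection-stable generator of the Borel sets, and the sets over
  which \<open>h\<close> integrates to 0 form a Dynkin system; \<open>all\<close> takes care of
  complements.\<close>

lemma AE_eq_0_if_box_integrals_eq_0:
  fixes h :: "complex \<Rightarrow> real"
  assumes h: "integrable lborel h"
    and box: "\<And>a b. (\<integral>x\<in>box a b. h x \<partial>lborel) = 0" and all: "integral\<^sup>L lborel h = 0"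
  shows "AE x in lborel. h x = 0"
proof -
  have int: "set_integrable lborel A h" if "A \<in> sets borel" for A
    unfolding set_integrable_def by (rule integrable_mult_indicator[OF _ h]) (use that in simp)
  have S: "sigma_sets UNIV (range (\<lambda>(a, b). box a b)) = sets (borel :: complex measure)"
    by (subst borel_eq_box) (simp add: sets_measure_of)
  have st: "Int_stable (range (\<lambda>(a, b). box a b :: complex set))"
    unfolding Int_stable_def
  proof (intro ballI)
    fix A B :: "complex set" assume "A \<in> range (\<lambda>(a, b). box a b)" "B \<in> range (\<lambda>(a, b). box a b)"
    then obtain a b c d where "A = box a b" "B = box c d" by fast
    then show "A \<inter> B \<in> range (\<lambda>(a, b). box a b)" by (simp only: box_Int_box) fast
  qed
  have "(\<integral>x\<in>A. h x \<partial>lborel) = 0" if "A \<in> sets borel" for A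
  proof -
    have "range (\<lambda>(a, b). box a b) \<subseteq> Pow (UNIV :: complex set)" by simp
    from st this that[folded S] show ?thesis
    proof (induction A rule: sigma_sets_induct_disjoint)
      case (basic A) then show ?case using box by auto
    next
      case empty show ?case by (simp add: set_lebesgue_integral_def)
    next
      case (compl A)
      then have A: "A \<in> sets borel" by (simp add: S)
      have "(\<integral>x\<in>A \<union> (UNIV - A). h x \<partial>lborel) = (\<integral>x\<in>A. h x \<partial>lborel) + (\<integral>x\<in>UNIV - A. h x \<partial>lborel)"
        by (rule set_integral_Un) (use A int in auto)
      then show ?case using compl all by (simp add: set_lebesgue_integral_def)
    next
      case (union A)
      then have A: "A i \<in> sets borel" for i unfolding S by blast
      have "(\<integral>x\<in>(\<Union>i. A i). h x \<partial>lborel) = (\<Sum>i. \<integral>x\<in>A i. h x \<partial>lborel)"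
        by (rule lebesgue_integral_countable_add) (use A int union in \<open>auto simp: disjoint_family_on_def\<close>)
      then show ?case using union by simp
    qed
  qed
  then have "AE x in lborel. h x = (\<lambda>_. 0) x"
    by (intro density_unique_real h) (auto simp: set_lebesgue_integral_def)
  then show ?thesis by simp
qed

text \<open>
  The profile is the derivative of \<open>flat_exp 0\<close>; this makes the \<open>\<epsilon>\<close>-derivative of the kernel
  the Laplacian of a test function.
\<close>

definition kern :: "real \<Rightarrow> complex \<Rightarrow> real" where
  "kern \<epsilon> u = flat_exp 2 (1 - (norm u)\<^sup>2 / \<epsilon>\<^sup>2) / \<epsilon>\<^sup>2"

text \<open>\<open>kern\<close> is left unnormalised. Its mass is the same for every radius, so this
  one number is divided out wherever a mollification is compared with the function.\<close>

definition kern_mass :: real where "kern_mass = integral\<^sup>L lborel (kern 1)"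

lemma Ck_flat_kern: "Ck n (\<lambda>u. flat_exp m (1 - (norm u)\<^sup>2 / \<epsilon>\<^sup>2))"
proof (rule Ck_flat_exp)
  have "Ck n (\<lambda>u. 1 + (- 1 / \<epsilon>\<^sup>2) * (norm u)\<^sup>2)" by (intro Ck_add Ck_mult Ck_const Ck_norm_sq)
  then show "Ck n (\<lambda>u. 1 - (norm u)\<^sup>2 / \<epsilon>\<^sup>2)" by simp
qed

lemma flat_kern_eq_0: "\<epsilon> > 0 \<Longrightarrow> norm u \<ge> \<epsilon> \<Longrightarrow> flat_exp m (1 - (norm u)\<^sup>2 / \<epsilon>\<^sup>2) = 0"
  by (simp add: flat_exp_def divide_simps power_mono)

lemma kern_eq_0: "\<epsilon> > 0 \<Longrightarrow> norm u \<ge> \<epsilon> \<Longrightarrow> kern \<epsilon> u = 0"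
  by (simp add: kern_def flat_kern_eq_0)

lemma kern_nonneg: "kern \<epsilon> u \<ge> 0"
  by (simp add: kern_def flat_exp_nonneg)

lemma test_flat_kern: "\<epsilon> > 0 \<Longrightarrow> (\<lambda>u. flat_exp m (1 - (norm u)\<^sup>2 / \<epsilon>\<^sup>2)) \<in> test_functions UNIV"
  by (rule test_functionsI[OF Ck_flat_kern, of "cball 0 \<epsilon>"]) (auto intro: flat_kern_eq_0)

lemma test_kern: "\<epsilon> > 0 \<Longrightarrow> kern \<epsilon> \<in> test_functions UNIV"
  using test_functions_cmult[OF test_flat_kern[of \<epsilon> 2], of "1 / \<epsilon>\<^sup>2"] by (simp add: kern_def[abs_def])

lemma test_flat_kern_shift:
  assumes "\<epsilon> > 0" "cball z \<epsilon> \<subseteq> \<Omega>"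
  shows "(\<lambda>w. flat_exp m (1 - (norm (w - z))\<^sup>2 / \<epsilon>\<^sup>2)) \<in> test_functions \<Omega>"
proof (rule test_functionsI[of _ "cball z \<epsilon>"])
  show "Ck n (\<lambda>w. flat_exp m (1 - (norm (w - z))\<^sup>2 / \<epsilon>\<^sup>2))" for n
    using Ck_affine_compose[OF Ck_flat_kern[of n m \<epsilon>], of 1 "- z"] by simp
qed (use assms in \<open>auto intro: flat_kern_eq_0 simp: dist_norm norm_minus_commute\<close>)

lemma kern_continuous: "\<epsilon> > 0 \<Longrightarrow> continuous_on S (kern \<epsilon>)"
  using test_functionsD(3)[OF test_kern] .

lemma kern_borel [measurable]: "\<epsilon> > 0 \<Longrightarrow> kern \<epsilon> \<in> borel_measurable borel"
  using kern_continuous by (intro borel_measurable_continuous_onI)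

lemma kern_integrable: "\<epsilon> > 0 \<Longrightarrow> integrable lborel (kern \<epsilon>)"
proof -
  assume "\<epsilon> > 0"
  then have "set_integrable lborel (cball 0 \<epsilon>) (kern \<epsilon>)"
    unfolding set_integrable_def by (intro borel_integrable_compact kern_continuous) auto
  moreover have "indicator (cball 0 \<epsilon>) u *\<^sub>R kern \<epsilon> u = kern \<epsilon> u" for u
    using kern_eq_0[OF \<open>\<epsilon> > 0\<close>, of u] by (auto simp: indicator_def)
  ultimately show ?thesis by (simp only: set_integrable_def)
qed

text \<open>Substitution of \<open>w + \<epsilon> *\<^sub>R x\<close>: the factor
  \<open>1 / \<epsilon>\<^sup>2\<close> in \<open>kern\<close> cancels the Jacobian in dimension
  two.\<close>

lemma kern_shift_integral:
  assumes "\<epsilon> > 0"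
  shows "(\<integral>z. kern \<epsilon> (z - w) \<partial>lborel) = kern_mass" "integrable lborel (\<lambda>z. kern \<epsilon> (z - w))"
proof -
  have k: "\<epsilon>\<^sup>2 * kern \<epsilon> (\<epsilon> *\<^sub>R u) = kern 1 u" for u
    using assms by (simp add: kern_def power_mult_distrib)
  have l: "lborel = density (distr lborel borel (\<lambda>x. w + \<epsilon> *\<^sub>R x)) (\<lambda>_. ennreal (\<epsilon>\<^sup>2))"
    using lborel_affine[of \<epsilon> w] assms by (simp add: power2_eq_square)
  have m [measurable]: "(\<lambda>z. kern \<epsilon> (z - w)) \<in> borel_measurable borel" using assms by measurable
  have "(\<integral>z. kern \<epsilon> (z - w) \<partial>lborel) = (\<integral>x. \<epsilon>\<^sup>2 * kern \<epsilon> (\<epsilon> *\<^sub>R x) \<partial>lborel)"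
    by (subst l, subst integral_density) (auto simp: integral_distr)
  then show "(\<integral>z. kern \<epsilon> (z - w) \<partial>lborel) = kern_mass" by (simp add: k kern_mass_def)
  show "integrable lborel (\<lambda>z. kern \<epsilon> (z - w))"
  proof -
    have "integrable lborel (\<lambda>x. \<epsilon>\<^sup>2 * kern \<epsilon> (\<epsilon> *\<^sub>R x))" using kern_integrable[of 1] by (simp only: k)
    then show ?thesis by (subst l, subst integrable_density) (auto simp: integrable_distr_eq)
  qed
qed

lemma kern_mass_pos: "kern_mass > 0"
proof -
  have "kern_mass \<noteq> 0"
  proof
    assume "kern_mass = 0"
    then have "AE x in lborel. kern 1 x = 0"
      using integral_nonneg_eq_0_iff_AE[OF kern_integrable[of 1]] by (simp add: kern_mass_def kern_nonneg)
    then have "AE x in lborel. x \<notin> ball (0::complex) 1"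
    proof (rule eventually_mono)
      fix x :: complex assume "kern 1 x = 0"
      then show "x \<notin> ball 0 1"
        using power_less_one_iff[of "cmod x" 2] by (auto simp: kern_def flat_exp_def split: if_splits)
    qed
    then have "ball (0::complex) 1 \<in> null_sets lborel"
      by (subst (asm) AE_iff_null_sets[symmetric]) auto
    then show False using open_not_negligible[of "ball (0::complex) 1"] by (simp add: negligible_iff_null_sets null_sets_completionI)
  qed
  moreover have "kern_mass \<ge> 0" by (simp add: kern_mass_def kern_nonneg)
  ultimately show ?thesis by simp
qed

text \<open>
  If the mollifications of \<open>f\<close> stabilise on \<open>U\<close>, the stable value is \<open>f\<close> itself: integrate over
  convex open sets, whose boundaries are null, and let \<open>\<epsilon>\<close> tend to \<open>0\<close>.
\<close>

lemma mollify_stable_AE: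
  fixes f :: "complex \<Rightarrow> real"
  assumes f: "integrable lborel f" and U: "open U" "convex U" "bounded U" and "\<epsilon>1 > 0"
    and stab: "\<And>z \<epsilon>. z \<in> U \<Longrightarrow> 0 < \<epsilon> \<Longrightarrow> \<epsilon> \<le> \<epsilon>1 \<Longrightarrow> (\<integral>w. f w * kern \<epsilon> (z - w) \<partial>lborel) = H z"
    and H: "H \<in> borel_measurable borel" "\<And>z. \<bar>H z\<bar> \<le> B"
  shows "AE z in lborel. z \<in> U \<longrightarrow> kern_mass * f z = H z"
proof -
  have [measurable]: "f \<in> borel_measurable borel" "H \<in> borel_measurable borel" using f H(1) by auto
  have key: "(\<integral>z. indicator A z * H z \<partial>lborel) = (\<integral>z. indicator A z * (kern_mass * f z) \<partial>lborel)"
    if A: "open A" "convex A" "A \<subseteq> U" for A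
  proof -
    have [measurable]: "A \<in> sets borel" using A by auto
    have finA: "integrable lborel (indicator A :: complex \<Rightarrow> real)"
      using bounded_subset[OF U(3) A(3)] emeasure_bounded_finite by (intro integrable_real_indicator) auto
    define e where "e n = \<epsilon>1 * inverse (real (Suc n))" for n
    have e: "0 < e n" "e n \<le> \<epsilon>1" for n using \<open>\<epsilon>1 > 0\<close> by (auto simp: e_def field_simps)
    have e0: "e \<longlonglongrightarrow> 0" unfolding e_def using tendsto_mult_right_zero[OF LIMSEQ_inverse_real_of_nat] by simp
    \<comment> \<open>The part of the kernel mass around \<open>w\<close> that lies in
      \<open>A\<close>; off the frontier of \<open>A\<close> it is eventually all of
      \<open>kern_mass\<close> or nothing.\<close>
    define m where "m n w = (\<integral>z. indicator A z * kern (e n) (z - w) \<partial>lborel)" for n w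
    have kb [measurable]: "kern (e n) \<in> borel_measurable borel" for n using e(1) by measurable
    have int1: "integrable lborel (\<lambda>z. indicator A z * kern (e n) (z - w))" for n w
      using kern_shift_integral(2)[OF e(1)]
      by (rule Bochner_Integration.integrable_bound) (auto simp: indicator_def)
    have m: "0 \<le> m n w" "m n w \<le> kern_mass" for n w
    proof -
      show "0 \<le> m n w" unfolding m_def by (intro integral_nonneg_AE) (simp add: kern_nonneg)
      have "m n w \<le> (\<integral>z. kern (e n) (z - w) \<partial>lborel)" unfolding m_def
        by (intro integral_mono int1 kern_shift_integral(2) e) (simp add: kern_nonneg indicator_def)
      then show "m n w \<le> kern_mass" by (simp add: kern_shift_integral(1) e)
    qed
    have eq: "(\<integral>z. indicator A z * H z \<partial>lborel) = (\<integral>w. f w * m n w \<partial>lborel)" for n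
    proof -
      obtain C where C: "C \<ge> 0" "\<And>z. \<bar>kern (e n) z\<bar> \<le> C" using test_functions_bounded[OF test_kern[OF e(1)]] by metis
      have "(\<integral>z. indicator A z * H z \<partial>lborel) = (\<integral>z. (\<integral>w. indicator A z * (f w * kern (e n) (z - w)) \<partial>lborel) \<partial>lborel)"
      proof (rule Bochner_Integration.integral_cong)
        fix z show "indicator A z * H z = (\<integral>w. indicator A z * (f w * kern (e n) (z - w)) \<partial>lborel)"
          using stab[of z "e n"] e A(3) by (cases "z \<in> A") auto
      qed simp
      also have "\<dots> = (\<integral>w. (\<integral>z. indicator A z * (f w * kern (e n) (z - w)) \<partial>lborel) \<partial>lborel)"
      proof (rule lborel_pair.Fubini_integral[symmetric])
        have "integrable (lborel \<Otimes>\<^sub>M lborel) (\<lambda>(z, w). indicator A z * f w :: real)"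
        proof (rule lborel_pair.Fubini_integrable)
          show "integrable lborel (\<lambda>x. \<integral>y. norm (case (x, y) of (z, w) \<Rightarrow> indicator A z * f w) \<partial>lborel)"
            using finA by (simp add: abs_mult)
          show "AE x in lborel. integrable lborel (\<lambda>y. case (x, y) of (z, w) \<Rightarrow> indicator A z * f w)" using f by simp
        qed simp
        from integrable_mult_right[OF this, of C]
        show "integrable (lborel \<Otimes>\<^sub>M lborel) (\<lambda>(w, z). indicator A w * (f z * kern (e n) (w - z)))"
        proof (rule Bochner_Integration.integrable_bound)
          show "AE x in lborel \<Otimes>\<^sub>M lborel. norm (case x of (w, z) \<Rightarrow> indicator A w * (f z * kern (e n) (w - z)))
                \<le> norm (C * (case x of (z, w) \<Rightarrow> indicator A z * f w))"
          proof (intro always_eventually allI)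
            fix x :: "complex \<times> complex"
            obtain w z where x: "x = (w, z)" by (cases x)
            have "\<bar>f z\<bar> * \<bar>kern (e n) (w - z)\<bar> \<le> \<bar>f z\<bar> * C" using C by (intro mult_left_mono) auto
            then show "norm (case x of (w, z) \<Rightarrow> indicator A w * (f z * kern (e n) (w - z))) \<le> norm (C * (case x of (z, w) \<Rightarrow> indicator A z * f w))"
              using C(1) by (simp add: x indicator_def abs_mult mult.commute)
          qed
        qed measurable
      qed
      also have "\<dots> = (\<integral>w. f w * m n w \<partial>lborel)" by (simp add: m_def mult_ac)
      finally show ?thesis .
    qed
    have "(\<lambda>n. \<integral>w. f w * m n w \<partial>lborel) \<longlonglongrightarrow> (\<integral>w. f w * (kern_mass * indicator A w) \<partial>lborel)"
    proof (rule integral_dominated_convergence[where w="\<lambda>w. kern_mass * \<bar>f w\<bar>"])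
      have [measurable]: "m n \<in> borel_measurable borel" for n
        unfolding m_def using lborel.borel_measurable_lebesgue_integral[of "\<lambda>w z. indicator A z * kern (e n) (z - w)" borel]
        by simp
      show "(\<lambda>w. f w * m n w) \<in> borel_measurable lborel" for n by simp
      show "AE w in lborel. norm (f w * m n w) \<le> kern_mass * \<bar>f w\<bar>" for n
        using m by (intro always_eventually allI) (simp add: abs_mult mult.commute[of "\<bar>f _\<bar>"] mult_right_mono)
      have "frontier A \<in> null_sets lborel"
        using negligible_convex_frontier[OF A(2)] by (simp add: negligible_iff_null_sets null_sets_completion_iff)
      then have "AE w in lborel. w \<notin> frontier A" by (rule AE_not_in)
      then show "AE w in lborel. (\<lambda>n. f w * m n w) \<longlonglongrightarrow> f w * (kern_mass * indicator A w)"
      proof (rule eventually_mono)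
        fix w assume w: "w \<notin> frontier A"
        have "(\<lambda>n. m n w) \<longlonglongrightarrow> kern_mass * indicator A w"
        proof (cases "w \<in> A")
          case True
          then obtain d where d: "d > 0" "ball w d \<subseteq> A" using A(1) open_contains_ball by blast
          have "\<forall>\<^sub>F n in sequentially. e n < d" using e0 d(1) by (rule order_tendstoD)
          then have "\<forall>\<^sub>F n in sequentially. m n w = kern_mass"
          proof (rule eventually_mono)
            fix n assume n: "e n < d"
            have "indicator A z * kern (e n) (z - w) = kern (e n) (z - w)" for z
            proof (cases "z \<in> A")
              case False
              then have "z \<notin> ball w d" using d(2) by blast
              then have "norm (z - w) \<ge> d" by (auto simp: dist_norm norm_minus_commute)
              then show ?thesis using kern_eq_0[OF e(1), of n "z - w"] n by auto
            qed simp
            then show "m n w = kern_mass" unfolding m_def by (simp only: kern_shift_integral(1)[OF e(1)])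
          qed
          then show ?thesis using True by (simp add: tendsto_eventually)
        next
          case False
          then have "w \<in> - closure A" using w by (auto simp: frontier_def interior_open[OF A(1)])
          then obtain d where d: "d > 0" "ball w d \<subseteq> - closure A" using open_contains_ball by blast
          have "\<forall>\<^sub>F n in sequentially. e n < d" using e0 d(1) by (rule order_tendstoD)
          then have "\<forall>\<^sub>F n in sequentially. m n w = 0"
          proof (rule eventually_mono)
            fix n assume n: "e n < d"
            have "indicator A z * kern (e n) (z - w) = 0" for z
            proof (cases "z \<in> A")
              case True
              then have "z \<notin> ball w d" using d(2) closure_subset by blast
              then have "norm (z - w) \<ge> d" by (auto simp: dist_norm norm_minus_commute)
              then show ?thesis using kern_eq_0[OF e(1), of n "z - w"] n by auto
            qed simp
            then show "m n w = 0" unfolding m_def by (simp only: Bochner_Integration.integral_zero)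
          qed
          then show ?thesis using False by (simp add: tendsto_eventually)
        qed
        then show "(\<lambda>n. f w * m n w) \<longlonglongrightarrow> f w * (kern_mass * indicator A w)" by (intro tendsto_intros)
      qed
    qed (use f in auto)
    then have "(\<lambda>n::nat. \<integral>z. indicator A z * H z \<partial>lborel) \<longlonglongrightarrow> (\<integral>w. f w * (kern_mass * indicator A w) \<partial>lborel)"
      by (simp only: eq[symmetric])
    then have "(\<integral>z. indicator A z * H z \<partial>lborel) = (\<integral>w. f w * (kern_mass * indicator A w) \<partial>lborel)"
      by (simp only: LIMSEQ_const_iff)
    then show ?thesis by (simp add: mult_ac)
  qed
  have [measurable]: "U \<in> sets borel" using U by auto
  define h where "h z = indicator U z * (kern_mass * f z) - indicator U z * H z" for z
  have i1: "integrable lborel (\<lambda>z. indicator A z * (kern_mass * f z))" if "A \<in> sets borel" for A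
    by (rule Bochner_Integration.integrable_bound[of _ "\<lambda>z. kern_mass * f z"]) (use f that in \<open>auto simp: indicator_def\<close>)
  have i2: "integrable lborel (\<lambda>z. indicator A z * H z)" if "A \<in> sets borel" "A \<subseteq> U" for A
  proof (rule Bochner_Integration.integrable_bound[of _ "\<lambda>z. B * indicator A z"])
    show "integrable lborel (\<lambda>z. B * indicator A z :: real)"
      using bounded_subset[OF U(3) that(2)] emeasure_bounded_finite that by (intro integrable_mult_right integrable_real_indicator) auto
    show "AE x in lborel. norm (indicator A x * H x) \<le> norm (B * indicator A x)"
      using H(2) by (intro always_eventually allI) (auto simp: indicator_def intro: order_trans[OF _ abs_ge_self])
  qed (use that in auto)
  have "AE x in lborel. h x = 0"
  proof (rule AE_eq_0_if_box_integrals_eq_0)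
    show "integrable lborel h" unfolding h_def by (intro Bochner_Integration.integrable_diff i1 i2) auto
    \<comment> \<open>A box may leave \<open>U\<close>, but its intersection with \<open>U\<close>
      is still open and convex, so \<open>key\<close> applies to it. Taking the whole plane for
      \<open>A\<close> gives the total integral.\<close>
    have int: "(\<integral>x. indicator A x * h x \<partial>lborel) = 0" if "open A" "convex A" for A
    proof -
      have "(\<integral>x. indicator A x * h x \<partial>lborel) = (\<integral>x. indicator (A \<inter> U) x * (kern_mass * f x) - indicator (A \<inter> U) x * H x \<partial>lborel)"
        by (rule Bochner_Integration.integral_cong) (auto simp: h_def indicator_def)
      also have "\<dots> = 0"
      proof -
        have A: "open (A \<inter> U)" "convex (A \<inter> U)" "A \<inter> U \<subseteq> U" using that U by (auto intro: convex_Int)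
        show ?thesis using key[OF A] i1[of "A \<inter> U"] i2[of "A \<inter> U"] A(1,3) by simp
      qed
      finally show ?thesis .
    qed
    then show "(\<integral>x\<in>box a b. h x \<partial>lborel) = 0" for a b
      using convex_box(2)[of a b] open_box[of a b] by (simp add: set_lebesgue_integral_def)
    show "integral\<^sup>L lborel h = 0" using int[of UNIV] by simp
  qed
  then show ?thesis
    by (rule eventually_mono) (auto simp: h_def)
qed

section \<open>Restricted integrals, local square integrability and the weak Cauchy-Riemann
  equations\<close>

abbreviation disk :: "complex set" where "disk \<equiv> ball 0 1"

lemma integral_lebesgue_on_subset:
  fixes g :: "complex \<Rightarrow> 'b::euclidean_space"
  assumes "S \<in> sets lebesgue" "T \<in> sets lebesgue" "S \<subseteq> T" "\<And>z. z \<in> T - S \<Longrightarrow> g z = 0"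
  shows "integral\<^sup>L (lebesgue_on T) g = integral\<^sup>L (lebesgue_on S) g"
proof -
  have "integral\<^sup>L (lebesgue_on T) g = (\<integral>x. indicat_real T x *\<^sub>R g x \<partial>lebesgue)"
    using assms(2) by (subst integral_restrict_space) auto
  also have "\<dots> = (\<integral>x. indicat_real S x *\<^sub>R g x \<partial>lebesgue)"
    by (rule Bochner_Integration.integral_cong) (use assms(3,4) in \<open>auto simp: indicator_def\<close>)
  also have "\<dots> = integral\<^sup>L (lebesgue_on S) g"
    using assms(1) by (subst integral_restrict_space) auto
  finally show ?thesis .
qed

lemma L2_loc_integrable:
  fixes g :: "complex \<Rightarrow> 'b::euclidean_space"
  assumes "g \<in> L2_loc \<Omega>" "compact C" "C \<subseteq> \<Omega>"
  shows "integrable (lebesgue_on C) g"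
proof -
  have m: "g \<in> borel_measurable (lebesgue_on C)"
    using assms(1) unfolding L2_loc_def by (auto intro: measurable_restrict_mono[OF _ assms(3)])
  have "integrable (lebesgue_on C) (\<lambda>z. (norm (g z))\<^sup>2)" using assms by (auto simp: L2_loc_def)
  moreover have "finite_measure (lebesgue_on C)"
    by (rule finite_measure_lebesgue_on) (rule lmeasurable_compact[OF assms(2)])
  then have "integrable (lebesgue_on C) (\<lambda>z. 1 :: real)" using finite_measure.integrable_const by blast
  ultimately have "integrable (lebesgue_on C) (\<lambda>z. 1 + (norm (g z))\<^sup>2)" by simp
  then show ?thesis
  proof (rule Bochner_Integration.integrable_bound)
    show "AE x in lebesgue_on C. norm (g x) \<le> norm (1 + (norm (g x))\<^sup>2)"
    proof (intro always_eventually allI)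
      fix x
      have "0 \<le> (norm (g x) - 1)\<^sup>2" by simp
      then have "2 * norm (g x) \<le> 1 + (norm (g x))\<^sup>2" by (simp add: power2_eq_square algebra_simps)
      then have "norm (g x) \<le> 1 + (norm (g x))\<^sup>2" using norm_ge_zero[of "g x"] by linarith
      then show "norm (g x) \<le> norm (1 + (norm (g x))\<^sup>2)" by simp
    qed
  qed (use m in auto)
qed

text \<open>
  A vector field \<open>g\<close> is weakly divergence-free and curl-free iff \<open>cnj g\<close> satisfies the
  Cauchy--Riemann equations weakly.
\<close>

definition weakly_CR :: "(complex \<Rightarrow> complex) \<Rightarrow> bool" where
  "weakly_CR g \<longleftrightarrow> g \<in> L2_loc disk \<and>
    (\<forall>\<phi>\<in>test_functions disk. (\<integral>z. g z \<bullet> grad \<phi> z \<partial>lebesgue_on disk) = 0 \<and>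
       (\<integral>z. (\<i> * g z) \<bullet> grad \<phi> z \<partial>lebesgue_on disk) = 0)"

lemma integrable_times_test:
  fixes g :: "complex \<Rightarrow> real"
  assumes "g \<in> L2_loc \<Omega>" "\<phi> \<in> test_functions \<Omega>" "\<Omega> \<in> sets lebesgue"
  shows "integrable (lebesgue_on \<Omega>) (\<lambda>z. g z * \<phi> z)"
proof -
  obtain C where C: "compact C" "C \<subseteq> \<Omega>" "\<And>z. z \<notin> C \<Longrightarrow> \<phi> z = 0"
    using test_functions_support[OF assms(2)] by metis
  obtain M where M: "\<And>z. \<bar>\<phi> z\<bar> \<le> M" using test_functions_bounded[OF assms(2)] by metis
  have "integrable (lebesgue_on C) (\<lambda>z. g z * \<phi> z)"
  proof (rule Bochner_Integration.integrable_bound)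
    show "integrable (lebesgue_on C) (\<lambda>z. M * g z)" using L2_loc_integrable[OF assms(1) C(1,2)] by simp
    show "(\<lambda>z. g z * \<phi> z) \<in> borel_measurable (lebesgue_on C)"
      using borel_measurable_integrable[OF L2_loc_integrable[OF assms(1) C(1,2)]]
        continuous_borel_measurable_lebesgue_on[OF test_functionsD(3)[OF assms(2)]] by simp
    show "AE x in lebesgue_on C. norm (g x * \<phi> x) \<le> norm (M * g x)"
      using M by (intro always_eventually allI) (simp add: abs_mult mult.commute[of "\<bar>g _\<bar>"] mult_right_mono order_trans[OF _ abs_ge_self])
  qed
  then have "integrable lebesgue (\<lambda>z. indicat_real C z *\<^sub>R (g z * \<phi> z))"
    using C(1) by (subst (asm) integrable_restrict_space) (auto simp: lmeasurable_compact fmeasurableD)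
  moreover have "indicat_real C z *\<^sub>R (g z * \<phi> z) = indicat_real \<Omega> z *\<^sub>R (g z * \<phi> z)" for z
    using C by (auto simp: indicator_def)
  ultimately have "integrable lebesgue (\<lambda>z. indicat_real \<Omega> z *\<^sub>R (g z * \<phi> z))" by (simp only:)
  then show ?thesis using assms(3) by (subst integrable_restrict_space) auto
qed

lemma L2_loc_component: "g \<in> L2_loc \<Omega> \<Longrightarrow> (\<lambda>z. g z \<bullet> h) \<in> L2_loc \<Omega>"
  unfolding L2_loc_def
proof safe
  fix C assume g: "g \<in> borel_measurable (lebesgue_on \<Omega>)" "\<forall>C. compact C \<and> C \<subseteq> \<Omega> \<longrightarrow> integrable (lebesgue_on C) (\<lambda>z. (norm (g z))\<^sup>2)"
    and C: "compact C" "C \<subseteq> \<Omega>"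
  then have "integrable (lebesgue_on C) (\<lambda>z. (norm h)\<^sup>2 * (norm (g z))\<^sup>2)" by simp
  then show "integrable (lebesgue_on C) (\<lambda>z. (norm (g z \<bullet> h))\<^sup>2)"
  proof (rule Bochner_Integration.integrable_bound)
    show "(\<lambda>z. (norm (g z \<bullet> h))\<^sup>2) \<in> borel_measurable (lebesgue_on C)"
      using measurable_restrict_mono[OF g(1) C(2)] by simp
    have "(norm (g x \<bullet> h))\<^sup>2 \<le> (norm h)\<^sup>2 * (norm (g x))\<^sup>2" for x
      using Cauchy_Schwarz_ineq2[of "g x" h] by (metis abs_ge_zero mult.commute power_mono power_mult_distrib real_norm_def)
    then show "AE x in lebesgue_on C. norm ((norm (g x \<bullet> h))\<^sup>2) \<le> norm ((norm h)\<^sup>2 * (norm (g x))\<^sup>2)"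
      by (intro always_eventually allI) simp
  qed
qed simp

text \<open>For the real part, the divergence equation is tested with the derivative of
  \<open>\<psi>\<close> in direction 1 and the curl equation with that in direction
  \<open>\<i>\<close>; the terms containing \<open>Im g\<close> cancel by
  \<open>mixed_partials\<close>. For the imaginary part the two directions change roles.\<close>

lemma weakly_CR_laplacian:
  assumes g: "weakly_CR g" and \<psi>: "\<psi> \<in> test_functions disk"
  defines "L \<equiv> (\<lambda>z. grad (\<lambda>w. grad \<psi> w \<bullet> 1) z \<bullet> 1 + grad (\<lambda>w. grad \<psi> w \<bullet> \<i>) z \<bullet> \<i>)"
  shows "(\<integral>z. Re (g z) * L z \<partial>lebesgue_on disk) = 0" "(\<integral>z. Im (g z) * L z \<partial>lebesgue_on disk) = 0"
proof -
  let ?G = "\<lambda>h k z. grad (\<lambda>w. grad \<psi> w \<bullet> h) z \<bullet> k"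
  let ?I = "\<lambda>f. integral\<^sup>L (lebesgue_on disk) f"
  have t: "?G h k \<in> test_functions disk" for h k by (intro test_functions_grad \<psi>)
  have c: "(\<lambda>z. Re (g z)) \<in> L2_loc disk" "(\<lambda>z. Im (g z)) \<in> L2_loc disk"
    using L2_loc_component[of g disk 1] L2_loc_component[of g disk \<i>] g by (auto simp: weakly_CR_def inner_complex_def)
  have i: "integrable (lebesgue_on disk) (\<lambda>z. Re (g z) * ?G h k z)" "integrable (lebesgue_on disk) (\<lambda>z. Im (g z) * ?G h k z)" for h k
    by (intro integrable_times_test c t; simp)+
  have 1: "?I (\<lambda>z. Re (g z) * ?G h 1 z) + ?I (\<lambda>z. Im (g z) * ?G h \<i> z) = 0" for h
  proof -
    have "0 = ?I (\<lambda>z. g z \<bullet> grad (\<lambda>w. grad \<psi> w \<bullet> h) z)"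
      using g test_functions_grad[OF \<psi>, of h] by (simp add: weakly_CR_def)
    also have "\<dots> = ?I (\<lambda>z. Re (g z) * ?G h 1 z + Im (g z) * ?G h \<i> z)" by (simp add: inner_complex_def)
    finally show ?thesis using Bochner_Integration.integral_add[OF i(1)[of h 1] i(2)[of h \<i>]] by linarith
  qed
  have 2: "?I (\<lambda>z. Re (g z) * ?G h \<i> z) - ?I (\<lambda>z. Im (g z) * ?G h 1 z) = 0" for h
  proof -
    have "0 = ?I (\<lambda>z. (\<i> * g z) \<bullet> grad (\<lambda>w. grad \<psi> w \<bullet> h) z)"
      using g test_functions_grad[OF \<psi>, of h] by (simp add: weakly_CR_def)
    also have "\<dots> = ?I (\<lambda>z. Re (g z) * ?G h \<i> z - Im (g z) * ?G h 1 z)" by (simp add: inner_complex_def algebra_simps)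
    finally show ?thesis using Bochner_Integration.integral_diff[OF i(1)[of h \<i>] i(2)[of h 1]] by linarith
  qed
  have m: "?G \<i> 1 z = ?G 1 \<i> z" for z by (rule mixed_partials[OF \<psi>])
  have "?I (\<lambda>z. Re (g z) * L z) = ?I (\<lambda>z. Re (g z) * ?G 1 1 z) + ?I (\<lambda>z. Re (g z) * ?G \<i> \<i> z)"
    unfolding L_def distrib_left by (rule Bochner_Integration.integral_add[OF i(1) i(1)])
  then show "?I (\<lambda>z. Re (g z) * L z) = 0" using 1[of 1] 2[of \<i>] unfolding m by linarith
  have "?I (\<lambda>z. Im (g z) * L z) = ?I (\<lambda>z. Im (g z) * ?G 1 1 z) + ?I (\<lambda>z. Im (g z) * ?G \<i> \<i> z)"
    unfolding L_def distrib_left by (rule Bochner_Integration.integral_add[OF i(2) i(2)])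
  then show "?I (\<lambda>z. Im (g z) * L z) = 0" using 1[of \<i>] 2[of 1] unfolding m by linarith
qed

text \<open>The Laplacian of \<open>flat_exp 0 (1 - (norm u)\<^sup>2)\<close>: the first derivative
  of \<open>flat_exp 0\<close> is \<open>flat_exp 2\<close>, and that of \<open>flat_exp 2\<close>
  is \<open>flat_exp 4 - 2 * flat_exp 3\<close>. The general radius follows by scaling.\<close>

definition lap_kern :: "complex \<Rightarrow> real" where
  "lap_kern u = - 4 * flat_exp 2 (1 - (norm u)\<^sup>2) + 4 * (norm u)\<^sup>2 * (flat_exp 4 (1 - (norm u)\<^sup>2) - 2 * flat_exp 3 (1 - (norm u)\<^sup>2))"

lemma grad_flat_kern:
  assumes "\<epsilon> > 0"
  shows "grad (\<lambda>w. flat_exp 0 (1 - (norm (w - z))\<^sup>2 / \<epsilon>\<^sup>2)) w = (- 2 / \<epsilon>\<^sup>2 * flat_exp 2 (1 - (norm (w - z))\<^sup>2 / \<epsilon>\<^sup>2)) *\<^sub>R (w - z)"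
proof (rule grad_eqI)
  have s: "((\<lambda>w. 1 - (norm (w - z))\<^sup>2 / \<epsilon>\<^sup>2) has_derivative (\<lambda>h. - 2 / \<epsilon>\<^sup>2 * ((w - z) \<bullet> h))) (at w)"
    unfolding power2_norm_eq_inner using assms by (auto intro!: derivative_eq_intros simp: inner_commute power2_eq_square)
  show "((\<lambda>w. flat_exp 0 (1 - (norm (w - z))\<^sup>2 / \<epsilon>\<^sup>2)) has_derivative
      (\<lambda>h. ((- 2 / \<epsilon>\<^sup>2 * flat_exp 2 (1 - (norm (w - z))\<^sup>2 / \<epsilon>\<^sup>2)) *\<^sub>R (w - z)) \<bullet> h)) (at w)"
    using has_derivative_compose[OF s flat_exp_has_derivative[of 0, unfolded has_field_derivative_def]]
    by (simp add: mult_ac numeral_2_eq_2)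
qed

lemma laplacian_flat_kern:
  fixes z :: complex
  assumes "\<epsilon> > 0"
  defines "\<psi> \<equiv> (\<lambda>w. flat_exp 0 (1 - (norm (w - z))\<^sup>2 / \<epsilon>\<^sup>2))"
  shows "grad (\<lambda>w. grad \<psi> w \<bullet> 1) w \<bullet> 1 + grad (\<lambda>w. grad \<psi> w \<bullet> \<i>) w \<bullet> \<i> = lap_kern ((w - z) /\<^sub>R \<epsilon>) / \<epsilon>\<^sup>2"
proof -
  define S where "S w = 1 - (norm (w - z))\<^sup>2 / \<epsilon>\<^sup>2" for w
  define D where "D = flat_exp 4 (S w) - 2 * flat_exp 3 (S w)"
  have s: "(S has_derivative (\<lambda>h. - 2 / \<epsilon>\<^sup>2 * ((w - z) \<bullet> h))) (at w)"
    unfolding S_def power2_norm_eq_inner using assms by (auto intro!: derivative_eq_intros simp: inner_commute power2_eq_square)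
  have "((\<lambda>w. flat_exp 2 (S w)) has_derivative (\<lambda>h. D * (- 2 / \<epsilon>\<^sup>2 * ((w - z) \<bullet> h)))) (at w)"
    using has_derivative_compose[OF s flat_exp_has_derivative[of 2, unfolded has_field_derivative_def]]
    by (simp add: D_def eval_nat_numeral)
  note d = this
  have al: "- 2 / e * (F * a + D * (- 2 / e * b) * c) = (- 2 / e * F) * a + (4 / e\<^sup>2 * D * c) * b" for e F a b c :: real
    by (simp add: divide_inverse power2_eq_square algebra_simps)
  have al2: "(- 2 / e * F) * s + (4 / e\<^sup>2 * D * a) * a + ((- 2 / e * F) * s + (4 / e\<^sup>2 * D * b) * b) =
      (- 4 * F * s + 4 * ((a\<^sup>2 + b\<^sup>2) / e) * D) / e" for e F a b s :: real
    by (simp add: divide_inverse power2_eq_square algebra_simps)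
  have g: "grad (\<lambda>w. grad \<psi> w \<bullet> h) w = (- 2 / \<epsilon>\<^sup>2 * flat_exp 2 (S w)) *\<^sub>R h + (4 / (\<epsilon>\<^sup>2)\<^sup>2 * D * ((w - z) \<bullet> h)) *\<^sub>R (w - z)" for h
  proof (rule grad_eqI)
    have "((\<lambda>w. - 2 / \<epsilon>\<^sup>2 * (flat_exp 2 (S w) * ((w - z) \<bullet> h))) has_derivative
       (\<lambda>k. ((- 2 / \<epsilon>\<^sup>2 * flat_exp 2 (S w)) *\<^sub>R h + (4 / (\<epsilon>\<^sup>2)\<^sup>2 * D * ((w - z) \<bullet> h)) *\<^sub>R (w - z)) \<bullet> k)) (at w)"
    proof (rule has_derivative_eq_rhs)
      show "((\<lambda>w. - 2 / \<epsilon>\<^sup>2 * (flat_exp 2 (S w) * ((w - z) \<bullet> h))) has_derivative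
        (\<lambda>k. - 2 / \<epsilon>\<^sup>2 * (flat_exp 2 (S w) * (k \<bullet> h) + D * (- 2 / \<epsilon>\<^sup>2 * ((w - z) \<bullet> k)) * ((w - z) \<bullet> h)))) (at w)"
        by (intro has_derivative_mult_right has_derivative_mult d) (auto intro!: derivative_eq_intros)
      show "(\<lambda>k. - 2 / \<epsilon>\<^sup>2 * (flat_exp 2 (S w) * (k \<bullet> h) + D * (- 2 / \<epsilon>\<^sup>2 * ((w - z) \<bullet> k)) * ((w - z) \<bullet> h))) =
        (\<lambda>k. ((- 2 / \<epsilon>\<^sup>2 * flat_exp 2 (S w)) *\<^sub>R h + (4 / (\<epsilon>\<^sup>2)\<^sup>2 * D * ((w - z) \<bullet> h)) *\<^sub>R (w - z)) \<bullet> k)"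
        unfolding al inner_add_left inner_scaleR_left by (simp only: inner_commute[of h])
    qed
    then show "((\<lambda>w. grad \<psi> w \<bullet> h) has_derivative
       (\<lambda>k. ((- 2 / \<epsilon>\<^sup>2 * flat_exp 2 (S w)) *\<^sub>R h + (4 / (\<epsilon>\<^sup>2)\<^sup>2 * D * ((w - z) \<bullet> h)) *\<^sub>R (w - z)) \<bullet> k)) (at w)"
      by (simp add: \<psi>_def grad_flat_kern[OF assms(1)] S_def mult_ac)
  qed
  have n: "(norm ((w - z) /\<^sub>R \<epsilon>))\<^sup>2 = (norm (w - z))\<^sup>2 / \<epsilon>\<^sup>2"
    using assms by (simp add: power_mult_distrib divide_inverse mult.commute norm_mult power_inverse)
  have "(norm (w - z))\<^sup>2 = ((w - z) \<bullet> 1)\<^sup>2 + ((w - z) \<bullet> \<i>)\<^sup>2" by (simp add: cmod_power2 inner_complex_def)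
  moreover have one: "(1 :: complex) \<bullet> 1 = 1" "\<i> \<bullet> \<i> = 1" by (simp_all add: inner_complex_def)
  ultimately show ?thesis
    unfolding g lap_kern_def n S_def[symmetric] D_def[symmetric] inner_add_left inner_scaleR_left
    using al2[of "\<epsilon>\<^sup>2" "flat_exp 2 (S w)" 1 "(w - z) \<bullet> 1" "(w - z) \<bullet> \<i>"] one
    by (simp only: mult_1_right)
qed

text \<open>With \<open>laplacian_flat_kern\<close> this is a heat-type identity: the
  \<open>\<epsilon>\<close>-derivative of the kernel is \<open>1 / (2 * \<epsilon>)\<close> times
  the Laplacian of \<open>flat_exp 0 (1 - (norm u)\<^sup>2 / \<epsilon>\<^sup>2)\<close>.\<close>

lemma kern_has_derivative:
  assumes "\<epsilon> > 0"
  shows "((\<lambda>\<epsilon>. kern \<epsilon> u) has_real_derivative lap_kern (u /\<^sub>R \<epsilon>) / (2 * \<epsilon> ^ 3)) (at \<epsilon>)"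
proof -
  define S where "S \<epsilon> = 1 - (norm u)\<^sup>2 / \<epsilon>\<^sup>2" for \<epsilon> :: real
  define D where "D = flat_exp 4 (S \<epsilon>) - 2 * flat_exp 3 (S \<epsilon>)"
  have s: "(S has_real_derivative 2 * (norm u)\<^sup>2 / \<epsilon> ^ 3) (at \<epsilon>)"
    unfolding S_def using assms by (auto intro!: derivative_eq_intros simp: field_simps eval_nat_numeral)
  have d: "((\<lambda>\<epsilon>. flat_exp 2 (S \<epsilon>)) has_real_derivative D * (2 * (norm u)\<^sup>2 / \<epsilon> ^ 3)) (at \<epsilon>)"
    using DERIV_chain2[OF flat_exp_has_derivative[of 2] s] by (simp add: D_def eval_nat_numeral)
  have "((\<lambda>\<epsilon>. flat_exp 2 (S \<epsilon>) / \<epsilon>\<^sup>2) has_real_derivative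
     (D * (2 * (norm u)\<^sup>2 / \<epsilon> ^ 3) * \<epsilon>\<^sup>2 - flat_exp 2 (S \<epsilon>) * (2 * \<epsilon>)) / (\<epsilon>\<^sup>2 * \<epsilon>\<^sup>2)) (at \<epsilon>)"
    using assms by (intro DERIV_divide d) (auto intro!: derivative_eq_intros)
  moreover have n: "(norm (u /\<^sub>R \<epsilon>))\<^sup>2 = (norm u)\<^sup>2 / \<epsilon>\<^sup>2"
    using assms by (simp add: power_mult_distrib divide_inverse mult.commute norm_mult power_inverse)
  have "(D * (2 * (norm u)\<^sup>2 / \<epsilon> ^ 3) * \<epsilon>\<^sup>2 - flat_exp 2 (S \<epsilon>) * (2 * \<epsilon>)) / (\<epsilon>\<^sup>2 * \<epsilon>\<^sup>2) = lap_kern (u /\<^sub>R \<epsilon>) / (2 * \<epsilon> ^ 3)"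
    unfolding lap_kern_def n S_def[symmetric] D_def[symmetric]
    using assms by (simp add: field_simps eval_nat_numeral)
  ultimately show ?thesis by (simp add: kern_def S_def)
qed

lemma lap_kern_bounded: obtains M where "M \<ge> 0" "\<And>u. \<bar>lap_kern u\<bar> \<le> M" "continuous_on UNIV lap_kern"
proof -
  have t: "(\<lambda>u. flat_exp m (1 - (norm u)\<^sup>2)) \<in> test_functions UNIV" for m using test_flat_kern[of 1 m] by simp
  have "lap_kern = (\<lambda>u. - 4 * flat_exp 2 (1 - (norm u)\<^sup>2) + 4 * ((norm u)\<^sup>2 * (flat_exp 4 (1 - (norm u)\<^sup>2) + (- 2) * flat_exp 3 (1 - (norm u)\<^sup>2))))"
    by (simp add: fun_eq_iff lap_kern_def)
  also have "\<dots> \<in> test_functions UNIV"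
    by (intro test_functions_add test_functions_cmult test_functions_mult[where f="\<lambda>u. (norm u)\<^sup>2"] t Ck_norm_sq)
  finally have l: "lap_kern \<in> test_functions UNIV" .
  show ?thesis using test_functions_bounded[OF l] test_functionsD(3)[OF l] that by metis
qed

lemma lap_kern_continuous: "continuous_on UNIV lap_kern"
  using lap_kern_bounded by blast

section \<open>Weakly harmonic functions and their smooth representatives\<close>

definition lapl :: "(complex \<Rightarrow> real) \<Rightarrow> complex \<Rightarrow> real" where
  "lapl \<psi> z = grad (\<lambda>w. grad \<psi> w \<bullet> 1) z \<bullet> 1 + grad (\<lambda>w. grad \<psi> w \<bullet> \<i>) z \<bullet> \<i>"

definition weakly_harmonic :: "(complex \<Rightarrow> real) \<Rightarrow> bool" where
  "weakly_harmonic f \<longleftrightarrow> f \<in> L2_loc disk \<and> (\<forall>\<psi>\<in>test_functions disk. (\<integral>z. f z * lapl \<psi> z \<partial>lebesgue_on disk) = 0)"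

lemma kern_minus: "kern \<epsilon> (z - w) = kern \<epsilon> (w - z)"
  by (simp add: kern_def norm_minus_commute)

lemma test_kern_shift:
  assumes "\<epsilon> > 0" "cball z \<epsilon> \<subseteq> \<Omega>" shows "(\<lambda>w. kern \<epsilon> (z - w)) \<in> test_functions \<Omega>"
  using test_functions_cmult[OF test_flat_kern_shift[OF assms, of 2], of "1 / \<epsilon>\<^sup>2"]
  by (simp add: kern_def norm_minus_commute)

lemma cball_subset_disk: "\<epsilon> < 1 - norm z \<Longrightarrow> cball z \<epsilon> \<subseteq> disk"
proof
  fix x assume "\<epsilon> < 1 - norm z" "x \<in> cball z \<epsilon>"
  then show "x \<in> disk" using norm_triangle_sub[of x z] by (auto simp: dist_norm norm_minus_commute)
qed

text \<open>A weak form of the mean value property: the derivative of the mollification with respect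
  to the radius is the integral of \<open>f\<close> against the Laplacian of a test function, hence
  0.\<close>

lemma mollify_stable:
  assumes f: "weakly_harmonic f" and z: "norm z < 1" and ab: "0 < a" "a < 1 - norm z" "0 < b" "b < 1 - norm z"
  shows "(\<integral>w. f w * kern a (z - w) \<partial>lebesgue_on disk) = (\<integral>w. f w * kern b (z - w) \<partial>lebesgue_on disk)"
proof -
  let ?A = "\<lambda>\<epsilon>. \<integral>w. f w * kern \<epsilon> (z - w) \<partial>lebesgue_on disk"
  let ?J = "{0<..<1 - norm z}"
  have fL: "f \<in> L2_loc disk" using f by (simp add: weakly_harmonic_def)
  have "(?A has_real_derivative 0) (at e)" if e: "e \<in> ?J" for e
  proof -
    \<comment> \<open>Halfway between \<open>e\<close> and the distance to the unit circle: all
      kernels with radius within \<open>d\<close> of \<open>e\<close> live on the fixed compact ball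
      \<open>C\<close>, on which \<open>f\<close> is integrable.\<close>
    define r where "r = (1 - norm z + e) / 2"
    define d where "d = min (e / 2) (r - e)"
    have r: "e > 0" "e < r" "r < 1 - norm z" using e by (auto simp: r_def field_simps)
    have "d > 0" using r by (simp add: d_def)
    moreover have "d \<le> e / 2" "d \<le> r - e" unfolding d_def by (rule min.cobounded1 min.cobounded2)+
    ultimately
    have d: "d > 0" "d \<le> e / 2" "e + d \<le> r" "r < 1 - norm z" "e > 0" "e < r" using r by linarith+
    define C where "C = cball z r"
    have C: "compact C" "C \<subseteq> disk" using d cball_subset_disk by (auto simp: C_def)
    obtain M where M: "M \<ge> 0" "\<And>u. \<bar>lap_kern u\<bar> \<le> M" using lap_kern_bounded by metis
    obtain M' where M': "M' \<ge> 0" "\<And>u. \<bar>kern e u\<bar> \<le> M'" using test_functions_bounded[OF test_kern[OF d(5)]] by metis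
    define B where "B = max M' (M / (2 * (e / 2) ^ 3))"
    have eq: "?A x = (\<integral>w. f w * kern x (z - w) \<partial>lebesgue_on C)" if "x \<in> ball e d" for x
    proof (rule integral_lebesgue_on_subset)
      have "x > 0" "x \<le> r" using that d by (auto simp: dist_real_def)
      then show "f w * kern x (z - w) = 0" if "w \<in> disk - C" for w
        using that kern_eq_0[of x "z - w"] by (auto simp: C_def dist_norm)
    qed (use C in \<open>auto simp: C_def\<close>)
    have bd: "\<bar>lap_kern u / (2 * x ^ 3)\<bar> \<le> B" if "x \<in> ball e d" for x u
    proof -
      have x: "e / 2 \<le> x" "0 < x" using that d by (auto simp: dist_real_def)
      then have "\<bar>lap_kern u / (2 * x ^ 3)\<bar> \<le> M / (2 * x ^ 3)" using M by (simp add: divide_right_mono)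
      also have "\<dots> \<le> M / (2 * (e / 2) ^ 3)" using x d M by (intro divide_left_mono mult_left_mono power_mono mult_pos_pos) auto
      finally show ?thesis by (simp add: B_def)
    qed
    have "((\<lambda>x. \<integral>w. f w * kern x (z - w) \<partial>lebesgue_on C) has_derivative
        (\<lambda>h. \<integral>w. f w * (lap_kern ((z - w) /\<^sub>R e) / (2 * e ^ 3) * h) \<partial>lebesgue_on C)) (at e)"
    proof (rule has_derivative_integral_kernel[where \<delta>=d and C=B])
      show "integrable (lebesgue_on C) f" by (rule L2_loc_integrable[OF fL C])
      show "(\<lambda>w. kern p (z - w)) \<in> borel_measurable (lebesgue_on C)" if "p \<in> ball e d" for p
      proof -
        have "p > 0" using that d by (auto simp: dist_real_def)
        then show ?thesis by (intro continuous_borel_measurable_lebesgue_on continuous_on_compose2[OF kern_continuous[of p UNIV]] continuous_intros) auto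
      qed
      show "(\<lambda>w. lap_kern ((z - w) /\<^sub>R e) / (2 * e ^ 3) * h) \<in> borel_measurable (lebesgue_on C)" for h
        using d by (intro continuous_borel_measurable_lebesgue_on continuous_intros continuous_on_compose2[OF lap_kern_continuous]) auto
      show "\<bar>kern e (z - w)\<bar> \<le> B" for w using M'(2)[of "z - w"] by (simp add: B_def)
      show "\<bar>kern p (z - w) - kern e (z - w)\<bar> \<le> B * norm (p - e)" if "p \<in> ball e d" for w p
      proof -
        have "norm (kern p (z - w) - kern e (z - w)) \<le> B * norm (p - e)"
        proof (rule field_differentiable_bound[of "ball e d" _ "\<lambda>x. lap_kern ((z - w) /\<^sub>R x) / (2 * x ^ 3)"])
          show "((\<lambda>\<epsilon>. kern \<epsilon> (z - w)) has_field_derivative lap_kern ((z - w) /\<^sub>R x) / (2 * x ^ 3)) (at x within ball e d)"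
            if "x \<in> ball e d" for x
          proof -
            have "x > 0" using that d by (auto simp: dist_real_def)
            from has_field_derivative_at_within[OF kern_has_derivative[OF this]] show ?thesis .
          qed
          show "norm (lap_kern ((z - w) /\<^sub>R x) / (2 * x ^ 3)) \<le> B" if "x \<in> ball e d" for x using bd[OF that] by simp
        qed (use that d in auto)
        then show ?thesis by simp
      qed
      show "((\<lambda>p. kern p (z - w)) has_derivative (*) (lap_kern ((z - w) /\<^sub>R e) / (2 * e ^ 3))) (at e)" for w
        using kern_has_derivative[OF d(5), of "z - w"] by (simp add: has_field_derivative_def)
      show "\<bar>lap_kern ((z - w) /\<^sub>R e) / (2 * e ^ 3) * h\<bar> \<le> B * norm h" for w h
        using mult_right_mono[OF bd[of e "(z - w) /\<^sub>R e"], of "\<bar>h\<bar>"] d by (simp add: abs_mult)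
    qed (use d in auto)
    \<comment> \<open>The integrand is \<open>h / (2 * e)\<close> times \<open>f\<close> against the
      Laplacian of a test function supported in the closed ball of radius \<open>e\<close> around
      \<open>z\<close>.\<close>
    moreover have "(\<lambda>h. \<integral>w. f w * (lap_kern ((z - w) /\<^sub>R e) / (2 * e ^ 3) * h) \<partial>lebesgue_on C) = (\<lambda>h. 0)"
    proof
      fix h
      let ?\<psi> = "\<lambda>w. flat_exp 0 (1 - (norm (w - z))\<^sup>2 / e\<^sup>2)"
      have t: "?\<psi> \<in> test_functions disk" using test_flat_kern_shift[OF d(5)] cball_subset_disk d by auto
      have lk: "lap_kern ((z - w) /\<^sub>R e) = lap_kern ((w - z) /\<^sub>R e)" for w by (simp add: lap_kern_def norm_minus_commute)
      have L: "lap_kern ((z - w) /\<^sub>R e) / e\<^sup>2 = lapl ?\<psi> w" for w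
        unfolding lapl_def laplacian_flat_kern[OF d(5)] by (simp add: lk)
      have "(\<integral>w. f w * lapl ?\<psi> w \<partial>lebesgue_on disk) = 0" using f t by (auto simp: weakly_harmonic_def)
      moreover have "(\<integral>w. f w * lapl ?\<psi> w \<partial>lebesgue_on disk) = (\<integral>w. f w * lapl ?\<psi> w \<partial>lebesgue_on C)"
      proof (rule integral_lebesgue_on_subset)
        fix w assume "w \<in> disk - C"
        then have "norm ((w - z) /\<^sub>R e) \<ge> 1" using d by (auto simp: C_def dist_norm norm_minus_commute divide_simps)
        then have "lap_kern ((w - z) /\<^sub>R e) = 0"
          using flat_kern_eq_0[of 1 "(w - z) /\<^sub>R e"] by (simp add: lap_kern_def)
        then show "f w * lapl ?\<psi> w = 0" by (simp add: L[symmetric] lk)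
      qed (use C in \<open>auto simp: C_def\<close>)
      ultimately have "(\<integral>w. f w * lapl ?\<psi> w \<partial>lebesgue_on C) = 0" by simp
      moreover have "f w * (lap_kern ((z - w) /\<^sub>R e) / (2 * e ^ 3) * h) = (h / (2 * e)) * (f w * lapl ?\<psi> w)" for w
        unfolding L[symmetric] using d by (simp add: field_simps eval_nat_numeral)
      ultimately show "(\<integral>w. f w * (lap_kern ((z - w) /\<^sub>R e) / (2 * e ^ 3) * h) \<partial>lebesgue_on C) = 0" by simp
    qed
    ultimately have "((\<lambda>x. \<integral>w. f w * kern x (z - w) \<partial>lebesgue_on C) has_derivative (\<lambda>h. 0)) (at e)" by (simp only:)
    then have "(?A has_derivative (\<lambda>h. 0)) (at e)"
      by (rule has_derivative_transform_within_open[of _ _ _ _ "ball e d"]) (use d eq in auto)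
    then show ?thesis by (simp add: has_field_derivative_def lambda_zero)
  qed
  then have "\<exists>c. \<forall>x\<in>?J. ?A x = c"
    by (intro has_field_derivative_zero_constant) (blast intro: has_field_derivative_at_within convex_real_interval)+
  then show ?thesis using ab by auto
qed

text \<open>The radius shrinks with the distance to the boundary so that the formula makes sense at
  every point of the disk; by stability it can be traded for any other admissible radius.\<close>

definition weyl :: "(complex \<Rightarrow> real) \<Rightarrow> complex \<Rightarrow> real" where
  "weyl f z = (\<integral>w. f w * kern ((1 - norm z) / 2) (z - w) \<partial>lebesgue_on disk) / kern_mass"

lemma weyl_eq:
  assumes f: "weakly_harmonic f" and "0 < \<epsilon>" "norm z + \<epsilon> < 1"
  shows "weyl f z = (\<integral>w. f w * kern \<epsilon> (z - w) \<partial>lebesgue_on disk) / kern_mass"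
  using mollify_stable[OF f, of z "(1 - norm z) / 2" \<epsilon>] assms by (simp add: weyl_def)

text \<open>Near \<open>z\<close> the fixed radius \<open>\<epsilon>\<close> may replace the
  variable radius in \<open>weyl\<close>; after that, differentiation only meets the first argument
  of the kernel.\<close>

lemma weyl_has_derivative:
  assumes f: "weakly_harmonic f" and z: "0 < \<epsilon>" "norm z + \<epsilon> < 1"
  shows "(weyl f has_derivative (\<lambda>h. (\<integral>w. f w * (grad (kern \<epsilon>) (z - w) \<bullet> h) \<partial>lebesgue_on disk) / kern_mass)) (at z)"
proof -
  have fL: "f \<in> L2_loc disk" using f by (simp add: weakly_harmonic_def)
  define r where "r = (1 - \<epsilon> + norm z) / 2"
  define C where "C = cball (0 :: complex) (r + \<epsilon>)"
  have r: "norm z < r" "r + \<epsilon> < 1" using z by (auto simp: r_def field_simps)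
  have C: "compact C" "C \<subseteq> disk" using r by (auto simp: C_def)
  have far: "norm (x - w) \<ge> \<epsilon>" if "norm x \<le> r" "w \<in> disk - C" for x w :: complex
    using that norm_triangle_ineq2[of w x] by (auto simp: C_def norm_minus_commute)
  have "((\<lambda>z. \<integral>w. f w * kern \<epsilon> (z - w) \<partial>lebesgue_on C) has_derivative
    (\<lambda>h. \<integral>w. f w * (grad (kern \<epsilon>) (z - w) \<bullet> h) \<partial>lebesgue_on C)) (at z)"
    by (rule mollify_has_derivative[OF L2_loc_integrable[OF fL C] test_kern[OF z(1)]])
  moreover have "(\<integral>w. f w * (grad (kern \<epsilon>) (z - w) \<bullet> h) \<partial>lebesgue_on C) = (\<integral>w. f w * (grad (kern \<epsilon>) (z - w) \<bullet> h) \<partial>lebesgue_on disk)" for h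
  proof (rule integral_lebesgue_on_subset[symmetric])
    fix w assume w: "w \<in> disk - C"
    define x where "x = z - w"
    have x: "norm x > \<epsilon>" using r(1) norm_triangle_ineq2[of w z] w by (auto simp: C_def x_def norm_minus_commute)
    have "grad (kern \<epsilon>) x = 0"
    proof (rule grad_eqI)
      show "(kern \<epsilon> has_derivative (\<lambda>h. 0 \<bullet> h)) (at x)"
      proof (rule has_derivative_transform_within_open[of "\<lambda>_. 0" _ _ _ "- cball 0 \<epsilon>"])
        show "0 = kern \<epsilon> y" if "y \<in> - cball 0 \<epsilon>" for y using kern_eq_0[OF z(1), of y] that by simp
      qed (use x in auto)
    qed
    then show "f w * (grad (kern \<epsilon>) (z - w) \<bullet> h) = 0" by (simp add: x_def)
  qed (use C in \<open>auto simp: C_def\<close>)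
  ultimately have "((\<lambda>z. \<integral>w. f w * kern \<epsilon> (z - w) \<partial>lebesgue_on C) has_derivative
    (\<lambda>h. \<integral>w. f w * (grad (kern \<epsilon>) (z - w) \<bullet> h) \<partial>lebesgue_on disk)) (at z)" by simp
  then have "((\<lambda>z. (\<integral>w. f w * kern \<epsilon> (z - w) \<partial>lebesgue_on C) / kern_mass) has_derivative
    (\<lambda>h. (\<integral>w. f w * (grad (kern \<epsilon>) (z - w) \<bullet> h) \<partial>lebesgue_on disk) / kern_mass)) (at z)"
    by (simp add: divide_inverse has_derivative_mult_left)
  then show ?thesis
  proof (rule has_derivative_transform_within_open[of _ _ _ _ "ball 0 r"])
    fix x :: complex assume x: "x \<in> ball 0 r"
    have "(\<integral>w. f w * kern \<epsilon> (x - w) \<partial>lebesgue_on disk) = (\<integral>w. f w * kern \<epsilon> (x - w) \<partial>lebesgue_on C)"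
      by (rule integral_lebesgue_on_subset) (use C far[of x] x z kern_eq_0 in \<open>auto simp: C_def\<close>)
    then show "(\<integral>w. f w * kern \<epsilon> (x - w) \<partial>lebesgue_on C) / kern_mass = weyl f x"
      using weyl_eq[OF f z(1), of x] x r by simp
  qed (use r in auto)
qed

text \<open>\<open>f\<close> is only locally integrable and Lebesgue measurable. It is therefore cut
  off to a closed ball and replaced by a Borel function before \<open>mollify_stable_AE\<close> is
  applied on a smaller ball; countably many such balls exhaust the disk.\<close>

lemma weyl_AE:
  assumes f: "weakly_harmonic f"
  shows "AE z in lebesgue_on disk. f z = weyl f z"
proof -
  have fL: "f \<in> L2_loc disk" using f by (simp add: weakly_harmonic_def)
  have loc: "AE z in lebesgue. z \<in> ball 0 R \<longrightarrow> f z = weyl f z" if R: "0 < R" "R < 1" for R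
  proof -
    define e where "e = (1 - R) / 2"
    define C where "C = cball (0 :: complex) (R + e)"
    have e: "e > 0" "R + e < 1" using R by (auto simp: e_def field_simps)
    have C: "compact C" "C \<subseteq> disk" "C \<in> sets lebesgue" using e by (auto simp: C_def)
    have i: "integrable lebesgue (\<lambda>z. indicat_real C z *\<^sub>R f z)"
      using L2_loc_integrable[OF fL C(1,2)] C(3) by (subst (asm) integrable_restrict_space) auto
    obtain g where g: "g \<in> borel_measurable lborel" "AE z in lborel. indicat_real C z *\<^sub>R f z = g z"
      using completion_ex_borel_measurable_real[OF borel_measurable_integrable[OF i]] by blast
    have gm: "g \<in> borel_measurable lebesgue" using g(1) by (rule measurable_completion)
    have gae: "AE z in lebesgue. indicat_real C z *\<^sub>R f z = g z" using g(2) by (rule AE_completion)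
    have gi: "integrable lebesgue g"
      using Bochner_Integration.integrable_cong_AE_imp[OF i gm] gae by (auto simp: eq_commute)
    have gl: "integrable lborel g" using gi g(1) by (simp add: integrable_completion)
    have int: "(\<integral>w. g w * kern \<epsilon> (z - w) \<partial>lborel) = (\<integral>w. f w * kern \<epsilon> (z - w) \<partial>lebesgue_on disk)"
      if "z \<in> ball 0 R" "0 < \<epsilon>" "\<epsilon> \<le> e" for z \<epsilon>
    proof -
      have k: "(\<lambda>w. kern \<epsilon> (z - w)) \<in> borel_measurable borel" using that by measurable
      have "(\<integral>w. g w * kern \<epsilon> (z - w) \<partial>lborel) = (\<integral>w. g w * kern \<epsilon> (z - w) \<partial>lebesgue)"
        using g(1) k by (intro integral_completion[symmetric]) auto
      also have "\<dots> = (\<integral>w. indicat_real C w *\<^sub>R (f w * kern \<epsilon> (z - w)) \<partial>lebesgue)"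
      proof (rule integral_cong_AE)
        show "(\<lambda>w. g w * kern \<epsilon> (z - w)) \<in> borel_measurable lebesgue"
          using gm measurable_completion[of "\<lambda>w. kern \<epsilon> (z - w)" lborel borel] k by simp
        have "(\<lambda>w. (indicat_real C w *\<^sub>R f w) * kern \<epsilon> (z - w)) \<in> borel_measurable lebesgue"
          using borel_measurable_integrable[OF i] measurable_completion[of "\<lambda>w. kern \<epsilon> (z - w)" lborel borel] k by simp
        then show "(\<lambda>w. indicat_real C w *\<^sub>R (f w * kern \<epsilon> (z - w))) \<in> borel_measurable lebesgue" by (simp add: mult.assoc)
        show "AE w in lebesgue. g w * kern \<epsilon> (z - w) = indicat_real C w *\<^sub>R (f w * kern \<epsilon> (z - w))"
          using gae by (rule eventually_mono) (simp add: mult.assoc[symmetric])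
      qed
      also have "\<dots> = (\<integral>w. f w * kern \<epsilon> (z - w) \<partial>lebesgue_on C)"
        using C(3) by (subst integral_restrict_space) auto
      also have "\<dots> = (\<integral>w. f w * kern \<epsilon> (z - w) \<partial>lebesgue_on disk)"
      proof (rule integral_lebesgue_on_subset[symmetric])
        fix w assume "w \<in> disk - C"
        then have "norm (z - w) \<ge> \<epsilon>" using that norm_triangle_ineq2[of w z] by (auto simp: C_def norm_minus_commute)
        then show "f w * kern \<epsilon> (z - w) = 0" using kern_eq_0 that by simp
      qed (use C in auto)
      finally show ?thesis .
    qed
    obtain M where M: "M \<ge> 0" "\<And>u. \<bar>kern e u\<bar> \<le> M" using test_functions_bounded[OF test_kern[OF e(1)]] by metis
    define H where "H z = (\<integral>w. g w * kern e (z - w) \<partial>lborel)" for z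
    have kb: "(\<lambda>w. kern e (z - w)) \<in> borel_measurable borel" for z using e(1) by measurable
    have "AE z in lborel. z \<in> ball 0 R \<longrightarrow> kern_mass * g z = H z"
    proof (rule mollify_stable_AE[OF gl _ _ _ e(1), where B="M * (\<integral>w. \<bar>g w\<bar> \<partial>lborel)"])
      fix z :: complex and \<epsilon> assume *: "z \<in> ball 0 R" "0 < \<epsilon>" "\<epsilon> \<le> e"
      show "(\<integral>w. g w * kern \<epsilon> (z - w) \<partial>lborel) = H z"
        unfolding H_def using int[OF *] int[of z e] mollify_stable[OF f, of z \<epsilon> e] * e by auto
    next
      have "Ck 0 (\<lambda>z. \<integral>w. g w * kern e (z - w) \<partial>lebesgue_on UNIV)"
        by (rule Ck_mollify[OF _ test_kern[OF e(1)]]) (simp add: lebesgue_on_UNIV_eq gi)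
      moreover have "(\<integral>w. g w * kern e (z - w) \<partial>lebesgue_on UNIV) = H z" for z
        unfolding H_def lebesgue_on_UNIV_eq using g(1) kb by (intro integral_completion) auto
      ultimately show "H \<in> borel_measurable borel" by (auto intro: borel_measurable_continuous_onI)
    next
      fix z
      have "\<bar>H z\<bar> \<le> (\<integral>w. norm (g w * kern e (z - w)) \<partial>lborel)" unfolding H_def using integral_norm_bound[of lborel "\<lambda>w. g w * kern e (z - w)"] by simp
      also have "\<dots> \<le> (\<integral>w. M * \<bar>g w\<bar> \<partial>lborel)"
      proof (rule integral_mono')
        show "integrable lborel (\<lambda>w. M * \<bar>g w\<bar>)" using gl by simp
        show "norm (g w * kern e (z - w)) \<le> M * \<bar>g w\<bar>" for w
          using M by (simp add: abs_mult mult.commute[of "\<bar>g w\<bar>"] mult_right_mono)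
      qed (use M in simp)
      finally show "\<bar>H z\<bar> \<le> M * (\<integral>w. \<bar>g w\<bar> \<partial>lborel)" by simp
    qed auto
    then have "AE z in lebesgue. z \<in> ball 0 R \<longrightarrow> kern_mass * g z = H z" by (rule AE_completion)
    with gae show ?thesis
    proof eventually_elim
      case (elim z)
      show ?case
      proof
        assume z: "z \<in> ball 0 R"
        then have "z \<in> C" using e by (simp add: C_def)
        then have "kern_mass * f z = H z" using elim z by simp
        also have "H z = kern_mass * weyl f z"
          using int[of z e] weyl_eq[OF f e(1), of z] z e kern_mass_pos by (simp add: H_def)
        finally show "f z = weyl f z" using kern_mass_pos by simp
      qed
    qed
  qed
  have "AE z in lebesgue. \<forall>n. z \<in> ball 0 (1 - 1 / (real n + 2)) \<longrightarrow> f z = weyl f z"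
    unfolding AE_all_countable by (intro allI loc) (auto simp: field_simps)
  then have "AE z in lebesgue. z \<in> disk \<longrightarrow> f z = weyl f z"
  proof (rule eventually_mono)
    fix z assume a: "\<forall>n. z \<in> ball 0 (1 - 1 / (real n + 2)) \<longrightarrow> f z = weyl f z"
    show "z \<in> disk \<longrightarrow> f z = weyl f z"
    proof
      assume "z \<in> disk"
      then have z: "norm z < 1" by simp
      then obtain n where n: "1 / (1 - norm z) < real n" using reals_Archimedean2 by blast
      then have "1 / (real n + 2) < 1 - norm z" using z by (simp add: field_simps)
      then show "f z = weyl f z" using a[rule_format, of n] by simp
    qed
  qed
  then show ?thesis by (subst AE_restrict_space_iff) auto
qed

text \<open>A function orthogonal to all test functions is in particular weakly harmonic, and its
  representative \<open>weyl f\<close> is itself an integral of \<open>f\<close> against a test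
  function.\<close>

lemma fundamental_lemma:
  fixes f :: "complex \<Rightarrow> real"
  assumes f: "f \<in> L2_loc disk" and 0: "\<And>\<phi>. \<phi> \<in> test_functions disk \<Longrightarrow> (\<integral>z. f z * \<phi> z \<partial>lebesgue_on disk) = 0"
  shows "AE z in lebesgue_on disk. f z = 0"
proof -
  have "lapl \<psi> \<in> test_functions disk" if "\<psi> \<in> test_functions disk" for \<psi>
    unfolding lapl_def[abs_def] using that by (intro test_functions_add test_functions_grad)
  then have h: "weakly_harmonic f" using f 0 by (simp add: weakly_harmonic_def)
  have w: "weyl f z = 0" if "z \<in> disk" for z
    unfolding weyl_def using 0[OF test_kern_shift[of "(1 - norm z) / 2" z disk]] cball_subset_disk[of "(1 - norm z) / 2" z] that
    by auto
  have "AE z in lebesgue_on disk. z \<in> disk" using AE_space[of "lebesgue_on disk"] by simp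
  with weyl_AE[OF h] show ?thesis by eventually_elim (simp add: w)
qed

text \<open>Differentiation in \<open>z\<close> moves onto the kernel, where it is minus the
  gradient in \<open>w\<close>. So the classical Cauchy-Riemann equations for the smooth
  representatives are the weak ones tested with the kernel.\<close>

lemma weyl_lemma:
  assumes g: "weakly_CR g"
  obtains F where "F holomorphic_on disk" "AE z in lebesgue_on disk. g z = cnj (F z)"
proof
  let ?u = "\<lambda>z. Re (g z)" and ?v = "\<lambda>z. Im (g z)"
  have c: "?u \<in> L2_loc disk" "?v \<in> L2_loc disk"
    using L2_loc_component[of g disk 1] L2_loc_component[of g disk \<i>] g by (auto simp: weakly_CR_def inner_complex_def)
  have u: "weakly_harmonic ?u" and v: "weakly_harmonic ?v"
    using weakly_CR_laplacian[OF g] c by (auto simp: weakly_harmonic_def lapl_def)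
  let ?F = "\<lambda>z. of_real (weyl ?u z) - \<i> * of_real (weyl ?v z)"
  show "AE z in lebesgue_on disk. g z = cnj (?F z)"
    using weyl_AE[OF u] weyl_AE[OF v] by eventually_elim (simp add: complex_eq_iff)
  show "?F holomorphic_on disk"
    unfolding holomorphic_on_def
  proof
    fix z assume "z \<in> disk"
    define e where "e = (1 - norm z) / 2"
    have e: "0 < e" "norm z + e < 1" using \<open>z \<in> disk\<close> by (auto simp: e_def field_simps)
    let ?D = "\<lambda>f h. \<integral>w. f w * (grad (kern e) (z - w) \<bullet> h) \<partial>lebesgue_on disk"
    have t: "(\<lambda>w. kern e (z - w)) \<in> test_functions disk" using test_kern_shift[OF e(1)] cball_subset_disk e by auto
    have gr: "grad (\<lambda>w. kern e (z - w)) w = - grad (kern e) (z - w)" for w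
    proof (rule grad_eqI)
      show "((\<lambda>w. kern e (z - w)) has_derivative (\<lambda>h. - grad (kern e) (z - w) \<bullet> h)) (at w)"
        by (rule has_derivative_eq_rhs, rule has_derivative_compose[of "\<lambda>w. z - w" "\<lambda>h. - h", OF _ test_functionsD(4)[OF test_kern[OF e(1)]]])
           (auto intro!: derivative_eq_intros)
    qed
    have t': "(\<lambda>w. grad (kern e) (z - w) \<bullet> h) \<in> test_functions disk" for h
      using test_functions_cmult[OF test_functions_grad[OF t], of "-1" h] by (simp add: gr)
    have i: "integrable (lebesgue_on disk) (\<lambda>w. ?u w * (grad (kern e) (z - w) \<bullet> h))"
        "integrable (lebesgue_on disk) (\<lambda>w. ?v w * (grad (kern e) (z - w) \<bullet> h))" for h
      by (intro integrable_times_test c t'; simp)+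
    have "0 = - (\<integral>w. g w \<bullet> grad (\<lambda>w. kern e (z - w)) w \<partial>lebesgue_on disk)" using g t by (simp add: weakly_CR_def)
    also have "\<dots> = (\<integral>w. ?u w * (grad (kern e) (z - w) \<bullet> 1) + ?v w * (grad (kern e) (z - w) \<bullet> \<i>) \<partial>lebesgue_on disk)"
      unfolding Bochner_Integration.integral_minus[symmetric]
      by (rule Bochner_Integration.integral_cong) (simp_all add: gr inner_complex_def)
    finally have 1: "?D ?u 1 + ?D ?v \<i> = 0" using Bochner_Integration.integral_add[OF i(1)[of 1] i(2)[of \<i>]] by linarith
    have "0 = - (\<integral>w. (\<i> * g w) \<bullet> grad (\<lambda>w. kern e (z - w)) w \<partial>lebesgue_on disk)" using g t by (simp add: weakly_CR_def)
    also have "\<dots> = (\<integral>w. ?u w * (grad (kern e) (z - w) \<bullet> \<i>) - ?v w * (grad (kern e) (z - w) \<bullet> 1) \<partial>lebesgue_on disk)"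
      unfolding Bochner_Integration.integral_minus[symmetric]
      by (rule Bochner_Integration.integral_cong) (simp_all add: gr inner_complex_def algebra_simps)
    finally have 2: "?D ?u \<i> - ?D ?v 1 = 0" using Bochner_Integration.integral_diff[OF i(1)[of \<i>] i(2)[of 1]] by linarith
    have lin: "?D f h = Re h * ?D f 1 + Im h * ?D f \<i>" if "f = ?u \<or> f = ?v" for f h
    proof -
      have ii: "integrable (lebesgue_on disk) (\<lambda>w. f w * (grad (kern e) (z - w) \<bullet> h))" for h using i that by blast
      have "?D f h = (\<integral>w. Re h * (f w * (grad (kern e) (z - w) \<bullet> 1)) + Im h * (f w * (grad (kern e) (z - w) \<bullet> \<i>)) \<partial>lebesgue_on disk)"
        by (simp add: inner_complex_def algebra_simps)
      also have "\<dots> = Re h * ?D f 1 + Im h * ?D f \<i>"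
        by (simp only: Bochner_Integration.integral_add[OF integrable_mult_right[OF ii] integrable_mult_right[OF ii]] integral_mult_right_zero)
      finally show ?thesis .
    qed
    let ?c = "(of_real (?D ?u 1) - \<i> * of_real (?D ?v 1)) / of_real kern_mass :: complex"
    have "(?F has_derivative (\<lambda>h. of_real (?D ?u h / kern_mass) - \<i> * of_real (?D ?v h / kern_mass))) (at z)"
      by (intro has_derivative_diff has_derivative_mult_right has_derivative_of_real weyl_has_derivative[OF u e] weyl_has_derivative[OF v e])
    moreover have "(\<lambda>h. of_real (?D ?u h / kern_mass) - \<i> * of_real (?D ?v h / kern_mass)) = (*) ?c"
    proof
      fix h
      have D: "?D ?u \<i> = ?D ?v 1" "?D ?v \<i> = - ?D ?u 1" using 1 2 by linarith+
      have gen: "of_real ((Re h * a + Im h * b) / m) - \<i> * of_real ((Re h * b + Im h * (- a)) / m) =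
          (of_real a - \<i> * of_real b) / of_real m * h" if "m > 0" for a b m :: real
        using that by (simp add: complex_eq_iff field_simps)
      show "of_real (?D ?u h / kern_mass) - \<i> * of_real (?D ?v h / kern_mass) = ?c * h"
        unfolding lin[of ?u h, OF disjI1[OF refl]] lin[of ?v h, OF disjI2[OF refl]] D by (rule gen[OF kern_mass_pos])
    qed
    ultimately have "(?F has_derivative (*) ?c) (at z)" by (simp only:)
    then show "?F field_differentiable at z within disk"
      unfolding field_differentiable_def has_field_derivative_def by (blast intro: has_derivative_at_withinI)
  qed
qed

section \<open>Square integrable fields on the disk\<close>

abbreviation "MD \<equiv> lebesgue_on disk"

lemma finite_measure_MD: "finite_measure MD"
  by (rule finite_measure_lebesgue_on) (rule lmeasurable_ball)

lemma integrable_const_MD [simp]: "integrable MD (\<lambda>z. c :: 'b::euclidean_space)"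
  using finite_measure.integrable_const[OF finite_measure_MD] .

text \<open>Functions rather than classes: values outside the disk are irrelevant, \<open>ip\<close>
  is only semidefinite, and equality almost everywhere is carried through explicitly by lemmas such
  as \<open>ip_cong_AE\<close>.\<close>

definition sqint :: "(complex \<Rightarrow> 'b::euclidean_space) set" where
  "sqint = {g \<in> borel_measurable MD. integrable MD (\<lambda>z. (norm (g z))\<^sup>2)}"

definition ip :: "(complex \<Rightarrow> 'b::euclidean_space) \<Rightarrow> (complex \<Rightarrow> 'b) \<Rightarrow> real" where
  "ip f g = (\<integral>z. f z \<bullet> g z \<partial>MD)"

lemma sqint_measurable [measurable_dest]: "g \<in> sqint \<Longrightarrow> g \<in> borel_measurable MD"
  and sqint_integrable: "g \<in> sqint \<Longrightarrow> integrable MD (\<lambda>z. (norm (g z))\<^sup>2)"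
  by (auto simp: sqint_def)

lemma sqintI_bound:
  assumes "f \<in> borel_measurable MD" "integrable MD B" "AE z in MD. (norm (f z))\<^sup>2 \<le> B z"
  shows "f \<in> sqint"
  unfolding sqint_def
proof safe
  show "integrable MD (\<lambda>z. (norm (f z))\<^sup>2)"
    using assms(2)
  proof (rule Bochner_Integration.integrable_bound)
    show "AE x in MD. norm ((norm (f x))\<^sup>2) \<le> norm (B x)"
      using assms(3) by (rule eventually_mono) auto
  qed (use assms(1) in auto)
qed (use assms in auto)

lemma norm_add_sq_le: "(norm (a + b))\<^sup>2 \<le> 2 * (norm a)\<^sup>2 + 2 * (norm (b :: 'b::real_inner))\<^sup>2"
proof -
  have "(norm (a + b))\<^sup>2 + (norm (a - b))\<^sup>2 = 2 * (norm a)\<^sup>2 + 2 * (norm b)\<^sup>2"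
    by (simp add: power2_norm_eq_inner inner_add_left inner_add_right inner_diff_left inner_diff_right inner_commute)
  then show ?thesis using zero_le_power2[of "norm (a - b)"] by linarith
qed

lemma sqint_add: "f \<in> sqint \<Longrightarrow> g \<in> sqint \<Longrightarrow> (\<lambda>z. f z + g z) \<in> sqint"
  by (rule sqintI_bound[where B="\<lambda>z. 2 * (norm (f z))\<^sup>2 + 2 * (norm (g z))\<^sup>2"])
     (auto simp: sqint_integrable norm_add_sq_le sqint_measurable)

lemma sqint_mult:
  assumes "g \<in> sqint" "\<gamma> \<in> borel_measurable MD" "AE z in MD. \<bar>\<gamma> z\<bar> \<le> (K :: real)"
  shows "(\<lambda>z. \<gamma> z *\<^sub>R g z) \<in> sqint"
proof (rule sqintI_bound[where B="\<lambda>z. K\<^sup>2 * (norm (g z))\<^sup>2"])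
  show "AE z in MD. (norm (\<gamma> z *\<^sub>R g z))\<^sup>2 \<le> K\<^sup>2 * (norm (g z))\<^sup>2"
    using assms(3) by (rule eventually_mono) (auto simp: power_mult_distrib intro!: mult_right_mono power2_le_iff_abs_le[THEN iffD2] abs_le_square_iff[THEN iffD1])
qed (use assms sqint_measurable sqint_integrable in auto)

lemma sqint_scaleR: "g \<in> sqint \<Longrightarrow> (\<lambda>z. c *\<^sub>R g z) \<in> sqint"
  by (rule sqint_mult[where K="\<bar>c\<bar>"]) auto

lemma sqint_minus: "g \<in> sqint \<Longrightarrow> (\<lambda>z. - g z) \<in> sqint"
  using sqint_scaleR[of g "-1"] by simp

lemma sqint_diff: "f \<in> sqint \<Longrightarrow> g \<in> sqint \<Longrightarrow> (\<lambda>z. f z - g z) \<in> sqint"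
  using sqint_add[OF _ sqint_minus] by fastforce

lemma sqint_rotate: "g \<in> sqint \<Longrightarrow> (\<lambda>z. \<i> * g z) \<in> sqint"
  by (auto simp: sqint_def norm_mult)

lemma sqint_zero: "(\<lambda>z. 0) \<in> sqint"
  by (auto simp: sqint_def)

lemma sqint_bounded:
  "g \<in> borel_measurable MD \<Longrightarrow> AE z in MD. norm (g z) \<le> C \<Longrightarrow> g \<in> sqint"
  by (rule sqintI_bound[where B="\<lambda>z. C\<^sup>2"]) (auto elim!: eventually_mono intro: power_mono)

lemma sqint_L2_loc:
  assumes "g \<in> sqint" shows "g \<in> L2_loc disk"
  unfolding L2_loc_def
proof safe
  fix C :: "complex set" assume C: "compact C" "C \<subseteq> disk"
  then have Cl: "C \<in> sets lebesgue" by (auto simp: lmeasurable_compact fmeasurableD)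
  have "integrable lebesgue (\<lambda>z. indicat_real disk z *\<^sub>R (norm (g z))\<^sup>2)"
    using sqint_integrable[OF assms] by (subst (asm) integrable_restrict_space) auto
  from integrable_mult_indicator[OF Cl this]
  have "integrable lebesgue (\<lambda>z. indicat_real C z *\<^sub>R indicat_real disk z *\<^sub>R (norm (g z))\<^sup>2)" .
  moreover have "indicat_real C z *\<^sub>R indicat_real disk z *\<^sub>R (norm (g z))\<^sup>2 = indicat_real C z *\<^sub>R (norm (g z))\<^sup>2" for z
    using C by (auto simp: indicator_def)
  ultimately have "integrable lebesgue (\<lambda>z. indicat_real C z *\<^sub>R (norm (g z))\<^sup>2)" by (simp only:)
  then show "integrable (lebesgue_on C) (\<lambda>z. (norm (g z))\<^sup>2)" using Cl by (subst integrable_restrict_space) auto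
qed (use assms in \<open>auto simp: sqint_def\<close>)

lemma ip_integrable:
  fixes f g :: "complex \<Rightarrow> 'b::euclidean_space"
  assumes "f \<in> sqint" "g \<in> sqint" shows "integrable MD (\<lambda>z. f z \<bullet> g z)"
proof (rule Bochner_Integration.integrable_bound)
  show "integrable MD (\<lambda>z. (norm (f z))\<^sup>2 + (norm (g z))\<^sup>2)" using assms by (simp add: sqint_integrable)
  have "\<bar>a \<bullet> b\<bar> \<le> (norm a)\<^sup>2 + (norm b)\<^sup>2" for a b :: 'b
  proof -
    have "0 \<le> (norm a - norm b)\<^sup>2" by simp
    then have "2 * (norm a * norm b) \<le> (norm a)\<^sup>2 + (norm b)\<^sup>2" by (simp add: power2_eq_square algebra_simps)
    moreover have "0 \<le> norm a * norm b" by simp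
    ultimately show ?thesis using Cauchy_Schwarz_ineq2[of a b] by linarith
  qed
  then show "AE x in MD. norm (f x \<bullet> g x) \<le> norm ((norm (f x))\<^sup>2 + (norm (g x))\<^sup>2)"
    by (intro always_eventually allI) simp
qed (use assms sqint_measurable in auto)

lemma ip_commute: "ip f g = ip g f"
  by (simp add: ip_def inner_commute)

lemma ip_add_left: "f \<in> sqint \<Longrightarrow> g \<in> sqint \<Longrightarrow> h \<in> sqint \<Longrightarrow> ip (\<lambda>z. f z + g z) h = ip f h + ip g h"
  unfolding ip_def inner_add_left by (intro Bochner_Integration.integral_add ip_integrable)

lemma ip_diff_left: "f \<in> sqint \<Longrightarrow> g \<in> sqint \<Longrightarrow> h \<in> sqint \<Longrightarrow> ip (\<lambda>z. f z - g z) h = ip f h - ip g h"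
  unfolding ip_def inner_diff_left by (intro Bochner_Integration.integral_diff ip_integrable)

lemma ip_scaleR_left: "ip (\<lambda>z. c *\<^sub>R f z) h = c * ip f h"
  unfolding ip_def by simp

lemma ip_add_right: "f \<in> sqint \<Longrightarrow> g \<in> sqint \<Longrightarrow> h \<in> sqint \<Longrightarrow> ip h (\<lambda>z. f z + g z) = ip h f + ip h g"
  using ip_add_left[of f g h] by (simp only: ip_commute[of h])

lemma ip_diff_right: "f \<in> sqint \<Longrightarrow> g \<in> sqint \<Longrightarrow> h \<in> sqint \<Longrightarrow> ip h (\<lambda>z. f z - g z) = ip h f - ip h g"
  using ip_diff_left[of f g h] by (simp only: ip_commute[of h])

lemma ip_scaleR_right: "ip h (\<lambda>z. c *\<^sub>R f z) = c * ip h f"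
  using ip_scaleR_left[of c f h] by (simp only: ip_commute[of h])

lemma ip_self: "ip f f = (\<integral>z. (norm (f z))\<^sup>2 \<partial>MD)"
  by (simp add: ip_def power2_norm_eq_inner)

lemma ip_self_nonneg: "ip f f \<ge> 0"
  by (simp add: ip_self)

lemma ip_cong_AE:
  assumes "f \<in> borel_measurable MD" "f' \<in> borel_measurable MD" "g \<in> borel_measurable MD" "g' \<in> borel_measurable MD"
    "AE z in MD. f z = f' z" "AE z in MD. g z = g' z"
  shows "ip f g = ip f' g'"
  unfolding ip_def
proof (rule integral_cong_AE)
  show "AE x in MD. f x \<bullet> g x = f' x \<bullet> g' x" using assms(5,6) by eventually_elim simp
qed (use assms in auto)

lemma ip_self_eq_0_iff: "f \<in> sqint \<Longrightarrow> ip f f = 0 \<longleftrightarrow> (AE z in MD. f z = 0)"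
  unfolding ip_self using integral_nonneg_eq_0_iff_AE[OF sqint_integrable] by simp

lemma ip_CS:
  assumes "f \<in> sqint" "g \<in> sqint" shows "(ip f g)\<^sup>2 \<le> ip f f * ip g g"
proof -
  have q: "0 \<le> ip f f - 2 * t * ip f g + t\<^sup>2 * ip g g" for t
  proof -
    have "ip (\<lambda>z. f z - t *\<^sub>R g z) (\<lambda>z. f z - t *\<^sub>R g z) = ip f f - 2 * t * ip f g + t\<^sup>2 * ip g g"
      using assms sqint_scaleR[OF assms(2), of t] sqint_diff[OF assms(1) sqint_scaleR[OF assms(2), of t]]
      by (simp add: ip_diff_left ip_diff_right ip_scaleR_left ip_scaleR_right ip_commute[of g f] power2_eq_square algebra_simps)
    then show ?thesis using ip_self_nonneg by metis
  qed
  show ?thesis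
  proof (cases "ip g g = 0")
    case True
    have "ip f g = 0"
    proof (rule ccontr)
      assume "ip f g \<noteq> 0"
      \<comment> \<open>With \<open>ip g g = 0\<close> the quadratic in \<open>t\<close> is affine;
        at this \<open>t\<close> it takes the value -1.\<close>
      then show False using q[of "(ip f f + 1) / (2 * ip f g)"] True by simp
    qed
    then show ?thesis using True by simp
  next
    case False
    then have "ip g g > 0" using ip_self_nonneg[of g] by simp
    then show ?thesis using q[of "ip f g / ip g g"] by (simp add: field_simps power2_eq_square)
  qed
qed

lemma ip_triangle_sq:
  assumes "f \<in> sqint" "g \<in> sqint"
  shows "ip (\<lambda>z. f z + g z) (\<lambda>z. f z + g z) \<le> 2 * ip f f + 2 * ip g g"
proof -
  have "ip (\<lambda>z. f z + g z) (\<lambda>z. f z + g z) \<le> (\<integral>z. 2 * (norm (f z))\<^sup>2 + 2 * (norm (g z))\<^sup>2 \<partial>MD)"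
    unfolding ip_self using sqint_add[OF assms] assms by (intro integral_mono) (auto simp: sqint_integrable norm_add_sq_le)
  then show ?thesis using assms by (simp add: ip_self sqint_integrable)
qed

lemma ip_triangle_sq_diff:
  assumes "f \<in> sqint" "g \<in> sqint" "h \<in> sqint"
  shows "ip (\<lambda>z. f z - g z) (\<lambda>z. f z - g z) \<le> 2 * ip (\<lambda>z. f z - h z) (\<lambda>z. f z - h z) + 2 * ip (\<lambda>z. g z - h z) (\<lambda>z. g z - h z)"
proof -
  have "ip (\<lambda>z. f z - g z) (\<lambda>z. f z - g z) = ip (\<lambda>z. (f z - h z) + (- 1) *\<^sub>R (g z - h z)) (\<lambda>z. (f z - h z) + (- 1) *\<^sub>R (g z - h z))"
    by simp
  also have "\<dots> \<le> 2 * ip (\<lambda>z. f z - h z) (\<lambda>z. f z - h z) + 2 * ip (\<lambda>z. (- 1) *\<^sub>R (g z - h z)) (\<lambda>z. (- 1) *\<^sub>R (g z - h z))"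
    by (intro ip_triangle_sq sqint_diff sqint_scaleR assms)
  finally show ?thesis by (simp only: ip_scaleR_left ip_scaleR_right)
qed

text \<open>Riesz-Fischer with a rate: geometric decay of the increments forces convergence almost
  everywhere, and Fatou's lemma passes the rate on to the limit.\<close>

lemma sqint_complete:
  fixes f :: "nat \<Rightarrow> complex \<Rightarrow> 'b::euclidean_space"
  assumes f: "\<And>n. f n \<in> sqint"
    and C: "\<And>m n. n \<le> m \<Longrightarrow> ip (\<lambda>z. f m z - f n z) (\<lambda>z. f m z - f n z) \<le> (1 / 4) ^ n"
  obtains g where "g \<in> sqint" "\<And>n. ip (\<lambda>z. f n z - g z) (\<lambda>z. f n z - g z) \<le> (1 / 4) ^ n"
proof -
  have [measurable]: "f n \<in> borel_measurable MD" for n using f by (rule sqint_measurable)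
  have d: "(\<lambda>z. f m z - f n z) \<in> sqint" for m n by (intro sqint_diff f)
  have nn: "(\<integral>\<^sup>+z. ennreal ((norm (f m z - f n z))\<^sup>2) \<partial>MD) = ennreal (ip (\<lambda>z. f m z - f n z) (\<lambda>z. f m z - f n z))" for m n
    unfolding ip_self by (rule nn_integral_eq_integral) (use sqint_integrable[OF d] in auto)
  define \<mu> where "\<mu> = measure MD (space MD)"
  have one: "(\<integral>\<^sup>+z. ennreal (norm (f (Suc n) z - f n z)) \<partial>MD) \<le> ennreal ((1 + \<mu>) * (1 / 2) ^ n)" for n
  proof -
    have i: "integrable MD (\<lambda>z. 2 ^ n * (norm (f (Suc n) z - f n z))\<^sup>2 + (1 / 2) ^ n)" using sqint_integrable[OF d] by simp
    \<comment> \<open>A weighted arithmetic-geometric mean. The weight \<open>2 ^ n\<close> balances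
      the bound \<open>(1 / 4) ^ n\<close>, so that both terms have integrals of order
      \<open>(1 / 2) ^ n\<close> and the increments are summable.\<close>
    have b: "norm (f (Suc n) z - f n z) \<le> 2 ^ n * (norm (f (Suc n) z - f n z))\<^sup>2 + (1 / 2) ^ n" for z
    proof -
      let ?t = "norm (f (Suc n) z - f n z)"
      have "0 \<le> 2 ^ n * (?t - (1 / 2) ^ n)\<^sup>2" by simp
      also have "\<dots> = 2 ^ n * ?t\<^sup>2 - 2 * ?t * (2 ^ n * (1 / 2) ^ n) + (2 ^ n * (1 / 2) ^ n) * (1 / 2) ^ n"
        by (simp add: power2_eq_square algebra_simps)
      also have "2 ^ n * (1 / 2) ^ n = (1 :: real)" by (simp add: power_mult_distrib[symmetric])
      finally have "0 \<le> 2 ^ n * ?t\<^sup>2 - 2 * ?t + (1 / 2) ^ n" by simp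
      moreover have "0 \<le> ?t" by simp
      ultimately show ?thesis by linarith
    qed
    have "(\<integral>\<^sup>+z. ennreal (norm (f (Suc n) z - f n z)) \<partial>MD) \<le> (\<integral>\<^sup>+z. ennreal (2 ^ n * (norm (f (Suc n) z - f n z))\<^sup>2 + (1 / 2) ^ n) \<partial>MD)"
      using b by (intro nn_integral_mono ennreal_leI) auto
    also have "\<dots> = ennreal (\<integral>z. 2 ^ n * (norm (f (Suc n) z - f n z))\<^sup>2 + (1 / 2) ^ n \<partial>MD)"
      by (rule nn_integral_eq_integral[OF i]) auto
    also have "(\<integral>z. 2 ^ n * (norm (f (Suc n) z - f n z))\<^sup>2 + (1 / 2) ^ n \<partial>MD) =
        2 ^ n * ip (\<lambda>z. f (Suc n) z - f n z) (\<lambda>z. f (Suc n) z - f n z) + \<mu> * (1 / 2) ^ n"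
      using sqint_integrable[OF d] by (simp add: ip_self \<mu>_def)
    also have "2 ^ n * ip (\<lambda>z. f (Suc n) z - f n z) (\<lambda>z. f (Suc n) z - f n z) \<le> 2 ^ n * (1 / 4) ^ n"
      using C[of n "Suc n"] by simp
    also have "2 ^ n * (1 / 4) ^ n = (1 / 2 :: real) ^ n" by (simp add: power_mult_distrib[symmetric])
    finally show ?thesis by (simp add: distrib_right ennreal_leI)
  qed
  have \<mu>: "\<mu> \<ge> 0" by (simp add: \<mu>_def)
  have "(\<integral>\<^sup>+z. (\<Sum>n. ennreal (norm (f (Suc n) z - f n z))) \<partial>MD) = (\<Sum>n. \<integral>\<^sup>+z. ennreal (norm (f (Suc n) z - f n z)) \<partial>MD)"
    by (rule nn_integral_suminf) measurable
  also have "\<dots> \<le> (\<Sum>n. ennreal ((1 + \<mu>) * (1 / 2) ^ n))" by (intro suminf_le one) auto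
  also have "\<dots> = ennreal (\<Sum>n. (1 + \<mu>) * (1 / 2) ^ n)" using \<mu> by (intro suminf_ennreal2) (auto intro: summable_mult)
  finally have "(\<integral>\<^sup>+z. (\<Sum>n. ennreal (norm (f (Suc n) z - f n z))) \<partial>MD) \<noteq> \<infinity>" by (auto simp: top_unique)
  then have "AE z in MD. (\<Sum>n. ennreal (norm (f (Suc n) z - f n z))) \<noteq> \<infinity>"
    by (intro nn_integral_PInf_AE) measurable
  then have conv: "AE z in MD. convergent (\<lambda>n. f n z)"
  proof (rule eventually_mono)
    fix z assume "(\<Sum>n. ennreal (norm (f (Suc n) z - f n z))) \<noteq> \<infinity>"
    then have "summable (\<lambda>n. norm (f (Suc n) z - f n z))" by (intro summable_suminf_not_top) auto
    then have "summable (\<lambda>n. f (Suc n) z - f n z)" by (rule summable_norm_cancel)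
    then have "convergent (\<lambda>n. \<Sum>i<n. f (Suc i) z - f i z)" by (simp only: summable_iff_convergent)
    then have "convergent (\<lambda>n. f n z - f 0 z)" by (simp only: sum_lessThan_telescope[of "\<lambda>n. f n z"])
    then show "convergent (\<lambda>n. f n z)" by (simp only: convergent_diff_const_right_iff)
  qed
  define g where "g z = lim (\<lambda>n. f n z)" for z
  have gm [measurable]: "g \<in> borel_measurable MD" unfolding g_def by (rule borel_measurable_lim_metric) measurable
  have lim: "AE z in MD. (\<lambda>n. f n z) \<longlonglongrightarrow> g z"
    using conv by (rule eventually_mono) (simp add: g_def convergent_LIMSEQ_iff)
  have fatou: "(\<integral>\<^sup>+z. ennreal ((norm (f n z - g z))\<^sup>2) \<partial>MD) \<le> ennreal ((1 / 4) ^ n)" for n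
  proof -
    have "(\<integral>\<^sup>+z. ennreal ((norm (f n z - g z))\<^sup>2) \<partial>MD) = (\<integral>\<^sup>+z. liminf (\<lambda>m. ennreal ((norm (f m z - f n z))\<^sup>2)) \<partial>MD)"
    proof (rule nn_integral_cong_AE, use lim in \<open>rule eventually_mono\<close>)
      fix z assume "(\<lambda>m. f m z) \<longlonglongrightarrow> g z"
      then have "(\<lambda>m. ennreal ((norm (f m z - f n z))\<^sup>2)) \<longlonglongrightarrow> ennreal ((norm (g z - f n z))\<^sup>2)"
        by (intro tendsto_ennrealI tendsto_intros)
      then have "liminf (\<lambda>m. ennreal ((norm (f m z - f n z))\<^sup>2)) = ennreal ((norm (g z - f n z))\<^sup>2)"
        by (intro lim_imp_Liminf) auto
      then show "ennreal ((norm (f n z - g z))\<^sup>2) = liminf (\<lambda>m. ennreal ((norm (f m z - f n z))\<^sup>2))"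
        by (simp only: norm_minus_commute)
    qed
    also have "\<dots> \<le> liminf (\<lambda>m. \<integral>\<^sup>+z. ennreal ((norm (f m z - f n z))\<^sup>2) \<partial>MD)"
      by (rule nn_integral_liminf) measurable
    also have "\<dots> \<le> ennreal ((1 / 4) ^ n)"
    proof (rule Liminf_le)
      show "\<forall>\<^sub>F m in sequentially. (\<integral>\<^sup>+z. ennreal ((norm (f m z - f n z))\<^sup>2) \<partial>MD) \<le> ennreal ((1 / 4) ^ n)"
        unfolding nn using C by (intro eventually_sequentiallyI[of n] ennreal_leI)
    qed simp
    finally show ?thesis .
  qed
  have dg: "(\<lambda>z. f n z - g z) \<in> sqint" for n
    unfolding sqint_def
  proof safe
    show "integrable MD (\<lambda>z. (norm (f n z - g z))\<^sup>2)"
      unfolding integrable_iff_bounded using fatou[of n] by (auto simp: order_le_less_trans)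
  qed measurable
  have "(\<lambda>z. f 0 z - (f 0 z - g z)) \<in> sqint" by (intro sqint_diff f dg)
  then have "g \<in> sqint" by simp
  moreover have "ip (\<lambda>z. f n z - g z) (\<lambda>z. f n z - g z) \<le> (1 / 4) ^ n" for n
  proof -
    have "(\<integral>\<^sup>+z. ennreal ((norm (f n z - g z))\<^sup>2) \<partial>MD) = ennreal (ip (\<lambda>z. f n z - g z) (\<lambda>z. f n z - g z))"
      unfolding ip_self by (rule nn_integral_eq_integral) (use sqint_integrable[OF dg] in auto)
    with fatou[of n] show ?thesis by (simp add: ennreal_le_iff)
  qed
  ultimately show ?thesis using that by blast
qed

section \<open>Weak gradients\<close>

lemma weak_gradient_iff:
  "has_weak_gradient disk u g \<longleftrightarrow> u \<in> L2_loc disk \<and> g \<in> L2_loc disk \<and>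
     (\<forall>\<phi>\<in>test_functions disk. \<forall>h\<in>Basis. (\<integral>z. u z * (grad \<phi> z \<bullet> h) \<partial>MD) = - (\<integral>z. (g z \<bullet> h) * \<phi> z \<partial>MD))"
  unfolding has_weak_gradient_def
  by (intro conj_cong ball_cong refl) (simp add: frechet_grad test_functionsD(2))

lemma weak_gradientD:
  assumes "has_weak_gradient disk u g" "\<phi> \<in> test_functions disk"
  shows "(\<integral>z. u z * (grad \<phi> z \<bullet> h) \<partial>MD) = - (\<integral>z. (g z \<bullet> h) * \<phi> z \<partial>MD)"
proof -
  have L: "u \<in> L2_loc disk" "g \<in> L2_loc disk" using assms(1) by (auto simp: weak_gradient_iff)
  have b: "(\<integral>z. u z * (grad \<phi> z \<bullet> h) \<partial>MD) = - (\<integral>z. (g z \<bullet> h) * \<phi> z \<partial>MD)" if "h \<in> Basis" for h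
    using assms that by (auto simp: weak_gradient_iff)
  have i: "integrable MD (\<lambda>z. u z * (grad \<phi> z \<bullet> h))" "integrable MD (\<lambda>z. (g z \<bullet> h) * \<phi> z)" for h
    by (intro integrable_times_test L test_functions_grad L2_loc_component assms; simp)+
  have h: "x \<bullet> h = Re h * (x \<bullet> 1) + Im h * (x \<bullet> \<i>)" for x by (simp add: inner_complex_def)
  have "(\<integral>z. u z * (grad \<phi> z \<bullet> h) \<partial>MD) = (\<integral>z. Re h * (u z * (grad \<phi> z \<bullet> 1)) + Im h * (u z * (grad \<phi> z \<bullet> \<i>)) \<partial>MD)"
    by (rule Bochner_Integration.integral_cong[OF refl]) (subst h, simp add: algebra_simps)
  also have "\<dots> = Re h * (\<integral>z. u z * (grad \<phi> z \<bullet> 1) \<partial>MD) + Im h * (\<integral>z. u z * (grad \<phi> z \<bullet> \<i>) \<partial>MD)"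
    by (simp only: Bochner_Integration.integral_add[OF integrable_mult_right[OF i(1)] integrable_mult_right[OF i(1)]] integral_mult_right_zero)
  also have "\<dots> = - (Re h * (\<integral>z. (g z \<bullet> 1) * \<phi> z \<partial>MD) + Im h * (\<integral>z. (g z \<bullet> \<i>) * \<phi> z \<partial>MD))"
    using b[of 1] b[of \<i>] by (simp add: Basis_complex_def)
  also have "Re h * (\<integral>z. (g z \<bullet> 1) * \<phi> z \<partial>MD) + Im h * (\<integral>z. (g z \<bullet> \<i>) * \<phi> z \<partial>MD)
      = (\<integral>z. Re h * ((g z \<bullet> 1) * \<phi> z) + Im h * ((g z \<bullet> \<i>) * \<phi> z) \<partial>MD)"
    by (simp only: Bochner_Integration.integral_add[OF integrable_mult_right[OF i(2)] integrable_mult_right[OF i(2)]] integral_mult_right_zero)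
  also have "\<dots> = (\<integral>z. (g z \<bullet> h) * \<phi> z \<partial>MD)"
    by (rule Bochner_Integration.integral_cong[OF refl]) (simp only: h distrib_right mult.assoc)
  finally show ?thesis .
qed

lemma L2_loc_add:
  fixes f g :: "complex \<Rightarrow> 'b::euclidean_space"
  assumes "f \<in> L2_loc disk" "g \<in> L2_loc disk" shows "(\<lambda>z. f z + g z) \<in> L2_loc disk"
  unfolding L2_loc_def
proof safe
  fix C :: "complex set" assume C: "compact C" "C \<subseteq> disk"
  have i: "integrable (lebesgue_on C) (\<lambda>z. 2 * (norm (f z))\<^sup>2 + 2 * (norm (g z))\<^sup>2)"
    using assms C by (auto simp: L2_loc_def)
  have m: "f \<in> borel_measurable (lebesgue_on C)" "g \<in> borel_measurable (lebesgue_on C)"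
    using assms unfolding L2_loc_def by (auto intro: measurable_restrict_mono[OF _ C(2)])
  show "integrable (lebesgue_on C) (\<lambda>z. (norm (f z + g z))\<^sup>2)"
    using i by (rule Bochner_Integration.integrable_bound) (use m in \<open>auto intro!: always_eventually simp: norm_add_sq_le\<close>)
qed (use assms in \<open>auto simp: L2_loc_def\<close>)

lemma L2_loc_scaleR:
  assumes "g \<in> L2_loc disk" shows "(\<lambda>z. c *\<^sub>R g z) \<in> L2_loc disk"
  using assms by (auto simp: L2_loc_def power_mult_distrib)

lemma weak_gradient_add:
  assumes "has_weak_gradient disk u g" "has_weak_gradient disk v h"
  shows "has_weak_gradient disk (\<lambda>z. u z + v z) (\<lambda>z. g z + h z)"
  unfolding weak_gradient_iff
proof (intro conjI ballI)
  have L: "u \<in> L2_loc disk" "g \<in> L2_loc disk" "v \<in> L2_loc disk" "h \<in> L2_loc disk" using assms by (auto simp: weak_gradient_iff)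
  then show "(\<lambda>z. u z + v z) \<in> L2_loc disk" "(\<lambda>z. g z + h z) \<in> L2_loc disk" by (auto intro: L2_loc_add)
  fix \<phi> and e :: complex assume \<phi>: "\<phi> \<in> test_functions disk"
  have i: "integrable MD (\<lambda>z. w z * (grad \<phi> z \<bullet> e))" "integrable MD (\<lambda>z. (p z \<bullet> e) * \<phi> z)"
    if "w \<in> L2_loc disk" "p \<in> L2_loc disk" for w p
    by (intro integrable_times_test that test_functions_grad L2_loc_component \<phi>; simp)+
  show "(\<integral>z. (u z + v z) * (grad \<phi> z \<bullet> e) \<partial>MD) = - (\<integral>z. ((g z + h z) \<bullet> e) * \<phi> z \<partial>MD)"
    using weak_gradientD[OF assms(1) \<phi>, of e] weak_gradientD[OF assms(2) \<phi>, of e] i L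
    by (simp add: distrib_right inner_add_left)
qed

lemma weak_gradient_scale:
  assumes "has_weak_gradient disk u g"
  shows "has_weak_gradient disk (\<lambda>z. c * u z) (\<lambda>z. c *\<^sub>R g z)"
  using assms L2_loc_scaleR[of u c] L2_loc_scaleR[of g c] by (auto simp: weak_gradient_iff mult.assoc)

lemma weak_gradient_diff:
  assumes "has_weak_gradient disk u g" "has_weak_gradient disk v h"
  shows "has_weak_gradient disk (\<lambda>z. u z - v z) (\<lambda>z. g z - h z)"
  using weak_gradient_add[OF assms(1) weak_gradient_scale[OF assms(2), of "-1"]] by simp

text \<open>\<open>u\<close> may blow up at the boundary, but the product of \<open>u\<close> and
  \<open>\<phi>\<close>, extended by zero, has a gradient that is bounded on the compact support of
  \<open>\<phi>\<close> and zero elsewhere. It is thus globally Lipschitz, and its directional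
  derivatives integrate to 0.\<close>

lemma test_global_derivative:
  assumes u: "continuous_on disk G" "\<And>z. z \<in> disk \<Longrightarrow> (u has_derivative (\<lambda>h. G z \<bullet> h)) (at z)"
    and \<phi>: "\<phi> \<in> test_functions disk"
  shows "(\<integral>z. u z * (grad \<phi> z \<bullet> h) \<partial>MD) = - (\<integral>z. (G z \<bullet> h) * \<phi> z \<partial>MD)"
    and "u \<in> L2_loc disk" and "G \<in> L2_loc disk"
proof -
  have cu: "continuous_on disk u" using u(2) by (meson continuous_at_imp_continuous_on has_derivative_continuous)
  have loc: "w \<in> L2_loc disk" if "continuous_on disk w" for w :: "complex \<Rightarrow> 'b::euclidean_space"
    unfolding L2_loc_def
  proof safe
    show "w \<in> borel_measurable MD" by (rule continuous_imp_measurable_on_sets_lebesgue[OF that]) auto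
    fix C :: "complex set" assume C: "compact C" "C \<subseteq> disk"
    have cw: "continuous_on C (\<lambda>z. (norm (w z))\<^sup>2)" using continuous_on_subset[OF that C(2)] by (intro continuous_intros)
    then obtain B where B: "\<And>z. z \<in> C \<Longrightarrow> norm ((norm (w z))\<^sup>2) \<le> B"
      using compact_imp_bounded[OF compact_continuous_image[OF cw C(1)]] by (auto simp: bounded_iff)
    have Cl: "C \<in> sets lebesgue" using C(1) by (simp add: lmeasurable_compact fmeasurableD)
    have "integrable (lebesgue_on C) (\<lambda>z. B)"
      using finite_measure.integrable_const[OF finite_measure_lebesgue_on[OF lmeasurable_compact[OF C(1)]]] .
    then show "integrable (lebesgue_on C) (\<lambda>z. (norm (w z))\<^sup>2)"
    proof (rule Bochner_Integration.integrable_bound)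
      show "(\<lambda>z. (norm (w z))\<^sup>2) \<in> borel_measurable (lebesgue_on C)"
        by (rule continuous_imp_measurable_on_sets_lebesgue[OF cw Cl])
      show "AE z in lebesgue_on C. norm ((norm (w z))\<^sup>2) \<le> norm B"
        using B by (intro AE_I2) (auto intro: order_trans[OF _ abs_ge_self])
    qed
  qed
  show uL: "u \<in> L2_loc disk" and GL: "G \<in> L2_loc disk" using loc cu u(1) by auto
  obtain C where C: "compact C" "C \<subseteq> disk" "\<And>z. z \<notin> C \<Longrightarrow> \<phi> z = 0" "\<And>z. z \<notin> C \<Longrightarrow> grad \<phi> z = 0"
    using test_functions_support[OF \<phi>] by metis
  define p where "p z = u z * \<phi> z" for z
  define P where "P z = (if z \<in> disk then u z *\<^sub>R grad \<phi> z + \<phi> z *\<^sub>R G z else 0)" for z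
  have pd: "(p has_derivative (\<lambda>h. P z \<bullet> h)) (at z)" for z
  proof (cases "z \<in> disk")
    case True
    have "(p has_derivative (\<lambda>h. u z * (grad \<phi> z \<bullet> h) + (G z \<bullet> h) * \<phi> z)) (at z)"
      unfolding p_def by (rule has_derivative_mult[OF u(2)[OF True] test_functionsD(4)[OF \<phi>]])
    then show ?thesis using True by (simp add: P_def inner_add_left mult.commute[of "\<phi> z"])
  next
    case False
    then have "z \<in> - C" using C by auto
    moreover have "open (- C)" using C(1) by (simp add: compact_imp_closed open_Compl)
    ultimately have "(p has_derivative (\<lambda>h. 0)) (at z)"
    proof (intro has_derivative_transform_within_open[OF has_derivative_const])
      show "0 = p x" if "x \<in> - C" for x using that C(3)[of x] by (simp add: p_def)
    qed
    then show ?thesis using False by (simp add: P_def)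
  qed
  have "continuous_on C (\<lambda>z. u z *\<^sub>R grad \<phi> z + \<phi> z *\<^sub>R G z)"
    using continuous_on_subset[OF cu C(2)] continuous_on_subset[OF u(1) C(2)] continuous_grad[OF \<phi>, of C] test_functionsD(3)[OF \<phi>, of C]
    by (intro continuous_intros)
  then have "bounded ((\<lambda>z. u z *\<^sub>R grad \<phi> z + \<phi> z *\<^sub>R G z) ` C)" by (intro compact_imp_bounded compact_continuous_image C)
  then obtain B0 where B0: "\<And>z. z \<in> C \<Longrightarrow> norm (u z *\<^sub>R grad \<phi> z + \<phi> z *\<^sub>R G z) \<le> B0" by (auto simp: bounded_iff)
  have B: "norm (P z) \<le> max B0 0" for z
    using B0[of z] C(3)[of z] C(4)[of z] subsetD[OF C(2), of z] by (cases "z \<in> C") (auto simp: P_def max.coboundedI1)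
  have on: "onorm (\<lambda>h. P z \<bullet> h) \<le> max B0 0" for z
    by (rule onorm_bound) (auto intro: order_trans[OF Cauchy_Schwarz_ineq2 mult_right_mono[OF B]])
  have lip: "\<bar>p x - p y\<bar> \<le> max B0 0 * norm (x - y)" for x y
    using differentiable_bound[of UNIV p "\<lambda>z h. P z \<bullet> h" "max B0 0" x y] pd on by simp
  have Pm: "P \<in> borel_measurable lebesgue"
    unfolding P_def
  proof (rule borel_measurable_if_I)
    show "(\<lambda>z. u z *\<^sub>R grad \<phi> z + \<phi> z *\<^sub>R G z) \<in> borel_measurable MD"
      using uL GL continuous_borel_measurable_lebesgue_on[OF continuous_grad[OF \<phi>]] continuous_borel_measurable_lebesgue_on[OF test_functionsD(3)[OF \<phi>]]
      by (auto simp: L2_loc_def)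
  qed simp
  have "integral\<^sup>L lebesgue (\<lambda>z. P z \<bullet> h) = 0"
  proof (rule integral_derivative_eq_0[where p=p and C="max B0 0" and R=1 and p'="\<lambda>z h. P z \<bullet> h"])
    show "p z = 0" if "norm z \<ge> 1" for z using that C(3)[of z] subsetD[OF C(2), of z] by (auto simp: p_def)
  qed (use lip pd Pm in auto)
  moreover have "indicat_real disk z *\<^sub>R (u z * (grad \<phi> z \<bullet> h) + (G z \<bullet> h) * \<phi> z) = P z \<bullet> h" for z
    by (simp add: P_def inner_add_left mult.commute)
  ultimately have "(\<integral>z. u z * (grad \<phi> z \<bullet> h) + (G z \<bullet> h) * \<phi> z \<partial>MD) = 0"
    by (subst integral_restrict_space) auto
  moreover have "integrable MD (\<lambda>z. u z * (grad \<phi> z \<bullet> h))" "integrable MD (\<lambda>z. (G z \<bullet> h) * \<phi> z)"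
    by (intro integrable_times_test uL GL test_functions_grad L2_loc_component \<phi>; simp)+
  ultimately show "(\<integral>z. u z * (grad \<phi> z \<bullet> h) \<partial>MD) = - (\<integral>z. (G z \<bullet> h) * \<phi> z \<partial>MD)" by simp
qed

lemma C1_weak_gradient:
  assumes u: "continuous_on disk G" "\<And>z. z \<in> disk \<Longrightarrow> (u has_derivative (\<lambda>h. G z \<bullet> h)) (at z)"
  shows "has_weak_gradient disk u G"
  unfolding weak_gradient_iff using test_global_derivative[OF u] test_functions_zero by blast

lemma test_weak_gradient: "\<phi> \<in> test_functions \<Omega> \<Longrightarrow> has_weak_gradient disk \<phi> (grad \<phi>)"
  by (intro C1_weak_gradient continuous_grad test_functionsD)

lemma weak_gradient_const: "has_weak_gradient disk (\<lambda>z. c) (\<lambda>z. 0)"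
  by (rule C1_weak_gradient) (auto intro!: derivative_eq_intros)

lemma has_derivative_Re_holomorphic:
  assumes "(f has_field_derivative f') (at z)"
  shows "((\<lambda>z. Re (f z)) has_derivative (\<lambda>h. cnj f' \<bullet> h)) (at z)"
  using has_derivative_Re[OF assms[unfolded has_field_derivative_def]] by (simp add: inner_complex_def)

lemma holomorphic_weak_gradient:
  assumes "f holomorphic_on disk"
  shows "has_weak_gradient disk (\<lambda>z. Re (f z)) (\<lambda>z. cnj (deriv f z))"
proof (rule C1_weak_gradient)
  show "continuous_on disk (\<lambda>z. cnj (deriv f z))"
    using holomorphic_deriv[OF assms] by (intro continuous_intros holomorphic_on_imp_continuous_on) auto
  show "((\<lambda>z. Re (f z)) has_derivative (\<lambda>h. cnj (deriv f z) \<bullet> h)) (at z)" if "z \<in> disk" for z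
    by (rule has_derivative_Re_holomorphic[OF holomorphic_derivI[OF assms _ that]]) simp
qed

text \<open>The constant \<open>c\<close> is allowed for because representatives of one class differ
  by constants; the difference of the gradients falls to the fundamental lemma, one component at a
  time.\<close>

lemma weak_gradient_AE_unique:
  assumes "has_weak_gradient disk u g" "has_weak_gradient disk v h" "AE z in MD. u z = v z + c"
  shows "AE z in MD. g z = h z"
proof -
  have L: "u \<in> L2_loc disk" "g \<in> L2_loc disk" "v \<in> L2_loc disk" "h \<in> L2_loc disk" using assms by (auto simp: weak_gradient_iff)
  have W: "has_weak_gradient disk (\<lambda>z. v z + c) (\<lambda>z. h z + 0)" by (intro weak_gradient_add weak_gradient_const assms)
  have D: "has_weak_gradient disk (\<lambda>z. u z - (v z + c)) (\<lambda>z. g z - h z)"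
    using weak_gradient_diff[OF assms(1) W] by simp
  have e: "AE z in MD. (g z - h z) \<bullet> e = 0" for e
  proof (rule fundamental_lemma)
    show "(\<lambda>z. (g z - h z) \<bullet> e) \<in> L2_loc disk" using D by (auto simp: weak_gradient_iff intro: L2_loc_component)
    fix \<phi> assume \<phi>: "\<phi> \<in> test_functions disk"
    have "(\<integral>z. (u z - (v z + c)) * (grad \<phi> z \<bullet> e) \<partial>MD) = (\<integral>z. 0 \<partial>MD)"
    proof (rule integral_cong_AE)
      show "(\<lambda>z. (u z - (v z + c)) * (grad \<phi> z \<bullet> e)) \<in> borel_measurable MD"
        using L continuous_borel_measurable_lebesgue_on[OF continuous_grad[OF \<phi>]] by (auto simp: L2_loc_def)
      show "AE z in MD. (u z - (v z + c)) * (grad \<phi> z \<bullet> e) = 0" using assms(3) by (rule eventually_mono) simp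
    qed simp
    then show "(\<integral>z. (g z - h z) \<bullet> e * \<phi> z \<partial>MD) = 0" using weak_gradientD[OF D \<phi>, of e] by simp
  qed
  from e[of 1] e[of \<i>] show ?thesis by eventually_elim (simp add: inner_complex_def complex_eq_iff)
qed

text \<open>Moving each component onto a second derivative of \<open>\<phi>\<close> leaves the two
  mixed partials with opposite signs.\<close>

lemma weak_gradient_curl_free:
  assumes "has_weak_gradient disk u g" and \<phi>: "\<phi> \<in> test_functions disk"
  shows "(\<integral>z. (\<i> * g z) \<bullet> grad \<phi> z \<partial>MD) = 0"
proof -
  have L: "u \<in> L2_loc disk" "g \<in> L2_loc disk" using assms by (auto simp: weak_gradient_iff)
  have t: "(\<lambda>z. grad \<phi> z \<bullet> h) \<in> test_functions disk" for h by (rule test_functions_grad[OF \<phi>])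
  have i: "integrable MD (\<lambda>z. (g z \<bullet> k) * (grad \<phi> z \<bullet> h))" for h k
    by (intro integrable_times_test t L2_loc_component L) simp
  have "(\<integral>z. (\<i> * g z) \<bullet> grad \<phi> z \<partial>MD) = (\<integral>z. (g z \<bullet> 1) * (grad \<phi> z \<bullet> \<i>) - (g z \<bullet> \<i>) * (grad \<phi> z \<bullet> 1) \<partial>MD)"
    by (rule Bochner_Integration.integral_cong) (simp_all add: inner_complex_def)
  also have "\<dots> = (\<integral>z. (g z \<bullet> 1) * (grad \<phi> z \<bullet> \<i>) \<partial>MD) - (\<integral>z. (g z \<bullet> \<i>) * (grad \<phi> z \<bullet> 1) \<partial>MD)"
    by (rule Bochner_Integration.integral_diff[OF i i])
  also have "\<dots> = - (\<integral>z. u z * (grad (\<lambda>z. grad \<phi> z \<bullet> \<i>) z \<bullet> 1) \<partial>MD) + (\<integral>z. u z * (grad (\<lambda>z. grad \<phi> z \<bullet> 1) z \<bullet> \<i>) \<partial>MD)"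
    using weak_gradientD[OF assms(1) t[of \<i>], of 1] weak_gradientD[OF assms(1) t[of 1], of \<i>] by linarith
  also have "\<dots> = 0" by (simp only: mixed_partials[OF \<phi>, of 1 _ \<i>])
  finally show ?thesis .
qed

text \<open>Being a gradient supplies the curl half of \<open>weakly_CR\<close>. Weyl's lemma then
  makes the conjugate field holomorphic, and convexity of the disk gives it a primitive.\<close>

lemma harmonic_field_holomorphic:
  assumes "has_weak_gradient disk u g" "\<And>\<phi>. \<phi> \<in> test_functions disk \<Longrightarrow> (\<integral>z. g z \<bullet> grad \<phi> z \<partial>MD) = 0"
  obtains f where "f holomorphic_on disk" "AE z in MD. g z = cnj (deriv f z)"
proof -
  have "weakly_CR g"
    using assms weak_gradient_curl_free[OF assms(1)] by (auto simp: weakly_CR_def weak_gradient_iff)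
  then obtain F where F: "F holomorphic_on disk" "AE z in MD. g z = cnj (F z)" by (rule weyl_lemma)
  obtain f where f: "\<And>x. x \<in> disk \<Longrightarrow> (f has_field_derivative F x) (at x within disk)"
    using holomorphic_convex_primitive'[OF _ _ F(1)] by auto
  have d: "(f has_field_derivative F x) (at x)" if "x \<in> disk" for x
    using f[OF that] at_within_open[OF that open_ball] by simp
  have "f holomorphic_on disk" using f unfolding holomorphic_on_def field_differentiable_def by blast
  moreover have "AE z in MD. z \<in> disk" using AE_space[of MD] by simp
  with F(2) have "AE z in MD. g z = cnj (deriv f z)" by eventually_elim (simp add: DERIV_imp_deriv[OF d])
  ultimately show ?thesis using that by blast
qed

lemma AE_MD_continuous_eq_0:
  fixes f :: "complex \<Rightarrow> real"
  assumes "continuous_on disk f" "AE z in MD. f z = 0" "z \<in> disk"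
  shows "f z = 0"
proof (rule ccontr)
  assume nz: "f z \<noteq> 0"
  define U where "U = {x \<in> disk. f x \<in> - {0}}"
  have "openin (top_of_set disk) (disk \<inter> f -` (- {0}))"
    using assms(1) by (rule continuous_openin_preimage_gen) auto
  then have U: "open U" by (simp add: U_def vimage_def Int_def openin_open_eq)
  have "AE z in lebesgue. z \<in> disk \<longrightarrow> f z = 0" using assms(2) by (subst (asm) AE_restrict_space_iff) auto
  then have "AE z in lebesgue. z \<notin> U" by (rule eventually_mono) (auto simp: U_def)
  then have "U \<in> null_sets lebesgue" using U by (subst AE_iff_null_sets) auto
  then have "negligible U" by (simp add: negligible_iff_null_sets)
  moreover have "z \<in> U" using nz assms(3) by (simp add: U_def)
  ultimately show False using open_not_negligible[OF U] by blast
qed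

text \<open>Read as a complex field, a real function with vanishing weak gradient satisfies
  \<open>weakly_CR\<close>; so it agrees with a holomorphic function that is real almost everywhere,
  by continuity everywhere, and hence constant.\<close>

lemma weak_gradient_0_const:
  assumes "has_weak_gradient disk u g" "AE z in MD. g z = 0"
  obtains c where "AE z in MD. u z = c"
proof -
  have L: "u \<in> L2_loc disk" "g \<in> L2_loc disk" using assms by (auto simp: weak_gradient_iff)
  have 0: "(\<integral>z. u z * (grad \<phi> z \<bullet> h) \<partial>MD) = 0" if \<phi>: "\<phi> \<in> test_functions disk" for \<phi> h
  proof -
    have "(\<integral>z. (g z \<bullet> h) * \<phi> z \<partial>MD) = (\<integral>z. 0 \<partial>MD)"
    proof (rule integral_cong_AE)
      show "(\<lambda>z. (g z \<bullet> h) * \<phi> z) \<in> borel_measurable MD"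
        using L continuous_borel_measurable_lebesgue_on[OF test_functionsD(3)[OF \<phi>]] by (auto simp: L2_loc_def)
      show "AE z in MD. (g z \<bullet> h) * \<phi> z = 0" using assms(2) by (rule eventually_mono) simp
    qed simp
    then show ?thesis using weak_gradientD[OF assms(1) \<phi>, of h] by simp
  qed
  have "weakly_CR (\<lambda>z. of_real (u z))"
    unfolding weakly_CR_def
  proof (intro conjI ballI)
    show "(\<lambda>z. complex_of_real (u z)) \<in> L2_loc disk" using L(1) by (auto simp: L2_loc_def)
    show "(\<integral>z. complex_of_real (u z) \<bullet> grad \<phi> z \<partial>MD) = 0" if "\<phi> \<in> test_functions disk" for \<phi>
      using 0[OF that, of 1] by (simp add: inner_complex_def)
    show "(\<integral>z. (\<i> * complex_of_real (u z)) \<bullet> grad \<phi> z \<partial>MD) = 0" if "\<phi> \<in> test_functions disk" for \<phi>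
      using 0[OF that, of \<i>] by (simp add: inner_complex_def)
  qed
  then obtain F where F: "F holomorphic_on disk" "AE z in MD. of_real (u z) = cnj (F z)" by (rule weyl_lemma)
  have "AE z in MD. Im (F z) = 0"
    using F(2)
  proof (rule eventually_mono)
    fix z assume "of_real (u z) = cnj (F z)"
    then have "Im (of_real (u z)) = Im (cnj (F z))" by (rule arg_cong)
    then show "Im (F z) = 0" by simp
  qed
  then have im: "Im (F z) = 0" if "z \<in> disk" for z
    using AE_MD_continuous_eq_0[of "\<lambda>z. Im (F z)"] that holomorphic_on_imp_continuous_on[OF F(1)] by (auto intro: continuous_intros)
  have "(F has_field_derivative 0) (at z within disk)" if z: "z \<in> disk" for z
  proof -
    have D: "(F has_field_derivative deriv F z) (at z)" by (rule holomorphic_derivI[OF F(1) _ z]) simp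
    have "((\<lambda>z. Im (F z)) has_derivative (\<lambda>h. Im (deriv F z * h))) (at z)"
      using has_derivative_Im[OF D[unfolded has_field_derivative_def]] .
    moreover have "((\<lambda>z. Im (F z)) has_derivative (\<lambda>h. 0)) (at z)"
      by (rule has_derivative_transform_within_open[of "\<lambda>_. 0" _ _ _ disk]) (use im z in auto)
    ultimately have "(\<lambda>h. Im (deriv F z * h)) = (\<lambda>h. 0)" by (rule has_derivative_unique)
    then have "Im (deriv F z * h) = 0" for h by metis
    from this[of 1] this[of \<i>] have "deriv F z = 0" by (simp add: complex_eq_iff)
    with D show ?thesis by (auto intro: has_field_derivative_at_within)
  qed
  then have "\<exists>c. \<forall>x\<in>disk. F x = c" by (intro has_field_derivative_zero_constant) auto
  then obtain c where c: "\<And>x. x \<in> disk \<Longrightarrow> F x = c" by auto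
  have "AE z in MD. z \<in> disk" using AE_space[of MD] by simp
  with F(2) have "AE z in MD. u z = Re c"
  proof eventually_elim
    case (elim z)
    then have "Re (of_real (u z)) = Re (cnj c)" using c by metis
    then show ?case by simp
  qed
  then show ?thesis using that by blast
qed

section \<open>The closure of the gradients of test functions\<close>

lemma grad_sqint: "\<phi> \<in> test_functions \<Omega> \<Longrightarrow> grad \<phi> \<in> sqint"
  using test_functions_bounded[of \<phi> \<Omega>] continuous_borel_measurable_lebesgue_on[OF continuous_grad[of \<phi> \<Omega>]]
  by (metis sqint_bounded AE_I2)

lemma test_sqint: "\<phi> \<in> test_functions \<Omega> \<Longrightarrow> \<phi> \<in> sqint"
  using test_functions_bounded[of \<phi> \<Omega>] continuous_borel_measurable_lebesgue_on[OF test_functionsD(3)[of \<phi> \<Omega>]]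
  by (metis sqint_bounded AE_I2 real_norm_def)

text \<open>The gradient fields of the elements of \<open>H10\<close> (see \<open>H10_cls\<close>).
  Fields instead of potentials turn every boundary condition into membership in one closed
  subspace.\<close>

definition G0 :: "(complex \<Rightarrow> complex) set" where
  "G0 = {d \<in> sqint. \<forall>e>0. \<exists>\<phi>\<in>test_functions disk. ip (\<lambda>z. d z - grad \<phi> z) (\<lambda>z. d z - grad \<phi> z) < e}"

lemma G0_sqint: "d \<in> G0 \<Longrightarrow> d \<in> sqint"
  by (simp add: G0_def)

lemma ip_zero_left [simp]: "ip (\<lambda>z. 0) f = 0"
  by (simp add: ip_def)

lemma G0_grad: "\<phi> \<in> test_functions disk \<Longrightarrow> grad \<phi> \<in> G0"
  unfolding G0_def by (auto intro!: grad_sqint bexI[of _ \<phi>])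

lemma G0_zero: "(\<lambda>z. 0) \<in> G0"
proof -
  have "grad (\<lambda>z. 0) = (\<lambda>z. 0)" by (rule ext, rule grad_eqI) simp
  then show ?thesis using G0_grad[OF test_functions_zero] by simp
qed

lemma G0_closed:
  assumes "d \<in> sqint" "\<And>e. e > 0 \<Longrightarrow> \<exists>d'\<in>G0. ip (\<lambda>z. d z - d' z) (\<lambda>z. d z - d' z) < e"
  shows "d \<in> G0"
  unfolding G0_def
proof safe
  fix e :: real assume e: "e > 0"
  then obtain d' where d': "d' \<in> G0" "ip (\<lambda>z. d z - d' z) (\<lambda>z. d z - d' z) < e / 4" using assms(2)[of "e / 4"] by auto
  then obtain \<phi> where \<phi>: "\<phi> \<in> test_functions disk" "ip (\<lambda>z. d' z - grad \<phi> z) (\<lambda>z. d' z - grad \<phi> z) < e / 4"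
    using e unfolding G0_def by (auto dest!: spec[of _ "e / 4"])
  have "ip (\<lambda>z. (d z - d' z) + (d' z - grad \<phi> z)) (\<lambda>z. (d z - d' z) + (d' z - grad \<phi> z))
      \<le> 2 * ip (\<lambda>z. d z - d' z) (\<lambda>z. d z - d' z) + 2 * ip (\<lambda>z. d' z - grad \<phi> z) (\<lambda>z. d' z - grad \<phi> z)"
    by (intro ip_triangle_sq sqint_diff assms(1) G0_sqint[OF d'(1)] grad_sqint[OF \<phi>(1)])
  then show "\<exists>\<phi>\<in>test_functions disk. ip (\<lambda>z. d z - grad \<phi> z) (\<lambda>z. d z - grad \<phi> z) < e"
    using d'(2) \<phi> by (intro bexI[of _ \<phi>]) auto
qed (use assms in auto)

lemma G0_add:
  assumes "c \<in> G0" "d \<in> G0" shows "(\<lambda>z. c z + d z) \<in> G0"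
  unfolding G0_def
proof safe
  fix e :: real assume e: "e > 0"
  then obtain \<phi> \<psi> where \<phi>: "\<phi> \<in> test_functions disk" "ip (\<lambda>z. c z - grad \<phi> z) (\<lambda>z. c z - grad \<phi> z) < e / 4"
    and \<psi>: "\<psi> \<in> test_functions disk" "ip (\<lambda>z. d z - grad \<psi> z) (\<lambda>z. d z - grad \<psi> z) < e / 4"
    using assms unfolding G0_def by (auto dest!: spec[of _ "e / 4"])
  have "ip (\<lambda>z. (c z - grad \<phi> z) + (d z - grad \<psi> z)) (\<lambda>z. (c z - grad \<phi> z) + (d z - grad \<psi> z))
      \<le> 2 * ip (\<lambda>z. c z - grad \<phi> z) (\<lambda>z. c z - grad \<phi> z) + 2 * ip (\<lambda>z. d z - grad \<psi> z) (\<lambda>z. d z - grad \<psi> z)"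
    by (intro ip_triangle_sq sqint_diff G0_sqint assms grad_sqint[OF \<phi>(1)] grad_sqint[OF \<psi>(1)])
  then show "\<exists>\<phi>\<in>test_functions disk. ip (\<lambda>z. c z + d z - grad \<phi> z) (\<lambda>z. c z + d z - grad \<phi> z) < e"
    using \<phi> \<psi> by (intro bexI[of _ "\<lambda>z. \<phi> z + \<psi> z"] test_functions_add) (auto simp: grad_add[OF \<phi>(1) \<psi>(1)] algebra_simps)
qed (use assms in \<open>auto intro: sqint_add G0_sqint\<close>)

lemma G0_scale:
  assumes "d \<in> G0" shows "(\<lambda>z. c *\<^sub>R d z) \<in> G0"
  unfolding G0_def
proof safe
  fix e :: real assume e: "e > 0"
  then have "e / (c\<^sup>2 + 1) > 0" by (simp add: add_nonneg_pos)
  then obtain \<phi> where \<phi>: "\<phi> \<in> test_functions disk" "ip (\<lambda>z. d z - grad \<phi> z) (\<lambda>z. d z - grad \<phi> z) < e / (c\<^sup>2 + 1)"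
    using assms unfolding G0_def by blast
  let ?I = "ip (\<lambda>z. d z - grad \<phi> z) (\<lambda>z. d z - grad \<phi> z)"
  have "ip (\<lambda>z. c *\<^sub>R (d z - grad \<phi> z)) (\<lambda>z. c *\<^sub>R (d z - grad \<phi> z)) = c\<^sup>2 * ?I"
    by (simp add: ip_scaleR_left ip_scaleR_right power2_eq_square)
  also have "\<dots> \<le> (c\<^sup>2 + 1) * ?I" using ip_self_nonneg by (intro mult_right_mono) auto
  also have "\<dots> < e" using \<phi>(2) by (simp add: pos_less_divide_eq add_nonneg_pos mult.commute)
  finally show "\<exists>\<phi>\<in>test_functions disk. ip (\<lambda>z. c *\<^sub>R d z - grad \<phi> z) (\<lambda>z. c *\<^sub>R d z - grad \<phi> z) < e"
    using \<phi> by (intro bexI[of _ "\<lambda>z. c * \<phi> z"] test_functions_cmult) (auto simp: grad_cmult[OF \<phi>(1)] scaleR_diff_right)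
qed (use assms in \<open>auto intro: sqint_scaleR G0_sqint\<close>)

lemma G0_diff: "c \<in> G0 \<Longrightarrow> d \<in> G0 \<Longrightarrow> (\<lambda>z. c z - d z) \<in> G0"
  using G0_add[OF _ G0_scale[of d "-1"], of c] by simp

lemma ip_self_cong_AE:
  assumes "f \<in> borel_measurable MD" "g \<in> borel_measurable MD" "AE z in MD. f z = g z"
  shows "ip f f = ip g g"
  by (rule ip_cong_AE) (use assms in auto)

lemma G0_cong_AE:
  assumes "d \<in> G0" "g \<in> borel_measurable MD" "AE z in MD. g z = d z"
  shows "g \<in> G0"
proof (rule G0_closed)
  show g: "g \<in> sqint"
    by (rule sqintI_bound[OF assms(2) sqint_integrable[OF G0_sqint[OF assms(1)]]])
       (use assms(3) in \<open>auto elim: eventually_mono\<close>)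
  fix e :: real assume "e > 0"
  have "ip (\<lambda>z. g z - d z) (\<lambda>z. g z - d z) = 0"
    using assms(3) by (subst ip_self_eq_0_iff[OF sqint_diff[OF g G0_sqint[OF assms(1)]]]) (auto elim: eventually_mono)
  with \<open>e > 0\<close> have "ip (\<lambda>z. g z - d z) (\<lambda>z. g z - d z) < e" by (simp only:)
  with assms(1) show "\<exists>d'\<in>G0. ip (\<lambda>z. g z - d' z) (\<lambda>z. g z - d' z) < e" by blast
qed

lemma small_ip_imp_eq:
  assumes "p \<in> sqint" "f \<in> sqint" "\<And>e. e > 0 \<Longrightarrow> \<exists>g\<in>sqint. ip p g = c \<and> ip (\<lambda>z. f z - g z) (\<lambda>z. f z - g z) < e"
  shows "ip p f = c"
proof (rule ccontr)
  assume "ip p f \<noteq> c"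
  define t where "t = (ip p f - c)\<^sup>2"
  have t: "t > 0" using \<open>ip p f \<noteq> c\<close> by (simp add: t_def)
  have pp: "ip p p + 1 > 0" using ip_self_nonneg[of p] by linarith
  then obtain g where g: "g \<in> sqint" "ip p g = c" "ip (\<lambda>z. f z - g z) (\<lambda>z. f z - g z) < t / (ip p p + 1)"
    using assms(3)[of "t / (ip p p + 1)"] t by auto
  have "t = (ip p (\<lambda>z. f z - g z))\<^sup>2" using assms g by (simp add: t_def ip_diff_right)
  also have "\<dots> \<le> ip p p * ip (\<lambda>z. f z - g z) (\<lambda>z. f z - g z)" by (intro ip_CS assms sqint_diff g)
  also have "\<dots> \<le> (ip p p + 1) * ip (\<lambda>z. f z - g z) (\<lambda>z. f z - g z)" using ip_self_nonneg by (intro mult_right_mono) auto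
  also have "\<dots> < t" using g(3) pp by (simp add: pos_less_divide_eq mult.commute)
  finally show False by simp
qed

lemma G0_orthogonal:
  assumes "p \<in> sqint" "\<And>\<phi>. \<phi> \<in> test_functions disk \<Longrightarrow> ip p (grad \<phi>) = 0" "d \<in> G0"
  shows "ip p d = 0"
proof (rule small_ip_imp_eq[OF assms(1) G0_sqint[OF assms(3)]])
  fix e :: real assume "e > 0"
  then obtain \<phi> where "\<phi> \<in> test_functions disk" "ip (\<lambda>z. d z - grad \<phi> z) (\<lambda>z. d z - grad \<phi> z) < e"
    using assms(3) unfolding G0_def by blast
  then show "\<exists>g\<in>sqint. ip p g = 0 \<and> ip (\<lambda>z. d z - g z) (\<lambda>z. d z - g z) < e"
    using assms(2) grad_sqint by blast
qed

text \<open>Integration by parts against the coordinate \<open>Re z\<close>, whose derivative in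
  direction 1 is 1, writes the integral of the square of \<open>\<phi>\<close> as -2 times that of
  \<open>Re z\<close> times \<open>\<phi>\<close> times its derivative. Since \<open>Re z\<close> is
  at most 1 in modulus, Cauchy-Schwarz gives the constant 4.\<close>

lemma poincare:
  assumes \<phi>: "\<phi> \<in> test_functions disk"
  shows "ip \<phi> \<phi> \<le> 4 * ip (grad \<phi>) (grad \<phi>)"
proof -
  define u where "u z = Re z * \<phi> z" for z
  have Ck_Re: "Ck n Re" for n by (rule Ck_bounded_linear[OF bounded_linear_Re])
  have u: "u \<in> test_functions disk" unfolding u_def by (rule test_functions_mult[OF \<phi> Ck_Re])
  have gu: "grad u z = Re z *\<^sub>R grad \<phi> z + \<phi> z *\<^sub>R 1" for z
  proof (rule grad_eqI)
    show "(u has_derivative (\<lambda>h. (Re z *\<^sub>R grad \<phi> z + \<phi> z *\<^sub>R 1) \<bullet> h)) (at z)"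
      unfolding u_def
      by (rule has_derivative_eq_rhs, rule has_derivative_mult[OF bounded_linear_imp_has_derivative[OF bounded_linear_Re] test_functionsD(4)[OF \<phi>]])
         (simp add: fun_eq_iff inner_add_left inner_complex_def[of 1])
  qed
  have p: "(\<lambda>z. grad \<phi> z \<bullet> 1) \<in> sqint" using test_sqint[OF test_functions_grad[OF \<phi>]] .
  have q: "u \<in> sqint" "\<phi> \<in> sqint" using test_sqint u \<phi> by auto
  have "ip u (\<lambda>z. grad \<phi> z \<bullet> 1) = - (\<integral>z. (grad u z \<bullet> 1) * \<phi> z \<partial>MD)"
    using weak_gradientD[OF test_weak_gradient[OF u] \<phi>, of 1] by (simp add: ip_def)
  also have "(\<integral>z. (grad u z \<bullet> 1) * \<phi> z \<partial>MD) = (\<integral>z. u z * (grad \<phi> z \<bullet> 1) + \<phi> z * \<phi> z \<partial>MD)"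
    by (rule Bochner_Integration.integral_cong) (auto simp: gu inner_add_left u_def algebra_simps inner_complex_def[of 1])
  also have "\<dots> = ip u (\<lambda>z. grad \<phi> z \<bullet> 1) + ip \<phi> \<phi>"
    using ip_integrable[OF q(1) p] ip_integrable[OF q(2) q(2)] by (simp add: ip_def)
  finally have eq: "ip \<phi> \<phi> = - 2 * ip u (\<lambda>z. grad \<phi> z \<bullet> 1)" by simp
  have uu: "ip u u \<le> ip \<phi> \<phi>"
    unfolding ip_self
  proof (rule integral_mono_AE)
    have "AE z in MD. z \<in> disk" using AE_space[of MD] by simp
    then show "AE z in MD. (norm (u z))\<^sup>2 \<le> (norm (\<phi> z))\<^sup>2"
    proof (rule eventually_mono)
      fix z :: complex assume "z \<in> disk"
      then have "\<bar>Re z\<bar> \<le> 1" using abs_Re_le_cmod[of z] by simp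
      then have "\<bar>u z\<bar> \<le> \<bar>\<phi> z\<bar>" by (simp add: u_def abs_mult mult_left_le_one_le)
      then show "(norm (u z))\<^sup>2 \<le> (norm (\<phi> z))\<^sup>2" by (simp add: abs_le_square_iff)
    qed
  qed (use sqint_integrable[OF q(1)] sqint_integrable[OF q(2)] in auto)
  have gg: "ip (\<lambda>z. grad \<phi> z \<bullet> 1) (\<lambda>z. grad \<phi> z \<bullet> 1) \<le> ip (grad \<phi>) (grad \<phi>)"
    unfolding ip_self
  proof (rule integral_mono)
    show "(norm (grad \<phi> z \<bullet> 1))\<^sup>2 \<le> (norm (grad \<phi> z))\<^sup>2" for z
      using Cauchy_Schwarz_ineq2[of "grad \<phi> z" 1] by (intro power_mono) auto
  qed (use sqint_integrable[OF p] sqint_integrable[OF grad_sqint[OF \<phi>]] in auto)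
  have "(ip \<phi> \<phi>)\<^sup>2 = 4 * (ip u (\<lambda>z. grad \<phi> z \<bullet> 1))\<^sup>2" by (simp add: eq power2_eq_square)
  also have "\<dots> \<le> 4 * (ip u u * ip (\<lambda>z. grad \<phi> z \<bullet> 1) (\<lambda>z. grad \<phi> z \<bullet> 1))" using ip_CS[OF q(1) p] by simp
  also have "\<dots> \<le> 4 * (ip \<phi> \<phi> * ip (grad \<phi>) (grad \<phi>))"
    using uu gg ip_self_nonneg by (intro mult_left_mono mult_mono) auto
  finally have "ip \<phi> \<phi> * ip \<phi> \<phi> \<le> ip \<phi> \<phi> * (4 * ip (grad \<phi>) (grad \<phi>))" by (simp add: power2_eq_square)
  then show ?thesis
    using ip_self_nonneg[of \<phi>] ip_self_nonneg[of "grad \<phi>"] by (cases "ip \<phi> \<phi> = 0") (auto simp: mult_le_cancel_left)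
qed

text \<open>A limit of gradients is a gradient: the Poincare inequality makes the potentials Cauchy
  along with their gradients, and both sides of the weak equation pass to the limit.\<close>

lemma G0_weak_gradient:
  assumes d: "d \<in> G0"
  obtains w where "w \<in> sqint" "has_weak_gradient disk w d"
proof -
  \<comment> \<open>The 16 absorbs the Poincare constant 4 and the constants 2 + 2 of the squared
    triangle inequality, leaving exactly the rate asked for by
    \<open>sqint_complete\<close>.\<close>
  have "\<forall>n. \<exists>\<phi>\<in>test_functions disk. ip (\<lambda>z. d z - grad \<phi> z) (\<lambda>z. d z - grad \<phi> z) < (1 / 4) ^ n / 16"
  proof
    fix n :: nat
    have "(1 / 4 :: real) ^ n / 16 > 0" by simp
    then show "\<exists>\<phi>\<in>test_functions disk. ip (\<lambda>z. d z - grad \<phi> z) (\<lambda>z. d z - grad \<phi> z) < (1 / 4) ^ n / 16"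
      using d unfolding G0_def by blast
  qed
  then obtain \<phi> where \<phi>: "\<And>n. \<phi> n \<in> test_functions disk"
    and lim: "\<And>n. ip (\<lambda>z. d z - grad (\<phi> n) z) (\<lambda>z. d z - grad (\<phi> n) z) < (1 / 4) ^ n / 16" by metis
  have ds: "d \<in> sqint" using d by (rule G0_sqint)
  have flip: "ip (\<lambda>z. f z - g z) (\<lambda>z. f z - g z) = ip (\<lambda>z. g z - f z) (\<lambda>z. g z - f z)" for f g :: "complex \<Rightarrow> complex"
    by (simp add: ip_self norm_minus_commute)
  have dif: "(\<lambda>z. \<phi> m z - \<phi> n z) \<in> test_functions disk" for m n
    using test_functions_add[OF \<phi>[of m] test_functions_cmult[OF \<phi>[of n], of "-1"]] by simp
  have gdif: "grad (\<lambda>z. \<phi> m z - \<phi> n z) = (\<lambda>z. grad (\<phi> m) z - grad (\<phi> n) z)" for m n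
    using grad_add[OF \<phi>[of m] test_functions_cmult[OF \<phi>[of n], of "-1"]] grad_cmult[OF \<phi>[of n], of "-1"]
    by (intro ext) simp
  obtain w where w: "w \<in> sqint" "\<And>n. ip (\<lambda>z. \<phi> n z - w z) (\<lambda>z. \<phi> n z - w z) \<le> (1 / 4) ^ n"
  proof (rule sqint_complete[of \<phi>])
    show "\<phi> n \<in> sqint" for n using test_sqint[OF \<phi>] .
    fix m n :: nat assume mn: "n \<le> m"
    have "ip (\<lambda>z. \<phi> m z - \<phi> n z) (\<lambda>z. \<phi> m z - \<phi> n z) \<le> 4 * ip (\<lambda>z. grad (\<phi> m) z - grad (\<phi> n) z) (\<lambda>z. grad (\<phi> m) z - grad (\<phi> n) z)"
      using poincare[OF dif[of m n]] by (simp only: gdif)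
    also have "\<dots> \<le> 4 * (2 * ip (\<lambda>z. grad (\<phi> m) z - d z) (\<lambda>z. grad (\<phi> m) z - d z) + 2 * ip (\<lambda>z. grad (\<phi> n) z - d z) (\<lambda>z. grad (\<phi> n) z - d z))"
      by (intro mult_left_mono ip_triangle_sq_diff grad_sqint[OF \<phi>] ds) auto
    also have "\<dots> \<le> 4 * (2 * ((1 / 4) ^ m / 16) + 2 * ((1 / 4) ^ n / 16))"
      using lim[of m] lim[of n] by (simp only: flip[of _ d]) (intro mult_left_mono add_mono; simp)
    also have "(1 / 4 :: real) ^ m \<le> (1 / 4) ^ n" using mn by (intro power_decreasing) auto
    finally show "ip (\<lambda>z. \<phi> m z - \<phi> n z) (\<lambda>z. \<phi> m z - \<phi> n z) \<le> (1 / 4) ^ n" by simp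
  qed (use that in blast)
  have "has_weak_gradient disk w d"
    unfolding weak_gradient_iff
  proof (intro conjI ballI)
    fix \<psi> h assume \<psi>: "\<psi> \<in> test_functions disk" and "h \<in> (Basis :: complex set)"
    have gs: "(\<lambda>z. grad \<psi> z \<bullet> h) \<in> sqint" using test_sqint[OF test_functions_grad[OF \<psi>]] .
    have ph: "(\<lambda>z. \<psi> z *\<^sub>R h) \<in> sqint" using test_sqint[OF \<psi>] by (auto simp: sqint_def power_mult_distrib)
    have L: "(\<lambda>n. ip (\<lambda>z. grad \<psi> z \<bullet> h) (\<phi> n)) \<longlonglongrightarrow> ip (\<lambda>z. grad \<psi> z \<bullet> h) w"
      and R: "(\<lambda>n. ip (\<lambda>z. \<psi> z *\<^sub>R h) (grad (\<phi> n))) \<longlonglongrightarrow> ip (\<lambda>z. \<psi> z *\<^sub>R h) d"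
    proof -
      have conv: "(\<lambda>n. ip p (f n)) \<longlonglongrightarrow> ip p g" if "p \<in> sqint" "g \<in> sqint" "\<And>n. f n \<in> sqint"
        "\<And>n. ip (\<lambda>z. f n z - g z) (\<lambda>z. f n z - g z) \<le> (1 / 4) ^ n"
        for p g and f :: "nat \<Rightarrow> complex \<Rightarrow> 'c::euclidean_space"
      proof -
        have "norm (ip p (f n) - ip p g) \<le> sqrt (ip p p) * (1 / 2) ^ n" for n
        proof -
          have "(ip p (f n) - ip p g)\<^sup>2 = (ip p (\<lambda>z. f n z - g z))\<^sup>2" using that by (simp add: ip_diff_right)
          also have "\<dots> \<le> ip p p * ip (\<lambda>z. f n z - g z) (\<lambda>z. f n z - g z)" by (intro ip_CS sqint_diff that)
          also have "\<dots> \<le> ip p p * (1 / 4) ^ n" using that(4) ip_self_nonneg by (intro mult_left_mono) auto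
          finally have "\<bar>ip p (f n) - ip p g\<bar> \<le> sqrt (ip p p * (1 / 4) ^ n)" using real_le_rsqrt[of "\<bar>ip p (f n) - ip p g\<bar>"] by simp
          also have "\<dots> = sqrt (ip p p) * (1 / 2) ^ n"
          proof -
            have "(1 / 4 :: real) ^ n = ((1 / 2) ^ n)\<^sup>2" by (simp add: power2_eq_square flip: power_mult_distrib)
            then show ?thesis by (simp add: real_sqrt_mult)
          qed
          finally show ?thesis by simp
        qed
        then have b: "\<forall>\<^sub>F n in sequentially. norm (ip p (f n) - ip p g) \<le> sqrt (ip p p) * (1 / 2) ^ n" by simp
        have "(\<lambda>n. sqrt (ip p p) * (1 / 2) ^ n) \<longlonglongrightarrow> 0"
          by (intro tendsto_mult_right_zero LIMSEQ_power_zero) simp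
        with b have "(\<lambda>n. ip p (f n) - ip p g) \<longlonglongrightarrow> 0" by (rule Lim_null_comparison)
        then show ?thesis by (rule LIM_zero_cancel)
      qed
      show "(\<lambda>n. ip (\<lambda>z. grad \<psi> z \<bullet> h) (\<phi> n)) \<longlonglongrightarrow> ip (\<lambda>z. grad \<psi> z \<bullet> h) w"
        by (rule conv[OF gs w(1) test_sqint[OF \<phi>] w(2)])
      show "(\<lambda>n. ip (\<lambda>z. \<psi> z *\<^sub>R h) (grad (\<phi> n))) \<longlonglongrightarrow> ip (\<lambda>z. \<psi> z *\<^sub>R h) d"
      proof (rule conv[OF ph ds grad_sqint[OF \<phi>]])
        fix n show "ip (\<lambda>z. grad (\<phi> n) z - d z) (\<lambda>z. grad (\<phi> n) z - d z) \<le> (1 / 4) ^ n"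
        proof -
          have "(1 / 4 :: real) ^ n / 16 \<le> (1 / 4) ^ n" by simp
          then show ?thesis using lim[of n] unfolding flip[of "grad (\<phi> n)" d] by linarith
        qed
      qed
    qed
    have "ip (\<lambda>z. grad \<psi> z \<bullet> h) (\<phi> n) = - ip (\<lambda>z. \<psi> z *\<^sub>R h) (grad (\<phi> n))" for n
      using weak_gradientD[OF test_weak_gradient[OF \<phi>[of n]] \<psi>, of h]
      by (simp add: ip_def mult.commute inner_commute)
    then have "(\<lambda>n. - ip (\<lambda>z. \<psi> z *\<^sub>R h) (grad (\<phi> n))) \<longlonglongrightarrow> ip (\<lambda>z. grad \<psi> z \<bullet> h) w" using L by simp
    with tendsto_minus[OF R] have "ip (\<lambda>z. grad \<psi> z \<bullet> h) w = - ip (\<lambda>z. \<psi> z *\<^sub>R h) d" by (rule LIMSEQ_unique[symmetric])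
    then show "(\<integral>z. w z * (grad \<psi> z \<bullet> h) \<partial>MD) = - (\<integral>z. (d z \<bullet> h) * \<psi> z \<partial>MD)"
      by (simp add: ip_def mult.commute inner_commute)
  qed (use sqint_L2_loc w(1) ds in auto)
  then show ?thesis using that w(1) by blast
qed

section \<open>Existence of weak solutions\<close>

definition ipg :: "(complex \<Rightarrow> real) \<Rightarrow> (complex \<Rightarrow> complex) \<Rightarrow> (complex \<Rightarrow> complex) \<Rightarrow> real" where
  "ipg \<gamma> f g = ip (\<lambda>z. \<gamma> z *\<^sub>R f z) g"

definition conductivity :: "real \<Rightarrow> (complex \<Rightarrow> real) \<Rightarrow> bool" where
  "conductivity K \<gamma> \<longleftrightarrow> \<gamma> \<in> borel_measurable MD \<and> (AE z in MD. inverse K \<le> \<gamma> z \<and> \<gamma> z \<le> K) \<and> K \<ge> 1"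

lemma conductivity_sqint:
  assumes "conductivity K \<gamma>" "f \<in> sqint" shows "(\<lambda>z. \<gamma> z *\<^sub>R f z) \<in> sqint"
proof (rule sqint_mult[OF assms(2), where K=K])
  have "0 < inverse K" using assms(1) by (simp add: conductivity_def)
  moreover have "AE z in MD. inverse K \<le> \<gamma> z \<and> \<gamma> z \<le> K" using assms by (simp add: conductivity_def)
  ultimately show "AE z in MD. \<bar>\<gamma> z\<bar> \<le> K" by (elim eventually_mono) linarith
qed (use assms in \<open>auto simp: conductivity_def\<close>)

lemma ipg_commute: "ipg \<gamma> f g = ipg \<gamma> g f"
  by (simp add: ipg_def ip_def inner_commute)

lemma ipg_add_left:
  "conductivity K \<gamma> \<Longrightarrow> f \<in> sqint \<Longrightarrow> g \<in> sqint \<Longrightarrow> h \<in> sqint \<Longrightarrow> ipg \<gamma> (\<lambda>z. f z + g z) h = ipg \<gamma> f h + ipg \<gamma> g h"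
  unfolding ipg_def scaleR_add_right by (intro ip_add_left conductivity_sqint)

lemma ipg_scale_left: "ipg \<gamma> (\<lambda>z. c *\<^sub>R f z) h = c * ipg \<gamma> f h"
  unfolding ipg_def using ip_scaleR_left[of c "\<lambda>z. \<gamma> z *\<^sub>R f z" h] by (simp add: mult.commute)

lemma ipg_add_right:
  "conductivity K \<gamma> \<Longrightarrow> f \<in> sqint \<Longrightarrow> g \<in> sqint \<Longrightarrow> h \<in> sqint \<Longrightarrow> ipg \<gamma> h (\<lambda>z. f z + g z) = ipg \<gamma> h f + ipg \<gamma> h g"
  using ipg_add_left[of K \<gamma> f g h] by (simp only: ipg_commute[of \<gamma> h])

lemma ipg_scale_right: "ipg \<gamma> h (\<lambda>z. c *\<^sub>R f z) = c * ipg \<gamma> h f"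
  using ipg_scale_left[of \<gamma> c f h] by (simp only: ipg_commute[of \<gamma> h])

lemma ipg_diff_left:
  "conductivity K \<gamma> \<Longrightarrow> f \<in> sqint \<Longrightarrow> g \<in> sqint \<Longrightarrow> h \<in> sqint \<Longrightarrow> ipg \<gamma> (\<lambda>z. f z - g z) h = ipg \<gamma> f h - ipg \<gamma> g h"
  unfolding ipg_def scaleR_diff_right by (intro ip_diff_left conductivity_sqint)

lemma ipg_diff_right:
  "conductivity K \<gamma> \<Longrightarrow> f \<in> sqint \<Longrightarrow> g \<in> sqint \<Longrightarrow> h \<in> sqint \<Longrightarrow> ipg \<gamma> h (\<lambda>z. f z - g z) = ipg \<gamma> h f - ipg \<gamma> h g"
  using ipg_diff_left[of K \<gamma> f g h] by (simp only: ipg_commute[of \<gamma> h])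

lemma ipg_mono:
  assumes "conductivity K \<gamma>" "conductivity K \<gamma>'" "AE z in MD. \<gamma> z \<le> \<gamma>' z" "f \<in> sqint"
  shows "ipg \<gamma> f f \<le> ipg \<gamma>' f f"
  unfolding ipg_def ip_def
proof (rule integral_mono_AE)
  show "AE z in MD. \<gamma> z *\<^sub>R f z \<bullet> f z \<le> \<gamma>' z *\<^sub>R f z \<bullet> f z"
    using assms(3) by (rule eventually_mono) (simp add: mult_right_mono)
qed (rule ip_integrable[OF conductivity_sqint[OF assms(1,4)] assms(4)] ip_integrable[OF conductivity_sqint[OF assms(2,4)] assms(4)])+

lemma ipg_const: "ipg (\<lambda>z. c) f g = c * ip f g"
  by (simp add: ipg_def ip_scaleR_left)

lemma conductivity_const: "K \<ge> 1 \<Longrightarrow> inverse K \<le> c \<Longrightarrow> c \<le> K \<Longrightarrow> conductivity K (\<lambda>z. c)"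
  by (simp add: conductivity_def)

lemma ipg_lower:
  assumes "conductivity K \<gamma>" "f \<in> sqint" shows "inverse K * ip f f \<le> ipg \<gamma> f f"
proof -
  have K: "K \<ge> 1" using assms by (simp add: conductivity_def)
  have "inverse K \<le> K" using K by (meson inverse_le_1_iff order_trans)
  then have "conductivity K (\<lambda>z. inverse K)" using K by (intro conductivity_const) auto
  moreover have "AE z in MD. inverse K \<le> \<gamma> z" using assms(1) by (auto simp: conductivity_def elim: eventually_mono)
  ultimately have "ipg (\<lambda>z. inverse K) f f \<le> ipg \<gamma> f f" using ipg_mono assms by blast
  then show ?thesis by (simp add: ipg_const)
qed

text \<open>Direct method: minimise the energy on the affine space of \<open>g\<close> plus
  \<open>G0\<close>. Convexity makes a minimising sequence Cauchy, closedness keeps its limit in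
  \<open>G0\<close>, and the first variation there is the weak equation.\<close>

lemma solution_exists:
  assumes \<gamma>: "conductivity K \<gamma>" and g: "g \<in> sqint"
  obtains d where "d \<in> G0" "\<And>w. w \<in> G0 \<Longrightarrow> ipg \<gamma> (\<lambda>z. g z + d z) w = 0"
proof -
  have K: "K \<ge> 1" using \<gamma> by (simp add: conductivity_def)
  define J where "J d = ipg \<gamma> (\<lambda>z. g z + d z) (\<lambda>z. g z + d z)" for d
  have pos: "ipg \<gamma> f f \<ge> 0" if "f \<in> sqint" for f
    using ipg_lower[OF \<gamma> that] ip_self_nonneg[of f] K by (meson inverse_nonnegative_iff_nonnegative mult_nonneg_nonneg order_trans zero_le_one)
  have Jpos: "J d \<ge> 0" if "d \<in> G0" for d unfolding J_def using that by (intro pos sqint_add g G0_sqint)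
  define m where "m = Inf (J ` G0)"
  have bdd: "bdd_below (J ` G0)" using Jpos by (auto intro!: bdd_belowI[of _ 0])
  have m: "m \<le> J d" if "d \<in> G0" for d unfolding m_def using that bdd by (intro cInf_lower) auto
  \<comment> \<open>The midpoint argument costs a factor 4 and the ellipticity bound a factor
    \<open>K\<close>; with this tolerance the minimising sequence has the rate
    \<open>(1 / 4) ^ n\<close>.\<close>
  define e where "e n = (1 / 4) ^ n / (4 * K)" for n :: nat
  have e: "e n > 0" for n using K by (simp add: e_def)
  have "\<exists>d\<in>G0. J d < m + e n" for n
  proof -
    have "Inf (J ` G0) < m + e n" using e[of n] by (simp add: m_def)
    then show ?thesis using cInf_lessD[of "J ` G0" "m + e n"] G0_zero by blast
  qed
  then obtain d where d: "\<And>n. d n \<in> G0" "\<And>n. J (d n) < m + e n" by metis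
  have ds: "d n \<in> sqint" for n using d(1) by (rule G0_sqint)
  have expand: "J (\<lambda>z. a z + t *\<^sub>R b z) = J a + 2 * t * ipg \<gamma> (\<lambda>z. g z + a z) b + t\<^sup>2 * ipg \<gamma> b b"
    if "a \<in> sqint" "b \<in> sqint" for a b t
  proof -
    have s: "(\<lambda>z. g z + a z) \<in> sqint" "(\<lambda>z. t *\<^sub>R b z) \<in> sqint" using that g by (auto intro: sqint_add sqint_scaleR)
    have "J (\<lambda>z. a z + t *\<^sub>R b z) = ipg \<gamma> (\<lambda>z. (g z + a z) + t *\<^sub>R b z) (\<lambda>z. (g z + a z) + t *\<^sub>R b z)"
      by (simp add: J_def add.assoc)
    also have "\<dots> = J a + 2 * t * ipg \<gamma> (\<lambda>z. g z + a z) b + t\<^sup>2 * ipg \<gamma> b b"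
      using ipg_add_left[OF \<gamma> s sqint_add[OF s]] ipg_add_right[OF \<gamma> s s(1)] ipg_add_right[OF \<gamma> s s(2)]
      unfolding ipg_scale_left ipg_scale_right J_def ipg_commute[of \<gamma> b "\<lambda>z. g z + a z"] power2_eq_square
      by (simp add: algebra_simps)
    finally show ?thesis .
  qed
  obtain d' where d': "d' \<in> sqint" "\<And>n. ip (\<lambda>z. d n z - d' z) (\<lambda>z. d n z - d' z) \<le> (1 / 4) ^ n"
  proof (rule sqint_complete[of d])
    fix k n :: nat assume nk: "n \<le> k"
    define b where "b z = d k z - d n z" for z
    have b: "b \<in> sqint" "b \<in> G0" unfolding b_def using ds d(1) by (auto intro: sqint_diff G0_diff)
    have 1: "J (d k) = J (d n) + 2 * ipg \<gamma> (\<lambda>z. g z + d n z) b + ipg \<gamma> b b"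
      using expand[OF ds[of n] b(1), of 1] by (simp add: b_def)
    have 2: "J (\<lambda>z. d n z + (1 / 2) *\<^sub>R b z) = J (d n) + ipg \<gamma> (\<lambda>z. g z + d n z) b + ipg \<gamma> b b / 4"
      using expand[OF ds[of n] b(1), of "1 / 2"] by (simp add: power2_eq_square)
    have "m \<le> J (\<lambda>z. d n z + (1 / 2) *\<^sub>R b z)" by (intro m G0_add G0_scale d(1) b)
    then have "ipg \<gamma> b b \<le> 2 * J (d k) + 2 * J (d n) - 4 * m" using 1 2 by linarith
    also have "\<dots> \<le> 2 * e k + 2 * e n" using d(2)[of k] d(2)[of n] by linarith
    also have "e k \<le> e n" unfolding e_def using nk K by (intro divide_right_mono power_decreasing) auto
    finally have "ipg \<gamma> b b \<le> (1 / 4) ^ n / K" by (simp add: e_def)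
    then have "inverse K * ip b b \<le> (1 / 4) ^ n / K" using ipg_lower[OF \<gamma> b(1)] by linarith
    then have "ip b b \<le> (1 / 4) ^ n" using K by (simp add: field_simps)
    then show "ip (\<lambda>z. d k z - d n z) (\<lambda>z. d k z - d n z) \<le> (1 / 4) ^ n" unfolding b_def .
  qed (use ds that in blast)+
  have flip: "ip (\<lambda>z. d' z - d n z) (\<lambda>z. d' z - d n z) \<le> (1 / 4) ^ n" for n
    using d'(2)[of n] by (simp add: ip_self norm_minus_commute)
  have p4: "\<exists>n. (1 / 4 :: real) ^ n < e" if "e > 0" for e using real_arch_pow_inv[OF that, of "1 / 4"] by simp
  have G: "d' \<in> G0"
  proof (rule G0_closed[OF d'(1)])
    fix e :: real assume "e > 0"
    then obtain n where "(1 / 4) ^ n < e" using p4 by blast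
    then show "\<exists>d''\<in>G0. ip (\<lambda>z. d' z - d'' z) (\<lambda>z. d' z - d'' z) < e" using flip[of n] d(1)[of n] by (intro bexI[of _ "d n"]) auto
  qed
  have "ipg \<gamma> (\<lambda>z. g z + d' z) w = 0" if w: "w \<in> G0" for w
  proof -
    have ws: "w \<in> sqint" using w by (rule G0_sqint)
    define W where "W = ipg \<gamma> w w"
    define L where "L = ipg \<gamma> (\<lambda>z. g z + d' z) w"
    have gw: "(\<lambda>z. \<gamma> z *\<^sub>R w z) \<in> sqint" using conductivity_sqint[OF \<gamma> ws] .
    \<comment> \<open>The variation is computed at the almost minimiser \<open>d n\<close>, so the
      inequality is obtained up to \<open>\<eta>\<close>: one half pays for the defect
      \<open>e n\<close>, the other for moving the linear term from \<open>d n\<close> to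
      \<open>d'\<close>.\<close>
    have "0 \<le> 2 * t * L + t\<^sup>2 * W" for t
    proof (rule field_le_epsilon)
      fix \<eta> :: real assume \<eta>: "\<eta> > 0"
      define c where "c = ip (\<lambda>z. \<gamma> z *\<^sub>R w z) (\<lambda>z. \<gamma> z *\<^sub>R w z)"
      have c: "c \<ge> 0" unfolding c_def by (rule ip_self_nonneg)
      have "min (\<eta> / 2) ((\<eta> / (4 * (\<bar>t\<bar> + 1)))\<^sup>2 / (c + 1)) > 0" using \<eta> c by (simp add: add_nonneg_pos)
      then obtain n where n: "(1 / 4) ^ n < min (\<eta> / 2) ((\<eta> / (4 * (\<bar>t\<bar> + 1)))\<^sup>2 / (c + 1))" using p4 by blast
      have "e n \<le> (1 / 4) ^ n" unfolding e_def using K by (simp add: field_simps)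
      then have en: "e n \<le> \<eta> / 2" using n by simp
      have "m \<le> J (\<lambda>z. d n z + t *\<^sub>R w z)" by (intro m G0_add G0_scale d(1) w)
      also have "\<dots> = J (d n) + 2 * t * ipg \<gamma> (\<lambda>z. g z + d n z) w + t\<^sup>2 * W" unfolding W_def by (rule expand[OF ds ws])
      finally have 1: "0 \<le> e n + 2 * t * ipg \<gamma> (\<lambda>z. g z + d n z) w + t\<^sup>2 * W" using d(2)[of n] by linarith
      have "ipg \<gamma> (\<lambda>z. g z + d n z) w - L = ipg \<gamma> (\<lambda>z. d n z - d' z) w"
        unfolding L_def using ipg_add_left[OF \<gamma> g ds[of n] ws] ipg_add_left[OF \<gamma> g d'(1) ws] ipg_diff_left[OF \<gamma> ds[of n] d'(1) ws] by linarith
      also have "\<dots> = ip (\<lambda>z. \<gamma> z *\<^sub>R w z) (\<lambda>z. d n z - d' z)" by (subst ipg_commute) (simp add: ipg_def)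
      finally have "(ipg \<gamma> (\<lambda>z. g z + d n z) w - L)\<^sup>2 \<le> c * ip (\<lambda>z. d n z - d' z) (\<lambda>z. d n z - d' z)"
        unfolding c_def using ip_CS[OF gw sqint_diff[OF ds[of n] d'(1)]] by simp
      also have "\<dots> \<le> (c + 1) * (1 / 4) ^ n" using d'(2)[of n] c ip_self_nonneg by (intro mult_mono) auto
      also have "\<dots> \<le> (\<eta> / (4 * (\<bar>t\<bar> + 1)))\<^sup>2" using n c by (simp add: pos_less_divide_eq add_nonneg_pos mult.commute less_imp_le)
      finally have "\<bar>ipg \<gamma> (\<lambda>z. g z + d n z) w - L\<bar> \<le> \<bar>\<eta> / (4 * (\<bar>t\<bar> + 1))\<bar>"
        by (simp only: abs_le_square_iff)
      then have a: "\<bar>ipg \<gamma> (\<lambda>z. g z + d n z) w - L\<bar> \<le> \<eta> / (4 * (\<bar>t\<bar> + 1))"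
        using \<eta> by simp
      have "2 * t * (ipg \<gamma> (\<lambda>z. g z + d n z) w - L) \<le> \<bar>2 * t * (ipg \<gamma> (\<lambda>z. g z + d n z) w - L)\<bar>" by (rule abs_ge_self)
      also have "\<dots> = 2 * \<bar>t\<bar> * \<bar>ipg \<gamma> (\<lambda>z. g z + d n z) w - L\<bar>" by (simp add: abs_mult)
      also have "\<dots> \<le> 2 * \<bar>t\<bar> * (\<eta> / (4 * (\<bar>t\<bar> + 1)))" by (intro mult_left_mono a) simp
      also have "\<dots> \<le> \<eta> / 2" using \<eta> by (simp add: field_simps)
      finally have "2 * t * ipg \<gamma> (\<lambda>z. g z + d n z) w \<le> 2 * t * L + \<eta> / 2" by (simp add: algebra_simps)
      then show "0 \<le> 2 * t * L + t\<^sup>2 * W + \<eta>" using 1 en by linarith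
    qed
    note q = this
    have W: "W \<ge> 0" unfolding W_def by (rule pos[OF ws])
    have "L = 0"
    proof (rule ccontr)
      assume "L \<noteq> 0"
      \<comment> \<open>Near the minimum of the quadratic; \<open>W + 1\<close> in place of
        \<open>W\<close> also covers \<open>W = 0\<close>.\<close>
      have "0 \<le> 2 * (- L / (W + 1)) * L + (- L / (W + 1))\<^sup>2 * W" by (rule q)
      also have "\<dots> = - (L\<^sup>2 / (W + 1)) * (2 - W / (W + 1))" by (simp add: divide_inverse power2_eq_square algebra_simps)
      also have "\<dots> < 0"
      proof -
        have "L\<^sup>2 / (W + 1) > 0" using W \<open>L \<noteq> 0\<close> by simp
        moreover have "2 - W / (W + 1) > 0" using W by (simp add: field_simps)
        ultimately have "L\<^sup>2 / (W + 1) * (2 - W / (W + 1)) > 0" by (rule mult_pos_pos)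
        then show ?thesis by (simp only: mult_minus_left neg_less_0_iff_less)
      qed
      finally show False by simp
    qed
    then show ?thesis by (simp add: L_def)
  qed
  with G show ?thesis using that by blast
qed

section \<open>Gluing harmonic functions across a circle\<close>

text \<open>The parameters are among the roots of a quadratic polynomial with leading coefficient
  \<open>(norm v)\<^sup>2\<close>.\<close>

lemma finite_line_sphere:
  assumes "v \<noteq> (0 :: complex)"
  shows "finite {t :: real. x + t *\<^sub>R v \<in> sphere c R}"
proof -
  let ?p = "[: (norm (x - c))\<^sup>2 - R\<^sup>2, 2 * ((x - c) \<bullet> v), (norm v)\<^sup>2 :]"
  have "{t. x + t *\<^sub>R v \<in> sphere c R} \<subseteq> {t. poly ?p t = 0}"
  proof safe
    fix t assume "x + t *\<^sub>R v \<in> sphere c R"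
    then have "(norm ((x - c) + t *\<^sub>R v))\<^sup>2 = R\<^sup>2" by (simp add: dist_norm norm_minus_commute algebra_simps)
    then show "poly ?p t = 0"
      unfolding power2_norm_eq_inner by (simp add: inner_add_left inner_add_right inner_commute algebra_simps power2_eq_square)
  qed
  moreover have "?p \<noteq> 0" using assms by simp
  ultimately show ?thesis using poly_roots_finite finite_subset by blast
qed

text \<open>The fundamental theorem of calculus along the segment from \<open>y\<close> to
  \<open>x\<close>: it meets the two circles in finitely many points, where continuity of
  \<open>w\<close> is enough.\<close>

lemma lipschitz_off_spheres:
  fixes w :: "complex \<Rightarrow> real"
  assumes cont: "continuous_on UNIV w"
    and der: "\<And>z. z \<notin> sphere c1 R1 \<Longrightarrow> z \<notin> sphere c2 R2 \<Longrightarrow> (w has_derivative (\<lambda>h. W z \<bullet> h)) (at z)"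
    and bnd: "\<And>z. norm (W z) \<le> C"
  shows "\<bar>w x - w y\<bar> \<le> C * norm (x - y)"
proof (cases "x = y")
  case False
  define v where "v = x - y"
  have v: "v \<noteq> 0" using False by (simp add: v_def)
  define S where "S = {t. y + t *\<^sub>R v \<in> sphere c1 R1} \<union> {t. y + t *\<^sub>R v \<in> sphere c2 R2}"
  have "finite S" unfolding S_def using finite_line_sphere[OF v] by simp
  have "((\<lambda>t. W (y + t *\<^sub>R v) \<bullet> v) has_integral (w (y + 1 *\<^sub>R v) - w (y + 0 *\<^sub>R v))) {0..1}"
  proof (rule fundamental_theorem_of_calculus_interior_strong[OF \<open>finite S\<close>])
    show "continuous_on {0..1} (\<lambda>t. w (y + t *\<^sub>R v))"
      by (intro continuous_on_compose2[OF cont] continuous_intros) auto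
    show "((\<lambda>t. w (y + t *\<^sub>R v)) has_vector_derivative W (y + t *\<^sub>R v) \<bullet> v) (at t)" if "t \<in> {0<..<1} - S" for t
    proof -
      have D: "(w has_derivative (\<lambda>h. W (y + t *\<^sub>R v) \<bullet> h)) (at (y + t *\<^sub>R v))"
        using that by (intro der) (auto simp: S_def)
      have "((\<lambda>t. w (y + t *\<^sub>R v)) has_derivative (\<lambda>s. W (y + t *\<^sub>R v) \<bullet> (s *\<^sub>R v))) (at t)"
        by (rule has_derivative_compose[of "\<lambda>t. y + t *\<^sub>R v" "\<lambda>s. s *\<^sub>R v", OF _ D]) (auto intro!: derivative_eq_intros)
      then show ?thesis by (simp add: has_vector_derivative_def)
    qed
  qed auto
  note I = this
  have "norm (w (y + 1 *\<^sub>R v) - w (y + 0 *\<^sub>R v)) \<le> (C * norm v) * measure lborel {0..1 :: real}"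
  proof (rule has_integral_bound_real[OF _ finite.emptyI])
    show "0 \<le> C * norm v" using order_trans[OF norm_ge_zero bnd] by simp
    show "norm (W (y + t *\<^sub>R v) \<bullet> v) \<le> C * norm v" for t
      using Cauchy_Schwarz_ineq2[of "W (y + t *\<^sub>R v)" v] mult_right_mono[OF bnd[of "y + t *\<^sub>R v"], of "norm v"] by simp
  qed (rule I)
  then show ?thesis by (simp add: v_def)
qed simp

lemma mollify_bounded:
  assumes "V \<in> borel_measurable lebesgue" "\<And>x. \<bar>V x\<bar> \<le> C" "\<epsilon> > 0"
  shows "integrable lebesgue (\<lambda>x. V x * kern \<epsilon> (z - x))"
proof (rule Bochner_Integration.integrable_bound)
  have [measurable]: "(\<lambda>x. kern \<epsilon> (x - z)) \<in> borel_measurable borel" using assms(3) by measurable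
  have "integrable lebesgue (\<lambda>x. kern \<epsilon> (x - z))"
    using kern_shift_integral(2)[OF assms(3)] by (simp add: integrable_completion)
  then show "integrable lebesgue (\<lambda>x. C * kern \<epsilon> (z - x))" by (simp add: kern_minus)
  show "(\<lambda>x. V x * kern \<epsilon> (z - x)) \<in> borel_measurable lebesgue"
    using assms(1) measurable_completion[of "\<lambda>x. kern \<epsilon> (x - z)" lborel borel] by (simp add: kern_minus)
  have "0 \<le> C" using assms(2)[of 0] by linarith
  then show "AE x in lebesgue. norm (V x * kern \<epsilon> (z - x)) \<le> norm (C * kern \<epsilon> (z - x))"
    using assms(2) by (intro always_eventually allI) (simp add: abs_mult mult_right_mono)
qed

lemma mollify_approx:
  assumes V: "V \<in> borel_measurable lebesgue" "\<And>x. \<bar>V x\<bar> \<le> C" "\<epsilon> > 0"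
    and near: "\<And>x. norm (x - z) < \<epsilon> \<Longrightarrow> \<bar>V x - y\<bar> \<le> \<eta>"
  shows "\<bar>(\<integral>x. V x * kern \<epsilon> (z - x) \<partial>lebesgue) / kern_mass - y\<bar> \<le> \<eta>"
proof -
  have [measurable]: "(\<lambda>x. kern \<epsilon> (x - z)) \<in> borel_measurable borel" using V(3) by measurable
  have k: "integrable lebesgue (\<lambda>x. kern \<epsilon> (z - x))" "(\<integral>x. kern \<epsilon> (z - x) \<partial>lebesgue) = kern_mass"
    using kern_shift_integral[OF V(3), of z] by (simp_all add: integrable_completion integral_completion kern_minus)
  have i: "integrable lebesgue (\<lambda>x. V x * kern \<epsilon> (z - x))" by (rule mollify_bounded[OF V])
  have "\<bar>\<integral>x. V x * kern \<epsilon> (z - x) - y * kern \<epsilon> (z - x) \<partial>lebesgue\<bar> \<le> (\<integral>x. \<bar>V x * kern \<epsilon> (z - x) - y * kern \<epsilon> (z - x)\<bar> \<partial>lebesgue)"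
    by (rule integral_abs_bound)
  also have "\<dots> \<le> (\<integral>x. \<eta> * kern \<epsilon> (z - x) \<partial>lebesgue)"
  proof (rule integral_mono)
    fix x
    show "\<bar>V x * kern \<epsilon> (z - x) - y * kern \<epsilon> (z - x)\<bar> \<le> \<eta> * kern \<epsilon> (z - x)"
    proof (cases "norm (x - z) < \<epsilon>")
      case True
      then show ?thesis using near[OF True] kern_nonneg[of \<epsilon> "z - x"]
        by (simp add: left_diff_distrib[symmetric] abs_mult mult_right_mono)
    next
      case False
      then show ?thesis using kern_eq_0[OF V(3), of "z - x"] by (simp add: norm_minus_commute)
    qed
  qed (use i k in auto)
  also have "(\<integral>x. V x * kern \<epsilon> (z - x) - y * kern \<epsilon> (z - x) \<partial>lebesgue) = (\<integral>x. V x * kern \<epsilon> (z - x) \<partial>lebesgue) - y * kern_mass"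
    using i k by simp
  finally have "\<bar>(\<integral>x. V x * kern \<epsilon> (z - x) \<partial>lebesgue) - y * kern_mass\<bar> \<le> \<eta> * kern_mass" using k by simp
  then have "\<bar>((\<integral>x. V x * kern \<epsilon> (z - x) \<partial>lebesgue) - y * kern_mass) / kern_mass\<bar> \<le> \<eta>"
    using kern_mass_pos by (simp add: pos_divide_le_eq abs_divide)
  then show ?thesis using kern_mass_pos by (simp add: diff_divide_distrib)
qed

text \<open>
  A Lipschitz function that vanishes outside the disk and is continuously differentiable off two
  circles: dilating by \<open>s < 1\<close> gives compact support in the disk, and mollifying gives test functions.
\<close>

lemma piecewise_C1_in_G0:
  fixes w :: "complex \<Rightarrow> real"
  assumes cont: "continuous_on UNIV w" and supp: "\<And>z. norm z \<ge> 1 \<Longrightarrow> w z = 0"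
    and der: "\<And>z. z \<notin> sphere c1 R1 \<Longrightarrow> z \<notin> sphere c2 R2 \<Longrightarrow> (w has_derivative (\<lambda>h. W z \<bullet> h)) (at z)"
    and bnd: "\<And>z. norm (W z) \<le> C"
    and contW: "\<And>z. z \<notin> sphere c1 R1 \<Longrightarrow> z \<notin> sphere c2 R2 \<Longrightarrow> isCont W z"
    and meas: "W \<in> borel_measurable borel"
  shows "W \<in> G0"
proof -
  have lip: "\<bar>w x - w y\<bar> \<le> C * norm (x - y)" for x y
    by (rule lipschitz_off_spheres[OF cont der bnd])
  have C: "C \<ge> 0" using order_trans[OF norm_ge_zero bnd] .
  have wb: "\<bar>w x\<bar> \<le> 2 * C" for x
  proof (cases "norm x \<ge> 1")
    case False
    then have "norm (x - 1) \<le> 2" using norm_triangle_ineq4[of x 1] by simp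
    then have "C * norm (x - 1) \<le> C * 2" using C by (rule mult_left_mono)
    then show ?thesis using lip[of x 1] supp[of 1] by simp
  qed (use supp C in simp)
  \<comment> \<open>Dilation puts the support into radius \<open>s n\<close>. As
    \<open>s n = 1 - 2 * e n\<close>, mollification at radius \<open>e n\<close> stays within radius
    \<open>s n + e n < 1\<close>.\<close>
  define s :: "nat \<Rightarrow> real" where "s n = 1 - 1 / (real n + 2)" for n
  define e :: "nat \<Rightarrow> real" where "e n = 1 / (2 * (real n + 2))" for n
  have se: "s n = 1 - 2 * e n" for n by (simp add: s_def e_def field_simps)
  have s: "s n \<ge> 1 / 2" "e n > 0" for n by (auto simp: s_def e_def field_simps)
  then have s: "s n \<ge> 1 / 2" "s n < 1" "e n > 0" "s n + e n < 1" for n using se[of n] s(1)[of n] s(2)[of n] by linarith+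
  have lims: "s \<longlonglongrightarrow> 1" "e \<longlonglongrightarrow> 0" unfolding s_def e_def by real_asymp+
  define W' where "W' n x = (1 / s n) *\<^sub>R W ((1 / s n) *\<^sub>R x)" for n x
  define w' where "w' n x = w ((1 / s n) *\<^sub>R x)" for n x
  have sn: "s n > 0" for n using s(1)[of n] by linarith
  have inv2: "1 / s n \<le> 2" for n using s(1)[of n] sn[of n] by (simp add: field_simps)
  have W'b: "norm (W' n x) \<le> 2 * C" for n x
  proof -
    have "norm (W' n x) = (1 / s n) * norm (W ((1 / s n) *\<^sub>R x))" using sn[of n] by (simp add: W'_def)
    also have "\<dots> \<le> 2 * C" using inv2[of n] sn[of n] bnd by (intro mult_mono) auto
    finally show ?thesis .
  qed
  have W'm: "W' n \<in> borel_measurable borel" for n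
    unfolding W'_def using measurable_compose[of "\<lambda>x. (1 / s n) *\<^sub>R x" borel borel W borel] meas by simp
  have W'ml: "(\<lambda>x. W' n x \<bullet> h) \<in> borel_measurable lebesgue" for n h
    using W'm[of n] by (intro measurable_completion) simp
  have w'c: "continuous_on UNIV (w' n)" for n
    unfolding w'_def by (intro continuous_on_compose2[OF cont] continuous_intros) auto
  have w'l: "\<bar>w' n x - w' n y\<bar> \<le> 2 * C * norm (x - y)" for n x y
  proof -
    have "\<bar>w' n x - w' n y\<bar> \<le> C * norm ((1 / s n) *\<^sub>R x - (1 / s n) *\<^sub>R y)" unfolding w'_def by (rule lip)
    also have "(1 / s n) *\<^sub>R x - (1 / s n) *\<^sub>R y = (1 / s n) *\<^sub>R (x - y)" by (simp add: scaleR_diff_right)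
    also have "C * norm ((1 / s n) *\<^sub>R (x - y)) = (1 / s n) * (C * norm (x - y))" using sn[of n] by simp
    also have "\<dots> \<le> 2 * (C * norm (x - y))" using inv2[of n] C by (intro mult_right_mono) auto
    finally show ?thesis by simp
  qed
  have w'0: "w' n x = 0" if "norm x \<ge> s n" for n x
    unfolding w'_def using that sn[of n] by (intro supp) (simp add: field_simps)
  have w'd: "AE x in lebesgue. (w' n has_derivative (\<lambda>h. W' n x \<bullet> h)) (at x)" for n
  proof -
    have "negligible (sphere (s n *\<^sub>R c1) (s n * R1) \<union> sphere (s n *\<^sub>R c2) (s n * R2))"
      by (intro negligible_Un negligible_sphere)
    then have "AE x in lebesgue. x \<notin> sphere (s n *\<^sub>R c1) (s n * R1) \<union> sphere (s n *\<^sub>R c2) (s n * R2)"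
      by (intro AE_not_in) (simp add: negligible_iff_null_sets)
    then show ?thesis
    proof (rule eventually_mono)
      fix x assume x: "x \<notin> sphere (s n *\<^sub>R c1) (s n * R1) \<union> sphere (s n *\<^sub>R c2) (s n * R2)"
      have sph: "(1 / s n) *\<^sub>R x \<notin> sphere c R" if "x \<notin> sphere (s n *\<^sub>R c) (s n * R)" for c R
      proof
        assume "(1 / s n) *\<^sub>R x \<in> sphere c R"
        then have "s n * norm (c - (1 / s n) *\<^sub>R x) = s n * R" by (simp add: dist_norm)
        moreover have "s n * norm (c - (1 / s n) *\<^sub>R x) = norm (s n *\<^sub>R (c - (1 / s n) *\<^sub>R x))" using sn[of n] by simp
        moreover have "s n *\<^sub>R (c - (1 / s n) *\<^sub>R x) = s n *\<^sub>R c - x" using sn[of n] by (simp add: scaleR_diff_right)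
        ultimately show False using that by (simp add: dist_norm)
      qed
      have D: "(w has_derivative (\<lambda>h. W ((1 / s n) *\<^sub>R x) \<bullet> h)) (at ((1 / s n) *\<^sub>R x))" using x sph by (intro der) auto
      have "((\<lambda>x. w ((1 / s n) *\<^sub>R x)) has_derivative (\<lambda>h. W ((1 / s n) *\<^sub>R x) \<bullet> ((1 / s n) *\<^sub>R h))) (at x)"
        by (rule has_derivative_compose[of "\<lambda>x. (1 / s n) *\<^sub>R x" "\<lambda>h. (1 / s n) *\<^sub>R h", OF _ D]) (auto intro!: derivative_eq_intros)
      then show "(w' n has_derivative (\<lambda>h. W' n x \<bullet> h)) (at x)" by (simp add: w'_def[abs_def] W'_def)
    qed
  qed
  have w'i: "integrable lebesgue (w' n)" for n
  proof (rule Bochner_Integration.integrable_bound)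
    show "integrable lebesgue (\<lambda>x::complex. 2 * C * indicator (ball 0 1) x)" by (rule integrable_indicator_bounded_lebesgue) auto
    show "AE x in lebesgue. norm (w' n x) \<le> norm (2 * C * indicator (ball 0 1) x :: real)"
    proof (intro always_eventually allI)
      fix x show "norm (w' n x) \<le> norm (2 * C * indicator (ball 0 1) x :: real)"
        using wb[of "(1 / s n) *\<^sub>R x"] w'0[of n x] s(2)[of n] C by (cases "norm x < 1") (auto simp: w'_def)
    qed
  qed (rule continuous_borel_measurable_lebesgue[OF w'c])
  define \<phi> where "\<phi> n z = (1 / kern_mass) * (\<integral>x. w' n x * kern (e n) (z - x) \<partial>lebesgue_on UNIV)" for n z
  have mol: "((\<lambda>z. \<integral>x. w' n x * kern (e n) (z - x) \<partial>lebesgue_on UNIV) has_derivative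
     (\<lambda>h. \<integral>x. w' n x * (grad (kern (e n)) (z - x) \<bullet> h) \<partial>lebesgue_on UNIV)) (at z)" for n z
    by (rule mollify_has_derivative[OF _ test_kern[OF s(3)]]) (simp add: lebesgue_on_UNIV_eq w'i)
  have \<phi>t: "\<phi> n \<in> test_functions disk" for n
  proof (rule test_functionsI[of _ "cball 0 (s n + e n)"])
    show "Ck m (\<phi> n)" for m
      unfolding \<phi>_def by (intro Ck_mult Ck_const Ck_mollify test_kern s) (simp add: lebesgue_on_UNIV_eq w'i)
    show "cball 0 (s n + e n) \<subseteq> disk" using s(4)[of n] by auto
    fix z :: complex assume z: "z \<notin> cball 0 (s n + e n)"
    have "w' n x * kern (e n) (z - x) = 0" for x
    proof (cases "norm x \<ge> s n")
      case False
      then have "norm (z - x) \<ge> e n" using z norm_triangle_ineq2[of z x] by simp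
      then show ?thesis using kern_eq_0[OF s(3)] by simp
    qed (simp add: w'0)
    then show "\<phi> n z = 0" unfolding \<phi>_def by (simp only: Bochner_Integration.integral_zero mult_zero_right)
  qed simp
  \<comment> \<open>Integration by parts in \<open>x\<close> for the dilated function times the
    kernel: the gradient of the mollification is the mollification of the gradient, although the
    latter exists only off two circles.\<close>
  have \<phi>g: "grad (\<phi> n) z \<bullet> h = (\<integral>x. (W' n x \<bullet> h) * kern (e n) (z - x) \<partial>lebesgue) / kern_mass" for n z h
  proof -
    have t: "kern (e n) \<in> test_functions UNIV" by (rule test_kern[OF s(3)])
    obtain M where M: "M \<ge> 0" "\<And>z. \<bar>kern (e n) z\<bar> \<le> M" "\<And>z. norm (grad (kern (e n)) z) \<le> M" "\<And>x y. \<bar>kern (e n) x - kern (e n) y\<bar> \<le> M * norm (x - y)"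
      using test_functions_bounded[OF t] by metis
    let ?p = "\<lambda>x. w' n x * kern (e n) (z - x)"
    let ?p' = "\<lambda>x h. w' n x * (grad (kern (e n)) (z - x) \<bullet> (- h)) + (W' n x \<bullet> h) * kern (e n) (z - x)"
    have gm: "(\<lambda>x. w' n x * (grad (kern (e n)) (z - x) \<bullet> h)) \<in> borel_measurable lebesgue" for h
      by (intro continuous_borel_measurable_lebesgue continuous_intros w'c continuous_on_compose2[OF continuous_grad[OF t, of UNIV]]) auto
    have i1: "integrable lebesgue (\<lambda>x. (W' n x \<bullet> h) * kern (e n) (z - x))"
    proof (rule mollify_bounded[OF W'ml _ s(3)])
      show "\<bar>W' n x \<bullet> h\<bar> \<le> 2 * C * norm h" for x
        using Cauchy_Schwarz_ineq2[of "W' n x" h] mult_right_mono[OF W'b[of n x], of "norm h"] by simp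
    qed
    have i2: "integrable lebesgue (\<lambda>x. w' n x * (grad (kern (e n)) (z - x) \<bullet> h))"
    proof (rule Bochner_Integration.integrable_bound[OF _ gm])
      show "integrable lebesgue (\<lambda>x. (M * norm h) * w' n x)" using w'i by simp
      have "\<bar>w' n x\<bar> * \<bar>grad (kern (e n)) (z - x) \<bullet> h\<bar> \<le> \<bar>w' n x\<bar> * (M * norm h)" for x
        using Cauchy_Schwarz_ineq2[of "grad (kern (e n)) (z - x)" h] mult_right_mono[OF M(3)[of "z - x"], of "norm h"]
        by (intro mult_left_mono) auto
      then show "AE x in lebesgue. norm (w' n x * (grad (kern (e n)) (z - x) \<bullet> h)) \<le> norm (M * norm h * w' n x)"
        using M(1) by (intro always_eventually allI) (simp add: abs_mult mult_ac)
    qed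
    have "integral\<^sup>L lebesgue (\<lambda>x. ?p' x h) = 0"
    proof (rule integral_derivative_eq_0[where p="?p" and C="2 * C * M + 2 * C * M" and R=1 and p'="?p'"])
      show "\<bar>?p x - ?p y\<bar> \<le> (2 * C * M + 2 * C * M) * norm (x - y)" for x y
      proof -
        have "?p x - ?p y = (w' n x - w' n y) * kern (e n) (z - x) + w' n y * (kern (e n) (z - x) - kern (e n) (z - y))"
          by (simp add: algebra_simps)
        also have "\<bar>\<dots>\<bar> \<le> \<bar>w' n x - w' n y\<bar> * \<bar>kern (e n) (z - x)\<bar> + \<bar>w' n y\<bar> * \<bar>kern (e n) (z - x) - kern (e n) (z - y)\<bar>"
          using abs_triangle_ineq by (simp add: abs_mult[symmetric])
        also have "\<dots> \<le> (2 * C * norm (x - y)) * M + 2 * C * (M * norm (x - y))"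
          using w'l[of n x y] M(2)[of "z - x"] M(4)[of "z - x" "z - y"] wb[of "(1 / s n) *\<^sub>R y"] C M(1)
          by (intro add_mono mult_mono) (auto simp: w'_def norm_minus_commute)
        finally show ?thesis by (simp add: algebra_simps)
      qed
      show "?p x = 0" if "1 \<le> norm x" for x using w'0[of n x] s(2)[of n] that by simp
      show "AE x in lebesgue. (?p has_derivative ?p' x) (at x)"
        using w'd[of n]
      proof (rule eventually_mono)
        fix x assume D: "(w' n has_derivative (\<lambda>h. W' n x \<bullet> h)) (at x)"
        have "((\<lambda>x. kern (e n) (z - x)) has_derivative (\<lambda>h. grad (kern (e n)) (z - x) \<bullet> (- h))) (at x)"
          by (rule has_derivative_compose[of "\<lambda>x. z - x" "\<lambda>h. - h", OF _ test_functionsD(4)[OF t]]) (auto intro!: derivative_eq_intros)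
        from has_derivative_mult[OF D this] show "(?p has_derivative ?p' x) (at x)" .
      qed
      show "(\<lambda>x. ?p' x h) \<in> borel_measurable lebesgue" using gm[of "- h"] borel_measurable_integrable[OF i1] by simp
    qed
    then have "(\<integral>x. (W' n x \<bullet> h) * kern (e n) (z - x) - w' n x * (grad (kern (e n)) (z - x) \<bullet> h) \<partial>lebesgue) = 0"
      by (simp add: inner_minus_right algebra_simps)
    then have eq: "(\<integral>x. w' n x * (grad (kern (e n)) (z - x) \<bullet> h) \<partial>lebesgue) = (\<integral>x. (W' n x \<bullet> h) * kern (e n) (z - x) \<partial>lebesgue)"
      using i1 i2 by simp
    have "(\<phi> n has_derivative (\<lambda>h. (1 / kern_mass) * (\<integral>x. w' n x * (grad (kern (e n)) (z - x) \<bullet> h) \<partial>lebesgue_on UNIV))) (at z)"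
      unfolding \<phi>_def by (rule has_derivative_mult_right[OF mol])
    from has_derivative_unique[OF test_functionsD(4)[OF \<phi>t] this]
    have "grad (\<phi> n) z \<bullet> h = (1 / kern_mass) * (\<integral>x. w' n x * (grad (kern (e n)) (z - x) \<bullet> h) \<partial>lebesgue_on UNIV)" by metis
    then show ?thesis by (simp add: eq lebesgue_on_UNIV_eq)
  qed
  have compb: "\<bar>W' n x \<bullet> h\<bar> \<le> 2 * C * norm h" for n x h
    using Cauchy_Schwarz_ineq2[of "W' n x" h] mult_right_mono[OF W'b[of n x], of "norm h"] by simp
  have conv: "(\<lambda>n. grad (\<phi> n) z \<bullet> h) \<longlonglongrightarrow> W z \<bullet> h" if z: "z \<notin> sphere c1 R1" "z \<notin> sphere c2 R2" for z h
    unfolding lim_sequentially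
  proof (intro allI impI)
    fix \<eta> :: real assume \<eta>: "\<eta> > 0"
    \<comment> \<open>Joint continuity in the dilation factor and the point, at
      \<open>(1, z)\<close>, controls dilation and mollification at once.\<close>
    let ?\<Phi> = "\<lambda>p :: real \<times> complex. ((1 / fst p) *\<^sub>R W ((1 / fst p) *\<^sub>R snd p)) \<bullet> h"
    have "isCont ?\<Phi> (1, z)"
    proof (intro continuous_intros)
      show "isCont (\<lambda>p. W ((1 / fst p) *\<^sub>R snd p)) (1, z)"
        by (rule isCont_o2[of _ "\<lambda>p. (1 / fst p) *\<^sub>R snd p"]) (auto intro!: continuous_intros contW z)
    qed auto
    then obtain d where d: "d > 0" "\<And>p. dist p (1, z) < d \<Longrightarrow> dist (?\<Phi> p) (?\<Phi> (1, z)) < \<eta> / 2"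
      using \<eta> unfolding continuous_at_eps_delta by (metis half_gt_zero)
    have "\<forall>\<^sub>F n in sequentially. dist (s n) 1 < d / 2" "\<forall>\<^sub>F n in sequentially. dist (e n) 0 < d / 2"
      using tendstoD[OF lims(1), of "d / 2"] tendstoD[OF lims(2), of "d / 2"] d(1) by simp_all
    then obtain N where N: "\<And>n. n \<ge> N \<Longrightarrow> dist (s n) 1 < d / 2 \<and> dist (e n) 0 < d / 2"
      using eventually_conj[of _ sequentially] unfolding eventually_sequentially by (metis nle_le order_trans)
    have "dist (grad (\<phi> n) z \<bullet> h) (W z \<bullet> h) < \<eta>" if n: "n \<ge> N" for n
    proof -
      have "\<bar>(\<integral>x. (W' n x \<bullet> h) * kern (e n) (z - x) \<partial>lebesgue) / kern_mass - W z \<bullet> h\<bar> \<le> \<eta> / 2"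
      proof (rule mollify_approx[OF W'ml compb s(3)])
        fix x assume x: "norm (x - z) < e n"
        have "dist (s n, x) (1, z) \<le> dist (s n) 1 + dist x z"
          unfolding dist_Pair_Pair by (rule sqrt_sum_squares_le_sum) auto
        also have "\<dots> < d" using N[OF n] x s(3)[of n] by (simp add: dist_norm)
        finally have "dist (?\<Phi> (s n, x)) (?\<Phi> (1, z)) < \<eta> / 2" by (rule d(2))
        then show "\<bar>W' n x \<bullet> h - W z \<bullet> h\<bar> \<le> \<eta> / 2" by (simp add: W'_def dist_real_def)
      qed
      then show ?thesis using \<eta> by (simp add: \<phi>g dist_real_def)
    qed
    then show "\<exists>no. \<forall>n\<ge>no. dist (grad (\<phi> n) z \<bullet> h) (W z \<bullet> h) < \<eta>" by blast
  qed
  have \<phi>b: "\<bar>grad (\<phi> n) z \<bullet> h\<bar> \<le> 2 * C * norm h" for n z h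
  proof -
    have "\<bar>(\<integral>x. (W' n x \<bullet> h) * kern (e n) (z - x) \<partial>lebesgue) / kern_mass - 0\<bar> \<le> 2 * C * norm h"
      by (rule mollify_approx[OF W'ml compb s(3)]) (use compb in simp)
    then show ?thesis by (simp only: \<phi>g diff_zero)
  qed
  have Wm: "W \<in> borel_measurable MD"
    using meas by (intro measurable_restrict_space1 measurable_completion) simp
  have Ws: "W \<in> sqint" using Wm bnd by (rule sqint_bounded[OF _ AE_I2])
  have gs: "(\<lambda>z. W z - grad (\<phi> n) z) \<in> sqint" for n by (intro sqint_diff Ws grad_sqint[OF \<phi>t])
  have "(\<lambda>n. \<integral>z. (norm (W z - grad (\<phi> n) z))\<^sup>2 \<partial>MD) \<longlonglongrightarrow> (\<integral>z. 0 \<partial>MD)"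
  proof (rule integral_dominated_convergence[where w="\<lambda>z. (5 * C)\<^sup>2"])
    show "(\<lambda>z. (norm (W z - grad (\<phi> n) z))\<^sup>2) \<in> borel_measurable MD" for n using sqint_integrable[OF gs] by auto
    show "AE z in MD. norm ((norm (W z - grad (\<phi> n) z))\<^sup>2) \<le> (5 * C)\<^sup>2" for n
    proof (intro always_eventually allI)
      fix z
      have "norm (grad (\<phi> n) z) \<le> \<bar>grad (\<phi> n) z \<bullet> 1\<bar> + \<bar>grad (\<phi> n) z \<bullet> \<i>\<bar>"
        using cmod_le[of "grad (\<phi> n) z"] by (simp add: inner_complex_def)
      also have "\<dots> \<le> 4 * C" using \<phi>b[of n z 1] \<phi>b[of n z \<i>] by simp
      finally have "norm (W z - grad (\<phi> n) z) \<le> 5 * C" using bnd[of z] norm_triangle_ineq4[of "W z" "grad (\<phi> n) z"] by linarith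
      then have "(norm (W z - grad (\<phi> n) z))\<^sup>2 \<le> (5 * C)\<^sup>2" by (rule power_mono) simp
      then show "norm ((norm (W z - grad (\<phi> n) z))\<^sup>2) \<le> (5 * C)\<^sup>2" by (simp only: real_norm_def abs_power2)
    qed
    have "negligible (sphere c1 R1 \<union> sphere c2 R2)" by (intro negligible_Un negligible_sphere)
    then have "AE z in lebesgue. z \<notin> sphere c1 R1 \<union> sphere c2 R2"
      by (intro AE_not_in) (simp add: negligible_iff_null_sets)
    then have "AE z in MD. z \<notin> sphere c1 R1 \<union> sphere c2 R2"
      by (subst AE_restrict_space_iff) (auto elim: eventually_mono)
    then show "AE z in MD. (\<lambda>n. (norm (W z - grad (\<phi> n) z))\<^sup>2) \<longlonglongrightarrow> 0"
    proof (rule eventually_mono)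
      fix z assume z: "z \<notin> sphere c1 R1 \<union> sphere c2 R2"
      have eq: "(norm x)\<^sup>2 = (x \<bullet> 1)\<^sup>2 + (x \<bullet> \<i>)\<^sup>2" for x by (simp add: cmod_power2 inner_complex_def)
      have "(\<lambda>n. (W z \<bullet> h - grad (\<phi> n) z \<bullet> h)\<^sup>2) \<longlonglongrightarrow> (W z \<bullet> h - W z \<bullet> h)\<^sup>2" for h
        using z by (intro tendsto_intros conv) auto
      from tendsto_add[OF this[of 1] this[of \<i>]]
      show "(\<lambda>n. (norm (W z - grad (\<phi> n) z))\<^sup>2) \<longlonglongrightarrow> 0" by (simp add: eq inner_diff_left)
    qed
  qed auto
  then have lim: "(\<lambda>n. ip (\<lambda>z. W z - grad (\<phi> n) z) (\<lambda>z. W z - grad (\<phi> n) z)) \<longlonglongrightarrow> 0" by (simp add: ip_self)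
  show ?thesis
  proof (rule G0_closed[OF Ws])
    fix \<eta> :: real assume "\<eta> > 0"
    with lim have "\<forall>\<^sub>F n in sequentially. ip (\<lambda>z. W z - grad (\<phi> n) z) (\<lambda>z. W z - grad (\<phi> n) z) < \<eta>" by (rule order_tendstoD)
    then obtain n where "ip (\<lambda>z. W z - grad (\<phi> n) z) (\<lambda>z. W z - grad (\<phi> n) z) < \<eta>"
      using eventually_happens'[OF sequentially_bot] by blast
    then show "\<exists>d'\<in>G0. ip (\<lambda>z. W z - d' z) (\<lambda>z. W z - d' z) < \<eta>" using G0_grad[OF \<phi>t] by blast
  qed
qed

text \<open>\<open>eq\<close> and \<open>zero\<close> make the glued potential continuous across the
  inner circle and the unit circle. Holomorphy on neighbourhoods of the closed regions bounds the
  gradient, as \<open>piecewise_C1_in_G0\<close> requires.\<close>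

lemma glued_gradient_in_G0:
  assumes \<rho>: "\<rho> > 0" "cball q \<rho> \<subseteq> disk"
    and U: "open U" "cball q \<rho> \<subseteq> U" "H1 holomorphic_on U"
    and V: "open V" "cball 0 1 - ball q \<rho> \<subseteq> V" "H2 holomorphic_on V"
    and eq: "\<And>z. z \<in> sphere q \<rho> \<Longrightarrow> Re (H1 z) = Re (H2 z)"
    and zero: "\<And>z. z \<in> sphere 0 1 \<Longrightarrow> Re (H2 z) = 0"
  shows "(\<lambda>z. if z \<in> ball q \<rho> then cnj (deriv H1 z) else if z \<in> disk then cnj (deriv H2 z) else 0) \<in> G0"
    (is "?W \<in> G0")
proof -
  define w where "w z = (if z \<in> cball q \<rho> then Re (H1 z) else if z \<in> cball 0 1 then Re (H2 z) else 0)" for z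
  have c1: "continuous_on U (\<lambda>z. Re (H1 z))" "continuous_on U (\<lambda>z. cnj (deriv H1 z))"
    using holomorphic_on_imp_continuous_on[OF U(3)] holomorphic_on_imp_continuous_on[OF holomorphic_deriv[OF U(3,1)]]
    by (auto intro: continuous_intros)
  have c2: "continuous_on V (\<lambda>z. Re (H2 z))" "continuous_on V (\<lambda>z. cnj (deriv H2 z))"
    using holomorphic_on_imp_continuous_on[OF V(3)] holomorphic_on_imp_continuous_on[OF holomorphic_deriv[OF V(3,1)]]
    by (auto intro: continuous_intros)
  have d1: "((\<lambda>z. Re (H1 z)) has_derivative (\<lambda>h. cnj (deriv H1 z) \<bullet> h)) (at z)" if "z \<in> U" for z
    by (rule has_derivative_Re_holomorphic[OF holomorphic_derivI[OF U(3,1) that]])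
  have d2: "((\<lambda>z. Re (H2 z)) has_derivative (\<lambda>h. cnj (deriv H2 z) \<bullet> h)) (at z)" if "z \<in> V" for z
    by (rule has_derivative_Re_holomorphic[OF holomorphic_derivI[OF V(3,1) that]])
  have dl: "norm (z - q) \<le> \<rho> \<Longrightarrow> norm z < 1" for z using \<rho>(2) by (auto simp: dist_norm norm_minus_commute subset_iff)
  have loc: "(w has_derivative (\<lambda>h. ?W z \<bullet> h)) (at z) \<and> isCont ?W z" if z: "z \<notin> sphere q \<rho>" "z \<notin> sphere 0 1" for z
  proof -
    consider "z \<in> ball q \<rho>" | "z \<in> disk - cball q \<rho>" | "z \<in> - cball 0 1" using z by fastforce
    then show ?thesis
    proof cases
      case 1
      have "(w has_derivative (\<lambda>h. cnj (deriv H1 z) \<bullet> h)) (at z)"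
        by (rule has_derivative_transform_within_open[OF d1 open_ball 1]) (use 1 U(2) in \<open>auto simp: w_def\<close>)
      moreover have "isCont ?W z"
      proof (rule continuous_on_interior[of "ball q \<rho>"])
        show "continuous_on (ball q \<rho>) ?W"
          by (rule continuous_on_eq[OF continuous_on_subset[OF c1(2), of "ball q \<rho>"]]) (use U(2) in auto)
      qed (use 1 in \<open>simp add: interior_open\<close>)
      ultimately show ?thesis using 1 by simp
    next
      case 2
      have o: "open (disk - cball q \<rho>)" by auto
      have "(w has_derivative (\<lambda>h. cnj (deriv H2 z) \<bullet> h)) (at z)"
        by (rule has_derivative_transform_within_open[OF d2 o 2]) (use 2 V(2) in \<open>auto simp: w_def\<close>)
      moreover have "isCont ?W z"
      proof (rule continuous_on_interior[of "disk - cball q \<rho>"])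
        show "continuous_on (disk - cball q \<rho>) ?W"
          by (rule continuous_on_eq[OF continuous_on_subset[OF c2(2), of "disk - cball q \<rho>"]]) (use V(2) in auto)
      qed (use 2 in \<open>simp add: interior_open[OF o]\<close>)
      ultimately show ?thesis using 2 by simp
    next
      case 3
      have o: "open (- cball (0 :: complex) 1)" by (simp add: open_Compl)
      have nq: "x \<notin> cball q \<rho>" if "x \<in> - cball 0 1" for x using that \<rho>(2) by (auto simp: subset_iff)
      have "(w has_derivative (\<lambda>h. 0)) (at z)"
        by (rule has_derivative_transform_within_open[OF has_derivative_const o 3, of 0]) (use nq in \<open>auto simp: w_def\<close>)
      moreover have "isCont ?W z"
      proof (rule continuous_on_interior[of "- cball 0 1"])
        show "continuous_on (- cball 0 1) ?W"
        proof (rule continuous_on_eq[OF continuous_on_const[of _ 0]])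
          show "0 = ?W x" if "x \<in> - cball 0 1" for x using nq[OF that] that by auto
        qed
      qed (use 3 in \<open>simp add: interior_open[OF o]\<close>)
      moreover have "?W z = 0" using 3 nq[OF 3] by auto
      ultimately show ?thesis by simp
    qed
  qed
  show ?thesis
  proof -
    have "bounded ((\<lambda>z. cnj (deriv H1 z)) ` cball q \<rho>)"
      by (intro compact_imp_bounded compact_continuous_image continuous_on_subset[OF c1(2) U(2)]) auto
    then obtain C1 where "\<forall>x\<in>(\<lambda>z. cnj (deriv H1 z)) ` cball q \<rho>. norm x \<le> C1" unfolding bounded_iff by blast
    then have C1: "norm (cnj (deriv H1 z)) \<le> C1" if "z \<in> cball q \<rho>" for z using that by blast
    have "compact (cball (0::complex) 1 - ball q \<rho>)" by (rule compact_diff) auto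
    then have "bounded ((\<lambda>z. cnj (deriv H2 z)) ` (cball 0 1 - ball q \<rho>))"
      by (intro compact_imp_bounded compact_continuous_image continuous_on_subset[OF c2(2) V(2)])
    then obtain C2 where "\<forall>x\<in>(\<lambda>z. cnj (deriv H2 z)) ` (cball 0 1 - ball q \<rho>). norm x \<le> C2" unfolding bounded_iff by blast
    then have C2: "norm (cnj (deriv H2 z)) \<le> C2" if "z \<in> cball 0 1 - ball q \<rho>" for z using that by blast
    define C where "C = max (max C1 C2) 0"
    have C: "C1 \<le> C" "C2 \<le> C" "0 \<le> C" by (simp_all add: C_def)
    have bnd: "norm (?W z) \<le> C" for z
    proof -
      consider "z \<in> ball q \<rho>" | "z \<notin> ball q \<rho>" "z \<in> disk" | "z \<notin> ball q \<rho>" "z \<notin> disk" by blast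
      then show ?thesis
      proof cases
        case 1 then show ?thesis using order_trans[OF C1[of z] C(1)] by simp
      next
        case 2 then show ?thesis using order_trans[OF C2[of z] C(2)] by simp
      next
        case 3 then show ?thesis using C(3) by simp
      qed
    qed
    have meas: "?W \<in> borel_measurable borel"
    proof -
      have "(\<lambda>z. indicat_real (ball q \<rho>) z *\<^sub>R cnj (deriv H1 z) + indicat_real (disk - ball q \<rho>) z *\<^sub>R cnj (deriv H2 z)) \<in> borel_measurable borel"
        by (intro borel_measurable_add borel_measurable_continuous_on_indicator continuous_on_subset[OF c1(2)] continuous_on_subset[OF c2(2)])
           (use U(2) V(2) in auto)
      also have "(\<lambda>z. indicat_real (ball q \<rho>) z *\<^sub>R cnj (deriv H1 z) + indicat_real (disk - ball q \<rho>) z *\<^sub>R cnj (deriv H2 z)) = ?W"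
        by (auto simp: fun_eq_iff indicator_def)
      finally show ?thesis .
    qed
    have cont: "continuous_on UNIV w"
    proof -
      have "continuous_on ((cball 0 1 - ball q \<rho>) \<union> - ball 0 1) (\<lambda>z. if z \<in> cball 0 1 then Re (H2 z) else 0)"
      proof (rule continuous_on_cases)
        show "continuous_on (cball 0 1 - ball q \<rho>) (\<lambda>z. Re (H2 z))" by (rule continuous_on_subset[OF c2(1) V(2)])
        show "\<forall>x. (x \<in> cball 0 1 - ball q \<rho> \<and> x \<notin> cball 0 1) \<or> (x \<in> - ball 0 1 \<and> x \<in> cball 0 1) \<longrightarrow> Re (H2 x) = 0"
          using zero by (auto simp: not_less)
      qed (auto intro!: closed_Diff)
      moreover have "(cball 0 1 - ball q \<rho>) \<union> - ball 0 1 = - ball q \<rho>"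
        using dl by (auto simp: dist_norm norm_minus_commute not_less)
      ultimately have o: "continuous_on (- ball q \<rho>) (\<lambda>z. if z \<in> cball 0 1 then Re (H2 z) else 0)" by simp
      have "continuous_on (cball q \<rho> \<union> - ball q \<rho>) (\<lambda>z. if z \<in> cball q \<rho> then Re (H1 z) else if z \<in> cball 0 1 then Re (H2 z) else 0)"
      proof (rule continuous_on_cases[OF _ _ _ o])
        show "continuous_on (cball q \<rho>) (\<lambda>z. Re (H1 z))" by (rule continuous_on_subset[OF c1(1) U(2)])
        show "\<forall>x. (x \<in> cball q \<rho> \<and> x \<notin> cball q \<rho>) \<or> (x \<in> - ball q \<rho> \<and> x \<in> cball q \<rho>) \<longrightarrow>
          Re (H1 x) = (if x \<in> cball 0 1 then Re (H2 x) else 0)"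
          using eq \<rho>(2) by (auto simp: not_less subset_iff less_imp_le)
      qed auto
      moreover have "cball q \<rho> \<union> - ball q \<rho> = UNIV" by auto
      ultimately show ?thesis by (simp add: w_def[abs_def])
    qed
    show ?thesis
    proof (rule piecewise_C1_in_G0[where w=w and C=C and ?c1.0=q and ?R1.0=\<rho> and ?c2.0=0 and ?R2.0=1, OF cont _ _ bnd _ meas])
      fix z :: complex assume z: "1 \<le> norm z"
      then have "z \<notin> cball q \<rho>" using \<rho>(2) by (auto simp: subset_iff)
      then show "w z = 0" using z zero[of z] by (auto simp: w_def)
    qed (use loc in blast)+
  qed
qed

text \<open>The gradient of \<open>Re f\<close>, for holomorphic \<open>f\<close>.\<close>

abbreviation hgrad :: "(complex \<Rightarrow> complex) \<Rightarrow> complex \<Rightarrow> complex" where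
  "hgrad f \<equiv> (\<lambda>z. cnj (deriv f z))"

lemma deriv_cong_open:
  assumes "open S" "z \<in> S" "\<And>x. x \<in> S \<Longrightarrow> f x = g x"
  shows "deriv f z = deriv g z"
proof (rule deriv_cong_ev)
  show "\<forall>\<^sub>F x in nhds z. f x = g x"
    using eventually_nhds_in_open[OF assms(1,2)] by (rule eventually_mono) (use assms(3) in auto)
qed simp

section \<open>Disks inside the unit disk\<close>

locale inclusion =
  fixes a :: complex and r :: real
  assumes a: "norm a < 1" and r: "0 < r" "r < 1"
begin

definition T :: "complex \<Rightarrow> complex" where "T z = (z - a) / (1 - cnj a * z)"

definition Ti :: "complex \<Rightarrow> complex" where "Ti w = (w + a) / (1 + cnj a * w)"

text \<open>The set where \<open>norm (T z) \<le> r\<close> is the pseudohyperbolic disk about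
  \<open>a\<close>; these are its Euclidean centre and radius (see \<open>T_le_r\<close>). Only for
  \<open>a = 0\<close> do the two centres coincide.\<close>

definition q :: complex where "q = ((1 - r\<^sup>2) / (1 - r\<^sup>2 * (norm a)\<^sup>2)) *\<^sub>R a"

definition \<rho> :: real where "\<rho> = r * (1 - (norm a)\<^sup>2) / (1 - r\<^sup>2 * (norm a)\<^sup>2)"

lemma a2: "(norm a)\<^sup>2 < 1"
  using a by (simp add: power_less_one_iff)

lemma r2: "r\<^sup>2 < 1"
  using r by (simp add: power_less_one_iff)

lemma r2a2: "r\<^sup>2 * (norm a)\<^sup>2 < 1"
proof -
  have "r\<^sup>2 * (norm a)\<^sup>2 \<le> 1 * (norm a)\<^sup>2" using r2 by (intro mult_right_mono) auto
  then show ?thesis using a2 by simp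
qed

lemma \<rho>_pos: "\<rho> > 0"
  unfolding \<rho>_def using r a2 r2a2 by simp

lemma cmod_diff_eq: "(norm (1 - cnj a * z))\<^sup>2 - (norm (z - a))\<^sup>2 = (1 - (norm a)\<^sup>2) * (1 - (norm z)\<^sup>2)"
  by (simp only: cmod_power2) (simp add: power2_eq_square algebra_simps)

lemma den_nonzero: "norm z \<le> 1 \<Longrightarrow> 1 - cnj a * z \<noteq> 0"
proof
  assume z: "norm z \<le> 1" and "1 - cnj a * z = 0"
  then have "norm (cnj a * z) = 1" by (metis norm_one right_minus_eq)
  moreover have "norm a * norm z \<le> norm a * 1" using z by (intro mult_left_mono) auto
  ultimately show False using a by (simp add: norm_mult)
qed

lemma den_nonzero': "norm z \<le> 1 \<Longrightarrow> 1 + cnj a * z \<noteq> 0"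
  using den_nonzero[of "- z"] by simp

text \<open>Completing the square in \<open>z\<close>; the constant terms agree by (1 - r^2)^2 A -
  r^2 (1 - A)^2 = (1 - r^2 A) (A - r^2), where A is the square of \<open>norm a\<close>. No division
  by the denominator of \<open>T\<close> takes place, so the identity also holds at its
  pole.\<close>

lemma circle_eq: "(norm (z - a))\<^sup>2 - r\<^sup>2 * (norm (1 - cnj a * z))\<^sup>2 = (1 - r\<^sup>2 * (norm a)\<^sup>2) * ((norm (z - q))\<^sup>2 - \<rho>\<^sup>2)"
proof -
  define D where "D = 1 - r\<^sup>2 * (norm a)\<^sup>2"
  define A where "A = (norm a)\<^sup>2"
  have D: "D > 0" using r2a2 by (simp add: D_def)
  have qd: "D *\<^sub>R q = (1 - r\<^sup>2) *\<^sub>R a" using D by (simp add: q_def D_def)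
  have \<rho>d: "D * \<rho> = r * (1 - A)" using D by (simp add: \<rho>_def D_def A_def)
  have "D * (D * ((norm (z - q))\<^sup>2 - \<rho>\<^sup>2)) = (norm (D *\<^sub>R z - D *\<^sub>R q))\<^sup>2 - (D * \<rho>)\<^sup>2"
    unfolding scaleR_diff_right[symmetric] using D by (simp add: power_mult_distrib right_diff_distrib power2_eq_square)
  also have "\<dots> = (norm (D *\<^sub>R z - (1 - r\<^sup>2) *\<^sub>R a))\<^sup>2 - (r * (1 - A))\<^sup>2" by (simp only: qd \<rho>d)
  also have "\<dots> = D\<^sup>2 * (norm z)\<^sup>2 - 2 * D * (1 - r\<^sup>2) * (z \<bullet> a) + ((1 - r\<^sup>2)\<^sup>2 * A - r\<^sup>2 * (1 - A)\<^sup>2)"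
    unfolding power2_norm_eq_inner A_def by (simp add: inner_diff_left inner_diff_right inner_commute power2_eq_square algebra_simps)
  also have "(1 - r\<^sup>2)\<^sup>2 * A - r\<^sup>2 * (1 - A)\<^sup>2 = D * (A - r\<^sup>2)" unfolding D_def A_def[symmetric] by (simp add: power2_eq_square algebra_simps)
  finally have "D * (D * ((norm (z - q))\<^sup>2 - \<rho>\<^sup>2)) = D * (D * (norm z)\<^sup>2 - 2 * (1 - r\<^sup>2) * (z \<bullet> a) + (A - r\<^sup>2))"
    by (simp only: power2_eq_square[of D]) (simp add: algebra_simps)
  then have 1: "D * ((norm (z - q))\<^sup>2 - \<rho>\<^sup>2) = D * (norm z)\<^sup>2 - 2 * (1 - r\<^sup>2) * (z \<bullet> a) + (A - r\<^sup>2)" using D by simp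
  have X1: "(norm (z - a))\<^sup>2 = (norm z)\<^sup>2 - 2 * (z \<bullet> a) + A" unfolding A_def power2_norm_eq_inner
    by (simp add: inner_diff_left inner_diff_right inner_commute)
  have X2: "(norm (1 - cnj a * z))\<^sup>2 = 1 - 2 * (z \<bullet> a) + A * (norm z)\<^sup>2"
    unfolding A_def by (simp only: cmod_power2) (simp add: inner_complex_def power2_eq_square algebra_simps)
  have "(norm (z - a))\<^sup>2 - r\<^sup>2 * (norm (1 - cnj a * z))\<^sup>2 = D * (norm z)\<^sup>2 - 2 * (1 - r\<^sup>2) * (z \<bullet> a) + (A - r\<^sup>2)"
    unfolding X1 X2 D_def A_def[symmetric] by (simp add: algebra_simps)
  with 1 show ?thesis by (simp only: D_def)
qed

lemma T_le: "1 - cnj a * z \<noteq> 0 \<Longrightarrow> norm (T z) \<le> c \<longleftrightarrow> norm (z - a) \<le> c * norm (1 - cnj a * z)"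
  by (simp add: T_def norm_divide divide_simps)

lemma sq_compare: "0 \<le> c \<Longrightarrow> (x :: real) \<ge> 0 \<Longrightarrow> y \<ge> 0 \<Longrightarrow> x \<le> c * y \<longleftrightarrow> x\<^sup>2 - c\<^sup>2 * y\<^sup>2 \<le> 0"
  by (metis abs_of_nonneg diff_le_0_iff_le mult_nonneg_nonneg abs_le_square_iff power_mult_distrib)

lemma T_le_r: "1 - cnj a * z \<noteq> 0 \<Longrightarrow> norm (T z) \<le> r \<longleftrightarrow> z \<in> cball q \<rho>"
proof -
  assume nz: "1 - cnj a * z \<noteq> 0"
  have "norm (T z) \<le> r \<longleftrightarrow> norm (z - a) \<le> r * norm (1 - cnj a * z)" using T_le[OF nz] .
  also have "\<dots> \<longleftrightarrow> (norm (z - a))\<^sup>2 - r\<^sup>2 * (norm (1 - cnj a * z))\<^sup>2 \<le> 0" using r by (intro sq_compare) auto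
  also have "\<dots> \<longleftrightarrow> (norm (z - q))\<^sup>2 - \<rho>\<^sup>2 \<le> 0" unfolding circle_eq using r2a2 by (simp add: mult_le_0_iff)
  also have "\<dots> \<longleftrightarrow> norm (z - q) \<le> \<rho>" using abs_le_square_iff[of "norm (z - q)" \<rho>] \<rho>_pos by simp
  finally show ?thesis by (simp add: dist_norm norm_minus_commute)
qed

lemma T_eq_r: "1 - cnj a * z \<noteq> 0 \<Longrightarrow> norm (T z) = r \<longleftrightarrow> z \<in> sphere q \<rho>"
proof -
  assume nz: "1 - cnj a * z \<noteq> 0"
  have "norm (T z) = r \<longleftrightarrow> norm (z - a) = r * norm (1 - cnj a * z)" using nz by (simp add: T_def norm_divide divide_simps)
  also have "\<dots> \<longleftrightarrow> (norm (z - a))\<^sup>2 = (r * norm (1 - cnj a * z))\<^sup>2" using r by (simp add: power2_eq_iff_nonneg)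
  also have "\<dots> \<longleftrightarrow> (norm (z - a))\<^sup>2 - r\<^sup>2 * (norm (1 - cnj a * z))\<^sup>2 = 0" by (simp add: power_mult_distrib)
  also have "\<dots> \<longleftrightarrow> (norm (z - q))\<^sup>2 - \<rho>\<^sup>2 = 0" unfolding circle_eq using r2a2 by simp
  also have "\<dots> \<longleftrightarrow> norm (z - q) = \<rho>" using \<rho>_pos by (simp add: power2_eq_iff_nonneg)
  finally show ?thesis by (simp add: dist_norm norm_minus_commute)
qed

lemma T_less_1: "1 - cnj a * z \<noteq> 0 \<Longrightarrow> norm (T z) < 1 \<longleftrightarrow> norm z < 1"
  and T_eq_1: "norm z = 1 \<Longrightarrow> norm (T z) = 1"
proof -
  assume nz: "1 - cnj a * z \<noteq> 0"
  have "norm (T z) < 1 \<longleftrightarrow> norm (z - a) < norm (1 - cnj a * z)" using nz by (simp add: T_def norm_divide divide_simps)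
  also have "\<dots> \<longleftrightarrow> (norm (z - a))\<^sup>2 < (norm (1 - cnj a * z))\<^sup>2" by (meson less_imp_le norm_ge_zero power_mono_iff linorder_not_less zero_less_numeral)
  also have "\<dots> \<longleftrightarrow> 0 < (1 - (norm a)\<^sup>2) * (1 - (norm z)\<^sup>2)" unfolding cmod_diff_eq[symmetric] by auto
  also have "\<dots> \<longleftrightarrow> (norm z)\<^sup>2 < 1" using a2 by (simp add: zero_less_mult_iff)
  also have "\<dots> \<longleftrightarrow> norm z < 1" by (simp add: power_less_one_iff)
  finally show "norm (T z) < 1 \<longleftrightarrow> norm z < 1" .
next
  assume z: "norm z = 1"
  then have "(norm (z - a))\<^sup>2 = (norm (1 - cnj a * z))\<^sup>2" using cmod_diff_eq[of z] by simp
  then have "norm (z - a) = norm (1 - cnj a * z)" by (simp add: power2_eq_iff_nonneg)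
  then show "norm (T z) = 1" using den_nonzero[of z] z by (simp add: T_def norm_divide)
qed

text \<open>Outside the unit disk \<open>cmod_diff_eq\<close> says that the numerator of
  \<open>T\<close> is at least as large as the denominator, which contradicts the bound by
  \<open>r\<close> unless both vanish. Numerator and denominator are compared directly because
  \<open>T\<close> may have its pole there.\<close>

lemma cball_in_disk: "cball q \<rho> \<subseteq> disk"
proof
  fix z assume z: "z \<in> cball q \<rho>"
  then have "norm (z - q) \<le> \<rho>" by (simp add: dist_norm norm_minus_commute)
  then have "(norm (z - q))\<^sup>2 \<le> \<rho>\<^sup>2" by (rule power_mono) simp
  then have "(norm (z - a))\<^sup>2 - r\<^sup>2 * (norm (1 - cnj a * z))\<^sup>2 \<le> 0" unfolding circle_eq using r2a2 by (simp add: mult_le_0_iff)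
  then have 1: "(norm (z - a))\<^sup>2 \<le> r\<^sup>2 * (norm (1 - cnj a * z))\<^sup>2" by simp
  show "z \<in> disk"
  proof (rule ccontr)
    assume "z \<notin> disk"
    then have z1: "norm z \<ge> 1" by simp
    then have "(norm z)\<^sup>2 \<ge> 1" by simp
    then have "(norm (1 - cnj a * z))\<^sup>2 \<le> (norm (z - a))\<^sup>2" using cmod_diff_eq[of z] a2 by (smt (verit) mult_nonneg_nonpos)
    with 1 have "(1 - r\<^sup>2) * (norm (1 - cnj a * z))\<^sup>2 \<le> 0" unfolding left_diff_distrib mult_1_left by linarith
    then have "norm (1 - cnj a * z) = 0" using r2 by (simp add: mult_le_0_iff)
    with 1 have "z = a" by simp
    with z1 a show False by simp
  qed
qed

lemma Ti_T: "1 - cnj a * z \<noteq> 0 \<Longrightarrow> Ti (T z) = z"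
proof -
  assume nz: "1 - cnj a * z \<noteq> 0"
  have "1 - cnj a * a \<noteq> 0" using den_nonzero[of a] a by simp
  moreover have "T z + a = (1 - cnj a * a) * z / (1 - cnj a * z)" using nz by (simp add: T_def field_simps)
  moreover have "1 + cnj a * T z = (1 - cnj a * a) / (1 - cnj a * z)" using nz by (simp add: T_def field_simps)
  ultimately show ?thesis using nz by (simp add: Ti_def)
qed

lemma T_Ti: "1 + cnj a * w \<noteq> 0 \<Longrightarrow> T (Ti w) = w"
proof -
  assume nz: "1 + cnj a * w \<noteq> 0"
  have "1 - cnj a * a \<noteq> 0" using den_nonzero[of a] a by simp
  moreover have "Ti w - a = (1 - cnj a * a) * w / (1 + cnj a * w)" using nz by (simp add: Ti_def field_simps)
  moreover have "1 - cnj a * Ti w = (1 - cnj a * a) / (1 + cnj a * w)" using nz by (simp add: Ti_def field_simps)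
  ultimately show ?thesis using nz by (simp add: T_def)
qed

lemma Ti_disk: "norm w < 1 \<Longrightarrow> norm (Ti w) < 1"
proof -
  assume w: "norm w < 1"
  then have nz: "1 + cnj a * w \<noteq> 0" by (intro den_nonzero') simp
  have "1 - cnj a * a \<noteq> 0" using den_nonzero[of a] a by simp
  moreover have "1 - cnj a * Ti w = (1 - cnj a * a) / (1 + cnj a * w)" using nz by (simp add: Ti_def field_simps)
  ultimately have "1 - cnj a * Ti w \<noteq> 0" using nz by simp
  then show ?thesis using T_less_1[of "Ti w"] T_Ti[OF nz] w by simp
qed

lemma T_deriv: "1 - cnj a * z \<noteq> 0 \<Longrightarrow> (T has_field_derivative (1 - (norm a)\<^sup>2) / (1 - cnj a * z)\<^sup>2) (at z)"
  unfolding T_def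
  by (auto intro!: derivative_eq_intros simp: power2_eq_square complex_norm_square[symmetric, unfolded power2_eq_square] algebra_simps simp flip: of_real_power of_real_mult)

lemma Ti_deriv: "1 + cnj a * z \<noteq> 0 \<Longrightarrow> (Ti has_field_derivative (1 - (norm a)\<^sup>2) / (1 + cnj a * z)\<^sup>2) (at z)"
  unfolding Ti_def
  by (auto intro!: derivative_eq_intros simp: power2_eq_square complex_norm_square[symmetric, unfolded power2_eq_square] algebra_simps simp flip: of_real_power of_real_mult)

lemma T_hol: "T holomorphic_on {z. 1 - cnj a * z \<noteq> 0}"
  unfolding T_def by (intro holomorphic_intros) auto

lemma Ti_hol: "Ti holomorphic_on {z. 1 + cnj a * z \<noteq> 0}"
  unfolding Ti_def by (intro holomorphic_intros) auto

end

section \<open>Dilation, reflection and image fields in the coordinate \<open>T\<close>\<close>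

context inclusion
begin

lemma Ti_hol_disk: "Ti holomorphic_on disk"
  by (rule holomorphic_on_subset[OF Ti_hol]) (use den_nonzero' in auto)

lemma T_disk: "norm z < 1 \<Longrightarrow> norm (T z) < 1"
  using T_less_1[of z] den_nonzero[of z] by simp

definition \<sigma> :: "real \<Rightarrow> complex \<Rightarrow> complex" where "\<sigma> t z = Ti (of_real t * T z)"

lemma \<sigma>_disk: "0 \<le> t \<Longrightarrow> t \<le> 1 \<Longrightarrow> norm z < 1 \<Longrightarrow> norm (\<sigma> t z) < 1"
  unfolding \<sigma>_def using T_disk[of z] mult_left_le_one_le[of "norm (T z)" t]
  by (intro Ti_disk) (simp add: norm_mult le_less_trans)

lemma \<sigma>_comp: "0 \<le> t \<Longrightarrow> t \<le> 1 \<Longrightarrow> norm z < 1 \<Longrightarrow> \<sigma> s (\<sigma> t z) = \<sigma> (s * t) z"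
proof -
  assume t: "0 \<le> t" "t \<le> 1" "norm z < 1"
  have "norm (of_real t * T z) \<le> 1"
    using T_disk[OF t(3)] t by (auto simp: norm_mult intro: mult_le_one)
  then show ?thesis unfolding \<sigma>_def by (simp add: T_Ti den_nonzero' mult.assoc)
qed

text \<open>
  Dilation by \<open>r\<^sup>2\<close> in the coordinate \<open>T\<close>, and reflection in the circle \<open>|T| = r\<close> (composed
  with conjugations, so as to be holomorphic).
\<close>

abbreviation S :: "(complex \<Rightarrow> complex) \<Rightarrow> complex \<Rightarrow> complex" where
  "S f \<equiv> (\<lambda>z. f (\<sigma> (r\<^sup>2) z))"

definition R :: "(complex \<Rightarrow> complex) \<Rightarrow> complex \<Rightarrow> complex" where
  "R f z = cnj (f (Ti (cnj (of_real (r\<^sup>2) / T z))))"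

text \<open>In the coordinate \<open>T\<close> this is the annulus between the radii
  \<open>r\<^sup>2\<close> and \<open>1 / r\<^sup>2\<close>. It contains the closed region between
  the inclusion and the unit circle with room on both sides, so that the image fields are smooth up
  to both circles.\<close>

definition VR :: "complex set" where
  "VR = {z. 1 - cnj a * z \<noteq> 0 \<and> r\<^sup>2 * norm (T z) < 1 \<and> T z \<noteq> 0 \<and> r\<^sup>2 / norm (T z) < 1}"

definition VS :: "complex set" where "VS = {z. 1 - cnj a * z \<noteq> 0 \<and> r\<^sup>2 * norm (T z) < 1}"

lemma open_den: "open {z. 1 - cnj a * z \<noteq> 0}"
  by (rule open_Collect_neq) (intro continuous_intros)+

lemma T_cont: "continuous_on {z. 1 - cnj a * z \<noteq> 0} T"
  by (rule holomorphic_on_imp_continuous_on[OF T_hol])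

lemma open_VS: "open VS"
proof -
  have "open ({z. 1 - cnj a * z \<noteq> 0} \<inter> T -` {w. r\<^sup>2 * norm w < 1})"
    by (rule continuous_open_preimage[OF T_cont open_den]) (intro open_Collect_less continuous_intros)
  moreover have "{z. 1 - cnj a * z \<noteq> 0} \<inter> T -` {w. r\<^sup>2 * norm w < 1} = VS" by (auto simp: VS_def)
  ultimately show ?thesis by simp
qed

lemma open_VR: "open VR"
proof -
  have "{w. r\<^sup>2 * norm w < 1 \<and> w \<noteq> 0 \<and> r\<^sup>2 / norm w < 1} = {w :: complex. r\<^sup>2 * norm w < 1} \<inter> {w. r\<^sup>2 < norm w}"
  proof (intro set_eqI iffI)
    fix w :: complex
    assume w: "w \<in> {w. r\<^sup>2 * norm w < 1} \<inter> {w. r\<^sup>2 < norm w}"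
    then have "norm w > 0" using zero_le_power2[of r] by (auto intro: le_less_trans)
    then show "w \<in> {w. r\<^sup>2 * norm w < 1 \<and> w \<noteq> 0 \<and> r\<^sup>2 / norm w < 1}" using w by (auto simp: field_simps)
  qed (auto simp: field_simps)
  moreover have "open ({w :: complex. r\<^sup>2 * norm w < 1} \<inter> {w. r\<^sup>2 < norm w})"
    by (intro open_Int open_Collect_less continuous_intros)
  ultimately have "open {w :: complex. r\<^sup>2 * norm w < 1 \<and> w \<noteq> 0 \<and> r\<^sup>2 / norm w < 1}" by simp
  then have "open ({z. 1 - cnj a * z \<noteq> 0} \<inter> T -` {w. r\<^sup>2 * norm w < 1 \<and> w \<noteq> 0 \<and> r\<^sup>2 / norm w < 1})"
    by (rule continuous_open_preimage[OF T_cont open_den])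
  moreover have "{z. 1 - cnj a * z \<noteq> 0} \<inter> T -` {w. r\<^sup>2 * norm w < 1 \<and> w \<noteq> 0 \<and> r\<^sup>2 / norm w < 1} = VR" by (auto simp: VR_def)
  ultimately show ?thesis by simp
qed

lemma T_le_1: "norm z \<le> 1 \<Longrightarrow> norm (T z) \<le> 1"
  using T_disk[of z] T_eq_1[of z] by (cases "norm z = 1") auto

lemma VS_closed_disk: "cball 0 1 \<subseteq> VS"
proof
  fix z :: complex assume "z \<in> cball 0 1"
  then have z: "norm z \<le> 1" by simp
  have "r\<^sup>2 * norm (T z) \<le> r\<^sup>2 * 1" using T_le_1[OF z] by (intro mult_left_mono) auto
  then show "z \<in> VS" using den_nonzero[OF z] r2 by (auto simp: VS_def)
qed

lemma VR_annulus: "cball 0 1 - ball q \<rho> \<subseteq> VR"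
proof
  fix z assume z: "z \<in> cball 0 1 - ball q \<rho>"
  then have nz: "1 - cnj a * z \<noteq> 0" and "z \<in> VS" using den_nonzero[of z] VS_closed_disk by auto
  have "norm (T z) \<ge> r"
  proof (rule ccontr)
    assume "\<not> norm (T z) \<ge> r"
    then have "norm (T z) \<le> r" "norm (T z) \<noteq> r" by auto
    then show False using T_le_r[OF nz] T_eq_r[OF nz] z by auto
  qed
  moreover have "r\<^sup>2 < r" using r by (simp add: power2_eq_square)
  ultimately have "r\<^sup>2 < norm (T z)" "T z \<noteq> 0" using r by auto
  then show "z \<in> VR" using \<open>z \<in> VS\<close> by (auto simp: VR_def VS_def divide_simps)
qed

lemma VR_sub_VS: "VR \<subseteq> VS"
  by (auto simp: VR_def VS_def)

lemma S_hol:
  assumes "f holomorphic_on disk" shows "S f holomorphic_on VS"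
proof -
  have "(\<lambda>z. of_real (r\<^sup>2) * T z) holomorphic_on VS"
    by (intro holomorphic_intros holomorphic_on_subset[OF T_hol]) (auto simp: VS_def)
  moreover have "f \<circ> Ti holomorphic_on disk"
    by (rule holomorphic_on_compose_gen[OF Ti_hol_disk assms]) (use Ti_disk in auto)
  ultimately have "(f \<circ> Ti) \<circ> (\<lambda>z. of_real (r\<^sup>2) * T z) holomorphic_on VS"
    by (rule holomorphic_on_compose_gen) (auto simp: VS_def norm_mult norm_power)
  then show ?thesis by (simp add: \<sigma>_def comp_def)
qed

lemma R_hol:
  assumes "f holomorphic_on disk" shows "R f holomorphic_on VR"
proof -
  have "f \<circ> Ti holomorphic_on disk"
    by (rule holomorphic_on_compose_gen[OF Ti_hol_disk assms]) (use Ti_disk in auto)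
  moreover have "cnj ` disk = disk" by (auto simp: image_iff intro!: bexI[of _ "cnj _"])
  ultimately have c: "cnj \<circ> (f \<circ> Ti) \<circ> cnj holomorphic_on disk"
    by (subst holomorphic_on_compose_cnj_cnj) simp_all
  have "(\<lambda>z. of_real (r\<^sup>2) / T z) holomorphic_on VR"
    by (intro holomorphic_intros holomorphic_on_subset[OF T_hol]) (auto simp: VR_def)
  from holomorphic_on_compose_gen[OF this c]
  have "(cnj \<circ> (f \<circ> Ti) \<circ> cnj) \<circ> (\<lambda>z. of_real (r\<^sup>2) / T z) holomorphic_on VR"
    by (rule) (auto simp: VR_def norm_divide norm_power)
  then show ?thesis by (simp add: R_def[abs_def] comp_def)
qed

text \<open>The method of images. \<open>W f\<close> is the part in \<open>G0\<close> of the field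
  \<open>indB\<close> times \<open>hgrad f\<close>, whose Helmholtz decomposition is completed by
  the harmonic field \<open>hgrad (S f)\<close> and, according to \<open>W_conjugate\<close>, by a
  rotated field of the same kind. The factor 1/2 distributes the jump of that field across the
  circle evenly between the two orthogonal types.\<close>

definition W :: "(complex \<Rightarrow> complex) \<Rightarrow> complex \<Rightarrow> complex" where
  "W f z = (if z \<in> ball q \<rho> then cnj (deriv (\<lambda>z. (f z - S f z) / 2) z)
     else if z \<in> disk then cnj (deriv (\<lambda>z. (R f z - S f z) / 2) z) else 0)"

text \<open>On the circle of radius \<open>r\<close> in the coordinate \<open>T\<close> the
  reflection fixes every point, so \<open>R f\<close> and \<open>f\<close> have the same real part;
  on the unit circle it acts like the dilation by \<open>r\<^sup>2\<close>, so \<open>R f\<close>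
  and \<open>S f\<close> have the same real part.\<close>

lemma W_G0:
  assumes f: "f holomorphic_on disk" shows "W f \<in> G0"
  unfolding W_def
proof (rule glued_gradient_in_G0[OF \<rho>_pos cball_in_disk open_ball cball_in_disk _ open_VR VR_annulus])
  have "S f holomorphic_on disk" by (rule holomorphic_on_subset[OF S_hol[OF f]]) (use VS_closed_disk in auto)
  then show "(\<lambda>z. (f z - S f z) / 2) holomorphic_on disk" using f by (intro holomorphic_intros) auto
  have "S f holomorphic_on VR" by (rule holomorphic_on_subset[OF S_hol[OF f] VR_sub_VS])
  then show "(\<lambda>z. (R f z - S f z) / 2) holomorphic_on VR" using R_hol[OF f] by (intro holomorphic_intros) auto
  have inv: "of_real (c\<^sup>2) / w = cnj w * of_real ((c / norm w)\<^sup>2)" for c and w :: complex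
  proof (cases "w = 0")
    case False
    have "w * cnj w = of_real ((norm w)\<^sup>2)" by (simp only: complex_norm_square)
    then have "of_real (c\<^sup>2) / w = of_real (c\<^sup>2) * cnj w / of_real ((norm w)\<^sup>2)" using False by (simp add: field_simps)
    then show ?thesis by (simp add: power_divide)
  qed simp
  show "Re ((f z - S f z) / 2) = Re ((R f z - S f z) / 2)" if z: "z \<in> sphere q \<rho>" for z
  proof -
    have "z \<in> cball q \<rho>" using z by simp
    then have "z \<in> disk" using cball_in_disk by blast
    then have nz: "1 - cnj a * z \<noteq> 0" by (intro den_nonzero) auto
    then have "norm (T z) = r" using T_eq_r z by simp
    then have "cnj (of_real (r\<^sup>2) / T z) = T z" using inv[of r "T z"] r by simp
    then have "R f z = cnj (f z)" using Ti_T[OF nz] by (simp add: R_def)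
    then show ?thesis by simp
  qed
  show "Re ((R f z - S f z) / 2) = 0" if z: "z \<in> sphere 0 1" for z
  proof -
    have "norm (T z) = 1" using T_eq_1[of z] z by simp
    then have "cnj (of_real (r\<^sup>2) / T z) = of_real (r\<^sup>2) * T z" using inv[of r "T z"] by (simp add: mult.commute)
    then have "R f z = cnj (S f z)" by (simp add: R_def \<sigma>_def)
    then show ?thesis by simp
  qed
qed

abbreviation indB :: "complex \<Rightarrow> real" where "indB \<equiv> indicator (ball q \<rho>)"

lemma W_inside:
  assumes f: "f holomorphic_on disk" and z: "z \<in> ball q \<rho>"
  shows "W f z = (hgrad f z - hgrad (S f) z) /\<^sub>R 2"
proof -
  have zd: "z \<in> disk" "z \<in> VS" using z cball_in_disk VS_closed_disk by (auto simp: subset_iff less_imp_le)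
  have "(f has_field_derivative deriv f z) (at z)" by (rule holomorphic_derivI[OF f _ zd(1)]) simp
  moreover have "(S f has_field_derivative deriv (S f) z) (at z)" by (rule holomorphic_derivI[OF S_hol[OF f] open_VS zd(2)])
  ultimately have "((\<lambda>z. (f z - S f z) / 2) has_field_derivative (deriv f z - deriv (S f) z) / 2) (at z)"
    by (intro DERIV_cdivide DERIV_diff)
  then show ?thesis using z by (simp add: W_def DERIV_imp_deriv scaleR_conv_of_real)
qed

lemma W_outside:
  assumes f: "f holomorphic_on disk" and z: "z \<in> disk - ball q \<rho>"
  shows "W f z = (cnj (deriv (R f) z) - hgrad (S f) z) /\<^sub>R 2"
proof -
  have zd: "z \<in> VR" "z \<in> VS" using z VR_annulus VS_closed_disk by auto
  have "(R f has_field_derivative deriv (R f) z) (at z)" by (rule holomorphic_derivI[OF R_hol[OF f] open_VR zd(1)])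
  moreover have "(S f has_field_derivative deriv (S f) z) (at z)" by (rule holomorphic_derivI[OF S_hol[OF f] open_VS zd(2)])
  ultimately have "((\<lambda>z. (R f z - S f z) / 2) has_field_derivative (deriv (R f) z - deriv (S f) z) / 2) (at z)"
    by (intro DERIV_cdivide DERIV_diff)
  then show ?thesis using z by (simp add: W_def DERIV_imp_deriv scaleR_conv_of_real)
qed

text \<open>
  The field on the left is divergence free with vanishing normal component: up to a rotation by a
  right angle it is again of the form \<open>W\<close>, for the harmonic conjugate.
\<close>

lemma W_conjugate:
  assumes f: "f holomorphic_on disk" and z: "z \<in> disk"
  shows "W f z + hgrad (S f) z - indB z *\<^sub>R hgrad f z = \<i> * W (\<lambda>z. - \<i> * f z) z"
proof -
  let ?g = "\<lambda>z. - \<i> * f z"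
  have g: "?g holomorphic_on disk" using f by (intro holomorphic_intros)
  have z': "z \<in> VS" using z VS_closed_disk by auto
  have dS: "deriv (S ?g) z = - \<i> * deriv (S f) z"
    by (rule DERIV_imp_deriv) (intro DERIV_cmult holomorphic_derivI[OF S_hol[OF f] open_VS z'])
  show ?thesis
  proof (cases "z \<in> ball q \<rho>")
    case True
    have "deriv ?g z = - \<i> * deriv f z"
      by (rule DERIV_imp_deriv) (intro DERIV_cmult holomorphic_derivI[OF f _ z]; simp)
    then show ?thesis unfolding W_inside[OF f True] W_inside[OF g True] dS
      using True by (auto simp: complex_eq_iff field_simps)
  next
    case False
    then have z2: "z \<in> disk - ball q \<rho>" "z \<in> VR" using z VR_annulus by auto
    have "R ?g = (\<lambda>z. \<i> * R f z)" by (simp add: R_def fun_eq_iff)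
    then have "deriv (R ?g) z = \<i> * deriv (R f) z"
      by (simp only:) (rule DERIV_imp_deriv, intro DERIV_cmult holomorphic_derivI[OF R_hol[OF f] open_VR z2(2)])
    then show ?thesis unfolding W_outside[OF f z2(1)] W_outside[OF g z2(1)] dS
      using False by (auto simp: complex_eq_iff field_simps)
  qed
qed

lemma hgrad_borel:
  assumes "f holomorphic_on disk" shows "hgrad f \<in> borel_measurable MD"
  by (rule continuous_imp_measurable_on_sets_lebesgue)
     (intro continuous_on_cnj holomorphic_on_imp_continuous_on holomorphic_deriv assms open_ball, simp)

lemma S_hgrad_sqint:
  assumes f: "f holomorphic_on disk" shows "hgrad (S f) \<in> sqint"
proof -
  have c: "continuous_on VS (hgrad (S f))"
    using holomorphic_on_imp_continuous_on[OF holomorphic_deriv[OF S_hol[OF f] open_VS]] by (intro continuous_intros)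
  have "bounded (hgrad (S f) ` cball 0 1)"
    by (intro compact_imp_bounded compact_continuous_image continuous_on_subset[OF c VS_closed_disk]) auto
  then obtain B where "\<forall>x\<in>hgrad (S f) ` cball 0 1. norm x \<le> B" unfolding bounded_iff by blast
  then have B: "norm (hgrad (S f) z) \<le> B" if "z \<in> cball 0 1" for z using that by blast
  show ?thesis
  proof (rule sqint_bounded)
    show "hgrad (S f) \<in> borel_measurable MD"
      by (rule hgrad_borel) (rule holomorphic_on_subset[OF S_hol[OF f]], use VS_closed_disk in auto)
    show "AE z in MD. norm (hgrad (S f) z) \<le> B" using B by (intro AE_I2) auto
  qed
qed

lemma indB_sqint: "g \<in> sqint \<Longrightarrow> (\<lambda>z. indB z *\<^sub>R g z) \<in> sqint"
proof (rule sqint_mult[where K=1])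
  have "(indB :: complex \<Rightarrow> real) \<in> borel_measurable borel" by (rule borel_measurable_indicator) simp
  then show "indB \<in> borel_measurable MD" by (intro measurable_restrict_space1 measurable_completion) simp
qed (auto simp: indicator_def)

section \<open>Orthogonality of potential, harmonic and rotated fields\<close>

lemma ip_rotate: "ip (\<lambda>z. \<i> * f z) g = - ip f (\<lambda>z. \<i> * g z)"
proof -
  have "(\<i> * f z) \<bullet> g z = - (f z \<bullet> (\<i> * g z))" for z by (simp add: inner_complex_def)
  then show ?thesis unfolding ip_def by (simp only: Bochner_Integration.integral_minus)
qed

text \<open>A rotated element of \<open>G0\<close> is a divergence-free field with vanishing normal
  component, hence orthogonal to gradients with arbitrary boundary values.\<close>

lemma gradient_rotate_orthogonal:
  assumes "has_weak_gradient disk u g" "g \<in> sqint" "d \<in> G0"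
  shows "ip (\<lambda>z. \<i> * d z) g = 0"
proof -
  have "ip (\<lambda>z. \<i> * g z) d = 0"
    by (rule G0_orthogonal[OF sqint_rotate[OF assms(2)] _ assms(3)]) (simp add: ip_def weak_gradient_curl_free[OF assms(1)])
  then show ?thesis by (simp add: ip_rotate ip_commute[of d])
qed

text \<open>The decomposition paired with an arbitrary gradient of finite energy; the rotated part
  drops out. It is used for harmonic \<open>g\<close>, where the \<open>G0\<close> part drops out as
  well, and for solutions \<open>g\<close> of the two-phase problem.\<close>

lemma W_identity:
  assumes f: "f holomorphic_on disk" "hgrad f \<in> sqint" and g: "has_weak_gradient disk u g" "g \<in> sqint"
  shows "ip (W f) g + ip (hgrad (S f)) g = ip (\<lambda>z. indB z *\<^sub>R hgrad f z) g"
proof -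
  have h: "(\<lambda>z. - \<i> * f z) holomorphic_on disk" using f by (intro holomorphic_intros)
  have s: "W f \<in> sqint" "hgrad (S f) \<in> sqint" "(\<lambda>z. indB z *\<^sub>R hgrad f z) \<in> sqint"
    using G0_sqint[OF W_G0] S_hgrad_sqint indB_sqint f by auto
  have "ip (W f) g + ip (hgrad (S f)) g - ip (\<lambda>z. indB z *\<^sub>R hgrad f z) g
      = ip (\<lambda>z. W f z + hgrad (S f) z - indB z *\<^sub>R hgrad f z) g"
    using ip_diff_left[OF sqint_add[OF s(1,2)] s(3) g(2)] ip_add_left[OF s(1,2) g(2)] by simp
  also have "\<dots> = ip (\<lambda>z. \<i> * W (\<lambda>z. - \<i> * f z) z) g"
    unfolding ip_def by (rule Bochner_Integration.integral_cong) (use W_conjugate[OF f(1)] in auto)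
  also have "\<dots> = 0" by (rule gradient_rotate_orthogonal[OF g W_G0[OF h]])
  finally show ?thesis by simp
qed

text \<open>The field of \<open>f\<close> is the rotated field of \<open>\<i> * f\<close>, a
  gradient of finite energy; so this is \<open>gradient_rotate_orthogonal\<close> read from the
  other side.\<close>

lemma holomorphic_orthogonal:
  assumes "f holomorphic_on disk" "hgrad f \<in> sqint" "d \<in> G0"
  shows "ip (hgrad f) d = 0"
proof -
  let ?h = "\<lambda>z. \<i> * f z"
  have h: "?h holomorphic_on disk" using assms by (intro holomorphic_intros)
  have d: "deriv ?h z = \<i> * deriv f z" if "z \<in> disk" for z
    by (rule DERIV_imp_deriv) (intro DERIV_cmult holomorphic_derivI[OF assms(1) _ that]; simp)
  have hs: "hgrad ?h \<in> sqint"
    unfolding sqint_def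
  proof safe
    show "hgrad ?h \<in> borel_measurable MD" by (rule hgrad_borel[OF h])
    have "integrable MD (\<lambda>z. (norm (hgrad ?h z))\<^sup>2) \<longleftrightarrow> integrable MD (\<lambda>z. (norm (hgrad f z))\<^sup>2)"
      by (rule Bochner_Integration.integrable_cong) (auto simp: d norm_mult)
    then show "integrable MD (\<lambda>z. (norm (hgrad ?h z))\<^sup>2)" using sqint_integrable[OF assms(2)] by simp
  qed
  have "ip (hgrad f) d = ip (\<lambda>z. \<i> * hgrad ?h z) d"
    unfolding ip_def by (rule Bochner_Integration.integral_cong) (auto simp: d)
  also have "\<dots> = - ip (\<lambda>z. \<i> * d z) (hgrad ?h)" by (simp add: ip_rotate ip_commute)
  also have "\<dots> = 0" by (simp only: gradient_rotate_orthogonal[OF holomorphic_weak_gradient[OF h] hs assms(3)])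
  finally show ?thesis .
qed

section \<open>Moments\<close>

text \<open>The \<open>j\<close>-th iterate of \<open>S\<close> as one dilation, which makes
  holomorphy immediate. The recursion \<open>fs_Suc\<close> holds at points of the disk and reaches
  derivatives through \<open>deriv_cong_open\<close>.\<close>

definition fs :: "(complex \<Rightarrow> complex) \<Rightarrow> nat \<Rightarrow> complex \<Rightarrow> complex" where
  "fs f j z = f (\<sigma> (r ^ (2 * j)) z)"

lemma \<sigma>_1: "norm z < 1 \<Longrightarrow> \<sigma> 1 z = z"
  by (simp add: \<sigma>_def Ti_T[OF den_nonzero[OF less_imp_le]])

lemma fs_0: "z \<in> disk \<Longrightarrow> fs f 0 z = f z"
  by (simp add: fs_def \<sigma>_1)

lemma fs_Suc: "z \<in> disk \<Longrightarrow> fs f (Suc j) z = S (fs f j) z"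
proof -
  assume z: "z \<in> disk"
  have "\<sigma> (r ^ (2 * j)) (\<sigma> (r\<^sup>2) z) = \<sigma> (r ^ (2 * j) * r\<^sup>2) z" using z r2 by (intro \<sigma>_comp) auto
  also have "r ^ (2 * j) * r\<^sup>2 = r ^ (2 * Suc j)" by (simp add: power2_eq_square)
  finally show ?thesis by (simp add: fs_def)
qed

lemma rpow: "0 \<le> r ^ n" "r ^ n \<le> 1"
  using r by (auto intro: power_le_one)

lemma \<sigma>_hol: "0 \<le> t \<Longrightarrow> t \<le> 1 \<Longrightarrow> \<sigma> t holomorphic_on disk"
proof -
  assume t: "0 \<le> t" "t \<le> 1"
  have "(\<lambda>z. of_real t * T z) holomorphic_on disk"
    by (intro holomorphic_intros holomorphic_on_subset[OF T_hol]) (use den_nonzero in auto)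
  then have "Ti \<circ> (\<lambda>z. of_real t * T z) holomorphic_on disk"
  proof (rule holomorphic_on_compose_gen[OF _ Ti_hol_disk], intro image_subsetI)
    fix x assume "x \<in> disk"
    then have "norm (T x) < 1" using T_disk by simp
    then have "t * norm (T x) < 1" using t mult_left_le_one_le[of "norm (T x)" t] by (simp add: le_less_trans)
    then show "of_real t * T x \<in> disk" using t by (simp add: norm_mult)
  qed
  then show ?thesis by (simp add: \<sigma>_def[abs_def] comp_def)
qed

lemma fs_hol: "f holomorphic_on disk \<Longrightarrow> fs f j holomorphic_on disk"
proof -
  assume f: "f holomorphic_on disk"
  have "f \<circ> \<sigma> (r ^ (2 * j)) holomorphic_on disk"
    by (rule holomorphic_on_compose_gen[OF \<sigma>_hol[OF rpow] f]) (use \<sigma>_disk[OF rpow] in auto)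
  then show ?thesis by (simp add: fs_def[abs_def] comp_def)
qed

lemma fs_hgrad_Suc: "z \<in> disk \<Longrightarrow> hgrad (fs f (Suc j)) z = hgrad (S (fs f j)) z"
  using deriv_cong_open[OF open_ball, of z 0 1 "fs f (Suc j)" "S (fs f j)"] fs_Suc by simp

lemma fs_hgrad_0: "z \<in> disk \<Longrightarrow> hgrad (fs f 0) z = hgrad f z"
  using deriv_cong_open[OF open_ball, of z 0 1 "fs f 0" f] fs_0 by simp

lemma sqint_cong: "(\<And>z. z \<in> disk \<Longrightarrow> f z = g z) \<Longrightarrow> f \<in> sqint \<longleftrightarrow> g \<in> sqint"
proof -
  assume e: "\<And>z. z \<in> disk \<Longrightarrow> f z = g z"
  have "f \<in> borel_measurable MD \<longleftrightarrow> g \<in> borel_measurable MD" by (rule measurable_cong) (use e in auto)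
  moreover have "integrable MD (\<lambda>z. (norm (f z))\<^sup>2) \<longleftrightarrow> integrable MD (\<lambda>z. (norm (g z))\<^sup>2)"
    by (rule Bochner_Integration.integrable_cong) (use e in auto)
  ultimately show ?thesis by (simp add: sqint_def)
qed

lemma ip_cong: "(\<And>z. z \<in> disk \<Longrightarrow> f z = f' z) \<Longrightarrow> (\<And>z. z \<in> disk \<Longrightarrow> g z = g' z) \<Longrightarrow> ip f g = ip f' g'"
  unfolding ip_def by (rule Bochner_Integration.integral_cong) auto

lemma fs_sqint: "f holomorphic_on disk \<Longrightarrow> hgrad f \<in> sqint \<Longrightarrow> hgrad (fs f j) \<in> sqint"
proof (cases j)
  case 0
  have "hgrad (fs f 0) \<in> sqint \<longleftrightarrow> hgrad f \<in> sqint" by (rule sqint_cong) (rule fs_hgrad_0)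
  with 0 show "hgrad f \<in> sqint \<Longrightarrow> hgrad (fs f j) \<in> sqint" by simp
next
  case (Suc n)
  have "hgrad (fs f (Suc n)) \<in> sqint \<longleftrightarrow> hgrad (S (fs f n)) \<in> sqint" by (rule sqint_cong) (rule fs_hgrad_Suc)
  with Suc show "f holomorphic_on disk \<Longrightarrow> hgrad (fs f j) \<in> sqint"
    using S_hgrad_sqint[OF fs_hol, of f n] by simp
qed

definition mom :: "(complex \<Rightarrow> complex) \<Rightarrow> nat \<Rightarrow> real" where
  "mom f j = ip (hgrad (fs f j)) (hgrad f)"

lemma fs_identity:
  assumes f: "f holomorphic_on disk" "hgrad f \<in> sqint" and g: "has_weak_gradient disk u g" "g \<in> sqint"
  shows "ip (W (fs f j)) g + ip (hgrad (fs f (Suc j))) g = ip (\<lambda>z. indB z *\<^sub>R hgrad (fs f j) z) g"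
proof -
  have "ip (hgrad (fs f (Suc j))) g = ip (hgrad (S (fs f j))) g" by (rule ip_cong[OF fs_hgrad_Suc refl])
  then show ?thesis using W_identity[OF fs_hol[OF f(1)] fs_sqint[OF f] g, of j] by simp
qed

text \<open>The operator \<open>S\<close> represents, with respect to the Dirichlet form of the
  disk, the Dirichlet form of the inclusion. The right-hand form is symmetric and nonnegative, which
  gives self-adjointness and positivity of \<open>S\<close>.\<close>

lemma fs_shift:
  assumes f: "f holomorphic_on disk" "hgrad f \<in> sqint"
  shows "ip (hgrad (fs f (Suc i))) (hgrad (fs f j)) = ip (\<lambda>z. indB z *\<^sub>R hgrad (fs f i) z) (hgrad (fs f j))"
proof -
  have "ip (W (fs f i)) (hgrad (fs f j)) = 0"
    using holomorphic_orthogonal[OF fs_hol[OF f(1)] fs_sqint[OF f] W_G0[OF fs_hol[OF f(1)]]] by (simp only: ip_commute)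
  then show ?thesis using fs_identity[OF f holomorphic_weak_gradient[OF fs_hol[OF f(1)]] fs_sqint[OF f], of i j] by simp
qed

lemma indB_symmetric: "ip (\<lambda>z. indB z *\<^sub>R f z) g = ip (\<lambda>z. indB z *\<^sub>R g z) f"
  by (simp add: ip_def inner_commute)

lemma fs_shift_commute:
  assumes f: "f holomorphic_on disk" "hgrad f \<in> sqint"
  shows "ip (hgrad (fs f (Suc i))) (hgrad (fs f j)) = ip (hgrad (fs f i)) (hgrad (fs f (Suc j)))"
  using fs_shift[OF f, of i j] fs_shift[OF f, of j i]
  by (simp only: indB_symmetric[of "hgrad (fs f i)"] ip_commute[of "hgrad (fs f i)"])

lemma mom_eq:
  assumes f: "f holomorphic_on disk" "hgrad f \<in> sqint"
  shows "ip (hgrad (fs f i)) (hgrad (fs f j)) = mom f (i + j)"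
proof (induction j arbitrary: i)
  case 0
  have "ip (hgrad (fs f i)) (hgrad (fs f 0)) = ip (hgrad (fs f i)) (hgrad f)" by (rule ip_cong[OF refl fs_hgrad_0])
  then show ?case by (simp add: mom_def)
next
  case (Suc j)
  then show ?case using fs_shift_commute[OF f, of i j] by simp
qed

lemma indB_idem: "ip (\<lambda>z. indB z *\<^sub>R f z) g = ip (\<lambda>z. indB z *\<^sub>R f z) (\<lambda>z. indB z *\<^sub>R g z)"
  unfolding ip_def by (rule Bochner_Integration.integral_cong) (auto simp: indicator_def)

text \<open>Even moments are inner products over the disk, odd ones inner products over the
  inclusion. Both parities therefore come with nonnegativity and a Cauchy-Schwarz
  inequality.\<close>

lemma mom_odd:
  assumes f: "f holomorphic_on disk" "hgrad f \<in> sqint"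
  shows "mom f (Suc (i + j)) = ip (\<lambda>z. indB z *\<^sub>R hgrad (fs f i) z) (\<lambda>z. indB z *\<^sub>R hgrad (fs f j) z)"
  using mom_eq[OF f, of "Suc i" j] fs_shift[OF f, of i j] indB_idem[of "hgrad (fs f i)" "hgrad (fs f j)"] by simp

lemma mom_nonneg:
  assumes f: "f holomorphic_on disk" "hgrad f \<in> sqint"
  shows "mom f n \<ge> 0"
proof (cases "even n")
  case True
  then obtain i where "n = i + i" by (metis dvdE mult_2)
  then show ?thesis using mom_eq[OF f, of i i] ip_self_nonneg by metis
next
  case False
  then obtain i where "n = Suc (i + i)" by (metis oddE mult_2 Suc_eq_plus1)
  then show ?thesis using mom_odd[OF f, of i i] ip_self_nonneg by metis
qed

lemma mom_log_convex:
  assumes f: "f holomorphic_on disk" "hgrad f \<in> sqint"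
  shows "(mom f (Suc n))\<^sup>2 \<le> mom f n * mom f (Suc (Suc n))"
proof (cases "even n")
  case True
  then obtain i where n: "n = i + i" by (metis dvdE mult_2)
  have "(ip (hgrad (fs f i)) (hgrad (fs f (Suc i))))\<^sup>2 \<le> ip (hgrad (fs f i)) (hgrad (fs f i)) * ip (hgrad (fs f (Suc i))) (hgrad (fs f (Suc i)))"
    by (intro ip_CS fs_sqint f)
  then show ?thesis by (simp add: mom_eq[OF f] n)
next
  case False
  then obtain i where n: "n = Suc (i + i)" by (metis oddE mult_2 Suc_eq_plus1)
  let ?X = "\<lambda>i z. indB z *\<^sub>R hgrad (fs f i) z"
  have "(ip (?X i) (?X (Suc i)))\<^sup>2 \<le> ip (?X i) (?X i) * ip (?X (Suc i)) (?X (Suc i))"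
    by (intro ip_CS indB_sqint fs_sqint f)
  then show ?thesis unfolding mom_odd[OF f, symmetric] by (simp add: n)
qed

end

section \<open>Decay of the moments and the bound by powers of \<open>r\<^sup>2\<close>\<close>

context inclusion
begin

lemma den_lower: "norm z \<le> 1 \<Longrightarrow> norm (1 - cnj a * z) \<ge> 1 - norm a"
proof -
  assume z: "norm z \<le> 1"
  have "norm a * norm z \<le> norm a * 1" using z by (intro mult_left_mono) auto
  then show ?thesis using norm_triangle_ineq2[of 1 "cnj a * z"] by (simp add: norm_mult)
qed

lemma deriv_bound: "norm z \<le> 1 \<Longrightarrow> norm (of_real (1 - (norm a)\<^sup>2) / (1 - cnj a * z)\<^sup>2) \<le> (1 - (norm a)\<^sup>2) / (1 - norm a)\<^sup>2"
proof -
  assume z: "norm z \<le> 1"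
  have "(1 - norm a)\<^sup>2 \<le> (norm (1 - cnj a * z))\<^sup>2" using den_lower[OF z] a by (intro power_mono) auto
  then show ?thesis using a a2 unfolding norm_divide norm_power norm_of_real
    by (intro frac_le) auto
qed

text \<open>For \<open>i > 0\<close> the dilation maps the disk into a fixed compact part of it,
  where \<open>deriv f\<close> is bounded; the chain rule contributes the factor
  \<open>r ^ (2 * i)\<close> to the field and its square to the energy. \<open>C\<close> depends on
  \<open>f\<close>, which does no harm because only the rate of decay enters.\<close>

lemma mom_even_decay:
  assumes f: "f holomorphic_on disk" "hgrad f \<in> sqint"
  obtains C where "\<And>i. i > 0 \<Longrightarrow> mom f (i + i) \<le> C * (r\<^sup>2) ^ (i + i)"
proof -
  define c where "c = (1 - (norm a)\<^sup>2) / (1 - norm a)\<^sup>2"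
  have c: "c \<ge> 0" using a2 by (simp add: c_def)
  have sub: "Ti ` cball 0 (r\<^sup>2) \<subseteq> disk" using Ti_disk r2 by auto
  have "continuous_on (cball 0 (r\<^sup>2)) Ti"
    using holomorphic_on_imp_continuous_on[OF Ti_hol_disk] by (rule continuous_on_subset) (use r2 in auto)
  then have cp: "compact (Ti ` cball 0 (r\<^sup>2))" by (rule compact_continuous_image) auto
  have "continuous_on (Ti ` cball 0 (r\<^sup>2)) (deriv f)"
    by (rule continuous_on_subset[OF holomorphic_on_imp_continuous_on[OF holomorphic_deriv[OF f(1) open_ball]] sub])
  then have "bounded (deriv f ` Ti ` cball 0 (r\<^sup>2))" by (rule compact_imp_bounded[OF compact_continuous_image[OF _ cp]])
  then obtain M where "\<forall>x\<in>deriv f ` Ti ` cball 0 (r\<^sup>2). norm x \<le> M" unfolding bounded_iff by blast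
  then have M: "norm (deriv f (Ti w)) \<le> M" if "norm w \<le> r\<^sup>2" for w using that by auto
  have M0: "M \<ge> 0" using order_trans[OF norm_ge_zero M[of 0]] by simp
  have "mom f (i + i) \<le> (measure MD (space MD) * (M * c * c)\<^sup>2) * (r\<^sup>2) ^ (i + i)" if i: "i > 0" for i
  proof -
    define t where "t = r ^ (2 * i)"
    have t: "0 \<le> t" "t \<le> r\<^sup>2" "t \<le> 1" unfolding t_def using r rpow i by (auto intro: power_decreasing)
    have b: "norm (hgrad (fs f i) z) \<le> M * c * c * t" if z: "z \<in> disk" for z
    proof -
      have z1: "norm z \<le> 1" using z by simp
      have w: "norm (of_real t * T z) \<le> r\<^sup>2"
        using T_le_1[OF z1] t mult_left_le[of "norm (T z)" t] by (simp add: norm_mult)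
      then have w1: "norm (of_real t * T z) \<le> 1" using r2 by linarith
      have sz: "\<sigma> t z \<in> disk" using \<sigma>_disk[OF t(1,3)] z by simp
      have "(\<sigma> t has_field_derivative (of_real (1 - (norm a)\<^sup>2) / (1 + cnj a * (of_real t * T z))\<^sup>2) *
          (of_real t * (of_real (1 - (norm a)\<^sup>2) / (1 - cnj a * z)\<^sup>2))) (at z)"
        unfolding \<sigma>_def[abs_def] using Ti_deriv[OF den_nonzero'[OF w1]] T_deriv[OF den_nonzero[OF z1]]
        by (intro DERIV_chain2[of Ti] DERIV_cmult) (simp_all add: of_real_diff)
      from DERIV_chain2[OF holomorphic_derivI[OF f(1) open_ball sz] this]
      have "deriv (fs f i) z = deriv f (\<sigma> t z) * ((of_real (1 - (norm a)\<^sup>2) / (1 + cnj a * (of_real t * T z))\<^sup>2) *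
          (of_real t * (of_real (1 - (norm a)\<^sup>2) / (1 - cnj a * z)\<^sup>2)))"
        unfolding fs_def[abs_def] t_def[symmetric] by (rule DERIV_imp_deriv)
      then have "norm (hgrad (fs f i) z) = norm (deriv f (\<sigma> t z)) * (norm (of_real (1 - (norm a)\<^sup>2) / (1 - cnj a * (- (of_real t * T z)))\<^sup>2) *
          (t * norm (of_real (1 - (norm a)\<^sup>2) / (1 - cnj a * z)\<^sup>2)))"
        using t(1) by (simp only: complex_mod_cnj norm_mult norm_of_real abs_of_nonneg mult_minus_right diff_minus_eq_add)
      also have "\<dots> \<le> M * (c * (t * c))"
        unfolding c_def using M[OF w] deriv_bound[of "- (of_real t * T z)"] deriv_bound[OF z1] w1 t M0 a2
        by (intro mult_mono mult_nonneg_nonneg) (auto simp: \<sigma>_def)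
      finally show ?thesis by (simp add: mult_ac)
    qed
    have "mom f (i + i) = ip (hgrad (fs f i)) (hgrad (fs f i))" by (simp add: mom_eq[OF f])
    also have "\<dots> \<le> (\<integral>z. (M * c * c * t)\<^sup>2 \<partial>MD)"
      unfolding ip_self by (rule integral_mono[OF sqint_integrable[OF fs_sqint[OF f]]]) (use b in \<open>auto intro: power_mono\<close>)
    also have "\<dots> = (measure MD (space MD) * (M * c * c)\<^sup>2) * t\<^sup>2" by (simp add: power_mult_distrib)
    also have "t\<^sup>2 = (r\<^sup>2) ^ (i + i)" by (simp add: t_def power_mult[symmetric] mult.commute mult_2_right[symmetric])
    finally show ?thesis .
  qed
  then show ?thesis using that by blast
qed

text \<open>
  By log-convexity the ratios of successive moments increase; by the decay of the even moments
  their limit is at most \<open>r\<^sup>2\<close>.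
\<close>

lemma mom_ratio:
  assumes f: "f holomorphic_on disk" "hgrad f \<in> sqint"
  shows "mom f (Suc n) \<le> r\<^sup>2 * mom f n"
proof (rule ccontr)
  assume "\<not> mom f (Suc n) \<le> r\<^sup>2 * mom f n"
  then have gt: "r\<^sup>2 * mom f n < mom f (Suc n)" by simp
  have r20: "r\<^sup>2 > 0" using r by simp
  have "mom f n \<noteq> 0"
  proof
    assume 0: "mom f n = 0"
    then have "(mom f (Suc n))\<^sup>2 \<le> 0" using mom_log_convex[OF f, of n] by simp
    then show False using gt 0 by simp
  qed
  then have pos: "mom f n > 0" using mom_nonneg[OF f, of n] by simp
  define l where "l = mom f (Suc n) / mom f n"
  have l: "l > r\<^sup>2" using gt pos by (simp add: l_def pos_less_divide_eq)
  then have lpos: "l \<ge> 0" using r20 by linarith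
  \<comment> \<open>A ratio exceeding \<open>r\<^sup>2\<close> never falls again: log-convexity
    divided by moments shown to be positive along the way.\<close>
  have step: "mom f (n + k) > 0 \<and> mom f (Suc (n + k)) \<ge> l * mom f (n + k)" for k
  proof (induction k)
    case 0
    then show ?case using pos by (simp add: l_def)
  next
    case (Suc k)
    let ?m = "n + k"
    have p: "mom f ?m > 0" "mom f (Suc ?m) \<ge> l * mom f ?m" using Suc by auto
    have p1: "mom f (Suc ?m) > 0" using p l r20 by (meson less_le_trans mult_pos_pos order_less_trans)
    have "l * mom f ?m * mom f (Suc ?m) \<le> mom f (Suc ?m) * mom f (Suc ?m)" using p p1 by (intro mult_right_mono) auto
    also have "\<dots> \<le> mom f ?m * mom f (Suc (Suc ?m))" using mom_log_convex[OF f, of ?m] by (simp add: power2_eq_square)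
    finally have "mom f ?m * (l * mom f (Suc ?m)) \<le> mom f ?m * mom f (Suc (Suc ?m))" by (simp add: mult_ac)
    then have "l * mom f (Suc ?m) \<le> mom f (Suc (Suc ?m))" using p(1) by simp
    then show ?case using p1 by simp
  qed
  have grow: "mom f (n + k) \<ge> l ^ k * mom f n" for k
  proof (induction k)
    case (Suc k)
    have "l ^ Suc k * mom f n = l * (l ^ k * mom f n)" by simp
    also have "\<dots> \<le> l * mom f (n + k)" using Suc lpos by (intro mult_left_mono) auto
    also have "\<dots> \<le> mom f (n + Suc k)" using step[of k] by simp
    finally show ?case .
  qed simp
  obtain C where C: "\<And>i. i > 0 \<Longrightarrow> mom f (i + i) \<le> C * (r\<^sup>2) ^ (i + i)" using mom_even_decay[OF f] by blast
  define y where "y = l / r\<^sup>2"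
  have y: "y > 1" using l r20 by (simp add: y_def)
  have "y ^ k \<le> C * l ^ n / mom f n" if "k \<ge> n" "k > 0" for k
  proof -
    \<comment> \<open>Starting from index \<open>n\<close>, this exponent ends at the even index
      \<open>k + k\<close>, where the decay estimate is available.\<close>
    have "l ^ (2 * k - n) * mom f n \<le> mom f (n + (2 * k - n))" by (rule grow)
    also have "n + (2 * k - n) = k + k" using that by simp
    also have "mom f (k + k) \<le> C * (r\<^sup>2) ^ (k + k)" by (rule C) fact
    finally have 1: "l ^ (2 * k - n) * mom f n \<le> C * (r\<^sup>2) ^ (k + k)" .
    have l0: "l > 0" using l r20 by linarith
    have "l ^ (k + k) = l ^ n * l ^ (2 * k - n)" using that by (simp add: power_add[symmetric] mult_2)
    then have "l ^ (k + k) * mom f n = l ^ n * (l ^ (2 * k - n) * mom f n)" by simp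
    also have "\<dots> \<le> l ^ n * (C * (r\<^sup>2) ^ (k + k))" using 1 l0 by (intro mult_left_mono) auto
    finally have "l ^ (k + k) / (r\<^sup>2) ^ (k + k) * mom f n \<le> C * l ^ n" using r20 by (simp add: field_simps)
    then have "y ^ (k + k) * mom f n \<le> C * l ^ n" by (simp add: y_def power_divide)
    moreover have "y ^ k \<le> y ^ (k + k)" using y by (intro power_increasing) auto
    ultimately have "y ^ k * mom f n \<le> C * l ^ n" using pos by (meson mult_right_mono less_imp_le order_trans)
    then show ?thesis using pos by (simp add: pos_le_divide_eq)
  qed
  moreover obtain k where "y ^ k > C * l ^ n / mom f n"
    using real_arch_pow[OF y] by blast
  \<comment> \<open>The Archimedean exponent is raised so that it is both positive and at least
    \<open>n\<close>.\<close>
  moreover have "y ^ k \<le> y ^ (k + Suc n)" using y by (intro power_increasing) auto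
  moreover have "k + Suc n \<ge> n" "k + Suc n > 0" by auto
  ultimately show False by (meson less_le_trans not_less)
qed

lemma mom_bound:
  assumes f: "f holomorphic_on disk" "hgrad f \<in> sqint"
  shows "mom f n \<le> (r\<^sup>2) ^ n * mom f 0"
proof (induction n)
  case (Suc n)
  have "mom f (Suc n) \<le> r\<^sup>2 * mom f n" by (rule mom_ratio[OF f])
  also have "\<dots> \<le> r\<^sup>2 * ((r\<^sup>2) ^ n * mom f 0)" using Suc by (intro mult_left_mono) auto
  finally show ?case by simp
qed simp

section \<open>Energy of the two-phase problem\<close>

definition \<gamma>c :: "real \<Rightarrow> complex \<Rightarrow> real" where "\<gamma>c c z = 1 + (c - 1) * indB z"

lemma indB_measurable: "(indB :: complex \<Rightarrow> real) \<in> borel_measurable MD"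
proof -
  have "(indB :: complex \<Rightarrow> real) \<in> borel_measurable borel" by (rule borel_measurable_indicator) simp
  then show ?thesis by (intro measurable_restrict_space1 measurable_completion) simp
qed

lemma \<gamma>c_conductivity: "K \<ge> 1 \<Longrightarrow> inverse K \<le> c \<Longrightarrow> c \<le> K \<Longrightarrow> conductivity K (\<gamma>c c)"
proof -
  assume K: "K \<ge> 1" "inverse K \<le> c" "c \<le> K"
  have "\<gamma>c c \<in> borel_measurable MD" unfolding \<gamma>c_def[abs_def] using indB_measurable by simp
  moreover have "AE z in MD. inverse K \<le> \<gamma>c c z \<and> \<gamma>c c z \<le> K"
    using K by (intro AE_I2) (auto simp: \<gamma>c_def indicator_def inverse_le_1_iff)
  ultimately show ?thesis using K by (simp add: conductivity_def)
qed

lemma ipg_\<gamma>c: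
  assumes "f \<in> sqint" "g \<in> sqint"
  shows "ipg (\<gamma>c c) f g = ip f g + (c - 1) * ip (\<lambda>z. indB z *\<^sub>R f z) g"
proof -
  have "ipg (\<gamma>c c) f g = ip (\<lambda>z. f z + (c - 1) *\<^sub>R (indB z *\<^sub>R f z)) g"
    unfolding ipg_def \<gamma>c_def by (simp add: scaleR_add_left)
  also have "\<dots> = ip f g + (c - 1) * ip (\<lambda>z. indB z *\<^sub>R f z) g"
    using ip_add_left[OF assms(1) sqint_scaleR[OF indB_sqint[OF assms(1)]] assms(2)] by (simp only: ip_scaleR_left)
  finally show ?thesis .
qed

text \<open>Testing the equation with the image fields \<open>W (fs f j)\<close> links the pairing
  of \<open>g\<close> over the inclusion at stage \<open>j\<close> with that at stage
  \<open>j + 1\<close>; iteration gives a series in \<open>k\<close> with vanishing remainder. The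
  disjunct \<open>k = 0\<close> covers the homogeneous case, in which the quotient carries no
  information.\<close>

lemma two_phase_energy:
  assumes f: "f holomorphic_on disk" "hgrad f \<in> sqint"
    and g: "has_weak_gradient disk u g" "g \<in> sqint"
    and d: "(\<lambda>z. g z - hgrad f z) \<in> G0" and sol: "\<And>w. w \<in> G0 \<Longrightarrow> ipg (\<gamma>c c) g w = 0"
    and c: "c > 0"
  defines "k \<equiv> (c - 1) / (c + 1)"
  shows "(\<lambda>j. k ^ j * mom f (Suc j)) sums ((ipg (\<gamma>c c) g g - mom f 0) / (2 * k)) \<or> k = 0"
proof -
  have k: "\<bar>k\<bar> < 1" using c by (simp add: k_def abs_less_iff field_simps)
  have ck: "(1 - k) * (c - 1) = 2 * k" using c by (simp add: k_def field_simps)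
  have k1: "1 - k \<noteq> 0" using k by auto
  define b where "b j = ip (\<lambda>z. indB z *\<^sub>R hgrad (fs f j) z) g" for j
  have m: "ip (hgrad (fs f j)) g = mom f j" for j
  proof -
    have "ip (hgrad (fs f j)) (\<lambda>z. g z - hgrad f z) = 0" by (rule holomorphic_orthogonal[OF fs_hol[OF f(1)] fs_sqint[OF f] d])
    then show ?thesis using ip_diff_right[OF g(2) f(2) fs_sqint[OF f], of j] by (simp add: mom_def)
  qed
  \<comment> \<open>The weak equation involves \<open>c - 1\<close>; multiplication by
    \<open>1 - k\<close> turns this factor into \<open>2 * k\<close>.\<close>
  have rec: "b j = (1 - k) * mom f (Suc j) + k * b (Suc j)" for j
  proof -
    have W: "W (fs f j) \<in> G0" "W (fs f j) \<in> sqint" using W_G0[OF fs_hol[OF f(1)]] G0_sqint by auto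
    have 1: "ip (W (fs f j)) g = b j - mom f (Suc j)" using fs_identity[OF f g, of j] m[of "Suc j"] by (simp add: b_def)
    \<comment> \<open>Inside the inclusion the image field is half the difference of the fields of
      \<open>fs f j\<close> and \<open>fs f (Suc j)\<close>; this is where stage
      \<open>j + 1\<close> enters.\<close>
    have "ip (\<lambda>z. indB z *\<^sub>R g z) (W (fs f j)) = ip (\<lambda>z. indB z *\<^sub>R W (fs f j) z) g" by (rule indB_symmetric)
    also have "\<dots> = ip (\<lambda>z. (1 / 2) *\<^sub>R (indB z *\<^sub>R hgrad (fs f j) z - indB z *\<^sub>R hgrad (fs f (Suc j)) z)) g"
    proof (rule ip_cong[OF _ refl])
      fix z assume z: "z \<in> disk"
      show "indB z *\<^sub>R W (fs f j) z = (1 / 2) *\<^sub>R (indB z *\<^sub>R hgrad (fs f j) z - indB z *\<^sub>R hgrad (fs f (Suc j)) z)"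
      proof (cases "z \<in> ball q \<rho>")
        case True
        then show ?thesis unfolding W_inside[OF fs_hol[OF f(1)] True] fs_hgrad_Suc[OF z] by simp
      qed simp
    qed
    also have "\<dots> = (b j - b (Suc j)) / 2"
      using ip_diff_left[OF indB_sqint[OF fs_sqint[OF f]] indB_sqint[OF fs_sqint[OF f]] g(2)]
      by (simp add: ip_scaleR_left b_def)
    finally have 2: "ip (\<lambda>z. indB z *\<^sub>R g z) (W (fs f j)) = (b j - b (Suc j)) / 2" .
    have "0 = ip g (W (fs f j)) + (c - 1) * ((b j - b (Suc j)) / 2)"
      using sol[OF W(1)] ipg_\<gamma>c[OF g(2) W(2)] 2 by simp
    then have "0 = (b j - mom f (Suc j)) + (c - 1) * ((b j - b (Suc j)) / 2)" using 1 by (simp add: ip_commute)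
    then have "(1 - k) * ((b j - mom f (Suc j)) + (c - 1) * ((b j - b (Suc j)) / 2)) = 0" by simp
    then have "(1 - k) * (b j - mom f (Suc j)) + ((1 - k) * (c - 1)) * ((b j - b (Suc j)) / 2) = 0"
      by (simp only: distrib_left mult.assoc)
    then have "(1 - k) * (b j - mom f (Suc j)) + k * (b j - b (Suc j)) = 0" unfolding ck by simp
    then show ?thesis by (simp add: algebra_simps)
  qed
  have part: "b 0 = (1 - k) * (\<Sum>j<N. k ^ j * mom f (Suc j)) + k ^ N * b N" for N
  proof (induction N)
    case (Suc N)
    then show ?case by (simp add: rec[of N] algebra_simps)
  qed simp
  have bb: "\<bar>b N\<bar> \<le> sqrt (mom f 0 * ip g g)" for N
  proof -
    have "(b N)\<^sup>2 \<le> ip (\<lambda>z. indB z *\<^sub>R hgrad (fs f N) z) (\<lambda>z. indB z *\<^sub>R hgrad (fs f N) z) * ip g g"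
      unfolding b_def by (intro ip_CS indB_sqint fs_sqint f g)
    also have "\<dots> = mom f (Suc (N + N)) * ip g g" by (simp add: mom_odd[OF f])
    also have "\<dots> \<le> mom f 0 * ip g g"
    proof (rule mult_right_mono[OF _ ip_self_nonneg])
      have "mom f (Suc (N + N)) \<le> (r\<^sup>2) ^ Suc (N + N) * mom f 0" by (rule mom_bound[OF f])
      also have "\<dots> \<le> 1 * mom f 0" by (intro mult_right_mono mom_nonneg[OF f] power_le_one[OF zero_le_power2 less_imp_le[OF r2]])
      finally show "mom f (Suc (N + N)) \<le> mom f 0" by simp
    qed
    finally show ?thesis by (intro real_le_rsqrt) simp
  qed
  have "(\<lambda>N. k ^ N * b N) \<longlonglongrightarrow> 0"
  proof (rule Lim_null_comparison)
    show "\<forall>\<^sub>F N in sequentially. norm (k ^ N * b N) \<le> \<bar>k\<bar> ^ N * sqrt (mom f 0 * ip g g)"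
      using bb by (intro always_eventually allI) (simp add: abs_mult power_abs mult_left_mono)
    show "(\<lambda>N. \<bar>k\<bar> ^ N * sqrt (mom f 0 * ip g g)) \<longlonglongrightarrow> 0"
      using k by (intro tendsto_mult_left_zero LIMSEQ_power_zero) simp
  qed
  then have "(\<lambda>N. (b 0 - k ^ N * b N) / (1 - k)) \<longlonglongrightarrow> (b 0 - 0) / (1 - k)" using k1 by (intro tendsto_intros)
  moreover have "(b 0 - k ^ N * b N) / (1 - k) = (\<Sum>j<N. k ^ j * mom f (Suc j))" for N
    using part[of N] k1 by (simp add: field_simps)
  ultimately have s: "(\<lambda>j. k ^ j * mom f (Suc j)) sums (b 0 / (1 - k))" by (simp add: sums_def)
  \<comment> \<open>One factor of the energy may be replaced by the harmonic field, since the
    difference lies in \<open>G0\<close>; only \<open>b 0\<close> then has to be known.\<close>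
  have "ipg (\<gamma>c c) g g = ipg (\<gamma>c c) g (hgrad f)"
  proof -
    have cond: "conductivity (max c (inverse c)) (\<gamma>c c)"
    proof (intro \<gamma>c_conductivity)
      show "1 \<le> max c (inverse c)" using c one_le_inverse_iff[of c] by (cases "c \<ge> 1") auto
      have "inverse (max c (inverse c)) \<le> inverse (inverse c)" using c by (intro le_imp_inverse_le) auto
      then show "inverse (max c (inverse c)) \<le> c" by simp
    qed simp
    show ?thesis using sol[OF d] ipg_diff_right[OF cond g(2) f(2) g(2)] by simp
  qed
  also have "\<dots> = mom f 0 + (c - 1) * b 0"
  proof -
    have "ip (hgrad (fs f 0)) g = ip (hgrad f) g" by (rule ip_cong[OF fs_hgrad_0 refl])
    then have "ip g (hgrad f) = mom f 0" using m[of 0] by (simp add: ip_commute)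
    moreover have "ip (\<lambda>z. indB z *\<^sub>R g z) (hgrad f) = b 0"
      unfolding b_def indB_symmetric[of g] by (rule ip_cong[OF _ refl]) (simp add: fs_hgrad_0)
    ultimately show ?thesis using ipg_\<gamma>c[OF g(2) f(2)] by simp
  qed
  finally have e: "ipg (\<gamma>c c) g g - mom f 0 = (c - 1) * b 0" by simp
  show ?thesis
  proof (cases "k = 0")
    case False
    have "c - 1 = 2 * k / (1 - k)" using ck k1 by (simp add: nonzero_eq_divide_eq mult.commute)
    then have "(c - 1) * b 0 / (2 * k) = b 0 / (1 - k)" using False by simp
    then show ?thesis using s e by simp
  qed simp
qed

text \<open>The value of 2 k r^2 times the sum over j of (k^j + (-k)^j) r^(2 j): the two geometric
  series for \<open>k\<close> and \<open>- k\<close>, combined.\<close>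

definition contrast :: "real \<Rightarrow> real" where "contrast k = 4 * k * r\<^sup>2 / (1 - k\<^sup>2 * r ^ 4)"

text \<open>Subtracting the two energy series leaves the coefficients
  \<open>k ^ j + (- k) ^ j\<close>, so the bounds on the moments can be inserted term by term;
  equality in all of them gives equality in the sum.\<close>

lemma two_phase_difference:
  assumes f: "f holomorphic_on disk" "hgrad f \<in> sqint" and K: "K > 1" and k: "k = (K - 1) / (K + 1)"
    and g1: "has_weak_gradient disk u1 g1" "g1 \<in> sqint" "(\<lambda>z. g1 z - hgrad f z) \<in> G0" "\<And>w. w \<in> G0 \<Longrightarrow> ipg (\<gamma>c K) g1 w = 0"
    and g2: "has_weak_gradient disk u2 g2" "g2 \<in> sqint" "(\<lambda>z. g2 z - hgrad f z) \<in> G0" "\<And>w. w \<in> G0 \<Longrightarrow> ipg (\<gamma>c (inverse K)) g2 w = 0"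
  shows "ipg (\<gamma>c K) g1 g1 - ipg (\<gamma>c (inverse K)) g2 g2 \<le> contrast k * mom f 0"
    and "(\<And>n. mom f n = (r\<^sup>2) ^ n * mom f 0) \<Longrightarrow> ipg (\<gamma>c K) g1 g1 - ipg (\<gamma>c (inverse K)) g2 g2 = contrast k * mom f 0"
proof -
  have k01: "0 < k" "k < 1" using K by (auto simp: k field_simps)
  have "inverse K - 1 = - (K - 1) / K" "inverse K + 1 = (K + 1) / K" using K by (simp_all add: field_simps)
  then have k': "(inverse K - 1) / (inverse K + 1) = - k" using K by (simp add: k minus_divide_left)
  let ?E1 = "ipg (\<gamma>c K) g1 g1" and ?E2 = "ipg (\<gamma>c (inverse K)) g2 g2"
  have s1: "(\<lambda>j. k ^ j * mom f (Suc j)) sums ((?E1 - mom f 0) / (2 * k))"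
    using two_phase_energy[OF f g1] K k01 k by auto
  have s2: "(\<lambda>j. (- k) ^ j * mom f (Suc j)) sums ((?E2 - mom f 0) / (2 * (- k)))"
    using two_phase_energy[OF f g2] K k01 k' by auto
  have s: "(\<lambda>j. (k ^ j + (- k) ^ j) * mom f (Suc j)) sums ((?E1 - ?E2) / (2 * k))"
    using sums_add[OF s1 s2] k01 by (simp add: distrib_right diff_divide_distrib)
  have kr: "norm (k * r\<^sup>2) < 1" "norm (- k * r\<^sup>2) < 1"
    using k01 r2 mult_le_one[of k "r\<^sup>2"] mult_strict_mono[of k 1 "r\<^sup>2" 1] by (auto simp: abs_mult)
  have "(\<lambda>j. (r\<^sup>2 * mom f 0) * ((k * r\<^sup>2) ^ j + (- k * r\<^sup>2) ^ j)) sums ((r\<^sup>2 * mom f 0) * (1 / (1 - k * r\<^sup>2) + 1 / (1 - (- k * r\<^sup>2))))"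
    by (intro sums_mult sums_add geometric_sums kr)
  moreover have "(r\<^sup>2 * mom f 0) * ((k * r\<^sup>2) ^ j + (- k * r\<^sup>2) ^ j) = (k ^ j + (- k) ^ j) * ((r\<^sup>2) ^ Suc j * mom f 0)" for j
    unfolding power_mult_distrib by (simp add: algebra_simps)
  moreover have "(r\<^sup>2 * mom f 0) * (1 / (1 - k * r\<^sup>2) + 1 / (1 - (- k * r\<^sup>2))) = contrast k * mom f 0 / (2 * k)"
  proof -
    have nz: "1 - k * r\<^sup>2 \<noteq> 0" "1 + k * r\<^sup>2 \<noteq> 0" using kr by auto
    have "1 - k\<^sup>2 * r ^ 4 = (1 - k * r\<^sup>2) * (1 + k * r\<^sup>2)" by (simp add: algebra_simps power2_eq_square eval_nat_numeral)
    moreover have "1 / (1 - k * r\<^sup>2) + 1 / (1 + k * r\<^sup>2) = 2 / ((1 - k * r\<^sup>2) * (1 + k * r\<^sup>2))" using nz by (simp add: field_simps)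
    ultimately have "1 / (1 - k * r\<^sup>2) + 1 / (1 - (- k * r\<^sup>2)) = 2 / (1 - k\<^sup>2 * r ^ 4)" by simp
    moreover have "contrast k * mom f 0 / (2 * k) = (r\<^sup>2 * mom f 0) * (2 / (1 - k\<^sup>2 * r ^ 4))"
    proof -
      have "4 * k * x / d * m / (2 * k) = x * m * (2 / d)" for x d m :: real
        using k01 by (cases "d = 0") (simp_all add: field_simps)
      then show ?thesis unfolding contrast_def .
    qed
    ultimately show ?thesis by (simp only:)
  qed
  ultimately have t: "(\<lambda>j. (k ^ j + (- k) ^ j) * ((r\<^sup>2) ^ Suc j * mom f 0)) sums (contrast k * mom f 0 / (2 * k))" by (simp only:)
  \<comment> \<open>Zero for odd \<open>j\<close> and \<open>2 * k ^ j\<close> for even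
    \<open>j\<close>; without this sign an upper bound on the moments would not bound the
    sum.\<close>
  have kk: "k ^ j + (- k) ^ j \<ge> 0" for j using k01 by (cases "even j") auto
  have "(?E1 - ?E2) / (2 * k) \<le> contrast k * mom f 0 / (2 * k)"
    by (rule sums_le[OF _ s t]) (intro mult_left_mono mom_bound[OF f] kk)
  then show "?E1 - ?E2 \<le> contrast k * mom f 0" using k01 by (simp add: divide_le_cancel)
  assume eq: "\<And>n. mom f n = (r\<^sup>2) ^ n * mom f 0"
  have "(\<lambda>j. (k ^ j + (- k) ^ j) * mom f (Suc j)) sums (contrast k * mom f 0 / (2 * k))" using t by (simp only: eq[of "Suc _"])
  then have "(?E1 - ?E2) / (2 * k) = contrast k * mom f 0 / (2 * k)" using s sums_unique2 by blast
  then show "?E1 - ?E2 = contrast k * mom f 0" using k01 by simp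
qed

text \<open>In the coordinate \<open>T\<close> the dilation is multiplication by
  \<open>r\<^sup>2\<close>, so \<open>T\<close> is an eigenfunction of \<open>S\<close>. Its field
  is bounded because the pole of \<open>T\<close> lies outside the closed disk.\<close>

lemma mom_T: "mom T n = (r\<^sup>2) ^ n * mom T 0"
  and T_hol_disk: "T holomorphic_on disk"
  and T_sqint: "hgrad T \<in> sqint"
  and T_energy_pos: "mom T 0 > 0"
proof -
  show hol: "T holomorphic_on disk" by (rule holomorphic_on_subset[OF T_hol]) (use den_nonzero in auto)
  have dT: "deriv T z = of_real (1 - (norm a)\<^sup>2) / (1 - cnj a * z)\<^sup>2" if "z \<in> disk" for z
    using T_deriv[OF den_nonzero, of z] that by (simp add: DERIV_imp_deriv)
  show sq: "hgrad T \<in> sqint"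
  proof (rule sqint_bounded[OF hgrad_borel[OF hol]])
    show "AE z in MD. norm (hgrad T z) \<le> (1 - (norm a)\<^sup>2) / (1 - norm a)\<^sup>2"
    proof (rule AE_I2)
      fix z assume "z \<in> space MD"
      then have "z \<in> disk" "norm z \<le> 1" by auto
      then show "norm (hgrad T z) \<le> (1 - (norm a)\<^sup>2) / (1 - norm a)\<^sup>2" unfolding complex_mod_cnj using deriv_bound[of z] dT by simp
    qed
  qed
  have fsT: "fs T j z = of_real ((r\<^sup>2) ^ j) * T z" if "z \<in> disk" for j z
  proof -
    have "norm (of_real (r ^ (2 * j)) * T z) = r ^ (2 * j) * norm (T z)"
      by (simp only: norm_mult norm_of_real abs_of_nonneg rpow)
    also have "\<dots> \<le> 1" using T_disk[of z] that rpow[of "2 * j"] by (intro mult_le_one) auto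
    finally have "norm (of_real (r ^ (2 * j)) * T z) \<le> 1" .
    then show ?thesis by (simp add: fs_def \<sigma>_def T_Ti den_nonzero' power_mult)
  qed
  have dfs: "hgrad (fs T j) z = (r\<^sup>2) ^ j *\<^sub>R hgrad T z" if z: "z \<in> disk" for j z
  proof -
    have "deriv (fs T j) z = deriv (\<lambda>z. of_real ((r\<^sup>2) ^ j) * T z) z"
      by (rule deriv_cong_open[OF open_ball z fsT])
    also have "\<dots> = of_real ((r\<^sup>2) ^ j) * deriv T z"
      by (rule DERIV_imp_deriv) (intro DERIV_cmult holomorphic_derivI[OF hol open_ball z])
    finally show ?thesis by (simp add: scaleR_conv_of_real)
  qed
  have mT: "mom T j = (r\<^sup>2) ^ j * ip (hgrad T) (hgrad T)" for j
  proof -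
    have "mom T j = ip (\<lambda>z. (r\<^sup>2) ^ j *\<^sub>R hgrad T z) (hgrad T)" unfolding mom_def by (rule ip_cong[OF dfs refl])
    then show ?thesis by (simp only: ip_scaleR_left)
  qed
  then show "mom T n = (r\<^sup>2) ^ n * mom T 0" by simp
  have "ip (hgrad T) (hgrad T) \<noteq> 0"
  proof
    assume "ip (hgrad T) (hgrad T) = 0"
    then have "AE z in MD. hgrad T z = 0" using ip_self_eq_0_iff[OF sq] by simp
    moreover have "AE z in MD. z \<in> disk" using AE_space[of MD] by simp
    ultimately have "AE z in MD. False"
    proof eventually_elim
      case (elim z)
      then have "of_real (1 - (norm a)\<^sup>2) / (1 - cnj a * z)\<^sup>2 = (0 :: complex)" using dT by simp
      then show ?case using a2 den_nonzero[of z] elim by (simp flip: of_real_diff)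
    qed
    then have "AE z in MD. (1 :: real) = 0" by simp
    then show False using AE_MD_continuous_eq_0[of "\<lambda>_. 1" 0] by simp
  qed
  then show "mom T 0 > 0" using ip_self_nonneg[of "hgrad T"] by (simp add: mT)
qed

end

section \<open>Classes and traces\<close>

text \<open>Ties a potential to one of its weak gradients of finite energy. Classes, cosets, norms
  and energies depend on this field up to null sets only, and the lemmas below translate each of
  them into a statement about fields.\<close>

definition field_of :: "(complex \<Rightarrow> real) \<Rightarrow> (complex \<Rightarrow> complex) \<Rightarrow> bool" where
  "field_of u g \<longleftrightarrow> has_weak_gradient disk u g \<and> g \<in> sqint"

lemma finite_energy_iff: "u \<in> finite_energy disk \<longleftrightarrow> (\<exists>g. field_of u g)"
  by (auto simp: finite_energy_def field_of_def sqint_def has_weak_gradient_def L2_loc_def)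

lemma field_of_diff: "field_of u g \<Longrightarrow> field_of v h \<Longrightarrow> field_of (\<lambda>z. u z - v z) (\<lambda>z. g z - h z)"
  by (auto simp: field_of_def intro: weak_gradient_diff sqint_diff)

lemma field_of_add: "field_of u g \<Longrightarrow> field_of v h \<Longrightarrow> field_of (\<lambda>z. u z + v z) (\<lambda>z. g z + h z)"
  by (auto simp: field_of_def intro: weak_gradient_add sqint_add)

lemma field_of_test: "\<phi> \<in> test_functions \<Omega> \<Longrightarrow> field_of \<phi> (grad \<phi>)"
  by (auto simp: field_of_def intro: test_weak_gradient grad_sqint)

lemma field_of_AE_unique:
  "field_of u g \<Longrightarrow> field_of v h \<Longrightarrow> AE z in MD. u z = v z + c \<Longrightarrow> AE z in MD. g z = h z"
  unfolding field_of_def by (elim conjE) (rule weak_gradient_AE_unique)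

lemma equiv_const_rel: "equiv (finite_energy disk) (const_rel disk)"
proof (rule equivI)
  show "const_rel disk \<subseteq> finite_energy disk \<times> finite_energy disk" by (auto simp: const_rel_def)
  show "refl_on (finite_energy disk) (const_rel disk)"
    by (auto simp: refl_on_def const_rel_def intro!: exI[of _ 0])
  show "sym (const_rel disk)"
  proof (rule symI)
    fix u v assume "(u, v) \<in> const_rel disk"
    then obtain c where "u \<in> finite_energy disk" "v \<in> finite_energy disk" "AE z in MD. u z = v z + c" by (auto simp: const_rel_def)
    moreover from this(3) have "AE z in MD. v z = u z + (- c)" by eventually_elim simp
    ultimately show "(v, u) \<in> const_rel disk" unfolding const_rel_def by blast
  qed
  show "trans (const_rel disk)"
  proof (rule transI)
    fix u v w assume "(u, v) \<in> const_rel disk" "(v, w) \<in> const_rel disk"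
    then obtain c d where "u \<in> finite_energy disk" "w \<in> finite_energy disk" "AE z in MD. u z = v z + c" "AE z in MD. v z = w z + d"
      by (auto simp: const_rel_def)
    moreover from this(3,4) have "AE z in MD. u z = w z + (c + d)" by eventually_elim simp
    ultimately show "(u, w) \<in> const_rel disk" unfolding const_rel_def by blast
  qed
qed

abbreviation cls :: "(complex \<Rightarrow> real) \<Rightarrow> (complex \<Rightarrow> real) set" where "cls \<equiv> H1_class disk"

lemma cls_mem: "v \<in> cls u \<longleftrightarrow> (u, v) \<in> const_rel disk"
  by (simp add: H1_class_def)

text \<open>Potentials with almost everywhere equal weak gradients differ by a constant, so a class
  is the same thing as a field up to null sets.\<close>

lemma cls_eq_iff:
  assumes "field_of u g" "field_of v h"
  shows "cls u = cls v \<longleftrightarrow> (AE z in MD. g z = h z)"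
proof -
  have fe: "u \<in> finite_energy disk" "v \<in> finite_energy disk" using assms by (auto simp: finite_energy_iff)
  have "cls u = cls v \<longleftrightarrow> (u, v) \<in> const_rel disk"
    unfolding H1_class_def using eq_equiv_class_iff[OF equiv_const_rel fe] by simp
  also have "\<dots> \<longleftrightarrow> (AE z in MD. g z = h z)"
  proof
    assume "(u, v) \<in> const_rel disk"
    then obtain c where "AE z in MD. u z = v z + c" by (auto simp: const_rel_def)
    then show "AE z in MD. g z = h z" by (rule field_of_AE_unique[OF assms])
  next
    assume "AE z in MD. g z = h z"
    then have "AE z in MD. g z - h z = 0" by eventually_elim simp
    then obtain c where "AE z in MD. u z - v z = c"
      using weak_gradient_0_const field_of_diff[OF assms] unfolding field_of_def by metis
    then have "AE z in MD. u z = v z + c" by eventually_elim simp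
    then show "(u, v) \<in> const_rel disk" using fe by (auto simp: const_rel_def)
  qed
  finally show ?thesis .
qed

lemma H1_Diamond_iff: "U \<in> H1_Diamond disk \<longleftrightarrow> (\<exists>u g. field_of u g \<and> U = cls u)"
  unfolding H1_Diamond_def quotient_def H1_class_def using finite_energy_iff by blast

lemma cls_H1_Diamond: "field_of u g \<Longrightarrow> cls u \<in> H1_Diamond disk"
  using H1_Diamond_iff by blast

text \<open>\<open>H1_grad\<close> chooses among the weak gradients of all representatives;
  uniqueness up to null sets makes the choice immaterial under integrals.\<close>

lemma H1_grad_AE:
  assumes "field_of u g"
  shows "AE z in MD. H1_grad disk (cls u) z = g z" "H1_grad disk (cls u) \<in> sqint"
proof -
  have "(u, u) \<in> const_rel disk" using assms by (auto simp: const_rel_def finite_energy_iff intro!: exI[of _ 0])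
  then have "u \<in> cls u" by (simp add: cls_mem)
  moreover have "has_weak_gradient disk u g" using assms by (simp add: field_of_def)
  ultimately have "\<exists>h. \<exists>v\<in>cls u. has_weak_gradient disk v h" by blast
  then have "\<exists>v\<in>cls u. has_weak_gradient disk v (H1_grad disk (cls u))" unfolding H1_grad_def by (rule someI_ex)
  then obtain v where v: "v \<in> cls u" "has_weak_gradient disk v (H1_grad disk (cls u))" by blast
  then obtain c where "AE z in MD. u z = v z + c" by (auto simp: cls_mem const_rel_def)
  moreover have "has_weak_gradient disk u g" using assms by (simp add: field_of_def)
  ultimately have "AE z in MD. g z = H1_grad disk (cls u) z" using weak_gradient_AE_unique[OF _ v(2)] by blast
  then show ae: "AE z in MD. H1_grad disk (cls u) z = g z" by eventually_elim simp
  show "H1_grad disk (cls u) \<in> sqint"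
  proof (rule sqintI_bound)
    show "H1_grad disk (cls u) \<in> borel_measurable MD" using v(2) by (auto simp: weak_gradient_iff L2_loc_def)
    show "integrable MD (\<lambda>z. (norm (g z))\<^sup>2)" using assms by (simp add: field_of_def sqint_integrable)
    show "AE z in MD. (norm (H1_grad disk (cls u) z))\<^sup>2 \<le> (norm (g z))\<^sup>2" using ae by eventually_elim simp
  qed
qed

lemma H1_norm_cls: "field_of u g \<Longrightarrow> H1_norm disk (cls u) = sqrt (ip g g)"
proof -
  assume u: "field_of u g"
  have "ip (H1_grad disk (cls u)) (H1_grad disk (cls u)) = ip g g"
    by (rule ip_self_cong_AE) (use H1_grad_AE[OF u] u in \<open>auto simp: sqint_measurable field_of_def\<close>)
  then show ?thesis by (simp add: H1_norm_def ip_self)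
qed

lemma energy_form_cls:
  assumes "field_of u g" "field_of v h" "\<gamma> \<in> borel_measurable MD"
  shows "energy_form disk \<gamma> (cls u) (cls v) = ipg \<gamma> g h"
proof -
  have s: "g \<in> borel_measurable MD" "h \<in> borel_measurable MD" using assms by (auto simp: field_of_def sqint_measurable)
  note m = H1_grad_AE(2)[OF assms(1), THEN sqint_measurable] H1_grad_AE(2)[OF assms(2), THEN sqint_measurable]
  have "energy_form disk \<gamma> (cls u) (cls v) = ip (\<lambda>z. \<gamma> z *\<^sub>R H1_grad disk (cls u) z) (H1_grad disk (cls v))"
    by (simp add: energy_form_def ip_def)
  also have "\<dots> = ip (\<lambda>z. \<gamma> z *\<^sub>R g z) h"
  proof (rule ip_cong_AE)
    show "AE z in MD. \<gamma> z *\<^sub>R H1_grad disk (cls u) z = \<gamma> z *\<^sub>R g z"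
      using H1_grad_AE(1)[OF assms(1)] by eventually_elim simp
  qed (use s m assms(3) H1_grad_AE(1)[OF assms(2)] in auto)
  finally show ?thesis by (simp add: ipg_def)
qed

lemma H1_diff_cls:
  assumes u: "field_of u g" and v: "field_of v h"
  shows "H1_diff disk (cls u) (cls v) = cls (\<lambda>z. u z - v z)"
proof -
  have 1: "cls (\<lambda>z. u' z - v' z) = cls (\<lambda>z. u z - v z)" if uv: "u' \<in> cls u" "v' \<in> cls v" for u' v'
  proof -
    obtain c d where c: "u' \<in> finite_energy disk" "AE z in MD. u z = u' z + c" and d: "v' \<in> finite_energy disk" "AE z in MD. v z = v' z + d"
      using uv by (auto simp: cls_mem const_rel_def)
    obtain g' h' where g': "field_of u' g'" and h': "field_of v' h'" using c d by (auto simp: finite_energy_iff)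
    have "AE z in MD. g z = g' z" "AE z in MD. h z = h' z"
      by (rule field_of_AE_unique[OF u g' c(2)], rule field_of_AE_unique[OF v h' d(2)])
    then have "AE z in MD. g' z - h' z = g z - h z" by eventually_elim simp
    then show ?thesis by (simp add: cls_eq_iff[OF field_of_diff[OF g' h'] field_of_diff[OF u v]])
  qed
  have "u \<in> cls u" "v \<in> cls v" using u v by (auto simp: cls_mem const_rel_def finite_energy_iff intro!: exI[of _ 0])
  then show ?thesis unfolding H1_diff_def using 1 by blast
qed

lemma H10_cls:
  assumes u: "field_of u g" shows "cls u \<in> H10 disk \<longleftrightarrow> g \<in> G0"
proof -
  have n: "H1_norm disk (H1_diff disk (cls u) (cls \<phi>)) = sqrt (ip (\<lambda>z. g z - grad \<phi> z) (\<lambda>z. g z - grad \<phi> z))"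
    if "\<phi> \<in> test_functions disk" for \<phi>
    using H1_norm_cls[OF field_of_diff[OF u field_of_test[OF that]]] by (simp add: H1_diff_cls[OF u field_of_test[OF that]])
  have gs: "g \<in> sqint" using u by (simp add: field_of_def)
  show ?thesis
  proof
    assume H: "cls u \<in> H10 disk"
    show "g \<in> G0"
      unfolding G0_def
    proof (intro CollectI conjI allI impI gs)
      fix e :: real assume "e > 0"
      then have "sqrt e > 0" by simp
      then obtain \<phi> where \<phi>: "\<phi> \<in> test_functions disk" "H1_norm disk (H1_diff disk (cls u) (cls \<phi>)) < sqrt e"
        using H unfolding H10_def by blast
      then show "\<exists>\<phi>\<in>test_functions disk. ip (\<lambda>z. g z - grad \<phi> z) (\<lambda>z. g z - grad \<phi> z) < e"
        using n[OF \<phi>(1)] by (intro bexI[of _ \<phi>]) auto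
    qed
  next
    assume G: "g \<in> G0"
    show "cls u \<in> H10 disk"
      unfolding H10_def
    proof (intro CollectI conjI allI impI cls_H1_Diamond[OF u])
      fix e :: real assume e: "e > 0"
      then have "e\<^sup>2 > 0" by simp
      then obtain \<phi> where \<phi>: "\<phi> \<in> test_functions disk" "ip (\<lambda>z. g z - grad \<phi> z) (\<lambda>z. g z - grad \<phi> z) < e\<^sup>2"
        using G unfolding G0_def by blast
      have "sqrt (ip (\<lambda>z. g z - grad \<phi> z) (\<lambda>z. g z - grad \<phi> z)) < e"
        using \<phi>(2) e by (intro real_less_lsqrt) auto
      then show "\<exists>\<phi>\<in>test_functions disk. H1_norm disk (H1_diff disk (cls u) (cls \<phi>)) < e"
        using n[OF \<phi>(1)] \<phi>(1) by (intro bexI[of _ \<phi>]) (simp only:)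
    qed
  qed
qed

lemma trace_rel_cls:
  assumes u: "field_of u g" and v: "field_of v h"
  shows "(cls u, cls v) \<in> trace_rel disk \<longleftrightarrow> (\<lambda>z. h z - g z) \<in> G0"
proof -
  have "(cls u, cls v) \<in> trace_rel disk \<longleftrightarrow> (\<lambda>z. g z - h z) \<in> G0"
    unfolding trace_rel_def using cls_H1_Diamond[OF u] cls_H1_Diamond[OF v]
    by (simp add: H1_diff_cls[OF u v] H10_cls[OF field_of_diff[OF u v]])
  also have "\<dots> \<longleftrightarrow> (\<lambda>z. h z - g z) \<in> G0"
    using G0_scale[of "\<lambda>z. g z - h z" "-1"] G0_scale[of "\<lambda>z. h z - g z" "-1"] by auto
  finally show ?thesis .
qed

lemma trace_rel_dom: "(U, V) \<in> trace_rel disk \<Longrightarrow> U \<in> H1_Diamond disk" "(U, V) \<in> trace_rel disk \<Longrightarrow> V \<in> H1_Diamond disk"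
  by (auto simp: trace_rel_def)

definition tr :: "(complex \<Rightarrow> real) \<Rightarrow> (complex \<Rightarrow> real) set set" where "tr u = trace_rel disk `` {cls u}"

lemma tr_mem: "field_of u g \<Longrightarrow> V \<in> tr u \<longleftrightarrow> (\<exists>v h. field_of v h \<and> V = cls v \<and> (\<lambda>z. h z - g z) \<in> G0)"
proof -
  assume u: "field_of u g"
  have "V \<in> tr u \<longleftrightarrow> (cls u, V) \<in> trace_rel disk" by (simp add: tr_def)
  also have "\<dots> \<longleftrightarrow> (\<exists>v h. field_of v h \<and> V = cls v \<and> (cls u, cls v) \<in> trace_rel disk)"
  proof
    assume V: "(cls u, V) \<in> trace_rel disk"
    then obtain v h where "field_of v h" "V = cls v" using trace_rel_dom(2)[OF V] unfolding H1_Diamond_iff by blast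
    with V show "\<exists>v h. field_of v h \<and> V = cls v \<and> (cls u, cls v) \<in> trace_rel disk" by metis
  qed (elim exE conjE, simp)
  also have "\<dots> \<longleftrightarrow> (\<exists>v h. field_of v h \<and> V = cls v \<and> (\<lambda>z. h z - g z) \<in> G0)"
    using trace_rel_cls[OF u] by blast
  finally show ?thesis .
qed

lemma H_half_iff: "\<phi> \<in> H_half disk \<longleftrightarrow> (\<exists>u g. field_of u g \<and> \<phi> = tr u)"
proof
  assume "\<phi> \<in> H_half disk"
  then obtain U where U: "U \<in> H1_Diamond disk" "\<phi> = trace_rel disk `` {U}" by (auto simp: H_half_def quotient_def)
  from U(1) obtain u g where "field_of u g" "U = cls u" unfolding H1_Diamond_iff by blast
  with U(2) show "\<exists>u g. field_of u g \<and> \<phi> = tr u" unfolding tr_def by metis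
next
  assume "\<exists>u g. field_of u g \<and> \<phi> = tr u"
  then obtain u g where u: "field_of u g" "\<phi> = tr u" by blast
  show "\<phi> \<in> H_half disk" unfolding H_half_def u(2) tr_def by (rule quotientI[OF cls_H1_Diamond[OF u(1)]])
qed

lemma equiv_trace_rel: "equiv (H1_Diamond disk) (trace_rel disk)"
proof (rule equivI)
  show "trace_rel disk \<subseteq> H1_Diamond disk \<times> H1_Diamond disk" by (auto simp: trace_rel_def)
  show "refl_on (H1_Diamond disk) (trace_rel disk)"
    unfolding refl_on_def
  proof (safe)
    fix U assume "U \<in> H1_Diamond disk"
    then obtain u g where u: "field_of u g" "U = cls u" by (auto simp: H1_Diamond_iff)
    then show "(U, U) \<in> trace_rel disk" using trace_rel_cls[OF u(1) u(1)] G0_zero by simp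
  qed
  show "sym (trace_rel disk)"
  proof (rule symI)
    fix U V assume UV: "(U, V) \<in> trace_rel disk"
    then obtain u g v h where u: "field_of u g" "U = cls u" and v: "field_of v h" "V = cls v"
      using trace_rel_dom H1_Diamond_iff by meson
    then show "(V, U) \<in> trace_rel disk"
      using UV trace_rel_cls[OF u(1) v(1)] trace_rel_cls[OF v(1) u(1)] G0_scale[of "\<lambda>z. h z - g z" "-1"] by simp
  qed
  show "trans (trace_rel disk)"
  proof (rule transI)
    fix U V X assume *: "(U, V) \<in> trace_rel disk" "(V, X) \<in> trace_rel disk"
    then obtain u g v h x i where u: "field_of u g" "U = cls u" and v: "field_of v h" "V = cls v" and x: "field_of x i" "X = cls x"
      using trace_rel_dom H1_Diamond_iff by meson
    then show "(U, X) \<in> trace_rel disk"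
      using * trace_rel_cls[OF u(1) v(1)] trace_rel_cls[OF v(1) x(1)] trace_rel_cls[OF u(1) x(1)]
        G0_add[of "\<lambda>z. h z - g z" "\<lambda>z. i z - h z"] by simp
  qed
qed

lemma tr_eqI:
  assumes "field_of u g" "field_of v h" "(\<lambda>z. h z - g z) \<in> G0"
  shows "tr u = tr v"
  unfolding tr_def using equiv_class_eq[OF equiv_trace_rel] trace_rel_cls[OF assms(1,2)] assms(3) by blast

lemma weak_solution_cls:
  assumes u: "field_of u g" and \<gamma>: "conductivity K \<gamma>"
  shows "weak_solution disk \<gamma> (cls u) \<longleftrightarrow> (\<forall>w\<in>G0. ipg \<gamma> g w = 0)"
proof -
  have m: "\<gamma> \<in> borel_measurable MD" using \<gamma> by (simp add: conductivity_def)
  have gs: "(\<lambda>z. \<gamma> z *\<^sub>R g z) \<in> sqint" using u conductivity_sqint[OF \<gamma>, of g] by (simp add: field_of_def)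
  have "weak_solution disk \<gamma> (cls u) \<longleftrightarrow> (\<forall>\<phi>\<in>test_functions disk. ipg \<gamma> g (grad \<phi>) = 0)"
    unfolding weak_solution_def using cls_H1_Diamond[OF u] energy_form_cls[OF u field_of_test m] by auto
  also have "\<dots> \<longleftrightarrow> (\<forall>w\<in>G0. ipg \<gamma> g w = 0)"
    using G0_grad G0_orthogonal[OF gs] by (auto simp: ipg_def)
  finally show ?thesis .
qed

section \<open>The Dirichlet problem in terms of fields\<close>

text \<open>The boundary condition is the membership of the difference in \<open>G0\<close>. A
  potential is demanded in addition, so that there is a class which
  \<open>dirichlet_solution\<close> can denote.\<close>

definition solves :: "(complex \<Rightarrow> real) \<Rightarrow> (complex \<Rightarrow> complex) \<Rightarrow> (complex \<Rightarrow> complex) \<Rightarrow> bool" where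
  "solves \<gamma> g p \<longleftrightarrow> (\<exists>u. field_of u p) \<and> (\<lambda>z. p z - g z) \<in> G0 \<and> (\<forall>w\<in>G0. ipg \<gamma> p w = 0)"

lemma solvesD:
  assumes "solves \<gamma> g p"
  shows "p \<in> sqint" "(\<lambda>z. p z - g z) \<in> G0" "\<And>w. w \<in> G0 \<Longrightarrow> ipg \<gamma> p w = 0"
  using assms by (auto simp: solves_def field_of_def)

lemma solves_exists:
  assumes \<gamma>: "conductivity K \<gamma>" and u: "field_of u g"
  obtains p where "solves \<gamma> g p"
proof -
  have g: "g \<in> sqint" using u by (simp add: field_of_def)
  obtain d where d: "d \<in> G0" "\<And>w. w \<in> G0 \<Longrightarrow> ipg \<gamma> (\<lambda>z. g z + d z) w = 0" using solution_exists[OF \<gamma> g] by blast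
  obtain w where "w \<in> sqint" "has_weak_gradient disk w d" by (rule G0_weak_gradient[OF d(1)])
  then have "field_of w d" using G0_sqint[OF d(1)] by (simp add: field_of_def)
  then have "solves \<gamma> g (\<lambda>z. g z + d z)" unfolding solves_def using field_of_add[OF u] d by auto
  then show ?thesis by (rule that)
qed

text \<open>The definite description needs uniqueness: the difference of two solutions lies in
  \<open>G0\<close> and may be used as test field in both equations, so its energy vanishes.\<close>

lemma dirichlet_solution_eq:
  assumes \<gamma>: "conductivity K \<gamma>" and u: "field_of u g" and p: "solves \<gamma> g p" and v: "field_of v p"
  shows "dirichlet_solution disk \<gamma> (tr u) = cls v"
  unfolding dirichlet_solution_def
proof (rule the_equality)
  show "cls v \<in> tr u \<and> weak_solution disk \<gamma> (cls v)"
    using tr_mem[OF u] weak_solution_cls[OF v \<gamma>] v solvesD[OF p] by blast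
next
  fix U assume U: "U \<in> tr u \<and> weak_solution disk \<gamma> U"
  then obtain w h where w: "field_of w h" "U = cls w" "(\<lambda>z. h z - g z) \<in> G0" using tr_mem[OF u] by blast
  have h0: "\<forall>w\<in>G0. ipg \<gamma> h w = 0" using U w weak_solution_cls[OF w(1) \<gamma>] by simp
  have hs: "h \<in> sqint" "p \<in> sqint" using w(1) solvesD(1)[OF p] by (auto simp: field_of_def)
  let ?d = "\<lambda>z. h z - p z"
  have d: "?d \<in> G0" using G0_diff[OF w(3) solvesD(2)[OF p]] by simp
  then have ds: "?d \<in> sqint" by (rule G0_sqint)
  have "ipg \<gamma> ?d ?d = ipg \<gamma> h ?d - ipg \<gamma> p ?d" by (rule ipg_diff_left[OF \<gamma> hs ds])
  then have "ipg \<gamma> ?d ?d = 0" using h0 d solvesD(3)[OF p d] by simp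
  then have "inverse K * ip ?d ?d \<le> 0" using ipg_lower[OF \<gamma> ds] by simp
  moreover have "K \<ge> 1" using \<gamma> by (simp add: conductivity_def)
  ultimately have "ip ?d ?d \<le> 0" by (simp add: mult_le_0_iff)
  then have "ip ?d ?d = 0" using ip_self_nonneg[of ?d] by simp
  then have "AE z in MD. ?d z = 0" using ip_self_eq_0_iff[OF ds] by simp
  then have "AE z in MD. h z = p z" by eventually_elim simp
  then show "U = cls v" using cls_eq_iff[OF w(1) v] w(2) by simp
qed

text \<open>The arbitrarily chosen extension of the second trace may be exchanged for the solution
  with that trace, since they differ by an element of \<open>G0\<close>. The right-hand side is
  symmetric, which prepares polarisation.\<close>

lemma DN_map_eq:
  assumes \<gamma>: "conductivity K \<gamma>" and u: "field_of u g" and p: "solves \<gamma> g p"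
    and v: "field_of v h" and p': "solves \<gamma> h p'"
  shows "DN_map disk \<gamma> (tr u) (tr v) = ipg \<gamma> p p'"
proof -
  obtain w where w: "field_of w p" using p by (auto simp: solves_def)
  have m: "\<gamma> \<in> borel_measurable MD" using \<gamma> by (simp add: conductivity_def)
  have "cls v \<in> tr v" using tr_mem[OF v] v G0_zero by force
  then have "(SOME V. V \<in> tr v) \<in> tr v" by (rule someI)
  then obtain x i where x: "field_of x i" "(SOME V. V \<in> tr v) = cls x" "(\<lambda>z. i z - h z) \<in> G0" using tr_mem[OF v] by blast
  have "DN_map disk \<gamma> (tr u) (tr v) = ipg \<gamma> p i"
    unfolding DN_map_def dirichlet_solution_eq[OF \<gamma> u p w] x(2) by (rule energy_form_cls[OF w x(1) m])
  also have "\<dots> = ipg \<gamma> p p'"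
  proof -
    have d: "(\<lambda>z. i z - p' z) \<in> G0" using G0_diff[OF x(3) solvesD(2)[OF p']] by simp
    have "i \<in> sqint" using x(1) by (simp add: field_of_def)
    from ipg_diff_right[OF \<gamma> this solvesD(1)[OF p'] solvesD(1)[OF p]] show ?thesis using solvesD(3)[OF p d] by simp
  qed
  finally show ?thesis .
qed

text \<open>Dirichlet's principle: the mixed term between \<open>p\<close> and the difference, which
  lies in \<open>G0\<close>, vanishes by the weak equation.\<close>

lemma solves_minimal:
  assumes \<gamma>: "conductivity K \<gamma>" and p: "solves \<gamma> g p" and h: "h \<in> sqint" "(\<lambda>z. h z - g z) \<in> G0"
  shows "ipg \<gamma> p p \<le> ipg \<gamma> h h"
proof -
  let ?d = "\<lambda>z. h z - p z"
  have d: "?d \<in> G0" using G0_diff[OF h(2) solvesD(2)[OF p]] by simp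
  then have ds: "?d \<in> sqint" by (rule G0_sqint)
  have ps: "p \<in> sqint" by (rule solvesD(1)[OF p])
  have "ipg \<gamma> (\<lambda>z. p z + ?d z) (\<lambda>z. p z + ?d z) = ipg \<gamma> p p + 2 * ipg \<gamma> p ?d + ipg \<gamma> ?d ?d"
    using ipg_add_left[OF \<gamma> ps ds sqint_add[OF ps ds]] ipg_add_right[OF \<gamma> ps ds ps] ipg_add_right[OF \<gamma> ps ds ds] ipg_commute[of \<gamma> ?d p]
    by linarith
  then have "ipg \<gamma> h h = ipg \<gamma> p p + ipg \<gamma> ?d ?d" using solvesD(3)[OF p d] by simp
  moreover have "ipg \<gamma> ?d ?d \<ge> 0"
  proof -
    have "inverse K * ip ?d ?d \<ge> 0" using \<gamma> ip_self_nonneg[of ?d] by (simp add: conductivity_def)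
    then show ?thesis using ipg_lower[OF \<gamma> ds] by linarith
  qed
  ultimately show ?thesis by simp
qed

lemma solves_add:
  assumes \<gamma>: "conductivity K \<gamma>" and "solves \<gamma> g p" "solves \<gamma> h p'"
  shows "solves \<gamma> (\<lambda>z. g z + h z) (\<lambda>z. p z + p' z)"
  unfolding solves_def
proof (intro conjI ballI)
  show "\<exists>u. field_of u (\<lambda>z. p z + p' z)" using assms field_of_add by (fastforce simp: solves_def)
  show "(\<lambda>z. p z + p' z - (g z + h z)) \<in> G0"
    using G0_add[OF solvesD(2)[OF assms(2)] solvesD(2)[OF assms(3)]] by (simp add: algebra_simps)
  show "ipg \<gamma> (\<lambda>z. p z + p' z) w = 0" if "w \<in> G0" for w
    using ipg_add_left[OF \<gamma> solvesD(1)[OF assms(2)] solvesD(1)[OF assms(3)] G0_sqint[OF that]]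
      solvesD(3)[OF assms(2) that] solvesD(3)[OF assms(3) that] by simp
qed

lemma solves_diff:
  assumes \<gamma>: "conductivity K \<gamma>" and "solves \<gamma> g p" "solves \<gamma> h p'"
  shows "solves \<gamma> (\<lambda>z. g z - h z) (\<lambda>z. p z - p' z)"
  unfolding solves_def
proof (intro conjI ballI)
  show "\<exists>u. field_of u (\<lambda>z. p z - p' z)" using assms field_of_diff by (fastforce simp: solves_def)
  show "(\<lambda>z. p z - p' z - (g z - h z)) \<in> G0"
    using G0_diff[OF solvesD(2)[OF assms(2)] solvesD(2)[OF assms(3)]] by (simp add: algebra_simps)
  show "ipg \<gamma> (\<lambda>z. p z - p' z) w = 0" if "w \<in> G0" for w
    using ipg_diff_left[OF \<gamma> solvesD(1)[OF assms(2)] solvesD(1)[OF assms(3)] G0_sqint[OF that]]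
      solvesD(3)[OF assms(2) that] solvesD(3)[OF assms(3) that] by simp
qed

section \<open>Trace classes represented by holomorphic functions\<close>

definition dirichlet_hol :: "(complex \<Rightarrow> complex) \<Rightarrow> bool" where
  "dirichlet_hol f \<longleftrightarrow> f holomorphic_on disk \<and> hgrad f \<in> sqint"

abbreviation htr :: "(complex \<Rightarrow> complex) \<Rightarrow> (complex \<Rightarrow> real) set set" where "htr f \<equiv> tr (\<lambda>z. Re (f z))"

lemma dirichlet_hol_field: "dirichlet_hol f \<Longrightarrow> field_of (\<lambda>z. Re (f z)) (hgrad f)"
  by (simp add: dirichlet_hol_def field_of_def holomorphic_weak_gradient)

text \<open>Solve the Dirichlet problem for conductivity 1. The resulting field is weakly
  divergence-free and a gradient, so Weyl's lemma turns it into that of a holomorphic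
  function.\<close>

lemma H_half_dirichlet_hol:
  assumes "\<phi> \<in> H_half disk" obtains f where "dirichlet_hol f" "\<phi> = htr f"
proof -
  obtain u g where u: "field_of u g" "\<phi> = tr u" using assms by (auto simp: H_half_iff)
  have c1: "conductivity 1 (\<lambda>z. 1)" by (rule conductivity_const) auto
  obtain p where p: "solves (\<lambda>z. 1) g p" by (rule solves_exists[OF c1 u(1)])
  then obtain v where v: "field_of v p" by (auto simp: solves_def)
  have "(\<integral>z. p z \<bullet> grad \<phi> z \<partial>MD) = 0" if "\<phi> \<in> test_functions disk" for \<phi>
    using solvesD(3)[OF p G0_grad[OF that]] by (simp add: ipg_def ip_def)
  then obtain f where f: "f holomorphic_on disk" "AE z in MD. p z = hgrad f z"
    using harmonic_field_holomorphic v unfolding field_of_def by metis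
  have ps: "p \<in> sqint" using v by (simp add: field_of_def)
  have m: "hgrad f \<in> borel_measurable MD"
    using holomorphic_weak_gradient[OF f(1)] by (auto simp: weak_gradient_iff L2_loc_def)
  have "hgrad f \<in> sqint"
    by (rule sqintI_bound[OF m sqint_integrable[OF ps]]) (use f(2) in \<open>auto elim: eventually_mono\<close>)
  with f have h: "dirichlet_hol f" by (simp add: dirichlet_hol_def)
  have "(\<lambda>z. hgrad f z - g z) \<in> G0"
  proof (rule G0_cong_AE[OF solvesD(2)[OF p]])
    show "(\<lambda>z. hgrad f z - g z) \<in> borel_measurable MD" using m u(1) by (auto simp: field_of_def sqint_measurable)
    show "AE z in MD. hgrad f z - g z = p z - g z" using f(2) by eventually_elim simp
  qed
  then have "tr u = htr f" by (rule tr_eqI[OF u(1) dirichlet_hol_field[OF h]])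
  with h u show ?thesis using that by blast
qed

lemma dirichlet_hol_orthogonal:
  assumes "dirichlet_hol f" "d \<in> G0" shows "ip (hgrad f) d = 0"
proof -
  \<comment> \<open>The statement involves no inclusion, so any admissible parameters serve.\<close>
  interpret inclusion 0 "1/2" by unfold_locales auto
  show ?thesis using holomorphic_orthogonal assms by (simp add: dirichlet_hol_def)
qed

text \<open>The harmonic extension attains the infimum, by Pythagoras: any other extension differs
  from it by an orthogonal field in \<open>G0\<close>.\<close>

lemma norm_half_htr:
  assumes f: "dirichlet_hol f" shows "norm_half disk (htr f) = sqrt (ip (hgrad f) (hgrad f))"
  unfolding norm_half_def
proof (rule cInf_eq_minimum)
  have "cls (\<lambda>z. Re (f z)) \<in> htr f" using tr_mem[OF dirichlet_hol_field[OF f]] dirichlet_hol_field[OF f] G0_zero by force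
  then show "sqrt (ip (hgrad f) (hgrad f)) \<in> H1_norm disk ` htr f"
    by (rule image_eqI[rotated]) (simp add: H1_norm_cls[OF dirichlet_hol_field[OF f]])
  fix x assume "x \<in> H1_norm disk ` htr f"
  then obtain V where V: "V \<in> htr f" "x = H1_norm disk V" by blast
  from V(1)[unfolded tr_mem[OF dirichlet_hol_field[OF f]]]
  obtain v h where v': "field_of v h" "V = cls v" "(\<lambda>z. h z - hgrad f z) \<in> G0" by blast
  then have v: "field_of v h" "x = H1_norm disk (cls v)" "(\<lambda>z. h z - hgrad f z) \<in> G0" using V(2) by auto
  have fs: "hgrad f \<in> sqint" using f by (simp add: dirichlet_hol_def)
  have "ip (\<lambda>z. hgrad f z + (h z - hgrad f z)) (\<lambda>z. hgrad f z + (h z - hgrad f z)) =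
     ip (hgrad f) (hgrad f) + 2 * ip (hgrad f) (\<lambda>z. h z - hgrad f z) + ip (\<lambda>z. h z - hgrad f z) (\<lambda>z. h z - hgrad f z)"
  proof -
    let ?d = "\<lambda>z. h z - hgrad f z"
    have ds: "?d \<in> sqint" by (rule G0_sqint[OF v(3)])
    show ?thesis
      using ip_add_left[OF fs ds sqint_add[OF fs ds]] ip_add_right[OF fs ds fs] ip_add_right[OF fs ds ds] ip_commute[of ?d "hgrad f"]
      by linarith
  qed
  then have "ip (hgrad f) (hgrad f) \<le> ip h h"
    using dirichlet_hol_orthogonal[OF f v(3)] ip_self_nonneg[of "\<lambda>z. h z - hgrad f z"] by simp
  then show "sqrt (ip (hgrad f) (hgrad f)) \<le> x" by (simp add: v(2) H1_norm_cls[OF v(1)])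
qed

lemma dirichlet_hol_linear:
  assumes "dirichlet_hol f" "dirichlet_hol h"
  shows "dirichlet_hol (\<lambda>z. f z + c * h z)" "\<And>z. z \<in> disk \<Longrightarrow> hgrad (\<lambda>z. f z + c * h z) z = hgrad f z + cnj c * hgrad h z"
proof -
  have hol: "f holomorphic_on disk" "h holomorphic_on disk" using assms by (auto simp: dirichlet_hol_def)
  have s: "(\<lambda>z. f z + c * h z) holomorphic_on disk" using hol by (intro holomorphic_intros)
  show d: "hgrad (\<lambda>z. f z + c * h z) z = hgrad f z + cnj c * hgrad h z" if z: "z \<in> disk" for z
  proof -
    have "deriv (\<lambda>z. f z + c * h z) z = deriv f z + c * deriv h z"
      by (rule DERIV_imp_deriv) (intro DERIV_add DERIV_cmult holomorphic_derivI[OF hol(1) open_ball z] holomorphic_derivI[OF hol(2) open_ball z])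
    then show ?thesis by simp
  qed
  have m: "hgrad f \<in> sqint" "hgrad h \<in> sqint" using assms by (auto simp: dirichlet_hol_def)
  have "(\<lambda>z. cnj c * hgrad h z) \<in> sqint" using m(2) by (auto simp: sqint_def norm_mult power_mult_distrib)
  then have "(\<lambda>z. hgrad f z + cnj c * hgrad h z) \<in> sqint" by (rule sqint_add[OF m(1)])
  then have i: "integrable MD (\<lambda>z. (norm (hgrad f z + cnj c * hgrad h z))\<^sup>2)" by (rule sqint_integrable)
  have "hgrad (\<lambda>z. f z + c * h z) \<in> L2_loc disk"
    using holomorphic_weak_gradient[OF s] unfolding weak_gradient_iff by blast
  then have "hgrad (\<lambda>z. f z + c * h z) \<in> borel_measurable MD" unfolding L2_loc_def by blast
  moreover have "AE z in MD. (norm (hgrad (\<lambda>z. f z + c * h z) z))\<^sup>2 \<le> (norm (hgrad f z + cnj c * hgrad h z))\<^sup>2"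
  proof (rule AE_I2)
    fix z assume "z \<in> space MD"
    then have "z \<in> disk" by simp
    then show "(norm (hgrad (\<lambda>z. f z + c * h z) z))\<^sup>2 \<le> (norm (hgrad f z + cnj c * hgrad h z))\<^sup>2" by (simp only: d)
  qed
  ultimately have "hgrad (\<lambda>z. f z + c * h z) \<in> sqint" using i by (intro sqintI_bound)
  with s show "dirichlet_hol (\<lambda>z. f z + c * h z)" by (simp add: dirichlet_hol_def)
qed

section \<open>The norm of the difference of two Dirichlet-to-Neumann maps\<close>

definition en :: "(complex \<Rightarrow> complex) \<Rightarrow> real" where "en f = ip (hgrad f) (hgrad f)"

lemma DN_htr:
  assumes "conductivity K \<gamma>" "dirichlet_hol f" "dirichlet_hol h" "solves \<gamma> (hgrad f) p" "solves \<gamma> (hgrad h) p'"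
  shows "DN_map disk \<gamma> (htr f) (htr h) = ipg \<gamma> p p'"
  by (rule DN_map_eq[OF assms(1) dirichlet_hol_field[OF assms(2)] assms(4) dirichlet_hol_field[OF assms(3)] assms(5)])

lemma solves_cong:
  assumes "solves \<gamma> g p" "\<And>z. z \<in> disk \<Longrightarrow> g z = h z" "h \<in> sqint"
  shows "solves \<gamma> h p"
proof -
  have "(\<lambda>z. p z - h z) \<in> G0"
  proof (rule G0_cong_AE[OF solvesD(2)[OF assms(1)]])
    show "(\<lambda>z. p z - h z) \<in> borel_measurable MD" using solvesD(1)[OF assms(1)] assms(3) by (auto simp: sqint_measurable)
    show "AE z in MD. p z - h z = p z - g z" using assms(2) by (intro AE_I2) auto
  qed
  then show ?thesis using assms(1) by (simp add: solves_def)
qed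

lemma en_cong: "(\<And>z. z \<in> disk \<Longrightarrow> hgrad f z = g z) \<Longrightarrow> en f = ip g g"
  unfolding en_def ip_def by (rule Bochner_Integration.integral_cong) auto

text \<open>Polarisation reduces the symmetric bilinear form to its quadratic form at the sum and
  the difference, and the parallelogram law adds up the two energies. For arguments of energy at
  most 1 the bilinear form is thus bounded by \<open>M\<close> itself, with no loss of a
  constant.\<close>

lemma DN_difference_bound:
  assumes \<gamma>: "conductivity K \<gamma>1" "conductivity K \<gamma>2"
    and Q: "\<And>f p1 p2. dirichlet_hol f \<Longrightarrow> solves \<gamma>1 (hgrad f) p1 \<Longrightarrow> solves \<gamma>2 (hgrad f) p2 \<Longrightarrow>
       \<bar>ipg \<gamma>1 p1 p1 - ipg \<gamma>2 p2 p2\<bar> \<le> M * en f"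
    and f: "dirichlet_hol f" and h: "dirichlet_hol h"
  shows "2 * \<bar>DN_map disk \<gamma>1 (htr f) (htr h) - DN_map disk \<gamma>2 (htr f) (htr h)\<bar> \<le> M * (en f + en h)"
proof -
  obtain p1 where p1: "solves \<gamma>1 (hgrad f) p1" by (rule solves_exists[OF \<gamma>(1) dirichlet_hol_field[OF f]])
  obtain p2 where p2: "solves \<gamma>2 (hgrad f) p2" by (rule solves_exists[OF \<gamma>(2) dirichlet_hol_field[OF f]])
  obtain r1 where r1: "solves \<gamma>1 (hgrad h) r1" by (rule solves_exists[OF \<gamma>(1) dirichlet_hol_field[OF h]])
  obtain r2 where r2: "solves \<gamma>2 (hgrad h) r2" by (rule solves_exists[OF \<gamma>(2) dirichlet_hol_field[OF h]])
  have D: "DN_map disk \<gamma>1 (htr f) (htr h) - DN_map disk \<gamma>2 (htr f) (htr h) = ipg \<gamma>1 p1 r1 - ipg \<gamma>2 p2 r2"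
    by (simp add: DN_htr[OF \<gamma>(1) f h p1 r1] DN_htr[OF \<gamma>(2) f h p2 r2])
  let ?s = "\<lambda>z. f z + 1 * h z" and ?d = "\<lambda>z. f z + (- 1) * h z"
  have hs: "dirichlet_hol ?s" "\<And>z. z \<in> disk \<Longrightarrow> hgrad ?s z = hgrad f z + hgrad h z"
  proof -
    show "dirichlet_hol ?s" by (rule dirichlet_hol_linear(1)[OF f h])
    show "hgrad ?s z = hgrad f z + hgrad h z" if "z \<in> disk" for z
      using dirichlet_hol_linear(2)[OF f h that, of 1] by (simp only: complex_cnj_one mult_1_left)
  qed
  have hd: "dirichlet_hol ?d" "\<And>z. z \<in> disk \<Longrightarrow> hgrad ?d z = hgrad f z - hgrad h z"
  proof -
    show "dirichlet_hol ?d" by (rule dirichlet_hol_linear(1)[OF f h])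
    show "hgrad ?d z = hgrad f z - hgrad h z" if "z \<in> disk" for z
      by (simp only: dirichlet_hol_linear(2)[OF f h that]) simp
  qed
  have sq: "hgrad f \<in> sqint" "hgrad h \<in> sqint" "hgrad ?s \<in> sqint" "hgrad ?d \<in> sqint"
    using f h hs(1) hd(1) unfolding dirichlet_hol_def by blast+
  have s: "solves \<gamma> (hgrad ?s) (\<lambda>z. p z + r z)" "solves \<gamma> (hgrad ?d) (\<lambda>z. p z - r z)"
    if "conductivity K \<gamma>" "solves \<gamma> (hgrad f) p" "solves \<gamma> (hgrad h) r" for \<gamma> p r
    by (rule solves_cong[OF solves_add[OF that] hs(2)[symmetric] sq(3)], assumption)
       (rule solves_cong[OF solves_diff[OF that] hd(2)[symmetric] sq(4)], assumption)
  have pol: "ipg \<gamma> (\<lambda>z. p z + r z) (\<lambda>z. p z + r z) - ipg \<gamma> (\<lambda>z. p z - r z) (\<lambda>z. p z - r z) = 4 * ipg \<gamma> p r"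
    if c: "conductivity K \<gamma>" and p: "p \<in> sqint" and r: "r \<in> sqint" for \<gamma> p r
    using ipg_add_left[OF c p r sqint_add[OF p r]] ipg_add_right[OF c p r p] ipg_add_right[OF c p r r]
      ipg_diff_left[OF c p r sqint_diff[OF p r]] ipg_diff_right[OF c p r p] ipg_diff_right[OF c p r r] ipg_commute[of \<gamma> r p]
    by linarith
  have par: "en ?s + en ?d = 2 * en f + 2 * en h"
  proof -
    have "en ?s = ip (\<lambda>z. hgrad f z + hgrad h z) (\<lambda>z. hgrad f z + hgrad h z)" by (rule en_cong[OF hs(2)])
    moreover have "en ?d = ip (\<lambda>z. hgrad f z - hgrad h z) (\<lambda>z. hgrad f z - hgrad h z)" by (rule en_cong[OF hd(2)])
    ultimately show ?thesis
      unfolding en_def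
      using ip_add_left[OF sq(1,2) sqint_add[OF sq(1,2)]] ip_add_right[OF sq(1,2,1)] ip_add_right[OF sq(1,2,2)]
        ip_diff_left[OF sq(1,2) sqint_diff[OF sq(1,2)]] ip_diff_right[OF sq(1,2,1)] ip_diff_right[OF sq(1,2,2)]
        ip_commute[of "hgrad h" "hgrad f"]
      by linarith
  qed
  have 1: "\<bar>ipg \<gamma>1 (\<lambda>z. p1 z + r1 z) (\<lambda>z. p1 z + r1 z) - ipg \<gamma>2 (\<lambda>z. p2 z + r2 z) (\<lambda>z. p2 z + r2 z)\<bar> \<le> M * en ?s"
    by (rule Q[OF hs(1) s(1)[OF \<gamma>(1) p1 r1] s(1)[OF \<gamma>(2) p2 r2]])
  have 2: "\<bar>ipg \<gamma>1 (\<lambda>z. p1 z - r1 z) (\<lambda>z. p1 z - r1 z) - ipg \<gamma>2 (\<lambda>z. p2 z - r2 z) (\<lambda>z. p2 z - r2 z)\<bar> \<le> M * en ?d"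
    by (rule Q[OF hd(1) s(2)[OF \<gamma>(1) p1 r1] s(2)[OF \<gamma>(2) p2 r2]])
  have "4 * \<bar>A - B\<bar> \<le> m1 + m2" if "\<bar>X1 - X2\<bar> \<le> m1" "\<bar>Y1 - Y2\<bar> \<le> m2" "X1 - Y1 = 4 * A" "X2 - Y2 = 4 * B"
    for A B X1 X2 Y1 Y2 m1 m2 :: real
    using that unfolding abs_le_iff by (cases "A \<ge> B") simp_all
  from this[OF 1 2 pol[OF \<gamma>(1) solvesD(1)[OF p1] solvesD(1)[OF r1]] pol[OF \<gamma>(2) solvesD(1)[OF p2] solvesD(1)[OF r2]]]
  have "4 * \<bar>ipg \<gamma>1 p1 r1 - ipg \<gamma>2 p2 r2\<bar> \<le> M * en ?s + M * en ?d" .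
  also have "\<dots> = M * (en ?s + en ?d)" by (rule distrib_left[symmetric])
  also have "\<dots> = M * (2 * en f + 2 * en h)" by (simp only: par)
  finally show ?thesis unfolding D by (simp add: algebra_simps)
qed

abbreviation DD :: "(complex \<Rightarrow> real) \<Rightarrow> (complex \<Rightarrow> real) \<Rightarrow> (complex \<Rightarrow> real) set set \<Rightarrow> (complex \<Rightarrow> real) set set \<Rightarrow> real" where
  "DD \<gamma>1 \<gamma>2 \<equiv> (\<lambda>\<phi> \<psi>. DN_map disk \<gamma>1 \<phi> \<psi> - DN_map disk \<gamma>2 \<phi> \<psi>)"

lemma norm_half_en: "dirichlet_hol f \<Longrightarrow> norm_half disk (htr f) = sqrt (en f)"
  using norm_half_htr by (simp add: en_def)

lemma htr_H_half: "dirichlet_hol f \<Longrightarrow> htr f \<in> H_half disk"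
  using H_half_iff dirichlet_hol_field by blast

lemma en_scale:
  assumes "dirichlet_hol f"
  shows "dirichlet_hol (\<lambda>z. of_real c * f z)" "en (\<lambda>z. of_real c * f z) = c\<^sup>2 * en f"
proof -
  have z: "dirichlet_hol (\<lambda>z. 0)" by (simp add: dirichlet_hol_def sqint_zero)
  show "dirichlet_hol (\<lambda>z. of_real c * f z)" using dirichlet_hol_linear(1)[OF z assms, of "of_real c"] by simp
  have "hgrad (\<lambda>z. of_real c * f z) w = c *\<^sub>R hgrad f w" if "w \<in> disk" for w
    using dirichlet_hol_linear(2)[OF z assms that, of "of_real c"] by (simp add: scaleR_conv_of_real)
  from en_cong[OF this] show "en (\<lambda>z. of_real c * f z) = c\<^sup>2 * en f"
    by (simp add: en_def ip_scaleR_left ip_scaleR_right power2_eq_square)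
qed

text \<open>Both suprema are taken over real sets: \<open>M\<close> shows that they are bounded
  above, and \<open>f0\<close>, normalised to norm 1, that they are nonempty. Pairing the normalised
  \<open>f0\<close> with itself gives the lower bound.\<close>

lemma norm_star_bounds:
  assumes \<gamma>: "conductivity K \<gamma>1" "conductivity K \<gamma>2" and M: "M \<ge> 0"
    and Q: "\<And>f p1 p2. dirichlet_hol f \<Longrightarrow> solves \<gamma>1 (hgrad f) p1 \<Longrightarrow> solves \<gamma>2 (hgrad f) p2 \<Longrightarrow>
       \<bar>ipg \<gamma>1 p1 p1 - ipg \<gamma>2 p2 p2\<bar> \<le> M * en f"
    and f0: "dirichlet_hol f0" "en f0 > 0"
  shows "norm_star disk (DD \<gamma>1 \<gamma>2) \<le> M"
    and "\<And>p1 p2. solves \<gamma>1 (hgrad f0) p1 \<Longrightarrow> solves \<gamma>2 (hgrad f0) p2 \<Longrightarrow>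
       ipg \<gamma>1 p1 p1 - ipg \<gamma>2 p2 p2 \<le> norm_star disk (DD \<gamma>1 \<gamma>2) * en f0"
proof -
  have bound: "\<bar>DD \<gamma>1 \<gamma>2 \<phi> \<psi>\<bar> \<le> M"
    if \<phi>: "\<phi> \<in> H_half disk" "norm_half disk \<phi> \<le> 1" and \<psi>: "\<psi> \<in> H_half disk" "norm_half disk \<psi> \<le> 1" for \<phi> \<psi>
  proof -
    obtain f where f: "dirichlet_hol f" "\<phi> = htr f" using H_half_dirichlet_hol[OF \<phi>(1)] by blast
    obtain h where h: "dirichlet_hol h" "\<psi> = htr h" using H_half_dirichlet_hol[OF \<psi>(1)] by blast
    have "en f \<le> 1" "en h \<le> 1" using \<phi>(2) \<psi>(2) f h by (auto simp: norm_half_en)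
    then have "M * (en f + en h) \<le> M * 2" using M by (intro mult_left_mono) auto
    then show ?thesis using DN_difference_bound[OF \<gamma> Q f(1) h(1)] f h by simp
  qed
  define t where "t = 1 / sqrt (en f0)"
  define f1 where "f1 z = of_real t * f0 z" for z
  have f1: "dirichlet_hol f1" "en f1 = 1"
    using en_scale[OF f0(1), of t] f0(2) by (simp_all add: f1_def[abs_def] t_def power_divide)
  then have n1: "htr f1 \<in> H_half disk" "norm_half disk (htr f1) = 1" using htr_H_half norm_half_en by auto
  have inner: "norm_minus_half disk (DD \<gamma>1 \<gamma>2 \<phi>) \<le> M" and up: "\<And>\<psi>. \<psi> \<in> H_half disk \<Longrightarrow> norm_half disk \<psi> \<le> 1 \<Longrightarrow>
      \<bar>DD \<gamma>1 \<gamma>2 \<phi> \<psi>\<bar> \<le> norm_minus_half disk (DD \<gamma>1 \<gamma>2 \<phi>)" if \<phi>: "\<phi> \<in> H_half disk" "norm_half disk \<phi> = 1" for \<phi>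
  proof -
    let ?S = "{\<bar>DD \<gamma>1 \<gamma>2 \<phi> \<psi>\<bar> |\<psi>. \<psi> \<in> H_half disk \<and> norm_half disk \<psi> \<le> 1}"
    have b: "x \<le> M" if "x \<in> ?S" for x using that bound[of \<phi>] \<phi> by auto
    have ne: "?S \<noteq> {}" using n1 by auto
    show "norm_minus_half disk (DD \<gamma>1 \<gamma>2 \<phi>) \<le> M" unfolding norm_minus_half_def using ne b by (rule cSup_least)
    have "bdd_above ?S" using b by (rule bdd_aboveI)
    then show "\<bar>DD \<gamma>1 \<gamma>2 \<phi> \<psi>\<bar> \<le> norm_minus_half disk (DD \<gamma>1 \<gamma>2 \<phi>)"
      if "\<psi> \<in> H_half disk" "norm_half disk \<psi> \<le> 1" for \<psi>
      unfolding norm_minus_half_def using that by (intro cSup_upper) auto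
  qed
  let ?T = "{norm_minus_half disk (DD \<gamma>1 \<gamma>2 \<phi>) |\<phi>. \<phi> \<in> H_half disk \<and> norm_half disk \<phi> = 1}"
  have bT: "x \<le> M" if "x \<in> ?T" for x using that inner by auto
  have neT: "?T \<noteq> {}" using n1 by auto
  show "norm_star disk (DD \<gamma>1 \<gamma>2) \<le> M" unfolding norm_star_def using neT bT by (rule cSup_least)
  have bdd: "bdd_above ?T" using bT by (rule bdd_aboveI)
  fix p1 p2 assume p: "solves \<gamma>1 (hgrad f0) p1" "solves \<gamma>2 (hgrad f0) p2"
  obtain r1 where r1: "solves \<gamma>1 (hgrad f1) r1" by (rule solves_exists[OF \<gamma>(1) dirichlet_hol_field[OF f1(1)]])
  obtain r2 where r2: "solves \<gamma>2 (hgrad f1) r2" by (rule solves_exists[OF \<gamma>(2) dirichlet_hol_field[OF f1(1)]])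
  have "DD \<gamma>1 \<gamma>2 (htr f1) (htr f1) \<le> norm_minus_half disk (DD \<gamma>1 \<gamma>2 (htr f1))"
    using up[OF n1 n1(1)] n1(2) by simp
  also have "\<dots> \<le> norm_star disk (DD \<gamma>1 \<gamma>2)" unfolding norm_star_def using n1 bdd by (intro cSup_upper) auto
  finally have N: "ipg \<gamma>1 r1 r1 - ipg \<gamma>2 r2 r2 \<le> norm_star disk (DD \<gamma>1 \<gamma>2)"
    by (simp add: DN_htr[OF \<gamma>(1) f1(1) f1(1) r1 r1] DN_htr[OF \<gamma>(2) f1(1) f1(1) r2 r2])
  have g1: "hgrad f1 z = t *\<^sub>R hgrad f0 z" if "z \<in> disk" for z
  proof -
    have zz: "dirichlet_hol (\<lambda>z. 0)" by (simp add: dirichlet_hol_def sqint_zero)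
    show ?thesis using dirichlet_hol_linear(2)[OF zz f0(1) that, of "of_real t"]
      by (simp add: f1_def[abs_def] scaleR_conv_of_real)
  qed
  have t: "t > 0" "t\<^sup>2 * en f0 = 1" using f0(2) by (simp_all add: t_def power_divide)
  \<comment> \<open>The two fields agree up to the scale factor only almost everywhere, so their
    energies are compared by minimality in both directions, each rescaled field competing with the
    other.\<close>
  have le: "ipg \<gamma> r r = t\<^sup>2 * ipg \<gamma> p p" if c: "conductivity K \<gamma>" and p: "solves \<gamma> (hgrad f0) p" and r: "solves \<gamma> (hgrad f1) r" for \<gamma> p r
  proof (rule antisym)
    have ps: "p \<in> sqint" and rs: "r \<in> sqint" using solvesD(1) p r by auto
    have "(\<lambda>z. t *\<^sub>R p z - hgrad f1 z) \<in> G0"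
    proof (rule G0_cong_AE[OF G0_scale[OF solvesD(2)[OF p], of t]])
      show "(\<lambda>z. t *\<^sub>R p z - hgrad f1 z) \<in> borel_measurable MD"
        using ps f1(1) by (auto simp: dirichlet_hol_def sqint_measurable)
      show "AE z in MD. t *\<^sub>R p z - hgrad f1 z = t *\<^sub>R (p z - hgrad f0 z)" by (intro AE_I2) (auto simp: g1 scaleR_diff_right)
    qed
    from solves_minimal[OF c r sqint_scaleR[OF ps] this] show "ipg \<gamma> r r \<le> t\<^sup>2 * ipg \<gamma> p p"
      by (simp add: ipg_scale_left ipg_scale_right power2_eq_square mult.assoc)
    have "(\<lambda>z. (1 / t) *\<^sub>R r z - hgrad f0 z) \<in> G0"
    proof (rule G0_cong_AE[OF G0_scale[OF solvesD(2)[OF r], of "1 / t"]])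
      show "(\<lambda>z. (1 / t) *\<^sub>R r z - hgrad f0 z) \<in> borel_measurable MD"
        using rs f0(1) by (auto simp: dirichlet_hol_def sqint_measurable)
      show "AE z in MD. (1 / t) *\<^sub>R r z - hgrad f0 z = (1 / t) *\<^sub>R (r z - hgrad f1 z)"
        using t(1) by (intro AE_I2) (auto simp: g1 scaleR_diff_right)
    qed
    from solves_minimal[OF c p sqint_scaleR[OF rs] this] have "ipg \<gamma> p p \<le> (1 / t)\<^sup>2 * ipg \<gamma> r r"
      by (simp add: ipg_scale_left ipg_scale_right power2_eq_square)
    then show "t\<^sup>2 * ipg \<gamma> p p \<le> ipg \<gamma> r r" using t(1) by (simp add: power_divide field_simps)
  qed
  have "t\<^sup>2 * (ipg \<gamma>1 p1 p1 - ipg \<gamma>2 p2 p2) \<le> norm_star disk (DD \<gamma>1 \<gamma>2)"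
    using N le[OF \<gamma>(1) p(1) r1] le[OF \<gamma>(2) p(2) r2] by (simp add: right_diff_distrib)
  then have "(t\<^sup>2 * (ipg \<gamma>1 p1 p1 - ipg \<gamma>2 p2 p2)) * en f0 \<le> norm_star disk (DD \<gamma>1 \<gamma>2) * en f0"
    using f0(2) by (intro mult_right_mono) auto
  moreover have "(t\<^sup>2 * (ipg \<gamma>1 p1 p1 - ipg \<gamma>2 p2 p2)) * en f0 = (t\<^sup>2 * en f0) * (ipg \<gamma>1 p1 p1 - ipg \<gamma>2 p2 p2)"
    by (simp only: mult_ac)
  ultimately show "ipg \<gamma>1 p1 p1 - ipg \<gamma>2 p2 p2 \<le> norm_star disk (DD \<gamma>1 \<gamma>2) * en f0" by (simp only: t(2) mult_1_left)
qed

lemma Gamma_cond_conductivity: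
  assumes "K > 1" "\<gamma> \<in> Gamma_cond disk K \<rho> q" shows "conductivity K \<gamma>"
  using assms by (simp add: Gamma_cond_def conductivity_def)

section \<open>Extreme conductivities and indistinguishability for one inclusion\<close>

context inclusion
begin

lemma mom_0: "dirichlet_hol f \<Longrightarrow> mom f 0 = en f"
  unfolding mom_def en_def by (rule ip_cong[OF fs_hgrad_0 refl])

text \<open>Each inequality combines minimality, with the solution of the larger conductivity as
  competitor, and pointwise comparison of the conductivities.\<close>

lemma energy_sandwich:
  assumes K: "K > 1" and \<gamma>: "\<gamma> \<in> Gamma_cond disk K \<rho> q"
    and f: "dirichlet_hol f" and p: "solves \<gamma> (hgrad f) p"
    and pl: "solves (\<gamma>c (inverse K)) (hgrad f) pl" and pu: "solves (\<gamma>c K) (hgrad f) pu"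
  shows "ipg (\<gamma>c (inverse K)) pl pl \<le> ipg \<gamma> p p" "ipg \<gamma> p p \<le> ipg (\<gamma>c K) pu pu"
proof -
  have iK: "inverse K \<le> 1" using K by (simp add: inverse_le_1_iff)
  have c: "conductivity K \<gamma>" "conductivity K (\<gamma>c (inverse K))" "conductivity K (\<gamma>c K)"
    using Gamma_cond_conductivity[OF K \<gamma>] K iK by (auto intro!: \<gamma>c_conductivity)
  have AE: "AE z in MD. inverse K \<le> \<gamma> z \<and> \<gamma> z \<le> K" "AE z in MD. \<gamma> z = 1 + indB z * (\<gamma> z - 1)"
    using \<gamma> by (auto simp: Gamma_cond_def)
  have lo: "AE z in MD. \<gamma>c (inverse K) z \<le> \<gamma> z" and hi: "AE z in MD. \<gamma> z \<le> \<gamma>c K z"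
  proof -
    have "\<gamma>c (inverse K) z \<le> \<gamma> z \<and> \<gamma> z \<le> \<gamma>c K z"
      if "inverse K \<le> \<gamma> z \<and> \<gamma> z \<le> K" "\<gamma> z = 1 + indB z * (\<gamma> z - 1)" for z
      using that by (cases "z \<in> ball q \<rho>") (simp_all add: \<gamma>c_def)
    then have "AE z in MD. \<gamma>c (inverse K) z \<le> \<gamma> z \<and> \<gamma> z \<le> \<gamma>c K z" by (rule eventually_elim2[OF AE])
    then show "AE z in MD. \<gamma>c (inverse K) z \<le> \<gamma> z" "AE z in MD. \<gamma> z \<le> \<gamma>c K z" by (rule eventually_mono, blast)+
  qed
  have "ipg (\<gamma>c (inverse K)) pl pl \<le> ipg (\<gamma>c (inverse K)) p p"
    by (rule solves_minimal[OF c(2) pl solvesD(1,2)[OF p]])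
  also have "\<dots> \<le> ipg \<gamma> p p" by (rule ipg_mono[OF c(2,1) lo solvesD(1)[OF p]])
  finally show "ipg (\<gamma>c (inverse K)) pl pl \<le> ipg \<gamma> p p" .
  have "ipg \<gamma> p p \<le> ipg \<gamma> pu pu" by (rule solves_minimal[OF c(1) p solvesD(1,2)[OF pu]])
  also have "\<dots> \<le> ipg (\<gamma>c K) pu pu" by (rule ipg_mono[OF c(1,3) hi solvesD(1)[OF pu]])
  finally show "ipg \<gamma> p p \<le> ipg (\<gamma>c K) pu pu" .
qed

lemma extreme_difference:
  assumes K: "K > 1" and k: "k = (K - 1) / (K + 1)" and f: "dirichlet_hol f"
    and pl: "solves (\<gamma>c (inverse K)) (hgrad f) pl" and pu: "solves (\<gamma>c K) (hgrad f) pu"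
  shows "ipg (\<gamma>c K) pu pu - ipg (\<gamma>c (inverse K)) pl pl \<le> contrast k * en f"
    and "f = T \<Longrightarrow> ipg (\<gamma>c K) pu pu - ipg (\<gamma>c (inverse K)) pl pl = contrast k * en f"
proof -
  have hf: "f holomorphic_on disk" "hgrad f \<in> sqint" using f by (auto simp: dirichlet_hol_def)
  obtain u1 where u1: "has_weak_gradient disk u1 pu" "pu \<in> sqint" using pu by (auto simp: solves_def field_of_def)
  obtain u2 where u2: "has_weak_gradient disk u2 pl" "pl \<in> sqint" using pl by (auto simp: solves_def field_of_def)
  note D = two_phase_difference[OF hf K k u1 solvesD(2)[OF pu] solvesD(3)[OF pu] u2 solvesD(2)[OF pl] solvesD(3)[OF pl]]
  show "ipg (\<gamma>c K) pu pu - ipg (\<gamma>c (inverse K)) pl pl \<le> contrast k * en f" using D(1) mom_0[OF f] by simp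
  show "ipg (\<gamma>c K) pu pu - ipg (\<gamma>c (inverse K)) pl pl = contrast k * en f" if "f = T"
  proof -
    have "mom f n = (r\<^sup>2) ^ n * mom f 0" for n unfolding that by (rule mom_T)
    from D(2)[OF _ _ this] show ?thesis by (simp only: mom_0[OF f])
  qed
qed

lemma dirichlet_hol_T: "dirichlet_hol T"
  using T_hol_disk T_sqint by (simp add: dirichlet_hol_def)

lemma en_T_pos: "en T > 0"
  using T_energy_pos mom_0[OF dirichlet_hol_T] by simp

lemma contrast_nonneg: "0 \<le> k \<Longrightarrow> k \<le> 1 \<Longrightarrow> contrast k \<ge> 0"
proof -
  assume k: "0 \<le> k" "k \<le> 1"
  have "k\<^sup>2 * r ^ 4 \<le> 1" using k r by (intro mult_le_one power_le_one) auto
  then show ?thesis using k by (simp add: contrast_def)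
qed

text \<open>Both energies lie between those of the two extreme conductivities, so they differ by at
  most the length of that interval.\<close>

lemma quadratic_bound:
  assumes K: "K > 1" and k: "k = (K - 1) / (K + 1)"
    and \<gamma>: "\<gamma>1 \<in> Gamma_cond disk K \<rho> q" "\<gamma>2 \<in> Gamma_cond disk K \<rho> q"
    and f: "dirichlet_hol f" and p: "solves \<gamma>1 (hgrad f) p1" "solves \<gamma>2 (hgrad f) p2"
  shows "\<bar>ipg \<gamma>1 p1 p1 - ipg \<gamma>2 p2 p2\<bar> \<le> contrast k * en f"
proof -
  have iK: "inverse K \<le> 1" using K by (simp add: inverse_le_1_iff)
  have c: "conductivity K (\<gamma>c (inverse K))" "conductivity K (\<gamma>c K)"
    using K iK by (auto intro!: \<gamma>c_conductivity)
  obtain pl where pl: "solves (\<gamma>c (inverse K)) (hgrad f) pl" by (rule solves_exists[OF c(1) dirichlet_hol_field[OF f]])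
  obtain pu where pu: "solves (\<gamma>c K) (hgrad f) pu" by (rule solves_exists[OF c(2) dirichlet_hol_field[OF f]])
  show ?thesis
    using energy_sandwich[OF K \<gamma>(1) f p(1) pl pu] energy_sandwich[OF K \<gamma>(2) f p(2) pl pu] extreme_difference(1)[OF K k f pl pu]
    by linarith
qed

lemma indistinguishable_inclusion:
  assumes K: "K > 1" and k: "k = (K - 1) / (K + 1)"
    and \<gamma>: "\<gamma>1 \<in> Gamma_cond disk K \<rho> q" "\<gamma>2 \<in> Gamma_cond disk K \<rho> q" and e: "contrast k \<le> \<epsilon>"
  shows "indistinguishable disk \<epsilon> \<gamma>1 \<gamma>2"
proof -
  have "0 \<le> k" "k \<le> 1" using K by (auto simp: k)
  then have "norm_star disk (DD \<gamma>1 \<gamma>2) \<le> contrast k"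
    by (intro norm_star_bounds(1)[OF Gamma_cond_conductivity[OF K \<gamma>(1)] Gamma_cond_conductivity[OF K \<gamma>(2)] _ quadratic_bound[OF K k \<gamma>] dirichlet_hol_T en_T_pos]
        contrast_nonneg)
  then show ?thesis using e by (simp add: indistinguishable_def)
qed

lemma \<gamma>c_Gamma_cond: "K > 1 \<Longrightarrow> inverse K \<le> c \<Longrightarrow> c \<le> K \<Longrightarrow> \<gamma>c c \<in> Gamma_cond disk K \<rho> q"
  using \<gamma>c_conductivity[of K c] by (auto simp: Gamma_cond_def conductivity_def \<gamma>c_def indicator_def intro!: AE_I2)

lemma distinguishable_inclusion:
  assumes K: "K > 1" and k: "k = (K - 1) / (K + 1)" and e: "\<epsilon> < contrast k"
  shows "\<not> indistinguishable disk \<epsilon> (\<gamma>c K) (\<gamma>c (inverse K))"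
proof -
  have iK: "inverse K \<le> 1" using K by (simp add: inverse_le_1_iff)
  have \<gamma>: "\<gamma>c K \<in> Gamma_cond disk K \<rho> q" "\<gamma>c (inverse K) \<in> Gamma_cond disk K \<rho> q"
    using K iK by (auto intro!: \<gamma>c_Gamma_cond)
  note c = Gamma_cond_conductivity[OF K \<gamma>(1)] Gamma_cond_conductivity[OF K \<gamma>(2)]
  obtain pl where pl: "solves (\<gamma>c (inverse K)) (hgrad T) pl" by (rule solves_exists[OF c(2) dirichlet_hol_field[OF dirichlet_hol_T]])
  obtain pu where pu: "solves (\<gamma>c K) (hgrad T) pu" by (rule solves_exists[OF c(1) dirichlet_hol_field[OF dirichlet_hol_T]])
  have k01: "0 \<le> k" "k \<le> 1" using K by (auto simp: k)
  have "contrast k * en T = ipg (\<gamma>c K) pu pu - ipg (\<gamma>c (inverse K)) pl pl"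
    using extreme_difference(2)[OF K k dirichlet_hol_T pl pu refl] by simp
  also have "\<dots> \<le> norm_star disk (DD (\<gamma>c K) (\<gamma>c (inverse K))) * en T"
    by (rule norm_star_bounds(2)[OF c contrast_nonneg[OF k01] quadratic_bound[OF K k \<gamma>] dirichlet_hol_T en_T_pos pu pl])
  finally have "contrast k \<le> norm_star disk (DD (\<gamma>c K) (\<gamma>c (inverse K)))" using en_T_pos by simp
  then show ?thesis using e by (simp add: indistinguishable_def)
qed

end

section \<open>The resolution limit\<close>

lemma Gamma_cond_mono:
  assumes "\<rho>' \<le> \<rho>" "\<gamma> \<in> Gamma_cond disk K \<rho>' q" shows "\<gamma> \<in> Gamma_cond disk K \<rho> q"
proof -
  have "AE z in MD. \<gamma> z = 1 + indicator (ball q \<rho>') z * (\<gamma> z - 1)" using assms(2) by (simp add: Gamma_cond_def)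
  then have "AE z in MD. \<gamma> z = 1 + indicator (ball q \<rho>) z * (\<gamma> z - 1)"
    by eventually_elim (use assms(1) in \<open>auto simp: indicator_def split: if_splits\<close>)
  then show ?thesis using assms(2) by (simp add: Gamma_cond_def)
qed

text \<open>The smaller root X of r X^2 - (1 + r^2) X + r (1 - t^2) = 0, the relation between the
  Euclidean radius X, the pseudohyperbolic radius r and the distance t of the Euclidean centre from
  0.\<close>

definition radius :: "real \<Rightarrow> real \<Rightarrow> real" where
  "radius t r = (1 + r\<^sup>2 - sqrt (1 + (4 * t\<^sup>2 - 2) * r\<^sup>2 + r ^ 4)) / (2 * r)"

text \<open>The Euclidean centre is prescribed, while \<open>inclusion\<close> is parametrised by
  the pseudohyperbolic centre \<open>a\<close>. The latter lies in the direction of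
  \<open>Q\<close>, so only its modulus has to be found.\<close>

lemma inclusion_exists:
  assumes r: "0 < r" "r < 1" and Q: "norm Q < 1"
  obtains a where "inclusion a r" "inclusion.q a r = Q" "inclusion.\<rho> a r = radius (norm Q) r"
proof -
  define t where "t = norm Q"
  have t: "0 \<le> t" "t < 1" using Q by (auto simp: t_def)
  have r2: "0 < r\<^sup>2" "r\<^sup>2 < 1" using r by (auto simp: power_less_one_iff)
  have den: "1 - r\<^sup>2 * s\<^sup>2 > 0" if "0 \<le> s" "s \<le> 1" for s
  proof -
    have "r\<^sup>2 * s\<^sup>2 \<le> r\<^sup>2 * 1" using that r2 by (intro mult_left_mono) (auto simp: power_le_one)
    then show ?thesis using r2 by linarith
  qed
  let ?F = "\<lambda>s. s * (1 - r\<^sup>2) / (1 - r\<^sup>2 * s\<^sup>2)"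
  \<comment> \<open>The modulus of the Euclidean centre as a function of \<open>s = norm a\<close>
    runs continuously from 0 to 1.\<close>
  have "\<exists>s\<ge>0. s \<le> 1 \<and> ?F s = t"
  proof (rule IVT')
    show "continuous_on {0..1} ?F" using den by (intro continuous_intros) (auto simp: less_imp_neq[symmetric])
  qed (use t r2 in auto)
  then obtain s where s: "0 \<le> s" "s \<le> 1" "?F s = t" by blast
  have s1: "s < 1"
  proof (rule ccontr)
    assume "\<not> s < 1"
    then have "s = 1" using s by simp
    then show False using s(3) t r2 by simp
  qed
  define D where "D = 1 - r\<^sup>2 * s\<^sup>2"
  have D: "D > 0" using den s by (simp add: D_def)
  have tD: "s * (1 - r\<^sup>2) = t * D" using s(3) D by (simp add: D_def field_simps)
  define a where "a = (if t = 0 then 0 else (s / t) *\<^sub>R Q)"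
  have s0: "t = 0 \<Longrightarrow> s = 0" using tD r2 by simp
  have na: "norm a = s" using s s0 t by (auto simp: a_def t_def)
  interpret inclusion a r using na s1 r by unfold_locales auto
  have "q = Q"
  proof (cases "t = 0")
    case True
    then have "norm Q = 0" "a = 0" by (simp_all add: t_def a_def)
    then show ?thesis unfolding q_def by simp
  next
    case False
    have "(1 - r\<^sup>2) / D * (s / t) = 1" using tD False D by (simp add: field_simps)
    moreover have "q = ((1 - r\<^sup>2) / D) *\<^sub>R a" unfolding q_def na D_def ..
    moreover have "a = (s / t) *\<^sub>R Q" using False by (simp only: a_def if_False)
    ultimately show ?thesis by (metis scaleR_one scaleR_scaleR)
  qed
  moreover have "\<rho> = radius (norm Q) r"
  proof -
    have \<rho>D: "\<rho> * D = r * (1 - s\<^sup>2)" using D by (simp add: \<rho>_def na D_def)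
    \<comment> \<open>The value that the square root in \<open>radius\<close> must have; positivity
      of \<open>B\<close> selects the right sign after squaring.\<close>
    define B where "B = 1 + r\<^sup>2 - 2 * r * \<rho>"
    have BD: "B * D = (1 - r\<^sup>2) * (1 + r\<^sup>2 * s\<^sup>2)"
    proof -
      have "B * D = (1 + r\<^sup>2) * D - 2 * r * (\<rho> * D)" by (simp add: B_def algebra_simps)
      also have "\<dots> = (1 + r\<^sup>2) * (1 - r\<^sup>2 * s\<^sup>2) - 2 * r * (r * (1 - s\<^sup>2))" by (simp only: \<rho>D) (simp only: D_def)
      also have "\<dots> = (1 - r\<^sup>2) * (1 + r\<^sup>2 * s\<^sup>2)" by (simp add: power2_eq_square algebra_simps)
      finally show ?thesis .
    qed
    have "B * D > 0" unfolding BD using r2 by (intro mult_pos_pos add_pos_nonneg) auto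
    then have B0: "B > 0" using D by (simp add: zero_less_mult_iff)
    have "(B * D)\<^sup>2 = (1 - r\<^sup>2)\<^sup>2 * D\<^sup>2 + 4 * r\<^sup>2 * (s * (1 - r\<^sup>2))\<^sup>2"
      by (simp only: BD) (simp add: D_def power2_eq_square algebra_simps)
    also have "\<dots> = (1 + (4 * t\<^sup>2 - 2) * r\<^sup>2 + r ^ 4) * D\<^sup>2"
      unfolding tD by (simp add: power_mult_distrib power2_eq_square algebra_simps eval_nat_numeral)
    finally have "B\<^sup>2 * D\<^sup>2 = (1 + (4 * t\<^sup>2 - 2) * r\<^sup>2 + r ^ 4) * D\<^sup>2" by (simp only: power_mult_distrib)
    then have "B\<^sup>2 = 1 + (4 * t\<^sup>2 - 2) * r\<^sup>2 + r ^ 4" using D by simp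
    then have "sqrt (1 + (4 * t\<^sup>2 - 2) * r\<^sup>2 + r ^ 4) = B" using B0 by (metis less_imp_le real_sqrt_unique)
    then show ?thesis using r by (simp add: radius_def t_def[symmetric] B_def)
  qed
  ultimately show ?thesis using that inclusion_axioms by blast
qed

theorem theorem3p8:
  fixes K k \<epsilon>\<^sub>0 l\<^sub>0 :: real and q :: complex
  assumes "K > 1"
    and "k = (K - 1) / (K + 1)"
    and "0 < \<epsilon>\<^sub>0" and "\<epsilon>\<^sub>0 < 4 * k / (1 - k\<^sup>2)"
    and "l\<^sub>0 = sqrt ((sqrt (4 + \<epsilon>\<^sub>0\<^sup>2) - 2) / (\<epsilon>\<^sub>0 * k))"
    and "q \<in> ball 0 1"
  shows "resolution_limit (ball 0 1) K \<epsilon>\<^sub>0 q =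
    (1 + l\<^sub>0\<^sup>2 - sqrt (1 + (4 * (cmod q)\<^sup>2 - 2) * l\<^sub>0\<^sup>2 + l\<^sub>0 ^ 4)) / (2 * l\<^sub>0)"
proof -
  have k: "0 < k" "k < 1" using assms(1) unfolding assms(2) by simp_all
  \<comment> \<open>This is \<open>k * l\<^sub>0\<^sup>2\<close>, the positive root of
    \<open>\<epsilon>\<^sub>0 * (1 - x\<^sup>2) = 4 * x\<close>; the contrast depends on the
    inclusion only through the product of \<open>k\<close> and \<open>r\<^sup>2\<close>.\<close>
  define x where "x = (sqrt (4 + \<epsilon>\<^sub>0\<^sup>2) - 2) / \<epsilon>\<^sub>0"
  define S where "S = sqrt (4 + \<epsilon>\<^sub>0\<^sup>2)"
  have S: "S\<^sup>2 = 4 + \<epsilon>\<^sub>0\<^sup>2" "S > 2"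
  proof -
    show "S\<^sup>2 = 4 + \<epsilon>\<^sub>0\<^sup>2" by (simp add: S_def add_nonneg_nonneg)
    have "sqrt (2\<^sup>2) < S" unfolding S_def using assms(3) by (intro real_sqrt_less_mono) simp
    then show "S > 2" by simp
  qed
  have x0: "x > 0" using S(2) assms(3) by (simp add: x_def S_def[symmetric])
  have root: "\<epsilon>\<^sub>0 * (1 - x\<^sup>2) = 4 * x"
  proof -
    have xe: "x * \<epsilon>\<^sub>0 = S - 2" using assms(3) by (simp add: x_def S_def)
    have "\<epsilon>\<^sub>0 * (\<epsilon>\<^sub>0 * (1 - x\<^sup>2) - 4 * x) = \<epsilon>\<^sub>0\<^sup>2 - (x * \<epsilon>\<^sub>0)\<^sup>2 - 4 * (x * \<epsilon>\<^sub>0)"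
      by (simp add: power2_eq_square algebra_simps)
    also have "\<dots> = 0" unfolding xe using S(1) by (simp add: power2_eq_square algebra_simps)
    finally show ?thesis using assms(3) by simp
  qed
  have x1: "x < 1"
  proof -
    have "x\<^sup>2 < 1" using root x0 assms(3) by (smt (verit) zero_less_mult_iff)
    then show ?thesis using x0 by (simp add: abs_square_less_1)
  qed
  have mono: "4 * y / (1 - y\<^sup>2) < 4 * z / (1 - z\<^sup>2)" if "0 < y" "y < z" "z < 1" for y z :: real
  proof -
    have "y\<^sup>2 < z\<^sup>2" "z\<^sup>2 < 1" using that by (auto simp: power_less_one_iff intro: power_strict_mono)
    then show ?thesis using that by (intro frac_less) auto
  qed
  have ex: "\<epsilon>\<^sub>0 = 4 * x / (1 - x\<^sup>2)"
  proof -
    have "1 - x\<^sup>2 \<noteq> 0" using root x0 by auto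
    then show ?thesis using root by (simp add: field_simps)
  qed
  \<comment> \<open>By strict monotonicity of 4 y / (1 - y^2) on (0, 1), the upper bound on
    \<open>\<epsilon>\<^sub>0\<close> says exactly this, and it is equivalent to
    \<open>l\<^sub>0 < 1\<close>.\<close>
  have xk: "x < k"
  proof (rule ccontr)
    assume "\<not> x < k"
    then have "4 * k / (1 - k\<^sup>2) \<le> 4 * x / (1 - x\<^sup>2)" using mono[of k x] k x1 by (cases "x = k") auto
    then show False using assms(4) ex by simp
  qed
  have l: "l\<^sub>0\<^sup>2 = x / k" "l\<^sub>0 = sqrt (x / k)"
  proof -
    have "(sqrt (4 + \<epsilon>\<^sub>0\<^sup>2) - 2) / (\<epsilon>\<^sub>0 * k) = x / k" by (simp add: x_def)
    then show "l\<^sub>0 = sqrt (x / k)" by (simp only: assms(5))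
    then show "l\<^sub>0\<^sup>2 = x / k" using x0 k by simp
  qed
  have l01: "0 < l\<^sub>0" "l\<^sub>0 < 1" using l(2) x0 xk k by auto
  have kl: "k * l\<^sub>0\<^sup>2 = x" using l(1) k by simp
  have ct: "4 * k * r\<^sup>2 / (1 - k\<^sup>2 * r ^ 4) = 4 * (k * r\<^sup>2) / (1 - (k * r\<^sup>2)\<^sup>2)" for r :: real
    by (simp add: power_mult_distrib)
  have qn: "norm q < 1" using assms(6) by simp
  define X where "X = {\<rho>. \<rho> > 0 \<and> ball q \<rho> \<subseteq> disk \<and>
     (\<forall>\<gamma>\<^sub>1\<in>Gamma_cond disk K \<rho> q. \<forall>\<gamma>\<^sub>2\<in>Gamma_cond disk K \<rho> q. indistinguishable disk \<epsilon>\<^sub>0 \<gamma>\<^sub>1 \<gamma>\<^sub>2)}"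
  have "Sup X = radius (norm q) l\<^sub>0"
  proof (rule cSup_eq_maximum)
    obtain a where a: "inclusion a l\<^sub>0" "inclusion.q a l\<^sub>0 = q" "inclusion.\<rho> a l\<^sub>0 = radius (norm q) l\<^sub>0"
      using inclusion_exists[OF l01 qn] .
    interpret I: inclusion a l\<^sub>0 by (rule a(1))
    have "I.contrast k = \<epsilon>\<^sub>0" by (simp only: I.contrast_def ct kl ex[symmetric])
    then show "radius (norm q) l\<^sub>0 \<in> X"
      unfolding X_def using I.\<rho>_pos I.cball_in_disk I.indistinguishable_inclusion[OF assms(1,2), of _ _ \<epsilon>\<^sub>0]
        ball_subset_cball[of q "radius (norm q) l\<^sub>0"] unfolding a(2,3) by auto
  next
    fix \<rho> assume \<rho>: "\<rho> \<in> X"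
    show "\<rho> \<le> radius (norm q) l\<^sub>0"
    proof (rule ccontr)
      assume "\<not> \<rho> \<le> radius (norm q) l\<^sub>0"
      \<comment> \<open>Continuity provides some \<open>r > l\<^sub>0\<close> whose inclusion about
        \<open>q\<close> still has radius below \<open>\<rho>\<close>; its contrast exceeds
        \<open>\<epsilon>\<^sub>0\<close>.\<close>
      have "isCont (radius (norm q)) l\<^sub>0"
        unfolding radius_def using l01 by (intro continuous_intros) auto
      then have "(radius (norm q) \<longlongrightarrow> radius (norm q) l\<^sub>0) (at_right l\<^sub>0)"
        unfolding isCont_def by (rule tendsto_within_subset) simp
      then have "\<forall>\<^sub>F r in at_right l\<^sub>0. radius (norm q) r < \<rho>"
        using \<open>\<not> \<rho> \<le> radius (norm q) l\<^sub>0\<close> by (intro order_tendstoD(2)) auto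
      moreover have "\<forall>\<^sub>F r in at_right l\<^sub>0. r \<in> {l\<^sub>0<..<1}" using l01(2) by (rule eventually_at_right_real)
      ultimately have "\<forall>\<^sub>F r in at_right l\<^sub>0. radius (norm q) r < \<rho> \<and> r \<in> {l\<^sub>0<..<1}" by (rule eventually_conj)
      then obtain r where r: "radius (norm q) r < \<rho>" "l\<^sub>0 < r" "r < 1"
        using eventually_happens'[OF trivial_limit_at_right_real] by fastforce
      obtain a where a: "inclusion a r" "inclusion.q a r = q" "inclusion.\<rho> a r = radius (norm q) r"
        using inclusion_exists[OF _ r(3) qn] l01 r(2) by auto
      interpret I: inclusion a r by (rule a(1))
      have "x < k * r\<^sup>2"
        unfolding kl[symmetric] using k l01 r(2) by (intro mult_strict_left_mono power_strict_mono) auto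
      moreover have "k * r\<^sup>2 < 1" using k I.r2 mult_strict_mono[of k 1 "r\<^sup>2" 1] by simp
      ultimately have "\<epsilon>\<^sub>0 < I.contrast k" unfolding I.contrast_def ct ex using x0 by (intro mono)
      then have "\<not> indistinguishable disk \<epsilon>\<^sub>0 (I.\<gamma>c K) (I.\<gamma>c (inverse K))" by (rule I.distinguishable_inclusion[OF assms(1,2)])
      \<comment> \<open>The extreme conductivities of the smaller concentric disk are admissible for
        the radius \<open>\<rho>\<close> as well, so they violate the defining property of
        \<open>X\<close>.\<close>
      moreover have "I.\<gamma>c c \<in> Gamma_cond disk K \<rho> q" if "inverse K \<le> c" "c \<le> K" for c
        using I.\<gamma>c_Gamma_cond[OF assms(1) that] Gamma_cond_mono[OF less_imp_le[OF r(1)]] unfolding a(2,3) by blast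
      moreover have "inverse K \<le> K" using assms(1) by (meson inverse_le_1_iff less_imp_le order_trans)
      ultimately show False using \<rho> unfolding X_def by auto
    qed
  qed
  then show ?thesis by (simp add: resolution_limit_def X_def radius_def)
qed

end
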